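(* There exist constants $c_0>0$, $C_0>0$, $0<k_1\le k_2$ and $0<\beta<1$, all independent of the mesh size $H$, the oversampling parameter $m\in\mathbb{N}$ and the frequency $\omega\ge\omega_0$, such that the following holds. If the resolution condition $\omega H\le c_0$ and the oversampling condition $$m\ \ge\ C_0\,\frac{\bigl|\log\bigl(\gamma(\omega)/\sqrt{C_{\mathrm{ol},m}}\bigr)\bigr|}{|\log\beta|}$$ are fulfilled, then $\mathcal{B}$ is inf-sup stable over $(\mathrm{id}+\mathcal{K}_m)\mathring{\mathcal{N}}(\mathcal{T}_H)$: there is $\gamma_{\mathrm{LOD}}(\omega)>0$ with $k_1\gamma(\omega)\le\gamma_{\mathrm{LOD}}(\omega)\le k_2\gamma(\omega)$ and $$\inf_{\mathbf{v}_H\in\mathring{\mathcal{N}}(\mathcal{T}_H)\setminus\{0\}}\ \sup_{\boldsymbol{\psi}_H\in\mathring{\mathcal{N}}(\mathcal{T}_H)\setminus\{0\}}\frac{|\mathcal{B}((\mathrm{id}+\mathcal{K}_m)\mathbf{v}_H,(\mathrm{id}+\mathcal{K}_m)\boldsymbol{\psi}_H)|}{\|\mathbf{v}_H\|_{\mathrm{curl},\omega}\|\boldsymbol{\psi}_H\|_{\mathrm{curl},\omega}}\ \ge\ \gamma_{\mathrm{LOD}}(\omega).$$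
   Context: Setting. $\Omega\subset\mathbb{R}^3$ is an open, bounded, contractible domain with polyhedral Lipschitz boundary. All functions are complex-valued; $(\cdot,\cdot)_{L^2(G)}$ is the complex $L^2$ inner product (conjugate-linear in the second argument). $\mathbf{H}(\mathrm{curl},G)$, $\mathbf{H}_0(\mathrm{curl},G)$ (zero tangential trace) are the usual spaces; the domain is omitted if $G=\Omega$. $\|\cdot\|_{\mathrm{curl},\omega,G}$ is the norm of the inner product $(\mathbf{v},\mathbf{w})_{\mathrm{curl},\omega,G}=(\mathrm{curl}\,\mathbf{v},\mathrm{curl}\,\mathbf{w})_{L^2(G)}+\omega^2(\mathbf{v},\mathbf{w})_{L^2(G)}$; $G$ is omitted if $G=\Omega$. The coefficients $\mu,\varepsilon\in L^\infty(\Omega,\mathbb{R}^{3\times3})$ are uniformly elliptic. For open $G\subset\Omega$, $$\mathcal{B}_G(\mathbf{v},\boldsymbol{\psi})=(\mu\,\mathrm{curl}\,\mathbf{v},\mathrm{curl}\,\boldsymbol{\psi})_{L^2(G)}-\omega^2(\varepsilon\mathbf{v},\boldsymbol{\psi})_{L^2(G)},\qquad \mathcal{B}=\mathcal{B}_\Omega .$$ The frequency satisfies $\omega\ge\omega_0$ for a fixed $\omega_0>0$ and is not an eigenvalue, so that the problem $\mathcal{B}(\mathbf{u},\cdot)=(\mathbf{f},\cdot)_{L^2(\Omega)}$ on $\mathbf{H}_0(\mathrm{curl})$ is uniquely solvable, and $\gamma(\omega)>0$ is a constant with $$\inf_{\mathbf{v}\in\mathbf{H}_0(\mathrm{curl})\setminus\{0\}}\sup_{\boldsymbol{\psi}\in\mathbf{H}_0(\mathrm{curl})\setminus\{0\}}\frac{|\mathcal{B}(\mathbf{v},\boldsymbol{\psi})|}{\|\mathbf{v}\|_{\mathrm{curl},\omega}\|\boldsymbol{\psi}\|_{\mathrm{curl},\omega}}\ge\gamma(\omega).$$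 Mesh. $\mathcal{T}_H$ is a regular (conforming), shape-regular, quasi-uniform partition of $\Omega$ into tetrahedra, $H=\max_T\mathrm{diam}(T)$. For $G\subset\overline\Omega$, $\mathrm{N}(G)=\mathrm{N}^1(G)=\mathrm{int}(\bigcup\{T\in\mathcal{T}_H: T\cap\overline G\ne\emptyset\})$ and $\mathrm{N}^m(G)=\mathrm{N}(\mathrm{N}^{m-1}(G))$. $C_{\mathrm{ol},m}$ is a uniform bound, $\max_{T}\mathrm{card}\{K\in\mathcal{T}_H:K\subset\overline{\mathrm{N}^m(T)}\}\le C_{\mathrm{ol},m}$, depending only polynomially on $m$. $\mathring{\mathcal{N}}(\mathcal{T}_H)=\{\mathbf{v}\in\mathbf{H}_0(\mathrm{curl}):\mathbf{v}|_T(\mathbf{x})=\mathbf{a}_T\times\mathbf{x}+\mathbf{b}_T,\ \mathbf{a}_T,\mathbf{b}_T\in\mathbb{C}^3\ \forall T\in\mathcal{T}_H\}$ is the lowest-order Nédélec space. Constants said to be independent of $H,m,\omega$ may depend on $\Omega$, on the shape-regularity and quasi-uniformity constants, on the bounds and ellipticity constants of $\mu,\varepsilon$, and on $\omega_0$. Interpolation. $\pi_H^E:\mathbf{H}_0(\mathrm{curl})\to\mathring{\mathcal{N}}(\mathcal{T}_H)$ is the Falk–Winther interpolation operator (local bounded cochain projection), a linear projection commuting with the exterior derivative (i.e. forming a commuting diagram with the corresponding projections onto the continuous piecewise linear space and the Raviart–Thomas space) and satisfying, with constants independent of $H$: for all $\mathbf{v}\in\mathbf{H}_0(\mathrm{curl})$,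 $T\in\mathcal{T}_H$, $\|\pi_H^E\mathbf{v}\|_{L^2(T)}\lesssim\|\mathbf{v}\|_{L^2(\mathrm{N}(T))}+H\|\mathrm{curl}\,\mathbf{v}\|_{L^2(\mathrm{N}(T))}$, $\|\mathrm{curl}\,\pi_H^E\mathbf{v}\|_{L^2(T)}\lesssim\|\mathrm{curl}\,\mathbf{v}\|_{L^2(\mathrm{N}(T))}$; and there are $\mathbf{z}\in\mathbf{H}^1_0(\Omega)$, $\theta\in H^1_0(\Omega)$ with $\mathbf{v}-\pi_H^E\mathbf{v}=\mathbf{z}+\nabla\theta$ and, for all $T$, $H^{-1}\|\mathbf{z}\|_{L^2(T)}+\|\nabla\mathbf{z}\|_{L^2(T)}\lesssim\|\mathrm{curl}\,\mathbf{v}\|_{L^2(\mathrm{N}^3(T))}$, $H^{-1}\|\theta\|_{L^2(T)}+\|\nabla\theta\|_{L^2(T)}\lesssim\|\mathbf{v}\|_{L^2(\mathrm{N}^3(T))}+H\|\mathrm{curl}\,\mathbf{v}\|_{L^2(\mathrm{N}^3(T))}$. Localized correctors. For $T\in\mathcal{T}_H$ and $m\in\mathbb{N}$ let $\Omega_T=\mathrm{N}^m(T)$. $\pi_{H,\Omega_T}^E:\mathbf{H}_0(\mathrm{curl},\Omega)\to\mathring{\mathcal{N}}(\mathcal{T}_H(\Omega_T))$ is the Falk–Winther operator enforcing zero tangential traces on $\partial\Omega_T$; it has the analogous projection, stability and decomposition properties on $\Omega_T$ (with constants independent of $H$, $m$, $T$) and differs from $\pi_H^E$ only near $\partial\Omega_T$.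 Set $$\mathbf{W}(\Omega_T)=\{\mathbf{w}\in\mathbf{H}_0(\mathrm{curl}):\mathbf{w}=0\text{ outside }\Omega_T,\ \pi_{H,\Omega_T}^E\mathbf{w}=0\}$$ (in general not a subspace of $\ker\pi_H^E$). For a functional $\mathbf{F}_T\in\mathbf{H}_0(\mathrm{curl})'$ (conjugate-linear) that vanishes on all $\mathbf{v}$ with $\mathrm{supp}(\mathbf{v})\subset\Omega\setminus T$, the localized corrector $\mathcal{G}_{T,m}(\mathbf{F}_T)\in\mathbf{W}(\Omega_T)$ solves $\mathcal{B}(\mathcal{G}_{T,m}(\mathbf{F}_T),\mathbf{w})=\mathbf{F}_T(\mathbf{w})$ for all $\mathbf{w}\in\mathbf{W}(\Omega_T)$ (well-posed under the resolution condition $\omega H\le c_0$, $c_0$ small enough). With $\mathcal{L}_T(\mathbf{v})=\mathcal{B}_T(\mathbf{v},\cdot)$, where $\mathcal{B}_T$ is the restriction of $\mathcal{B}$ to $T$, define $$\mathcal{K}_m(\mathbf{v}_H)=-\sum_{T\in\mathcal{T}_H}\mathcal{G}_{T,m}(\mathcal{L}_T(\mathbf{v}_H)).$$ *)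

theory Defs
  imports "HOL-Analysis.Analysis"
begin

text \<open>
  Elements of L2 and of the Sobolev spaces are represented by functions on the whole of R^3 of which
  only the values almost everywhere in the domain \<open>\<Omega>\<close> matter; equality of such elements
  is equality almost everywhere in \<open>\<Omega>\<close>.
\<close>

type_synonym point = "real ^ 3"
type_synonym sfield = "point \<Rightarrow> complex"
type_synonym vfield = "point \<Rightarrow> complex ^ 3"

subsection \<open>L2 spaces\<close>

definition ae_eq :: "point set \<Rightarrow> (point \<Rightarrow> 'b) \<Rightarrow> (point \<Rightarrow> 'b) \<Rightarrow> bool"
  where "ae_eq G f g \<longleftrightarrow> (AE x in lebesgue. x \<in> G \<longrightarrow> f x = g x)"

definition L2 :: "point set \<Rightarrow> (point \<Rightarrow> 'b::euclidean_space) set"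
  where "L2 G = {f. f \<in> borel_measurable (lebesgue_on G)
                    \<and> integrable (lebesgue_on G) (\<lambda>x. (norm (f x))\<^sup>2)}"

definition l2norm :: "point set \<Rightarrow> (point \<Rightarrow> 'b::euclidean_space) \<Rightarrow> real"
  where "l2norm G f = sqrt (integral\<^sup>L (lebesgue_on G) (\<lambda>x. (norm (f x))\<^sup>2))"

definition l2ips :: "point set \<Rightarrow> sfield \<Rightarrow> sfield \<Rightarrow> complex"
  where "l2ips G p q = integral\<^sup>L (lebesgue_on G) (\<lambda>x. p x * cnj (q x))"

definition l2ip :: "point set \<Rightarrow> vfield \<Rightarrow> vfield \<Rightarrow> complex"
  where "l2ip G v w = integral\<^sup>L (lebesgue_on G) (\<lambda>x. \<Sum>i\<in>UNIV. v x $ i * cnj (w x $ i))"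

subsection \<open>Test functions and weak derivatives\<close>

definition pd :: "3 \<Rightarrow> (point \<Rightarrow> 'b::real_normed_vector) \<Rightarrow> point \<Rightarrow> 'b"
  where "pd i f x = frechet_derivative f (at x) (axis i 1)"

primrec C_k :: "nat \<Rightarrow> (point \<Rightarrow> 'b::real_normed_vector) \<Rightarrow> bool" where
  "C_k 0 f \<longleftrightarrow> continuous_on UNIV f"
| "C_k (Suc k) f \<longleftrightarrow> (\<forall>x. f differentiable (at x)) \<and> (\<forall>i. C_k k (pd i f))"

definition test_fun :: "point set \<Rightarrow> (point \<Rightarrow> 'b::real_normed_vector) set"
  where "test_fun G = {\<phi>. (\<forall>k. C_k k \<phi>) \<and> compact (closure {x. \<phi> x \<noteq> 0})
                            \<and> closure {x. \<phi> x \<noteq> 0} \<subseteq> G}"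

definition cgrad :: "sfield \<Rightarrow> vfield"
  where "cgrad p x = (\<chi> i. pd i p x)"

definition ccurl :: "vfield \<Rightarrow> vfield"
  where "ccurl v x = vector [pd 2 v x $ 3 - pd 3 v x $ 2,
                             pd 3 v x $ 1 - pd 1 v x $ 3,
                             pd 1 v x $ 2 - pd 2 v x $ 1]"

definition cdiv :: "vfield \<Rightarrow> sfield"
  where "cdiv v x = (\<Sum>i\<in>UNIV. pd i v x $ i)"

text \<open>
  Test functions are complex-valued, so the conjugation in the inner products below is harmless.
  Weak derivatives are unique only up to null sets, whence the choice operator.
\<close>

definition weak_grad :: "point set \<Rightarrow> sfield \<Rightarrow> vfield \<Rightarrow> bool"
  where "weak_grad G p g \<longleftrightarrow> g \<in> L2 G
           \<and> (\<forall>\<phi>\<in>test_fun G. l2ips G p (cdiv \<phi>) = - l2ip G g \<phi>)"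

definition weak_curl :: "point set \<Rightarrow> vfield \<Rightarrow> vfield \<Rightarrow> bool"
  where "weak_curl G v c \<longleftrightarrow> c \<in> L2 G
           \<and> (\<forall>\<phi>\<in>test_fun G. l2ip G v (ccurl \<phi>) = l2ip G c \<phi>)"

definition weak_div :: "point set \<Rightarrow> vfield \<Rightarrow> sfield \<Rightarrow> bool"
  where "weak_div G q d \<longleftrightarrow> d \<in> L2 G
           \<and> (\<forall>\<phi>\<in>test_fun G. l2ip G q (cgrad \<phi>) = - l2ips G d \<phi>)"

definition grad :: "point set \<Rightarrow> sfield \<Rightarrow> vfield"
  where "grad G p = (SOME g. weak_grad G p g)"

definition curl :: "point set \<Rightarrow> vfield \<Rightarrow> vfield"
  where "curl G v = (SOME c. weak_curl G v c)"

definition dvg :: "point set \<Rightarrow> vfield \<Rightarrow> sfield"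
  where "dvg G q = (SOME d. weak_div G q d)"

definition jac :: "point set \<Rightarrow> vfield \<Rightarrow> point \<Rightarrow> complex ^ 3 ^ 3"
  where "jac G z x = (\<chi> i. grad G (\<lambda>y. z y $ i) x)"

definition H1 :: "point set \<Rightarrow> sfield set"
  where "H1 G = {p \<in> L2 G. \<exists>g. weak_grad G p g}"

definition Hcurl :: "point set \<Rightarrow> vfield set"
  where "Hcurl G = {v \<in> L2 G. \<exists>c. weak_curl G v c}"

definition Hdiv :: "point set \<Rightarrow> vfield set"
  where "Hdiv G = {q \<in> L2 G. \<exists>d. weak_div G q d}"

text \<open>The spaces with zero trace (zero tangential trace, zero normal trace) are the closures of the
  test functions.\<close>

definition H10 :: "point set \<Rightarrow> sfield set"
  where "H10 G = {p \<in> H1 G. \<exists>\<phi>. (\<forall>n::nat. \<phi> n \<in> test_fun G)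
           \<and> (\<lambda>n. l2norm G (\<lambda>x. p x - \<phi> n x)) \<longlonglongrightarrow> 0
           \<and> (\<lambda>n. l2norm G (\<lambda>x. grad G p x - cgrad (\<phi> n) x)) \<longlonglongrightarrow> 0}"

definition H0curl :: "point set \<Rightarrow> vfield set"
  where "H0curl G = {v \<in> Hcurl G. \<exists>\<phi>. (\<forall>n::nat. \<phi> n \<in> test_fun G)
           \<and> (\<lambda>n. l2norm G (\<lambda>x. v x - \<phi> n x)) \<longlonglongrightarrow> 0
           \<and> (\<lambda>n. l2norm G (\<lambda>x. curl G v x - ccurl (\<phi> n) x)) \<longlonglongrightarrow> 0}"

definition H0div :: "point set \<Rightarrow> vfield set"
  where "H0div G = {q \<in> Hdiv G. \<exists>\<phi>. (\<forall>n::nat. \<phi> n \<in> test_fun G)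
           \<and> (\<lambda>n. l2norm G (\<lambda>x. q x - \<phi> n x)) \<longlonglongrightarrow> 0
           \<and> (\<lambda>n. l2norm G (\<lambda>x. dvg G q x - cdiv (\<phi> n) x)) \<longlonglongrightarrow> 0}"

text \<open>For \<open>D\<close> a subdomain of \<open>\<Omega>\<close>, the spaces with zero trace on the boundary of \<open>D\<close> are identified
  with the members of the corresponding space on \<open>\<Omega>\<close> that vanish outside \<open>D\<close>.\<close>

definition vanishing_outside ::
    "point set \<Rightarrow> point set \<Rightarrow> (point \<Rightarrow> 'b::zero) set \<Rightarrow> (point \<Rightarrow> 'b) set"
  where "vanishing_outside \<Omega> D S = {v \<in> S. ae_eq (\<Omega> - D) v (\<lambda>x. 0)}"

subsection \<open>The domain and the meshes\<close>

definition lipschitz_boundary :: "point set \<Rightarrow> bool"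
  where "lipschitz_boundary \<Omega> \<longleftrightarrow>
    (\<forall>x\<in>frontier \<Omega>. \<exists>r>0. \<exists>e g L. norm e = 1 \<and> L-lipschitz_on UNIV (g :: point \<Rightarrow> real)
        \<and> \<Omega> \<inter> ball x r = {y \<in> ball x r. e \<bullet> y > g (y - (e \<bullet> y) *\<^sub>R e)})"

definition polyhedral_boundary :: "point set \<Rightarrow> bool"
  where "polyhedral_boundary \<Omega> \<longleftrightarrow>
    (\<exists>F. finite F \<and> (\<forall>P\<in>F. polytope P \<and> aff_dim P = 2) \<and> frontier \<Omega> = \<Union>F)"

definition admissible_domain :: "point set \<Rightarrow> bool"
  where "admissible_domain \<Omega> \<longleftrightarrow> \<Omega> \<noteq> {} \<and> open \<Omega> \<and> bounded \<Omega> \<and> contractible \<Omega>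
           \<and> lipschitz_boundary \<Omega> \<and> polyhedral_boundary \<Omega>"

definition mesh_size :: "point set set \<Rightarrow> real"
  where "mesh_size \<T> = Max (diameter ` \<T>)"

text \<open>\<open>\<sigma>\<close> is the shape-regularity and \<open>\<kappa>\<close> the quasi-uniformity constant; elements are closed.\<close>

definition tet_mesh :: "point set \<Rightarrow> real \<Rightarrow> real \<Rightarrow> point set set \<Rightarrow> bool"
  where "tet_mesh \<Omega> \<sigma> \<kappa> \<T> \<longleftrightarrow> triangulation \<T> \<and> (\<forall>T\<in>\<T>. 3 simplex T) \<and> \<Union>\<T> = closure \<Omega>
           \<and> (\<forall>T\<in>\<T>. \<exists>x. cball x (diameter T / \<sigma>) \<subseteq> T)
           \<and> (\<forall>T\<in>\<T>. mesh_size \<T> \<le> \<kappa> * diameter T)"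

definition nbh :: "point set set \<Rightarrow> point set \<Rightarrow> point set"
  where "nbh \<T> G = interior (\<Union>{T \<in> \<T>. T \<inter> closure G \<noteq> {}})"

definition nbhm :: "point set set \<Rightarrow> nat \<Rightarrow> point set \<Rightarrow> point set"
  where "nbhm \<T> m G = (nbh \<T> ^^ m) G"

definition submesh :: "point set set \<Rightarrow> point set \<Rightarrow> point set set"
  where "submesh \<T> D = {K \<in> \<T>. K \<subseteq> closure D}"

subsection \<open>Finite element spaces\<close>

definition cvec :: "point \<Rightarrow> complex ^ 3"
  where "cvec x = (\<chi> i. complex_of_real (x $ i))"

definition ccross :: "complex ^ 3 \<Rightarrow> complex ^ 3 \<Rightarrow> complex ^ 3"
  where "ccross a b = vector [a $ 2 * b $ 3 - a $ 3 * b $ 2,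
                              a $ 3 * b $ 1 - a $ 1 * b $ 3,
                              a $ 1 * b $ 2 - a $ 2 * b $ 1]"

text \<open>In the following, \<open>\<T>\<close> is a mesh of the subdomain \<open>D\<close> of \<open>\<Omega>\<close>.\<close>

definition lagrange :: "point set \<Rightarrow> point set \<Rightarrow> point set set \<Rightarrow> sfield set"
  where "lagrange \<Omega> D \<T> = {p \<in> vanishing_outside \<Omega> D (H10 \<Omega>).
           \<forall>T\<in>\<T>. \<exists>a b. ae_eq T p (\<lambda>x. (\<Sum>i\<in>UNIV. a $ i * cvec x $ i) + b)}"

definition nedelec :: "point set \<Rightarrow> point set \<Rightarrow> point set set \<Rightarrow> vfield set"
  where "nedelec \<Omega> D \<T> = {v \<in> vanishing_outside \<Omega> D (H0curl \<Omega>).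
           \<forall>T\<in>\<T>. \<exists>a b. ae_eq T v (\<lambda>x. ccross a (cvec x) + b)}"

definition raviart_thomas :: "point set \<Rightarrow> point set \<Rightarrow> point set set \<Rightarrow> vfield set"
  where "raviart_thomas \<Omega> D \<T> = {q \<in> vanishing_outside \<Omega> D (H0div \<Omega>).
           \<forall>T\<in>\<T>. \<exists>a b. ae_eq T q (\<lambda>x. a *s cvec x + b)}"

subsection \<open>Local bounded cochain projections\<close>

definition linear_sop :: "point set \<Rightarrow> sfield set \<Rightarrow> (sfield \<Rightarrow> sfield) \<Rightarrow> bool"
  where "linear_sop \<Omega> S P \<longleftrightarrow>
    (\<forall>u\<in>S. \<forall>v\<in>S. ae_eq \<Omega> u v \<longrightarrow> ae_eq \<Omega> (P u) (P v))
    \<and> (\<forall>u\<in>S. \<forall>v\<in>S. ae_eq \<Omega> (P (\<lambda>x. u x + v x)) (\<lambda>x. P u x + P v x))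
    \<and> (\<forall>c. \<forall>u\<in>S. ae_eq \<Omega> (P (\<lambda>x. c * u x)) (\<lambda>x. c * P u x))"

definition linear_vop :: "point set \<Rightarrow> vfield set \<Rightarrow> (vfield \<Rightarrow> vfield) \<Rightarrow> bool"
  where "linear_vop \<Omega> S P \<longleftrightarrow>
    (\<forall>u\<in>S. \<forall>v\<in>S. ae_eq \<Omega> u v \<longrightarrow> ae_eq \<Omega> (P u) (P v))
    \<and> (\<forall>u\<in>S. \<forall>v\<in>S. ae_eq \<Omega> (P (\<lambda>x. u x + v x)) (\<lambda>x. P u x + P v x))
    \<and> (\<forall>c. \<forall>u\<in>S. ae_eq \<Omega> (P (\<lambda>x. c *s u x)) (\<lambda>x. c *s P u x))"

definition commuting :: "point set \<Rightarrow> point set \<Rightarrow> point set set \<Rightarrow> (vfield \<Rightarrow> vfield) \<Rightarrow> bool"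
  where "commuting \<Omega> D \<T> \<pi>E \<longleftrightarrow> (\<exists>\<pi>V \<pi>F.
     linear_sop \<Omega> (vanishing_outside \<Omega> D (H10 \<Omega>)) \<pi>V
     \<and> (\<forall>p\<in>vanishing_outside \<Omega> D (H10 \<Omega>). \<pi>V p \<in> lagrange \<Omega> D \<T>)
     \<and> (\<forall>p\<in>lagrange \<Omega> D \<T>. ae_eq \<Omega> (\<pi>V p) p)
     \<and> linear_vop \<Omega> (vanishing_outside \<Omega> D (H0div \<Omega>)) \<pi>F
     \<and> (\<forall>q\<in>vanishing_outside \<Omega> D (H0div \<Omega>). \<pi>F q \<in> raviart_thomas \<Omega> D \<T>)
     \<and> (\<forall>q\<in>raviart_thomas \<Omega> D \<T>. ae_eq \<Omega> (\<pi>F q) q)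
     \<and> (\<forall>p\<in>vanishing_outside \<Omega> D (H10 \<Omega>). ae_eq \<Omega> (\<pi>E (grad \<Omega> p)) (grad \<Omega> (\<pi>V p)))
     \<and> (\<forall>v\<in>vanishing_outside \<Omega> D (H0curl \<Omega>). ae_eq \<Omega> (curl \<Omega> (\<pi>E v)) (\<pi>F (curl \<Omega> v))))"

text \<open>
  The Falk--Winther operator enters through the following properties: it is a linear projection
  onto the Nedelec space, commutes with the exterior derivative, and is locally stable with a local
  regular decomposition of \<open>v - \<pi> v\<close>; \<open>C\<close> bounds all constants.  \<open>D = \<Omega>\<close> with the full
  mesh gives the global operator; a subdomain \<open>D\<close> with its submesh \<open>\<T>\<close> gives the operator enforcing
  zero tangential traces on the boundary of \<open>D\<close>.  \<open>H\<close> is always the size of the full mesh.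
\<close>

definition falk_winther ::
    "point set \<Rightarrow> point set \<Rightarrow> point set set \<Rightarrow> real \<Rightarrow> real \<Rightarrow> (vfield \<Rightarrow> vfield) \<Rightarrow> bool"
  where "falk_winther \<Omega> D \<T> H C \<pi> \<longleftrightarrow>
     linear_vop \<Omega> (H0curl \<Omega>) \<pi>
     \<and> (\<forall>v\<in>H0curl \<Omega>. \<pi> v \<in> nedelec \<Omega> D \<T>)
     \<and> (\<forall>v\<in>nedelec \<Omega> D \<T>. ae_eq \<Omega> (\<pi> v) v)
     \<and> commuting \<Omega> D \<T> \<pi>
     \<and> (\<forall>v\<in>vanishing_outside \<Omega> D (H0curl \<Omega>). \<forall>T\<in>\<T>.
          l2norm T (\<pi> v) \<le> C * (l2norm (nbh \<T> T) v + H * l2norm (nbh \<T> T) (curl \<Omega> v))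
          \<and> l2norm T (curl \<Omega> (\<pi> v)) \<le> C * l2norm (nbh \<T> T) (curl \<Omega> v))
     \<and> (\<forall>v\<in>vanishing_outside \<Omega> D (H0curl \<Omega>). \<exists>z \<theta>.
          (\<forall>i. (\<lambda>x. z x $ i) \<in> vanishing_outside \<Omega> D (H10 \<Omega>))
          \<and> \<theta> \<in> vanishing_outside \<Omega> D (H10 \<Omega>)
          \<and> ae_eq \<Omega> (\<lambda>x. v x - \<pi> v x) (\<lambda>x. z x + grad \<Omega> \<theta> x)
          \<and> (\<forall>T\<in>\<T>.
               l2norm T z / H + l2norm T (jac \<Omega> z) \<le> C * l2norm (nbhm \<T> 3 T) (curl \<Omega> v)
               \<and> l2norm T \<theta> / H + l2norm T (grad \<Omega> \<theta>)
                   \<le> C * (l2norm (nbhm \<T> 3 T) v + H * l2norm (nbhm \<T> 3 T) (curl \<Omega> v))))"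

text \<open>
  \<open>\<pi>loc T\<close> is the operator on \<open>\<Omega>\<^sub>T = N^m(T)\<close>.  It coincides with \<open>\<pi>\<close> on every element separated by
  \<open>r\<close> layers from the part of the boundary of \<open>\<Omega>\<^sub>T\<close> interior to \<open>\<Omega>\<close>.
\<close>

definition local_falk_winther ::
    "point set \<Rightarrow> point set set \<Rightarrow> nat \<Rightarrow> real \<Rightarrow> nat \<Rightarrow> (vfield \<Rightarrow> vfield)
      \<Rightarrow> (point set \<Rightarrow> vfield \<Rightarrow> vfield) \<Rightarrow> bool"
  where "local_falk_winther \<Omega> \<T> m C r \<pi> \<pi>loc \<longleftrightarrow> (\<forall>T\<in>\<T>.
     falk_winther \<Omega> (nbhm \<T> m T) (submesh \<T> (nbhm \<T> m T)) (mesh_size \<T>) C (\<pi>loc T)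
     \<and> (\<forall>v\<in>vanishing_outside \<Omega> (nbhm \<T> m T) (H0curl \<Omega>). \<forall>K\<in>\<T>.
          nbhm \<T> r K \<subseteq> nbhm \<T> m T \<longrightarrow> ae_eq K (\<pi>loc T v) (\<pi> v)))"

subsection \<open>The sesquilinear form\<close>

definition coefficient :: "point set \<Rightarrow> real \<Rightarrow> real \<Rightarrow> (point \<Rightarrow> real ^ 3 ^ 3) \<Rightarrow> bool"
  where "coefficient \<Omega> \<alpha> \<Lambda> A \<longleftrightarrow> A \<in> borel_measurable (lebesgue_on \<Omega>)
     \<and> (AE x in lebesgue. x \<in> \<Omega> \<longrightarrow>
          (\<forall>\<xi>. \<alpha> * (norm \<xi>)\<^sup>2 \<le> \<xi> \<bullet> (A x *v \<xi>) \<and> norm (A x *v \<xi>) \<le> \<Lambda> * norm \<xi>))"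

definition mat_app :: "(point \<Rightarrow> real ^ 3 ^ 3) \<Rightarrow> vfield \<Rightarrow> vfield"
  where "mat_app A v x = (\<chi> i j. complex_of_real (A x $ i $ j)) *v v x"

definition Bform :: "(point \<Rightarrow> real ^ 3 ^ 3) \<Rightarrow> (point \<Rightarrow> real ^ 3 ^ 3) \<Rightarrow> real \<Rightarrow> point set \<Rightarrow> point set
      \<Rightarrow> vfield \<Rightarrow> vfield \<Rightarrow> complex"
  where "Bform \<mu> \<epsilon> \<omega> \<Omega> G v \<psi> =
     l2ip G (mat_app \<mu> (curl \<Omega> v)) (curl \<Omega> \<psi>) - complex_of_real (\<omega>\<^sup>2) * l2ip G (mat_app \<epsilon> v) \<psi>"

definition curl_ip :: "real \<Rightarrow> point set \<Rightarrow> vfield \<Rightarrow> vfield \<Rightarrow> complex"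
  where "curl_ip \<omega> \<Omega> v w = l2ip \<Omega> (curl \<Omega> v) (curl \<Omega> w) + complex_of_real (\<omega>\<^sup>2) * l2ip \<Omega> v w"

definition curl_norm :: "real \<Rightarrow> point set \<Rightarrow> vfield \<Rightarrow> real"
  where "curl_norm \<omega> \<Omega> v = sqrt (Re (curl_ip \<omega> \<Omega> v v))"

definition uniquely_solvable :: "point set \<Rightarrow> (vfield \<Rightarrow> vfield \<Rightarrow> complex) \<Rightarrow> bool"
  where "uniquely_solvable \<Omega> b \<longleftrightarrow> (\<forall>f\<in>L2 \<Omega>.
     (\<exists>u\<in>H0curl \<Omega>. \<forall>\<psi>\<in>H0curl \<Omega>. b u \<psi> = l2ip \<Omega> f \<psi>)
     \<and> (\<forall>u\<in>H0curl \<Omega>. \<forall>u'\<in>H0curl \<Omega>.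
          (\<forall>\<psi>\<in>H0curl \<Omega>. b u \<psi> = l2ip \<Omega> f \<psi>) \<and> (\<forall>\<psi>\<in>H0curl \<Omega>. b u' \<psi> = l2ip \<Omega> f \<psi>)
            \<longrightarrow> ae_eq \<Omega> u u'))"

definition nonzero :: "point set \<Rightarrow> vfield set \<Rightarrow> vfield set"
  where "nonzero \<Omega> V = {v \<in> V. \<not> ae_eq \<Omega> v (\<lambda>x. 0)}"

text \<open>Extended-real valued, so that no side condition on the space \<open>V\<close> is needed.\<close>

definition inf_sup :: "real \<Rightarrow> point set \<Rightarrow> vfield set \<Rightarrow> (vfield \<Rightarrow> vfield \<Rightarrow> complex) \<Rightarrow> ereal"
  where "inf_sup \<omega> \<Omega> V b = (INF v\<in>nonzero \<Omega> V. SUP \<psi>\<in>nonzero \<Omega> V.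
           ereal (cmod (b v \<psi>) / (curl_norm \<omega> \<Omega> v * curl_norm \<omega> \<Omega> \<psi>)))"

subsection \<open>Localized correctors\<close>

definition W_loc :: "point set \<Rightarrow> point set set \<Rightarrow> nat \<Rightarrow> (point set \<Rightarrow> vfield \<Rightarrow> vfield)
      \<Rightarrow> point set \<Rightarrow> vfield set"
  where "W_loc \<Omega> \<T> m \<pi>loc T =
     {w \<in> vanishing_outside \<Omega> (nbhm \<T> m T) (H0curl \<Omega>). ae_eq \<Omega> (\<pi>loc T w) (\<lambda>x. 0)}"

definition G_loc :: "point set \<Rightarrow> point set set \<Rightarrow> nat \<Rightarrow> (point set \<Rightarrow> vfield \<Rightarrow> vfield)
      \<Rightarrow> (vfield \<Rightarrow> vfield \<Rightarrow> complex) \<Rightarrow> point set \<Rightarrow> (vfield \<Rightarrow> complex) \<Rightarrow> vfield"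
  where "G_loc \<Omega> \<T> m \<pi>loc b T F =
     (SOME g. g \<in> W_loc \<Omega> \<T> m \<pi>loc T \<and> (\<forall>w\<in>W_loc \<Omega> \<T> m \<pi>loc T. b g w = F w))"

definition K_loc :: "point set \<Rightarrow> point set set \<Rightarrow> nat \<Rightarrow> (point set \<Rightarrow> vfield \<Rightarrow> vfield)
      \<Rightarrow> (point \<Rightarrow> real ^ 3 ^ 3) \<Rightarrow> (point \<Rightarrow> real ^ 3 ^ 3) \<Rightarrow> real \<Rightarrow> vfield \<Rightarrow> vfield"
  where "K_loc \<Omega> \<T> m \<pi>loc \<mu> \<epsilon> \<omega> v x =
     - (\<Sum>T\<in>\<T>. G_loc \<Omega> \<T> m \<pi>loc (Bform \<mu> \<epsilon> \<omega> \<Omega> \<Omega>) T (Bform \<mu> \<epsilon> \<omega> \<Omega> T v) x)"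

definition overlap_bound :: "point set set \<Rightarrow> (nat \<Rightarrow> real) \<Rightarrow> bool"
  where "overlap_bound \<T> Col \<longleftrightarrow>
     (\<forall>m\<ge>1. \<forall>T\<in>\<T>. real (card {K \<in> \<T>. K \<subseteq> closure (nbhm \<T> m T)}) \<le> Col m)"

definition poly_bounded :: "(nat \<Rightarrow> real) \<Rightarrow> bool"
  where "poly_bounded f \<longleftrightarrow> (\<exists>A d. \<forall>m\<ge>1. f m \<le> A * real m ^ d)"

end

theory Submission
  imports Defs
begin

text \<open>
  An element \<open>w\<close> of the kernel of a Falk--Winther operator splits as \<open>w = z + \<nabla>\<theta>\<close> with \<open>z\<close> of size \<open>H\<close>, and
  testing \<open>\<B>(w, \<cdot>)\<close> with (the kernel part of) \<open>z - \<nabla>\<theta>\<close> makes the form coercive, element by element, up to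
  a perturbation of size \<open>(\<omega>H)\<^sup>2\<close>.  Hence the local corrector problems are solvable, and with the test function
  \<open>\<eta>z - \<nabla>(\<eta>\<theta>)\<close> for a cutoff \<open>\<eta>\<close> the energy of a corrector outside \<open>j\<close> layers around its element decays
  like \<open>\<beta>\<^sup>j\<close>.  No ideal (global) corrector is needed: for \<open>w\<close> in the kernel of the global operator, cutting off \<open>w\<close>
  inside \<open>\<Omega>\<^sub>T\<close> gives an admissible test function of the local problem, so \<open>\<B>((id + \<K>\<^sub>m)v, w)\<close> is exponentially
  small.  Given \<open>v\<close>, choose \<open>\<psi>\<close> almost attaining the inf-sup constant for \<open>(id + \<K>\<^sub>m)v\<close> and replace it by
  \<open>(id + \<K>\<^sub>m)\<pi>\<psi>\<close>: the difference is an element of the kernel up to the small function \<open>\<pi>\<K>\<^sub>m\<pi>\<psi>\<close>.  The overlap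
  bound may be taken as \<open>Mm\<^sup>3\<close>; for large \<open>M\<close> the oversampling condition makes all errors small against \<open>\<gamma>\<close>.
\<close>

section \<open>Square-integrable functions\<close>

text \<open>Gradients have no curl and no factor \<open>H\<close>, so the mass term has the wrong
  sign on them; hence the sign flip of the gradient part. Flipped and cut-off fields leave the
  kernel and are brought back by \<open>id - \<pi>\<close>: commutation keeps the projected gradient
  curl-free, and locality of \<open>\<pi>\<close> costs one layer. Cutting off \<open>w\<close>
  itself would leave a product of the cutoff gradient, of size \<open>1/H\<close>, with a gradient
  that has no factor \<open>H\<close>. Cutting off \<open>z\<close> and \<open>\<theta>\<close>
  separately pairs every \<open>1/H\<close> with a factor \<open>H\<close>, so the constants do not
  see the mesh size. A local kernel is not contained in the global one, so \<open>\<pi>\<close> does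
  not annihilate the correctors; but there it acts only on the outer layers, where they have
  decayed. Fields are determined up to null sets and correctors are picked by \<open>SOME\<close>.
  Solvability therefore comes before any statement about correctors, and it is obtained from a
  Babuska-Necas argument on a semidefinite space of functions. As the form is not assumed hermitian,
  coercivity is proved in both orders of the arguments.\<close>

lemma discriminant_nonneg:
  fixes a b c :: real
  assumes "\<And>t. 0 \<le> a + 2 * t * b + t\<^sup>2 * c"
  shows "b\<^sup>2 \<le> a * c"
proof (cases "c = 0")
  case True
  have "b = 0"
  proof (rule ccontr)
    assume b: "b \<noteq> 0"
    \<comment> \<open>This parameter makes \<open>a + 2 t b\<close> equal to -1.\<close>
    have "0 \<le> a + 2 * (- (a + 1) / (2 * b)) * b + (- (a + 1) / (2 * b))\<^sup>2 * c" by (rule assms)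
    also have "\<dots> = -1" using b True by (simp add: field_simps)
    finally show False by simp
  qed
  then show ?thesis using True by simp
next
  case False
  have c: "c > 0"
  proof (rule ccontr)
    assume "\<not> c > 0"
    then have c: "c < 0" using False by simp
    \<comment> \<open>Large enough that \<open>t (-c)\<close> dominates the remaining coefficients;
      the extra 1 ensures \<open>t \<ge> 1\<close>, with which \<open>\<bar>a\<bar>\<close> is
      absorbed.\<close>
    define t where "t = (2 * \<bar>b\<bar> + \<bar>a\<bar> + 1) / (- c) + 1"
    have t1: "t \<ge> 1" unfolding t_def using c divide_nonneg_pos[of "2 * \<bar>b\<bar> + \<bar>a\<bar> + 1" "- c"] by simp
    have "t * (- c) \<ge> 2 * \<bar>b\<bar> + \<bar>a\<bar> + 1"
      unfolding t_def using c by (simp add: field_simps)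
    then have "t * (t * (- c)) \<ge> t * (2 * \<bar>b\<bar> + \<bar>a\<bar> + 1)"
      using t1 by (intro mult_left_mono) auto
    moreover have "t * (2 * \<bar>b\<bar> + \<bar>a\<bar> + 1) \<ge> 2 * t * b + \<bar>a\<bar> + 1"
    proof -
      have "t * b \<le> t * \<bar>b\<bar>" using t1 by (intro mult_left_mono) auto
      moreover have "\<bar>a\<bar> \<le> t * \<bar>a\<bar>" using t1 mult_right_mono[of 1 t "\<bar>a\<bar>"] by simp
      moreover have "t * (2 * \<bar>b\<bar> + \<bar>a\<bar> + 1) = 2 * (t * \<bar>b\<bar>) + t * \<bar>a\<bar> + t" "2 * t * b = 2 * (t * b)"
        by (simp_all add: algebra_simps)
      ultimately show ?thesis using t1 by linarith
    qed
    ultimately have "a + 2 * t * b + t\<^sup>2 * c < 0"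
      by (simp add: power2_eq_square algebra_simps)
    with assms[of t] show False by simp
  qed
  have "0 \<le> a + 2 * (- b / c) * b + (- b / c)\<^sup>2 * c" by (rule assms)
  also have "\<dots> = a - b\<^sup>2 / c" using False by (simp add: power2_eq_square field_simps)
  finally have "b\<^sup>2 / c \<le> a" by simp
  then show ?thesis using c by (simp add: field_simps)
qed

lemma norm_cmult_vec: "norm (c *s v) = cmod c * norm (v :: complex ^ 'n)"
  by (simp add: norm_vec_def norm_mult L2_set_right_distrib)

lemma inner_vec_complex: "(u :: complex ^ 'n) \<bullet> v = Re (\<Sum>i\<in>UNIV. u $ i * cnj (v $ i))"
  by (simp add: inner_vec_def inner_complex_def)

lemma cmod_sum_mult_cnj_le: "cmod (\<Sum>i\<in>UNIV. u $ i * cnj (v $ i)) \<le> norm u * norm (v :: complex ^ 'n)"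
proof -
  have "cmod (\<Sum>i\<in>UNIV. u $ i * cnj (v $ i)) \<le> (\<Sum>i\<in>UNIV. \<bar>cmod (u $ i)\<bar> * \<bar>cmod (v $ i)\<bar>)"
    by (rule order_trans[OF norm_sum]) (simp add: norm_mult)
  also have "\<dots> \<le> L2_set (\<lambda>i. cmod (u $ i)) UNIV * L2_set (\<lambda>i. cmod (v $ i)) UNIV"
    by (rule L2_set_mult_ineq)
  finally show ?thesis by (simp add: norm_vec_def)
qed

lemma sum_norm_le_sq: "(norm (a + b))\<^sup>2 \<le> 2 * (norm a)\<^sup>2 + 2 * (norm (b::'b::real_normed_vector))\<^sup>2"
proof -
  have "(norm (a + b))\<^sup>2 \<le> (norm a + norm b)\<^sup>2" by (intro power_mono norm_triangle_ineq) auto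
  also have "\<dots> \<le> 2 * (norm a)\<^sup>2 + 2 * (norm b)\<^sup>2"
    using zero_le_power2[of "norm a - norm b"] by (simp add: power2_eq_square algebra_simps)
  finally show ?thesis .
qed

lemma L2D:
  assumes "f \<in> L2 G"
  shows L2_measurable: "f \<in> borel_measurable (lebesgue_on G)"
    and L2_integrable: "integrable (lebesgue_on G) (\<lambda>x. (norm (f x))\<^sup>2)"
  using assms by (auto simp: L2_def)

lemma L2_bound:
  assumes "f \<in> borel_measurable (lebesgue_on G)" "integrable (lebesgue_on G) h"
    and "AE x in lebesgue_on G. (norm (f x))\<^sup>2 \<le> h x"
  shows "f \<in> L2 G"
  unfolding L2_def
  using assms by (auto intro!: Bochner_Integration.integrable_bound[OF assms(2)] elim!: AE_mp)

lemma L2_zero [simp]: "(\<lambda>x. 0) \<in> L2 G" by (simp add: L2_def)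

lemma L2_add:
  assumes "f \<in> L2 G" "g \<in> L2 G" shows "(\<lambda>x. f x + g x) \<in> L2 G"
  by (rule L2_bound[where h="\<lambda>x. 2 * (norm (f x))\<^sup>2 + 2 * (norm (g x))\<^sup>2"])
    (use L2D[OF assms(1)] L2D[OF assms(2)] in \<open>auto simp: sum_norm_le_sq\<close>)

lemma L2_scaleR:
  assumes "f \<in> L2 G" shows "(\<lambda>x. c *\<^sub>R f x) \<in> L2 G"
  using L2D[OF assms] by (auto simp: L2_def power_mult_distrib)

lemma L2_uminus: "f \<in> L2 G \<Longrightarrow> (\<lambda>x. - f x) \<in> L2 G"
  using L2_scaleR[of f G "-1"] by simp

lemma L2_diff:
  assumes "f \<in> L2 G" "g \<in> L2 G" shows "(\<lambda>x. f x - g x) \<in> L2 G"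
  using L2_add[OF assms(1) L2_uminus[OF assms(2)]] by simp

lemma L2_mult_bounded:
  fixes f :: "point \<Rightarrow> 'b::euclidean_space"
  assumes "f \<in> L2 G" "h \<in> borel_measurable (lebesgue_on G)"
    and "AE x in lebesgue_on G. norm (h x) \<le> B * norm (f x)"
  shows "h \<in> L2 G"
proof (rule L2_bound[where h="\<lambda>x. B\<^sup>2 * (norm (f x))\<^sup>2"])
  show "AE x in lebesgue_on G. (norm (h x))\<^sup>2 \<le> B\<^sup>2 * (norm (f x))\<^sup>2"
    using assms(3) 
  proof eventually_elim
    case (elim x)
    then have "(norm (h x))\<^sup>2 \<le> (B * norm (f x))\<^sup>2" by (intro power_mono) auto
    then show ?case by (simp add: power_mult_distrib)
  qed
qed (use L2D[OF assms(1)] assms in auto)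

lemma measurable_cvec_cong: 
  fixes f :: "'a \<Rightarrow> complex ^ 'n"
  shows "f \<in> borel_measurable M \<longleftrightarrow> (\<forall>i. (\<lambda>x. f x $ i) \<in> borel_measurable M)"
proof
  assume "f \<in> borel_measurable M"
  then show "\<forall>i. (\<lambda>x. f x $ i) \<in> borel_measurable M"
    by (auto intro!: measurable_compose[where N=borel and g="\<lambda>y. y $ _"] borel_measurable_continuous_onI continuous_intros)
next
  assume *: "\<forall>i. (\<lambda>x. f x $ i) \<in> borel_measurable M"
  show "f \<in> borel_measurable M"
  proof (subst borel_measurable_euclidean_space, intro ballI)
    fix b :: "complex ^ 'n" assume "b \<in> Basis"
    then obtain i c where b: "b = axis i c" by (auto simp: Basis_vec_def)
    have "(\<lambda>x. f x \<bullet> b) = (\<lambda>x. (f x $ i) \<bullet> c)" by (simp add: b inner_axis)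
    then show "(\<lambda>x. f x \<bullet> b) \<in> borel_measurable M" using * by (simp add: borel_measurable_inner)
  qed
qed

lemma L2_cmult:
  fixes f :: "point \<Rightarrow> complex ^ 3"
  assumes "f \<in> L2 G" shows "(\<lambda>x. c *s f x) \<in> L2 G"
  by (rule L2_mult_bounded[OF assms, where B="cmod c"])
    (use L2D[OF assms] in \<open>auto simp: norm_cmult_vec measurable_cvec_cong intro!: borel_measurable_times\<close>)

lemma L2_norm_mult_integrable:
  assumes "f \<in> L2 G" "g \<in> L2 G"
  shows "integrable (lebesgue_on G) (\<lambda>x. norm (f x) * norm (g x))"
proof -
  note m = L2D[OF assms(1)] L2D[OF assms(2)]
  show "integrable (lebesgue_on G) (\<lambda>x. norm (f x) * norm (g x))"
  proof (rule Bochner_Integration.integrable_bound)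
    show "integrable (lebesgue_on G) (\<lambda>x. (norm (f x))\<^sup>2 + (norm (g x))\<^sup>2)" using m by simp
    have "a * b \<le> a\<^sup>2 + b\<^sup>2" if "a \<ge> 0" "b \<ge> 0" for a b :: real
      using sum_squares_bound[of a b] mult_nonneg_nonneg[OF that] by linarith
    then show "AE x in lebesgue_on G. norm (norm (f x) * norm (g x)) \<le> norm ((norm (f x))\<^sup>2 + (norm (g x))\<^sup>2)"
      by (auto simp: abs_mult)
  qed (use m in measurable)
qed

lemma l2ip_integrable:
  assumes "v \<in> L2 G" "w \<in> L2 G"
  shows "integrable (lebesgue_on G) (\<lambda>x. \<Sum>i\<in>UNIV. v x $ i * cnj (w x $ i :: complex))"
proof (rule Bochner_Integration.integrable_bound[OF L2_norm_mult_integrable[OF assms]])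
  have "(\<lambda>x. v x $ i) \<in> borel_measurable (lebesgue_on G)" "(\<lambda>x. w x $ i) \<in> borel_measurable (lebesgue_on G)" for i
    using L2D[OF assms(1)] L2D[OF assms(2)] by (auto simp: measurable_cvec_cong)
  moreover have "cnj \<in> borel_measurable borel"
    by (intro borel_measurable_continuous_onI continuous_intros)
  ultimately show "(\<lambda>x. \<Sum>i\<in>UNIV. v x $ i * cnj (w x $ i)) \<in> borel_measurable (lebesgue_on G)"
    by (intro borel_measurable_sum borel_measurable_times) (auto intro: measurable_compose)
qed (auto simp: abs_mult intro!: cmod_sum_mult_cnj_le)

lemma l2norm_nonneg [simp]: "0 \<le> l2norm G f"
  by (simp add: l2norm_def)

lemma l2norm_sq: "(l2norm G f)\<^sup>2 = integral\<^sup>L (lebesgue_on G) (\<lambda>x. (norm (f x))\<^sup>2)"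
  by (simp add: l2norm_def)

lemma l2norm_zero [simp]: "l2norm G (\<lambda>x. 0) = 0" by (simp add: l2norm_def)

lemma l2norm_minus_commute: "l2norm G (\<lambda>x. f x - g x) = l2norm G (\<lambda>x. g x - f x)"
  by (simp add: l2norm_def norm_minus_commute)

lemma l2norm_scaleR: "l2norm G (\<lambda>x. c *\<^sub>R f x) = \<bar>c\<bar> * l2norm G f"
  by (simp add: l2norm_def power_mult_distrib real_sqrt_mult)

lemma l2norm_cmult: "l2norm G (\<lambda>x. c *s f x) = cmod c * l2norm G (f :: vfield)"
  by (simp add: l2norm_def power_mult_distrib real_sqrt_mult norm_cmult_vec)

lemma integral_inner_le:
  assumes f: "f \<in> L2 G" and g: "g \<in> L2 G"
  shows "integral\<^sup>L (lebesgue_on G) (\<lambda>x. norm (f x) * norm (g x)) \<le> l2norm G f * l2norm G g"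
proof -
  let ?I = "integral\<^sup>L (lebesgue_on G)"
  note m = L2_integrable[OF f] L2_integrable[OF g] L2_norm_mult_integrable[OF f g]
  have "(?I (\<lambda>x. norm (f x) * norm (g x)))\<^sup>2 \<le> ?I (\<lambda>x. (norm (f x))\<^sup>2) * ?I (\<lambda>x. (norm (g x))\<^sup>2)"
  proof (rule discriminant_nonneg)
    fix t :: real
    have "0 \<le> ?I (\<lambda>x. (norm (f x) + t * norm (g x))\<^sup>2)" by simp
    also have "\<dots> = ?I (\<lambda>x. (norm (f x))\<^sup>2 + (2 * t) * (norm (f x) * norm (g x)) + t\<^sup>2 * (norm (g x))\<^sup>2)"
      by (simp add: power2_eq_square algebra_simps)
    also have "\<dots> = ?I (\<lambda>x. (norm (f x))\<^sup>2) + 2 * t * ?I (\<lambda>x. norm (f x) * norm (g x)) + t\<^sup>2 * ?I (\<lambda>x. (norm (g x))\<^sup>2)"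
      using m by simp
    finally show "0 \<le> \<dots>" .
  qed
  then have "(?I (\<lambda>x. norm (f x) * norm (g x)))\<^sup>2 \<le> (l2norm G f * l2norm G g)\<^sup>2"
    by (simp add: power_mult_distrib l2norm_sq)
  then show ?thesis by (rule power2_le_imp_le) simp
qed

lemma cmod_l2ip_le:
  assumes "v \<in> L2 G" "w \<in> L2 G"
  shows "cmod (l2ip G v w) \<le> l2norm G v * l2norm G w"
proof -
  have "cmod (l2ip G v w) \<le> integral\<^sup>L (lebesgue_on G) (\<lambda>x. cmod (\<Sum>i\<in>UNIV. v x $ i * cnj (w x $ i)))"
    unfolding l2ip_def by (rule integral_norm_bound)
  also have "\<dots> \<le> integral\<^sup>L (lebesgue_on G) (\<lambda>x. norm (v x) * norm (w x))"
    using l2ip_integrable[OF assms] L2_norm_mult_integrable[OF assms]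
    by (intro integral_mono cmod_sum_mult_cnj_le) auto
  also have "\<dots> \<le> l2norm G v * l2norm G w" by (rule integral_inner_le[OF assms])
  finally show ?thesis .
qed

lemma l2norm_mono:
  assumes "g \<in> L2 G" "f \<in> borel_measurable (lebesgue_on G)" "AE x in lebesgue_on G. norm (f x) \<le> norm (g x)"
  shows "l2norm G f \<le> l2norm G g"
  unfolding l2norm_def
proof (intro real_sqrt_le_mono integral_mono_AE)
  have "f \<in> L2 G" by (rule L2_mult_bounded[OF assms(1,2), where B=1]) (use assms in simp)
  then show "integrable (lebesgue_on G) (\<lambda>x. (norm (f x))\<^sup>2)" by (rule L2_integrable)
  show "AE x in lebesgue_on G. (norm (f x))\<^sup>2 \<le> (norm (g x))\<^sup>2"
    using assms(3) by eventually_elim (auto intro: power_mono)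
qed (use L2D[OF assms(1)] in auto)

lemma l2norm_triangle:
  assumes f: "f \<in> L2 G" and g: "g \<in> L2 G"
  shows "l2norm G (\<lambda>x. f x + g x) \<le> l2norm G f + l2norm G g"
proof -
  let ?I = "integral\<^sup>L (lebesgue_on G)"
  note m = L2_integrable[OF f] L2_integrable[OF g] L2_norm_mult_integrable[OF f g]
  have "(l2norm G (\<lambda>x. f x + g x))\<^sup>2 \<le> ?I (\<lambda>x. (norm (f x))\<^sup>2 + 2 * (norm (f x) * norm (g x)) + (norm (g x))\<^sup>2)"
    unfolding l2norm_sq
  proof (intro integral_mono L2_integrable L2_add f g)
    show "(norm (f x + g x))\<^sup>2 \<le> (norm (f x))\<^sup>2 + 2 * (norm (f x) * norm (g x)) + (norm (g x))\<^sup>2" for x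
      using power_mono[OF norm_triangle_ineq[of "f x" "g x"], of 2] by (simp add: power2_sum algebra_simps)
  qed (use m in auto)
  also have "\<dots> = (l2norm G f)\<^sup>2 + 2 * ?I (\<lambda>x. norm (f x) * norm (g x)) + (l2norm G g)\<^sup>2"
    using m by (simp add: l2norm_sq)
  also have "\<dots> \<le> (l2norm G f + l2norm G g)\<^sup>2"
    using integral_inner_le[OF f g] by (simp add: power2_sum)
  finally show ?thesis by (rule power2_le_imp_le) simp
qed

lemma l2norm_triangle_diff:
  assumes f: "f \<in> L2 G" and g: "g \<in> L2 G" and h: "h \<in> L2 G"
  shows "l2norm G (\<lambda>x. f x - h x) \<le> l2norm G (\<lambda>x. f x - g x) + l2norm G (\<lambda>x. g x - h x)"
  using l2norm_triangle[OF L2_diff[OF f g] L2_diff[OF g h]] by simp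

lemma ae_eq_iff:
  assumes "G \<in> sets lebesgue"
  shows "ae_eq G f g \<longleftrightarrow> (AE x in lebesgue_on G. f x = g x)"
  unfolding ae_eq_def using assms by (subst AE_restrict_space_iff) auto

lemma ae_eq_refl [simp]: "ae_eq G f f" by (simp add: ae_eq_def)

lemma ae_eq_sym: "ae_eq G f g \<Longrightarrow> ae_eq G g f" by (auto simp: ae_eq_def elim: AE_mp)

lemma ae_eq_trans: "ae_eq G f g \<Longrightarrow> ae_eq G g h \<Longrightarrow> ae_eq G f h"
  unfolding ae_eq_def by (rule AE_mp[OF AE_conjI]) auto

lemma ae_eq_mono: "ae_eq G f g \<Longrightarrow> G' \<subseteq> G \<Longrightarrow> ae_eq G' f g"
  unfolding ae_eq_def by (auto elim!: AE_mp)

lemma ae_eq_comp2: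
  "ae_eq G f f' \<Longrightarrow> ae_eq G g g' \<Longrightarrow> ae_eq G (\<lambda>x. F x (f x) (g x)) (\<lambda>x. F x (f' x) (g' x))"
  unfolding ae_eq_def by (rule AE_mp[OF AE_conjI]) auto

lemma ae_eq_comp: "ae_eq G f f' \<Longrightarrow> ae_eq G (\<lambda>x. F x (f x)) (\<lambda>x. F x (f' x))"
  unfolding ae_eq_def by (auto elim!: AE_mp)

text \<open>Rests on the completeness of Lebesgue measure; it allows a field to be exchanged for an
  almost everywhere equal one without a new measurability assumption.\<close>

lemma measurable_ae_eq:
  fixes f g :: "point \<Rightarrow> 'b::euclidean_space"
  assumes G: "G \<in> sets lebesgue" and f: "f \<in> borel_measurable (lebesgue_on G)" and "ae_eq G f g"
  shows "g \<in> borel_measurable (lebesgue_on G)"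
proof -
  have "(\<lambda>x. indicator G x *\<^sub>R f x) \<in> borel_measurable lebesgue"
    using f G by (simp add: borel_measurable_restrict_space_iff)
  moreover have "AE x in lebesgue. indicator G x *\<^sub>R f x = indicator G x *\<^sub>R g x"
    using assms(3) unfolding ae_eq_def by eventually_elim (auto simp: indicator_def)
  ultimately have "(\<lambda>x. indicator G x *\<^sub>R g x) \<in> borel_measurable lebesgue"
    by (rule borel_measurable_AE)
  then show ?thesis using G by (simp add: borel_measurable_restrict_space_iff)
qed

lemma L2_ae_eq:
  assumes G: "G \<in> sets lebesgue" and f: "f \<in> L2 G" and "ae_eq G f g"
  shows "g \<in> L2 G"
  by (rule L2_mult_bounded[OF f measurable_ae_eq[OF G L2_measurable[OF f] assms(3)], where B=1])
    (use assms(3) in \<open>auto simp: ae_eq_iff[OF G] elim: AE_mp\<close>)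

lemma l2norm_ae_eq:
  assumes G: "G \<in> sets lebesgue" and f: "f \<in> L2 G" and "ae_eq G f g"
  shows "l2norm G f = l2norm G g"
  unfolding l2norm_def
  using L2_measurable[OF f] measurable_ae_eq[OF G L2_measurable[OF f] assms(3)] assms(3)
  by (intro arg_cong[where f=sqrt] integral_cong_AE) (auto simp: ae_eq_iff[OF G] elim: AE_mp)

lemma l2ip_ae_eq:
  assumes G: "G \<in> sets lebesgue" and f: "v \<in> L2 G" "w \<in> L2 G" and "ae_eq G v v'" "ae_eq G w w'"
  shows "l2ip G v w = l2ip G v' w'"
  unfolding l2ip_def
  using l2ip_integrable[OF f] l2ip_integrable[OF L2_ae_eq[OF G f(1) assms(4)] L2_ae_eq[OF G f(2) assms(5)]]
    assms(4,5)
  by (intro integral_cong_AE) (auto simp: ae_eq_iff[OF G] elim!: AE_mp[OF AE_conjI])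

lemma l2ip_add_left:
  assumes "u \<in> L2 G" "v \<in> L2 G" "w \<in> L2 G"
  shows "l2ip G (\<lambda>x. u x + v x) w = l2ip G u w + l2ip G v w"
  unfolding l2ip_def
  using l2ip_integrable[OF assms(1,3)] l2ip_integrable[OF assms(2,3)]
  by (simp add: algebra_simps sum.distrib)

lemma l2ip_add_right:
  assumes "u \<in> L2 G" "v \<in> L2 G" "w \<in> L2 G"
  shows "l2ip G w (\<lambda>x. u x + v x) = l2ip G w u + l2ip G w v"
  unfolding l2ip_def
  using l2ip_integrable[OF assms(3,1)] l2ip_integrable[OF assms(3,2)]
  by (simp add: algebra_simps sum.distrib)

lemma l2ip_cmult_left: "l2ip G (\<lambda>x. c *s u x) w = c * l2ip G u w"
proof -
  have "(\<lambda>x. \<Sum>i\<in>UNIV. (c *s u x) $ i * cnj (w x $ i)) = (\<lambda>x. c * (\<Sum>i\<in>UNIV. u x $ i * cnj (w x $ i)))"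
    by (simp add: sum_distrib_left mult.assoc)
  then show ?thesis unfolding l2ip_def by (simp only: integral_mult_right_zero)
qed

lemma l2ip_cmult_right: "l2ip G u (\<lambda>x. c *s w x) = cnj c * l2ip G u w"
proof -
  have "(\<lambda>x. \<Sum>i\<in>UNIV. u x $ i * cnj ((c *s w x) $ i)) = (\<lambda>x. cnj c * (\<Sum>i\<in>UNIV. u x $ i * cnj (w x $ i)))"
    by (simp add: sum_distrib_left mult.left_commute)
  then show ?thesis unfolding l2ip_def by (simp only: integral_mult_right_zero)
qed

lemma l2ip_diff_left:
  assumes "u \<in> L2 G" "v \<in> L2 G" "w \<in> L2 G"
  shows "l2ip G (\<lambda>x. u x - v x) w = l2ip G u w - l2ip G v w"
  unfolding l2ip_def
  using l2ip_integrable[OF assms(1,3)] l2ip_integrable[OF assms(2,3)]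
  by (simp add: algebra_simps sum_subtractf)

lemma l2ip_tendsto_left:
  assumes "u \<in> L2 G" "\<And>n. v n \<in> L2 G" "w \<in> L2 G" "(\<lambda>n. l2norm G (\<lambda>x. u x - v n x)) \<longlonglongrightarrow> 0"
  shows "(\<lambda>n. l2ip G (v n) w) \<longlonglongrightarrow> l2ip G u w"
proof -
  have "(\<lambda>n. l2norm G (\<lambda>x. u x - v n x) * l2norm G w) \<longlonglongrightarrow> 0"
    using tendsto_mult_right[OF assms(4), of "l2norm G w"] by simp
  then have "(\<lambda>n. l2ip G u w - l2ip G (v n) w) \<longlonglongrightarrow> 0"
    by (rule Lim_null_comparison[rotated])
      (use assms cmod_l2ip_le[OF L2_diff[OF assms(1,2)] assms(3)] in \<open>simp add: l2ip_diff_left\<close>)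
  from tendsto_diff[OF tendsto_const[of "l2ip G u w"] this] show ?thesis by simp
qed

subsection \<open>Completeness\<close>

lemma L2_dominated:
  fixes f :: "nat \<Rightarrow> point \<Rightarrow> 'b::euclidean_space"
  assumes "g \<in> L2 G" "\<And>n. f n \<in> borel_measurable (lebesgue_on G)" 
    "AE x in lebesgue_on G. (\<lambda>n. f n x) \<longlonglongrightarrow> 0"
    "\<And>n. AE x in lebesgue_on G. norm (f n x) \<le> B * norm (g x :: 'c::euclidean_space)"
  shows "(\<lambda>n. l2norm G (f n)) \<longlonglongrightarrow> 0"
proof -
  have "(\<lambda>n. integral\<^sup>L (lebesgue_on G) (\<lambda>x. (norm (f n x))\<^sup>2)) \<longlonglongrightarrow> integral\<^sup>L (lebesgue_on G) (\<lambda>x. 0)"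
  proof (rule integral_dominated_convergence)
    show "integrable (lebesgue_on G) (\<lambda>x. B\<^sup>2 * (norm (g x))\<^sup>2)"
      using L2_integrable[OF assms(1)] by simp
    show "AE x in lebesgue_on G. (\<lambda>n. (norm (f n x))\<^sup>2) \<longlonglongrightarrow> 0"
      using assms(3)
    proof eventually_elim
      case (elim x)
      from tendsto_power[OF tendsto_norm[OF elim], of 2] show ?case by simp
    qed
    show "AE x in lebesgue_on G. norm ((norm (f n x))\<^sup>2) \<le> B\<^sup>2 * (norm (g x))\<^sup>2" for n
      using assms(4)[of n]
    proof eventually_elim
      case (elim x)
      then have "(norm (f n x))\<^sup>2 \<le> (B * norm (g x))\<^sup>2" by (intro power_mono) auto
      then show ?case by (simp add: power_mult_distrib)
    qed
  qed (use assms(2) in auto)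
  then have "(\<lambda>n. sqrt (integral\<^sup>L (lebesgue_on G) (\<lambda>x. (norm (f n x))\<^sup>2))) \<longlonglongrightarrow> sqrt 0"
    by (intro tendsto_real_sqrt) simp
  then show ?thesis by (simp add: l2norm_def)
qed

lemma nn_integral_l2norm:
  assumes "f \<in> L2 G"
  shows "(\<integral>\<^sup>+x. ennreal ((norm (f x))\<^sup>2) \<partial>lebesgue_on G) = ennreal ((l2norm G f)\<^sup>2)"
  unfolding l2norm_sq using L2_integrable[OF assms] by (intro nn_integral_eq_integral) auto

text \<open>Riesz-Fischer for a geometric rate. With the weights \<open>2 ^ n\<close> the sum of the
  squared increments still has a finite integral, so almost everywhere the increments are bounded by
  a multiple of \<open>sqrt (1/2) ^ n\<close> and the sequence converges pointwise. Fatou's lemma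
  turns the pointwise limit into the norm estimate.\<close>

lemma L2_complete_fast:
  fixes f :: "nat \<Rightarrow> point \<Rightarrow> 'b::euclidean_space"
  assumes f: "\<And>n. f n \<in> L2 G"
    and d: "\<And>n m. n \<le> m \<Longrightarrow> l2norm G (\<lambda>x. f m x - f n x) \<le> (1/2) ^ n"
  shows "\<exists>g\<in>L2 G. \<forall>n. l2norm G (\<lambda>x. g x - f n x) \<le> (1/2) ^ n"
proof -
  let ?M = "lebesgue_on G"
  note fm [measurable] = L2_measurable[OF f]
  define D where "D = (\<lambda>n x. norm (f (Suc n) x - f n x))"
  have [measurable]: "D n \<in> borel_measurable ?M" for n unfolding D_def by measurable
  have "(\<integral>\<^sup>+x. (\<Sum>n. ennreal (2 ^ n * (D n x)\<^sup>2)) \<partial>?M) = (\<Sum>n. \<integral>\<^sup>+x. ennreal (2 ^ n * (D n x)\<^sup>2) \<partial>?M)"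
    by (intro nn_integral_suminf) measurable
  also have "\<dots> \<le> (\<Sum>n. ennreal ((1/2) ^ n))"
  proof (rule suminf_le)
    fix n
    have "(\<integral>\<^sup>+x. ennreal (2 ^ n * (D n x)\<^sup>2) \<partial>?M) = ennreal (2 ^ n) * (\<integral>\<^sup>+x. ennreal ((D n x)\<^sup>2) \<partial>?M)"
      by (simp add: ennreal_mult nn_integral_cmult)
    also have "(\<integral>\<^sup>+x. ennreal ((D n x)\<^sup>2) \<partial>?M) = ennreal ((l2norm G (\<lambda>x. f (Suc n) x - f n x))\<^sup>2)"
      unfolding D_def by (rule nn_integral_l2norm[OF L2_diff[OF f f]])
    also have "ennreal (2 ^ n) * \<dots> \<le> ennreal (2 ^ n * ((1/2) ^ n)\<^sup>2)"
      using d[of n "Suc n"] by (subst ennreal_mult[symmetric]) (auto intro!: ennreal_leI power_mono)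
    also have "2 ^ n * ((1/2::real) ^ n)\<^sup>2 = (1/2) ^ n"
      by (simp add: power2_eq_square field_simps flip: power_mult_distrib)
    finally show "(\<integral>\<^sup>+x. ennreal (2 ^ n * (D n x)\<^sup>2) \<partial>?M) \<le> ennreal ((1/2) ^ n)" .
  qed auto
  also have "\<dots> = ennreal (\<Sum>n. (1/2) ^ n)"
    by (intro suminf_ennreal2) (auto intro: summable_geometric)
  also have "\<dots> < \<infinity>" by simp
  finally have "AE x in ?M. (\<Sum>n. ennreal (2 ^ n * (D n x)\<^sup>2)) \<noteq> \<infinity>"
    by (intro nn_integral_PInf_AE) auto
  then have conv: "AE x in ?M. convergent (\<lambda>n. f n x)"
  proof eventually_elim
    case (elim x)
    then have sm: "summable (\<lambda>n. 2 ^ n * (D n x)\<^sup>2)"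
      by (intro summable_suminf_not_top) auto
    then have "(\<lambda>n. 2 ^ n * (D n x)\<^sup>2) \<longlonglongrightarrow> 0" by (rule summable_LIMSEQ_zero)
    then obtain C where C: "\<And>n. norm (2 ^ n * (D n x)\<^sup>2) \<le> C"
      using convergent_imp_Bseq[of "\<lambda>n. 2 ^ n * (D n x)\<^sup>2"] by (auto simp: convergent_def Bseq_def)
    have Dle: "D n x \<le> sqrt C * (sqrt (1/2)) ^ n" for n
    proof -
      have "(D n x)\<^sup>2 \<le> C * (1/2) ^ n" using C[of n] by (simp add: field_simps)
      then have "sqrt ((D n x)\<^sup>2) \<le> sqrt (C * (1/2) ^ n)" by (rule real_sqrt_le_mono)
      then show ?thesis by (simp add: D_def real_sqrt_mult real_sqrt_power)
    qed
    have "summable (\<lambda>n. sqrt C * (sqrt (1/2)) ^ n)"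
      by (intro summable_mult summable_geometric) (simp add: real_sqrt_divide)
    then have "summable (\<lambda>n. f (Suc n) x - f n x)"
      by (rule summable_comparison_test'[where N=0]) (use Dle in \<open>simp add: D_def\<close>)
    then have "convergent (\<lambda>n. f n x - f 0 x)" by (simp add: summable_iff_convergent sum_lessThan_telescope[of "\<lambda>n. f n x"])
    from convergent_add[OF this convergent_const[of "f 0 x"]] show "convergent (\<lambda>n. f n x)" by simp
  qed
  define g where "g = (\<lambda>x. lim (\<lambda>n. f n x))"
  have gm [measurable]: "g \<in> borel_measurable ?M" unfolding g_def by (rule borel_measurable_lim_metric[OF fm])
  have lim: "AE x in ?M. (\<lambda>n. f n x) \<longlonglongrightarrow> g x"
    using conv by eventually_elim (simp add: g_def convergent_LIMSEQ_iff)
  have bound: "(\<integral>\<^sup>+x. ennreal ((norm (g x - f n x))\<^sup>2) \<partial>?M) \<le> ennreal (((1/2) ^ n)\<^sup>2)" for n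
  proof -
    have "(\<integral>\<^sup>+x. ennreal ((norm (g x - f n x))\<^sup>2) \<partial>?M) = (\<integral>\<^sup>+x. liminf (\<lambda>m. ennreal ((norm (f m x - f n x))\<^sup>2)) \<partial>?M)"
      using lim
    proof (intro nn_integral_cong_AE, eventually_elim)
      case (elim x)
      have "(\<lambda>m. ennreal ((norm (f m x - f n x))\<^sup>2)) \<longlonglongrightarrow> ennreal ((norm (g x - f n x))\<^sup>2)"
        by (intro tendsto_intros tendsto_ennrealI elim)
      then show ?case by (rule lim_imp_Liminf[symmetric, OF sequentially_bot])
    qed
    also have "\<dots> \<le> liminf (\<lambda>m. \<integral>\<^sup>+x. ennreal ((norm (f m x - f n x))\<^sup>2) \<partial>?M)"
      by (intro nn_integral_liminf) measurable
    also have "\<dots> = liminf (\<lambda>m. ennreal ((l2norm G (\<lambda>x. f m x - f n x))\<^sup>2))"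
      by (simp add: nn_integral_l2norm[OF L2_diff[OF f f]])
    also have "\<dots> \<le> ennreal (((1/2) ^ n)\<^sup>2)"
    proof (rule Liminf_le)
      show "\<forall>\<^sub>F m in sequentially. ennreal ((l2norm G (\<lambda>x. f m x - f n x))\<^sup>2) \<le> ennreal (((1/2) ^ n)\<^sup>2)"
        using eventually_ge_at_top[of n] by eventually_elim (intro ennreal_leI power_mono d; simp)
    qed simp
    finally show ?thesis .
  qed
  have diff: "(\<lambda>x. g x - f n x) \<in> L2 G" for n
    unfolding L2_def
  proof (clarify, intro conjI)
    show "integrable ?M (\<lambda>x. (norm (g x - f n x))\<^sup>2)"
      using bound[of n] by (intro integrableI_bounded) (auto intro: le_less_trans)
  qed measurable
  have "(\<lambda>x. (g x - f 0 x) + f 0 x) \<in> L2 G" by (rule L2_add[OF diff f])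
  then have "g \<in> L2 G" by simp
  moreover have "l2norm G (\<lambda>x. g x - f n x) \<le> (1/2) ^ n" for n
  proof (rule power2_le_imp_le)
    show "(l2norm G (\<lambda>x. g x - f n x))\<^sup>2 \<le> ((1/2) ^ n)\<^sup>2"
      using bound[of n] unfolding nn_integral_l2norm[OF diff] by (subst (asm) ennreal_le_iff) auto
  qed simp
  ultimately show ?thesis by blast
qed

lemma L2_complete:
  fixes f :: "nat \<Rightarrow> point \<Rightarrow> 'b::euclidean_space"
  assumes f: "\<And>n. f n \<in> L2 G"
    and Cauchy: "\<And>e. e > 0 \<Longrightarrow> \<exists>N. \<forall>n\<ge>N. \<forall>m\<ge>N. l2norm G (\<lambda>x. f n x - f m x) < e"
  shows "\<exists>g\<in>L2 G. (\<lambda>n. l2norm G (\<lambda>x. g x - f n x)) \<longlonglongrightarrow> 0"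
proof -
  have "\<exists>N. \<forall>k. \<forall>n\<ge>N k. \<forall>m\<ge>N k. l2norm G (\<lambda>x. f n x - f m x) < (1/2) ^ k"
    by (rule choice) (use Cauchy in simp)
  then obtain N where N: "\<And>k n m. N k \<le> n \<Longrightarrow> N k \<le> m \<Longrightarrow> l2norm G (\<lambda>x. f n x - f m x) < (1/2) ^ k" by blast
  \<comment> \<open>Any index beyond all of \<open>N 0, ..., N k\<close> would do; the sum is one,
    and it yields a subsequence with the geometric rate.\<close>
  define r where "r k = (\<Sum>i\<le>k. N i)" for k
  have rN: "N i \<le> r k" if "i \<le> k" for i k
    unfolding r_def using that by (intro member_le_sum) auto
  obtain g where g: "g \<in> L2 G" and gb: "\<And>k. l2norm G (\<lambda>x. g x - f (r k) x) \<le> (1/2) ^ k"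
    using L2_complete_fast[of "\<lambda>k. f (r k)" G, OF f less_imp_le[OF N[OF rN rN]]] by auto
  have "(\<lambda>n. l2norm G (\<lambda>x. g x - f n x)) \<longlonglongrightarrow> 0"
  proof (rule LIMSEQ_I)
    fix e :: real assume "e > 0"
    then obtain k where k: "(1/2) ^ k < e / 2" using real_arch_pow_inv[of "e/2" "1/2"] by auto
    have "l2norm G (\<lambda>x. g x - f n x) < e" if "n \<ge> N k" for n
    proof -
      have "l2norm G (\<lambda>x. g x - f n x) \<le> l2norm G (\<lambda>x. g x - f (r k) x) + l2norm G (\<lambda>x. f (r k) x - f n x)"
        by (rule l2norm_triangle_diff[OF g f f])
      also have "\<dots> < e" using gb[of k] N[OF rN[of k k] that] k by simp
      finally show ?thesis .
    qed
    then show "\<exists>no. \<forall>n\<ge>no. norm (l2norm G (\<lambda>x. g x - f n x) - 0) < e" by auto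
  qed
  with g show ?thesis by blast
qed

section \<open>Solvability of variational problems\<close>

text \<open>Fields that differ on a null set are different elements of \<open>S\<close>, so an inner
  product is only semidefinite on the carrier. Scalars are real: the complex problem enters through
  real parts.\<close>

locale psd_form =
  fixes S :: "('a \<Rightarrow> 'b::real_vector) set" and p :: "('a \<Rightarrow> 'b) \<Rightarrow> ('a \<Rightarrow> 'b) \<Rightarrow> real"
  assumes S_zero: "(\<lambda>x. 0) \<in> S"
    and S_add: "u \<in> S \<Longrightarrow> v \<in> S \<Longrightarrow> (\<lambda>x. u x + v x) \<in> S"
    and S_scale: "u \<in> S \<Longrightarrow> (\<lambda>x. c *\<^sub>R u x) \<in> S"
    and p_sym: "u \<in> S \<Longrightarrow> v \<in> S \<Longrightarrow> p u v = p v u"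
    and p_add: "u \<in> S \<Longrightarrow> v \<in> S \<Longrightarrow> w \<in> S \<Longrightarrow> p (\<lambda>x. u x + v x) w = p u w + p v w"
    and p_scale: "u \<in> S \<Longrightarrow> w \<in> S \<Longrightarrow> p (\<lambda>x. c *\<^sub>R u x) w = c * p u w"
    and p_nonneg: "u \<in> S \<Longrightarrow> 0 \<le> p u u"
begin

lemma S_diff: "u \<in> S \<Longrightarrow> v \<in> S \<Longrightarrow> (\<lambda>x. u x - v x) \<in> S"
  using S_add[OF _ S_scale[of v "-1"], of u] by simp

lemma p_add2: "u \<in> S \<Longrightarrow> v \<in> S \<Longrightarrow> w \<in> S \<Longrightarrow> p w (\<lambda>x. u x + v x) = p w u + p w v"
  using p_add[of u v w] p_sym S_add by metis

lemma p_scale2: "u \<in> S \<Longrightarrow> w \<in> S \<Longrightarrow> p w (\<lambda>x. c *\<^sub>R u x) = c * p w u"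
  using p_scale[of u w c] p_sym S_scale by metis

lemma p_diff: "u \<in> S \<Longrightarrow> v \<in> S \<Longrightarrow> w \<in> S \<Longrightarrow> p (\<lambda>x. u x - v x) w = p u w - p v w"
  using p_add[of u "\<lambda>x. (-1) *\<^sub>R v x" w] p_scale[of v w "-1"] S_scale[of v "-1"] by simp

lemma p_diff2: "u \<in> S \<Longrightarrow> v \<in> S \<Longrightarrow> w \<in> S \<Longrightarrow> p w (\<lambda>x. u x - v x) = p w u - p w v"
  using p_diff[of u v w] p_sym S_diff by metis

lemma p_CS: 
  assumes "u \<in> S" "v \<in> S" shows "(p u v)\<^sup>2 \<le> p u u * p v v"
proof (rule discriminant_nonneg)
  fix t
  have "0 \<le> p (\<lambda>x. u x + t *\<^sub>R v x) (\<lambda>x. u x + t *\<^sub>R v x)"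
    using assms by (intro p_nonneg S_add S_scale)
  also have "\<dots> = p u u + 2 * t * p u v + t\<^sup>2 * p v v"
    using assms S_scale[of v t] S_add[of u "\<lambda>x. t *\<^sub>R v x"] p_sym[of v u]
    by (simp add: p_add p_add2 p_scale p_scale2 power2_eq_square algebra_simps)
  finally show "0 \<le> p u u + 2 * t * p u v + t\<^sup>2 * p v v" .
qed

lemma p_CS_sqrt: 
  assumes "u \<in> S" "v \<in> S" shows "\<bar>p u v\<bar> \<le> sqrt (p u u) * sqrt (p v v)"
  using real_sqrt_le_mono[OF p_CS[OF assms]] by (simp add: real_sqrt_mult)

end

locale complete_psd_form = psd_form +
  assumes complete: "(\<And>n. X n \<in> S) \<Longrightarrow>
      (\<And>e. e > 0 \<Longrightarrow> \<exists>N. \<forall>n\<ge>N. \<forall>m\<ge>N. p (\<lambda>x. X n x - X m x) (\<lambda>x. X n x - X m x) < e) \<Longrightarrow>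
      \<exists>x\<in>S. (\<lambda>n. p (\<lambda>y. X n y - x y) (\<lambda>y. X n y - x y)) \<longlonglongrightarrow> 0"
begin

text \<open>Direct method of the calculus of variations: the representative minimises
  \<open>p w w - 2 F w\<close>. The parallelogram identity makes a minimising sequence Cauchy, and
  the first variation at the limit is the required identity.\<close>

lemma riesz:
  assumes F_add: "\<And>u v. u \<in> S \<Longrightarrow> v \<in> S \<Longrightarrow> F (\<lambda>x. u x + v x) = F u + F v"
    and F_scale: "\<And>u c. u \<in> S \<Longrightarrow> F (\<lambda>x. c *\<^sub>R u x) = c * F u"
    and F_bound: "\<And>u. u \<in> S \<Longrightarrow> \<bar>F u\<bar> \<le> C * sqrt (p u u)"
  shows "\<exists>f\<in>S. \<forall>w\<in>S. p f w = F w"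
proof -
  define J where "J w = p w w - 2 * F w" for w
  have "J w \<ge> - C\<^sup>2" if "w \<in> S" for w
  proof -
    have "F w \<le> C * sqrt (p w w)" using F_bound[OF that] by simp
    moreover have "0 \<le> (sqrt (p w w) - C)\<^sup>2" by simp
    ultimately show ?thesis using p_nonneg[OF that] unfolding J_def power2_diff
      by (simp add: mult.commute mult.left_commute)
  qed
  then have bdd: "bdd_below (J ` S)" by (intro bdd_belowI2[of S "- C\<^sup>2" J])
  define m where "m = Inf (J ` S)"
  have m: "m \<le> J w" if "w \<in> S" for w unfolding m_def using bdd that by (auto intro: cInf_lower)
  have "\<exists>x\<in>S. J x < m + 1 / real (Suc n)" for n
  proof -
    have "Inf (J ` S) < m + 1 / real (Suc n)" by (simp add: m_def)
    then show ?thesis using cInf_less_iff[of "J ` S" "m + 1 / real (Suc n)"] S_zero bdd by auto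
  qed
  then obtain X where X: "\<And>n. X n \<in> S" and JX: "\<And>n. J (X n) < m + 1 / real (Suc n)" by metis
  \<comment> \<open>Evaluating \<open>J\<close> at the midpoint bounds the distance of
    \<open>x\<close> and \<open>y\<close> by their excess over the infimum \<open>m\<close>.\<close>
  have par: "p (\<lambda>t. x t - y t) (\<lambda>t. x t - y t) \<le> 2 * (J x - m) + 2 * (J y - m)" if "x \<in> S" "y \<in> S" for x y
  proof -
    let ?z = "\<lambda>t. (1/2::real) *\<^sub>R (x t + y t)"
    have z: "?z \<in> S" using that by (intro S_add S_scale)
    have xy: "(\<lambda>t. x t + y t) \<in> S" "(\<lambda>t. x t - y t) \<in> S" using that by (auto intro: S_add S_diff)
    have "p ?z ?z = (1/4) * (p x x + 2 * p x y + p y y)"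
      using that xy S_scale[OF xy(1), of "1/2"] p_sym[of y x]
      by (simp add: p_scale p_scale2 p_add p_add2)
    moreover have "F ?z = (1/2) * (F x + F y)" using that xy by (simp add: F_scale F_add)
    moreover have "p (\<lambda>t. x t - y t) (\<lambda>t. x t - y t) = p x x - 2 * p x y + p y y"
      using that xy p_sym[of y x] by (simp add: p_diff p_diff2)
    ultimately show ?thesis using m[OF z] by (simp add: J_def)
  qed
  have "\<exists>x\<in>S. (\<lambda>n. p (\<lambda>y. X n y - x y) (\<lambda>y. X n y - x y)) \<longlonglongrightarrow> 0"
  proof (rule complete[OF X])
    fix e :: real assume "e > 0"
    then obtain N where N: "1 / real (Suc N) < e / 4" using nat_approx_posE[of "e/4"] by auto
    have "p (\<lambda>t. X n t - X k t) (\<lambda>t. X n t - X k t) < e" if "n \<ge> N" "k \<ge> N" for n k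
    proof -
      have "1 / real (Suc j) \<le> e / 4" if "j \<ge> N" for j
        using that by (intro order_trans[OF _ less_imp_le[OF N]] divide_left_mono) auto
      then have "J (X j) < m + e / 4" if "j \<ge> N" for j
        using order.strict_trans2[OF JX[of j] add_left_mono] that by blast
      from this[OF \<open>n \<ge> N\<close>] this[OF \<open>k \<ge> N\<close>]
      have "2 * (J (X n) - m) + 2 * (J (X k) - m) < e" by (simp add: field_simps)
      with par[OF X X, of n k] show ?thesis by (rule le_less_trans)
    qed
    then show "\<exists>N. \<forall>n\<ge>N. \<forall>m\<ge>N. p (\<lambda>x. X n x - X m x) (\<lambda>x. X n x - X m x) < e" by blast
  qed
  then obtain x where x: "x \<in> S" and lim: "(\<lambda>n. p (\<lambda>y. X n y - x y) (\<lambda>y. X n y - x y)) \<longlonglongrightarrow> 0" by blast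
  have "p x w = F w" if w: "w \<in> S" for w
  proof -
    have "(\<lambda>n. sqrt (p (\<lambda>y. X n y - x y) (\<lambda>y. X n y - x y)) * sqrt (p w w)) \<longlonglongrightarrow> sqrt 0 * sqrt (p w w)"
      by (intro tendsto_intros lim)
    then have "(\<lambda>n. p (X n) w - p x w) \<longlonglongrightarrow> 0"
      by (simp only: real_sqrt_zero mult_zero_left, elim Lim_null_comparison[rotated], intro always_eventually allI)
        (use p_CS_sqrt[OF S_diff[OF X x] w] in \<open>simp add: p_diff[OF X x w]\<close>)
    from tendsto_add[OF this tendsto_const[of "p x w"]]
    have pl: "(\<lambda>n. p (X n) w) \<longlonglongrightarrow> p x w" by simp
    \<comment> \<open>Comparing \<open>J (X n + t w)\<close> with the infimum and letting
      \<open>n\<close> grow leaves a nonnegative quadratic in \<open>t\<close> without constant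
      term; \<open>discriminant_nonneg\<close> then kills its linear coefficient.\<close>
    have "0 \<le> 0 + 2 * t * (p x w - F w) + t\<^sup>2 * p w w" for t
    proof -
      have "0 \<le> 1 / real (Suc n) + 2 * t * (p (X n) w - F w) + t\<^sup>2 * p w w" for n
      proof -
        have "m \<le> J (\<lambda>s. X n s + t *\<^sub>R w s)" by (intro m S_add S_scale X w)
        also have "\<dots> = J (X n) + 2 * t * (p (X n) w - F w) + t\<^sup>2 * p w w"
          using X[of n] w S_scale[OF w, of t] S_add[OF X[of n] S_scale[OF w, of t]] p_sym[OF w X[of n]]
          by (simp add: J_def p_add p_add2 p_scale p_scale2 F_add F_scale power2_eq_square algebra_simps)
        finally show ?thesis using JX[of n] by linarith
      qed
      moreover have "(\<lambda>n. 1 / real (Suc n) + 2 * t * (p (X n) w - F w) + t\<^sup>2 * p w w)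
          \<longlonglongrightarrow> 0 + 2 * t * (p x w - F w) + t\<^sup>2 * p w w"
        by (intro tendsto_intros pl LIMSEQ_Suc[OF lim_1_over_n])
      ultimately show ?thesis by (intro LIMSEQ_le_const) auto
    qed
    from discriminant_nonneg[OF this] show ?thesis by simp
  qed
  with x show ?thesis by blast
qed

text \<open>Babuska--Necas: with \<open>A\<close> the adjoint of \<open>a\<close>, the form \<open>p (A u) (A w)\<close> is an equivalent inner product;
  the Riesz representative \<open>u\<close> of \<open>F\<close> for it yields the solution \<open>A u\<close>.\<close>

lemma necas:
  assumes a_add: "\<And>u v w. u \<in> S \<Longrightarrow> v \<in> S \<Longrightarrow> w \<in> S \<Longrightarrow> a (\<lambda>x. u x + v x) w = a u w + a v w"
    and a_scale: "\<And>u w c. u \<in> S \<Longrightarrow> w \<in> S \<Longrightarrow> a (\<lambda>x. c *\<^sub>R u x) w = c * a u w"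
    and a_add2: "\<And>u v w. u \<in> S \<Longrightarrow> v \<in> S \<Longrightarrow> w \<in> S \<Longrightarrow> a w (\<lambda>x. u x + v x) = a w u + a w v"
    and a_scale2: "\<And>u w c. u \<in> S \<Longrightarrow> w \<in> S \<Longrightarrow> a w (\<lambda>x. c *\<^sub>R u x) = c * a w u"
    and a_bound: "\<And>u w. u \<in> S \<Longrightarrow> w \<in> S \<Longrightarrow> \<bar>a u w\<bar> \<le> K * sqrt (p u u) * sqrt (p w w)"
    and inf_sup: "\<And>w. w \<in> S \<Longrightarrow> \<exists>u\<in>S. c * p w w \<le> a u w \<and> p u u \<le> D * p w w"
    and c: "c > 0"
    and F_add: "\<And>u v. u \<in> S \<Longrightarrow> v \<in> S \<Longrightarrow> F (\<lambda>x. u x + v x) = F u + F v"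
    and F_scale: "\<And>u c. u \<in> S \<Longrightarrow> F (\<lambda>x. c *\<^sub>R u x) = c * F u"
    and F_bound: "\<And>u. u \<in> S \<Longrightarrow> \<bar>F u\<bar> \<le> C * sqrt (p u u)"
  shows "\<exists>g\<in>S. \<forall>w\<in>S. a g w = F w"
proof -
  have "\<forall>w\<in>S. \<exists>f\<in>S. \<forall>u\<in>S. p f u = a u w"
  proof
    fix w assume w: "w \<in> S"
    show "\<exists>f\<in>S. \<forall>u\<in>S. p f u = a u w"
      by (rule riesz[where F="\<lambda>u. a u w" and C="K * sqrt (p w w)"])
        (use w a_bound a_add a_scale in \<open>auto simp: mult_ac\<close>)
  qed
  then obtain A where A: "\<And>w. w \<in> S \<Longrightarrow> A w \<in> S" and pA: "\<And>u w. u \<in> S \<Longrightarrow> w \<in> S \<Longrightarrow> p (A w) u = a u w"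
    by metis
  define q where "q u w = p (A u) (A w)" for u w
  \<comment> \<open>The sign of \<open>D\<close> is not given, whereas a positive factor is required
    below.\<close>
  define D' where "D' = max D 1"
  have D': "D' > 0" by (simp add: D'_def)
  \<comment> \<open>The partner \<open>u\<close> of \<open>w\<close> gives
    \<open>c p w w \<le> a u w = p (A w) u\<close>; Cauchy-Schwarz and the bound on
    \<open>p u u\<close> turn this into a lower bound for the norm of \<open>A w\<close>.\<close>
  have lower: "c\<^sup>2 * p w w \<le> D' * q w w" if w: "w \<in> S" for w
  proof (cases "p w w = 0")
    case True
    then show ?thesis using p_nonneg[OF A[OF w]] D' by (simp add: q_def)
  next
    case False
    then have pos: "p w w > 0" using p_nonneg[OF w] by simp
    obtain u where u: "u \<in> S" "c * p w w \<le> a u w" "p u u \<le> D * p w w" using inf_sup[OF w] by blast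
    have "(c * p w w)\<^sup>2 \<le> (p (A w) u)\<^sup>2" using u c pos pA[OF u(1) w] by (intro power_mono) auto
    also have "\<dots> \<le> q w w * p u u" unfolding q_def by (rule p_CS[OF A[OF w] u(1)])
    also have "\<dots> \<le> q w w * (D' * p w w)"
      using order_trans[OF u(3) mult_right_mono[of D D' "p w w"]] pos p_nonneg[OF A[OF w]]
      by (intro mult_left_mono) (auto simp: q_def D'_def)
    finally have "(c\<^sup>2 * p w w) * p w w \<le> (D' * q w w) * p w w" by (simp add: power2_eq_square mult_ac)
    then show ?thesis using pos by (rule mult_right_le_imp_le)
  qed
  \<comment> \<open>This shows that \<open>q\<close> is linear in its second argument because
    \<open>a\<close> is linear in its second, so linearity of the chosen adjoint \<open>A\<close>
    never has to be established.\<close>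
  have qa: "q u w = a (A u) w" if "u \<in> S" "w \<in> S" for u w
    using pA[OF A[OF that(1)] that(2)] p_sym[OF A A] that by (simp add: q_def)
  have upper: "q w w \<le> K\<^sup>2 * p w w" if w: "w \<in> S" for w
  proof (cases "q w w = 0")
    case False
    then have pos: "q w w > 0" using p_nonneg[OF A[OF w]] by (simp add: q_def)
    have "q w w \<le> K * sqrt (q w w) * sqrt (p w w)"
      using a_bound[OF A[OF w] w] unfolding qa[OF w w, symmetric] by (simp add: q_def)
    then have "(q w w)\<^sup>2 \<le> (K * sqrt (q w w) * sqrt (p w w))\<^sup>2" using pos by (intro power_mono) auto
    also have "\<dots> = (K\<^sup>2 * p w w) * q w w" using pos p_nonneg[OF w] by (simp add: power_mult_distrib)
    finally show ?thesis using pos by (simp add: power2_eq_square)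
  qed (use p_nonneg[OF w] in simp)
  have qsym: "q u v = q v u" if "u \<in> S" "v \<in> S" for u v 
    using p_sym[OF A A] that by (simp add: q_def)
  interpret q: complete_psd_form S q
  proof
    show "q (\<lambda>x. u x + v x) w = q u w + q v w" if "u \<in> S" "v \<in> S" "w \<in> S" for u v w
      using that S_add qsym[of _ w] qa a_add2 A by (metis (no_types, lifting))
    show "q (\<lambda>x. c *\<^sub>R u x) w = c * q u w" if "u \<in> S" "w \<in> S" for u w c
      using that S_scale qsym[of _ w] qa a_scale2 A by (metis (no_types, lifting))
    show "0 \<le> q u u" if "u \<in> S" for u using p_nonneg[OF A[OF that]] by (simp add: q_def)
    fix X :: "nat \<Rightarrow> 'a \<Rightarrow> 'b" assume X: "\<And>n. X n \<in> S" 
      and Cauchy: "\<And>e. e > 0 \<Longrightarrow> \<exists>N. \<forall>n\<ge>N. \<forall>m\<ge>N. q (\<lambda>x. X n x - X m x) (\<lambda>x. X n x - X m x) < e"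
    have "\<exists>x\<in>S. (\<lambda>n. p (\<lambda>y. X n y - x y) (\<lambda>y. X n y - x y)) \<longlonglongrightarrow> 0"
    proof (rule complete[OF X])
      fix e :: real assume "e > 0"
      then have "c\<^sup>2 * e / D' > 0" using c D' by simp
      from Cauchy[OF this] obtain N where N: "\<And>n m. n \<ge> N \<Longrightarrow> m \<ge> N \<Longrightarrow> q (\<lambda>x. X n x - X m x) (\<lambda>x. X n x - X m x) < c\<^sup>2 * e / D'"
        by blast
      have "p (\<lambda>x. X n x - X m x) (\<lambda>x. X n x - X m x) < e" if "n \<ge> N" "m \<ge> N" for n m
      proof -
        have "c\<^sup>2 * p (\<lambda>x. X n x - X m x) (\<lambda>x. X n x - X m x) \<le> D' * q (\<lambda>x. X n x - X m x) (\<lambda>x. X n x - X m x)"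
          by (rule lower[OF S_diff[OF X X]])
        also have "\<dots> < c\<^sup>2 * e" using N[OF that] D' by (simp add: field_simps)
        finally show ?thesis using c by simp
      qed
      then show "\<exists>N. \<forall>n\<ge>N. \<forall>m\<ge>N. p (\<lambda>x. X n x - X m x) (\<lambda>x. X n x - X m x) < e" by blast
    qed
    then obtain x where x: "x \<in> S" and lim: "(\<lambda>n. p (\<lambda>y. X n y - x y) (\<lambda>y. X n y - x y)) \<longlonglongrightarrow> 0" by blast
    from tendsto_mult_right[OF lim, of "K\<^sup>2"]
    have "(\<lambda>n. K\<^sup>2 * p (\<lambda>y. X n y - x y) (\<lambda>y. X n y - x y)) \<longlonglongrightarrow> 0" by (simp add: mult.commute)
    then have "(\<lambda>n. q (\<lambda>y. X n y - x y) (\<lambda>y. X n y - x y)) \<longlonglongrightarrow> 0"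
      by (rule Lim_null_comparison[rotated])
        (use upper[OF S_diff[OF X x]] p_nonneg[OF A[OF S_diff[OF X x]]] in \<open>auto simp: q_def\<close>)
    with x show "\<exists>x\<in>S. (\<lambda>n. q (\<lambda>y. X n y - x y) (\<lambda>y. X n y - x y)) \<longlonglongrightarrow> 0" by blast
  qed (auto simp: S_zero S_add S_scale qsym)
  have "\<exists>f\<in>S. \<forall>w\<in>S. q f w = F w"
  proof (rule q.riesz[OF F_add F_scale])
    fix u assume u: "u \<in> S"
    have "p u u \<le> D' / c\<^sup>2 * q u u" using lower[OF u] c by (simp add: field_simps)
    then have "sqrt (p u u) \<le> sqrt (D' / c\<^sup>2) * sqrt (q u u)" by (metis real_sqrt_le_mono real_sqrt_mult)
    then have "\<bar>C\<bar> * sqrt (p u u) \<le> (\<bar>C\<bar> * sqrt (D' / c\<^sup>2)) * sqrt (q u u)"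
      using mult_left_mono[of _ _ "\<bar>C\<bar>"] by (simp add: mult.assoc)
    moreover have "C * sqrt (p u u) \<le> \<bar>C\<bar> * sqrt (p u u)" using p_nonneg[OF u] by (intro mult_right_mono) auto
    ultimately show "\<bar>F u\<bar> \<le> (\<bar>C\<bar> * sqrt (D' / c\<^sup>2)) * sqrt (q u u)" using F_bound[OF u] by linarith
  qed
  then obtain f where f: "f \<in> S" "\<And>w. w \<in> S \<Longrightarrow> q f w = F w" by blast
  then show ?thesis using A[OF f(1)] qa[OF f(1)] by metis
qed

end

section \<open>Smooth functions\<close>

abbreviation smooth :: "(point \<Rightarrow> 'b::real_normed_vector) \<Rightarrow> bool"
  where "smooth f \<equiv> \<forall>k. C_k k f"

lemma pd_eq: "(f has_derivative f') (at x) \<Longrightarrow> pd i f x = f' (axis i 1)"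
  by (simp add: pd_def frechet_derivative_at[symmetric])

lemma pd_const [simp]: "pd i (\<lambda>x. c) = (\<lambda>x. 0)" by (simp add: pd_def fun_eq_iff)

lemma differentiable_frechet: "f differentiable (at x) \<Longrightarrow> (f has_derivative frechet_derivative f (at x)) (at x)"
  by (simp add: frechet_derivative_works)

lemma pd_linear:
  assumes "bounded_linear L" "f differentiable (at x)"
  shows "pd i (\<lambda>x. L (f x)) x = L (pd i f x)"
  by (subst pd_eq[OF bounded_linear.has_derivative[OF assms(1) differentiable_frechet[OF assms(2)]]])
    (simp add: pd_def)

lemma pd_bilinear:
  assumes "bounded_bilinear B" "f differentiable (at x)" "g differentiable (at x)"
  shows "pd i (\<lambda>x. B (f x) (g x)) x = B (f x) (pd i g x) + B (pd i f x) (g x)"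
  by (subst pd_eq[OF bounded_bilinear.FDERIV[OF assms(1) differentiable_frechet[OF assms(2)] differentiable_frechet[OF assms(3)]]])
    (simp add: pd_def)

lemma pd_add:
  assumes "f differentiable (at x)" "g differentiable (at x)"
  shows "pd i (\<lambda>x. f x + g x) x = pd i f x + pd i g x"
  by (subst pd_eq[OF has_derivative_add[OF differentiable_frechet[OF assms(1)] differentiable_frechet[OF assms(2)]]])
    (simp add: pd_def)

lemma C_k_Suc_D: "C_k (Suc k) f \<Longrightarrow> C_k k f"
proof (induction k arbitrary: f)
  case 0
  then show ?case by (simp add: continuous_at_imp_continuous_on differentiable_imp_continuous_within)
next
  case (Suc k)
  then show ?case by (metis C_k.simps(2))
qed

lemma C_k_const [simp]: "C_k k (\<lambda>x. c)"
  by (induction k arbitrary: c) (auto intro: continuous_intros)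

lemma C_k_linear:
  assumes "bounded_linear L" shows "C_k k f \<Longrightarrow> C_k k (\<lambda>x. L (f x))"
proof (induction k arbitrary: f)
  case 0
  then show ?case using bounded_linear.continuous_on[OF assms] by simp
next
  case (Suc k)
  then have d: "\<And>x. f differentiable (at x)" and p: "\<And>i. C_k k (pd i f)" by auto
  have "pd i (\<lambda>x. L (f x)) = (\<lambda>x. L (pd i f x))" for i
    using pd_linear[OF assms d] by (simp add: fun_eq_iff)
  moreover have "(\<lambda>x. L (f x)) differentiable (at x)" for x
    using bounded_linear.has_derivative[OF assms differentiable_frechet[OF d]] by (auto simp: differentiable_def)
  ultimately show ?case using Suc.IH[OF p] by simp
qed

lemma C_k_add: "C_k k f \<Longrightarrow> C_k k g \<Longrightarrow> C_k k (\<lambda>x. f x + g x)"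
proof (induction k arbitrary: f g)
  case 0
  then show ?case by (auto intro: continuous_intros)
next
  case (Suc k)
  then have d: "\<And>x. f differentiable (at x)" "\<And>x. g differentiable (at x)"
    and p: "\<And>i. C_k k (pd i f)" "\<And>i. C_k k (pd i g)" by auto
  have "pd i (\<lambda>x. f x + g x) = (\<lambda>x. pd i f x + pd i g x)" for i
    using pd_add[OF d] by (simp add: fun_eq_iff)
  then show ?case using Suc.IH[OF p] d by simp
qed

lemma C_k_bilinear:
  assumes B: "bounded_bilinear B"
  shows "C_k k f \<Longrightarrow> C_k k g \<Longrightarrow> C_k k (\<lambda>x. B (f x) (g x))"
proof (induction k arbitrary: f g)
  case 0
  then show ?case using bounded_bilinear.continuous_on[OF B] by simp
next
  case (Suc k)
  then have d: "\<And>x. f differentiable (at x)" "\<And>x. g differentiable (at x)"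
    and p: "\<And>i. C_k k (pd i f)" "\<And>i. C_k k (pd i g)" by auto
  have fg: "C_k k f" "C_k k g" using Suc.prems C_k_Suc_D by blast+
  have "pd i (\<lambda>x. B (f x) (g x)) = (\<lambda>x. B (f x) (pd i g x) + B (pd i f x) (g x))" for i
    using pd_bilinear[OF B d] by (simp add: fun_eq_iff)
  moreover have "(\<lambda>x. B (f x) (g x)) differentiable (at x)" for x
    using bounded_bilinear.FDERIV[OF B differentiable_frechet[OF d(1)] differentiable_frechet[OF d(2)]]
    by (auto simp: differentiable_def)
  ultimately show ?case using Suc.IH p fg by (simp add: C_k_add)
qed

lemma C_k_diff: "C_k k f \<Longrightarrow> C_k k g \<Longrightarrow> C_k k (\<lambda>x. f x - g x)"
  using C_k_add[OF _ C_k_linear[OF bounded_linear_minus[OF bounded_linear_ident]], of k f g] by simp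

lemma C_k_sum: "(\<And>i. i \<in> I \<Longrightarrow> C_k k (f i)) \<Longrightarrow> C_k k (\<lambda>x. \<Sum>i\<in>I. f i x)"
  by (induction I rule: infinite_finite_induct) (auto intro: C_k_add)

lemma C_k_prod: "(\<And>i. i \<in> I \<Longrightarrow> C_k k (f i :: point \<Rightarrow> real)) \<Longrightarrow> C_k k (\<lambda>x. \<Prod>i\<in>I. f i x)"
  by (induction I rule: infinite_finite_induct) (auto intro: C_k_bilinear[OF bounded_bilinear_mult])

lemma bounded_linear_axis: "bounded_linear (axis i :: 'a::real_normed_vector \<Rightarrow> 'a ^ 'n)"
proof (rule bounded_linear_intro[where K=1])
  fix x :: 'a
  have "norm (axis i x :: 'a ^ 'n) = norm x"
    unfolding norm_vec_def L2_set_def axis_def by (simp add: if_distrib[of "\<lambda>y. (norm y)\<^sup>2"] cong: if_cong)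
  then show "norm (axis i x :: 'a ^ 'n) \<le> norm x * 1" by simp
qed (auto simp: axis_def vec_eq_iff)

lemma C_k_vec:
  fixes f :: "point \<Rightarrow> 'a::real_normed_vector ^ 'n"
  assumes "\<And>i. C_k k (\<lambda>x. f x $ i)" shows "C_k k f"
proof -
  have "f = (\<lambda>x. \<Sum>i\<in>UNIV. axis i (f x $ i))"
    by (simp add: fun_eq_iff vec_eq_iff axis_def if_distrib cong: if_cong)
  moreover have "C_k k (\<lambda>x. \<Sum>i\<in>UNIV. axis i (f x $ i))"
    by (rule C_k_sum, rule C_k_linear[OF bounded_linear_axis assms])
  ultimately show ?thesis by simp
qed

lemma C_k_component: "C_k k f \<Longrightarrow> C_k k (\<lambda>x. f x $ i)"
  by (rule C_k_linear[OF bounded_linear_vec_nth])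

lemma smooth_D:
  assumes "smooth f"
  shows smooth_differentiable: "f differentiable (at x)" and smooth_pd: "smooth (pd i f)"
    and smooth_continuous: "continuous_on UNIV f"
proof -
  show "f differentiable (at x)" using assms[rule_format, of "Suc 0"] by simp
  show "continuous_on UNIV f" using assms[rule_format, of 0] by simp
  show "smooth (pd i f)" using assms C_k.simps(2) by blast
qed

lemma pd_component: "f differentiable (at x) \<Longrightarrow> pd j f x $ i = pd j (\<lambda>x. f x $ i) x"
  using pd_linear[OF bounded_linear_vec_nth] by metis

lemma smooth_cgrad: "smooth p \<Longrightarrow> smooth (cgrad p)"
  by (intro allI C_k_vec) (simp add: cgrad_def smooth_pd)

lemma smooth_ccurl: 
  assumes "smooth v" shows "smooth (ccurl v)"
proof (intro allI C_k_vec)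
  fix k i
  have c: "C_k k (\<lambda>x. pd j v x $ l)" for j l by (intro C_k_component smooth_pd[OF assms, rule_format])
  show "C_k k (\<lambda>x. ccurl v x $ i)"
    using exhaust_3[of i] by (auto simp: ccurl_def intro!: C_k_diff c)
qed

lemma smooth_add:
  assumes "smooth f" "smooth g" shows "smooth (\<lambda>x. f x + g x)"
  by (rule allI, rule C_k_add[OF spec[OF assms(1)] spec[OF assms(2)]])

lemma smooth_linear:
  assumes "bounded_linear L" "smooth f" shows "smooth (\<lambda>x. L (f x))"
  by (rule allI, rule C_k_linear[OF assms(1) spec[OF assms(2)]])

lemma smooth_bilinear:
  assumes "bounded_bilinear B" "smooth f" "smooth g" shows "smooth (\<lambda>x. B (f x) (g x))"
  by (rule allI, rule C_k_bilinear[OF assms(1) spec[OF assms(2)] spec[OF assms(3)]])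

lemma test_funD:
  assumes "\<phi> \<in> test_fun G"
  shows "smooth \<phi>" "compact (closure {x. \<phi> x \<noteq> 0})" "closure {x. \<phi> x \<noteq> 0} \<subseteq> G"
  using assms by (auto simp: test_fun_def)

lemma test_fun_outside: "\<phi> \<in> test_fun G \<Longrightarrow> x \<notin> G \<Longrightarrow> \<phi> x = 0"
  using test_funD(3)[of \<phi> G] closure_subset[of "{x. \<phi> x \<noteq> 0}"] by auto

lemma test_funI:
  assumes "smooth \<psi>" "compact K" "K \<subseteq> G" "\<And>x. x \<notin> K \<Longrightarrow> \<psi> x = 0"
  shows "\<psi> \<in> test_fun G"
proof -
  have "closure {x. \<psi> x \<noteq> 0} \<subseteq> K" using assms by (intro closure_minimal compact_imp_closed) auto
  then show ?thesis unfolding test_fun_def using assms(1,3) compact_Int_closed[OF assms(2) closed_closure[of "{x. \<psi> x \<noteq> 0}"]]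
    by (auto simp: inf.absorb2)
qed

lemma test_fun_sub:
  assumes "\<phi> \<in> test_fun G" "smooth \<psi>" "\<And>x. x \<notin> closure {x. \<phi> x \<noteq> 0} \<Longrightarrow> \<psi> x = 0"
  shows "\<psi> \<in> test_fun G"
  using test_funI[OF assms(2) test_funD(2,3)[OF assms(1)] assms(3)] .

lemma test_fun_mono: "G \<subseteq> G' \<Longrightarrow> test_fun G \<subseteq> test_fun G'" by (auto simp: test_fun_def)

lemma notin_support: "x \<notin> closure {x. \<phi> x \<noteq> 0} \<Longrightarrow> \<phi> x = 0"
  using closure_subset[of "{x. \<phi> x \<noteq> 0}"] by auto

lemma test_fun_zero [simp]: "(\<lambda>x. 0) \<in> test_fun G" by (rule test_funI[where K="{}"]) auto

lemma test_fun_add: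
  assumes "\<phi> \<in> test_fun G" "\<psi> \<in> test_fun G" shows "(\<lambda>x. \<phi> x + \<psi> x) \<in> test_fun G"
proof (rule test_funI[OF _ compact_Un[OF test_funD(2)[OF assms(1)] test_funD(2)[OF assms(2)]]])
  show "smooth (\<lambda>x. \<phi> x + \<psi> x)" by (rule smooth_add[OF test_funD(1)[OF assms(1)] test_funD(1)[OF assms(2)]])
  show "closure {x. \<phi> x \<noteq> 0} \<union> closure {x. \<psi> x \<noteq> 0} \<subseteq> G"
    by (rule Un_least[OF test_funD(3)[OF assms(1)] test_funD(3)[OF assms(2)]])
  fix x assume "x \<notin> closure {x. \<phi> x \<noteq> 0} \<union> closure {x. \<psi> x \<noteq> 0}"
  then have "\<phi> x = 0" "\<psi> x = 0" using notin_support[of x \<phi>] notin_support[of x \<psi>] by simp_all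
  then show "\<phi> x + \<psi> x = 0" by simp
qed

lemma test_fun_linear:
  assumes "bounded_linear L" "\<phi> \<in> test_fun G" shows "(\<lambda>x. L (\<phi> x)) \<in> test_fun G"
proof (rule test_fun_sub[OF assms(2)])
  show "smooth (\<lambda>x. L (\<phi> x))" by (rule smooth_linear[OF assms(1) test_funD(1)[OF assms(2)]])
  fix x assume "x \<notin> closure {x. \<phi> x \<noteq> 0}"
  then have "\<phi> x = 0" by (rule notin_support)
  then show "L (\<phi> x) = 0" using linear_0[OF bounded_linear.linear[OF assms(1)]] by simp
qed

lemma test_fun_scaleR:
  assumes "smooth \<eta>" "\<phi> \<in> test_fun G" shows "(\<lambda>x. (\<eta> x :: real) *\<^sub>R \<phi> x) \<in> test_fun G"
proof (rule test_fun_sub[OF assms(2)])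
  show "smooth (\<lambda>x. \<eta> x *\<^sub>R \<phi> x)"
    by (rule smooth_bilinear[OF bounded_bilinear_scaleR assms(1) test_funD(1)[OF assms(2)]])
  fix x assume "x \<notin> closure {x. \<phi> x \<noteq> 0}"
  then have "\<phi> x = 0" by (rule notin_support)
  then show "\<eta> x *\<^sub>R \<phi> x = 0" by simp
qed

lemma notin_support_pd:
  assumes x: "x \<notin> closure {x. \<phi> x \<noteq> 0}" shows "pd i \<phi> x = 0"
proof -
  have "(\<phi> has_derivative (\<lambda>h. 0)) (at x)"
  proof (rule has_derivative_transform_within_open[OF has_derivative_const[of 0], of "- closure {x. \<phi> x \<noteq> 0}"])
    fix y assume "y \<in> - closure {x. \<phi> x \<noteq> 0}"
    then have "\<phi> y = 0" by (intro notin_support) simp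
    then show "0 = \<phi> y" by simp
  qed (use x in \<open>auto simp: open_Compl\<close>)
  then show "pd i \<phi> x = 0" by (rule pd_eq)
qed

lemma test_fun_pd:
  assumes "\<phi> \<in> test_fun G" shows "pd i \<phi> \<in> test_fun G"
  by (rule test_fun_sub[OF assms smooth_pd[OF test_funD(1)[OF assms]] notin_support_pd])

lemma test_fun_component: "\<phi> \<in> test_fun G \<Longrightarrow> (\<lambda>x. \<phi> x $ i) \<in> test_fun G"
  by (rule test_fun_linear[OF bounded_linear_vec_nth])

lemma test_fun_cgrad:
  assumes "\<phi> \<in> test_fun G" shows "cgrad \<phi> \<in> test_fun G"
proof (rule test_fun_sub[OF assms smooth_cgrad[OF test_funD(1)[OF assms]]])
  fix x assume x: "x \<notin> closure {x. \<phi> x \<noteq> 0}"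
  have "pd i \<phi> x = 0" for i by (rule notin_support_pd[OF x])
  then show "cgrad \<phi> x = 0" by (simp add: cgrad_def vec_eq_iff)
qed

lemma test_fun_ccurl:
  assumes "\<phi> \<in> test_fun G" shows "ccurl \<phi> \<in> test_fun G"
proof (rule test_fun_sub[OF assms smooth_ccurl[OF test_funD(1)[OF assms]]])
  fix x assume x: "x \<notin> closure {x. \<phi> x \<noteq> 0}"
  have "pd i \<phi> x = 0" for i by (rule notin_support_pd[OF x])
  then show "ccurl \<phi> x = 0" by (simp add: ccurl_def vec_eq_iff forall_3)
qed

lemma test_fun_bounded: 
  assumes "\<phi> \<in> test_fun G" shows "\<exists>B. (\<forall>x. norm (\<phi> x) \<le> B) \<and> 0 \<le> B"
proof -
  have "compact (\<phi> ` closure {x. \<phi> x \<noteq> 0})"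
    by (intro compact_continuous_image test_funD(2)[OF assms] continuous_on_subset[OF smooth_continuous[OF test_funD(1)[OF assms]]]) auto
  then obtain B where B: "\<And>x. x \<in> closure {x. \<phi> x \<noteq> 0} \<Longrightarrow> norm (\<phi> x) \<le> B" 
    using compact_imp_bounded bounded_iff by (metis imageI)
  have "norm (\<phi> x) \<le> max B 0" for x using B[of x] notin_support[of x \<phi>] by (cases "x \<in> closure {x. \<phi> x \<noteq> 0}") auto
  then show ?thesis by (intro exI[of _ "max B 0"]) auto
qed

lemma measurable_continuous_lebesgue_on:
  fixes f :: "point \<Rightarrow> 'b::euclidean_space"
  assumes "continuous_on UNIV f" shows "f \<in> borel_measurable (lebesgue_on G)"
  by (intro measurable_restrict_space1 measurable_completion)
    (use borel_measurable_continuous_onI[OF assms] in simp)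

lemma lebesgue_on_integral:
  fixes f :: "point \<Rightarrow> 'b::euclidean_space"
  assumes "G \<in> sets lebesgue"
  shows "integral\<^sup>L (lebesgue_on G) f = integral\<^sup>L lebesgue (\<lambda>x. indicator G x *\<^sub>R f x)"
    and "integrable (lebesgue_on G) f \<longleftrightarrow> integrable lebesgue (\<lambda>x. indicator G x *\<^sub>R f x)"
  using assms by (auto simp: integral_restrict_space integrable_restrict_space)

lemma integrable_indicator_compact:
  assumes "compact (K :: point set)" "G \<in> sets lebesgue"
  shows "integrable (lebesgue_on G) (\<lambda>x. indicator K x :: real)"
proof -
  have "K \<in> lmeasurable" using assms by (simp add: lmeasurable_compact)
  then have "integrable lebesgue (\<lambda>x. indicator K x :: real)"
    by (intro integrable_real_indicator) (auto simp: fmeasurable_def)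
  then show ?thesis using integrable_mult_indicator[OF assms(2)] assms(2) by (simp only: lebesgue_on_integral)
qed

lemma test_fun_L2:
  assumes "\<phi> \<in> test_fun G" "G' \<in> sets lebesgue" shows "\<phi> \<in> L2 G'"
proof -
  obtain B where B: "\<And>x. norm (\<phi> x) \<le> B" "0 \<le> B" using test_fun_bounded[OF assms(1)] by blast
  let ?K = "closure {x. \<phi> x \<noteq> 0}"
  show ?thesis
  proof (rule L2_bound)
    show "\<phi> \<in> borel_measurable (lebesgue_on G')"
      by (rule measurable_continuous_lebesgue_on[OF smooth_continuous[OF test_funD(1)[OF assms(1)]]])
    show "integrable (lebesgue_on G') (\<lambda>x. B\<^sup>2 * indicator ?K x)"
      by (intro integrable_mult_right integrable_indicator_compact test_funD(2)[OF assms(1)] assms)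
    show "AE x in lebesgue_on G'. (norm (\<phi> x))\<^sup>2 \<le> B\<^sup>2 * indicator ?K x"
    proof (rule AE_I2)
      fix x show "(norm (\<phi> x))\<^sup>2 \<le> B\<^sup>2 * indicator ?K x"
        using B notin_support[of x \<phi>] by (cases "x \<in> ?K") (auto intro: power_mono)
    qed
  qed
qed

subsection \<open>Integration by parts\<close>

lemma pd_line:
  assumes "f differentiable (at (x + s *\<^sub>R axis i 1))"
  shows "((\<lambda>s. f (x + s *\<^sub>R axis i 1)) has_vector_derivative pd i f (x + s *\<^sub>R axis i 1)) (at s)"
proof -
  have d: "(f has_derivative frechet_derivative f (at (x + s *\<^sub>R axis i 1))) (at (x + s *\<^sub>R axis i 1))"
    by (rule differentiable_frechet[OF assms])
  have "((\<lambda>s. x + s *\<^sub>R axis i (1::real)) has_derivative (\<lambda>h. h *\<^sub>R axis i 1)) (at s)"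
    by (auto intro!: derivative_eq_intros)
  from has_derivative_compose[OF this d] show ?thesis
    unfolding has_vector_derivative_def pd_def
    using linear_scale[OF has_derivative_linear[OF d]] by (simp add: fun_eq_iff)
qed

lemma lebesgue_integral_translation:
  fixes f :: "point \<Rightarrow> 'b::euclidean_space"
  assumes "continuous_on UNIV f"
  shows "integral\<^sup>L lebesgue (\<lambda>x. f (x + c)) = integral\<^sup>L lebesgue f"
proof -
  have [measurable]: "f \<in> borel_measurable borel" by (rule borel_measurable_continuous_onI[OF assms])
  have "integral\<^sup>L lebesgue (\<lambda>x. f (x + c)) = integral\<^sup>L lborel (\<lambda>x. f (c + x))"
    by (subst integral_completion) (simp_all add: add.commute)
  also have "\<dots> = integral\<^sup>L (distr lborel borel ((+) c)) f"
    by (subst integral_distr) auto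
  also have "\<dots> = integral\<^sup>L lebesgue f"
    by (subst lborel_distr_plus, subst integral_completion) auto
  finally show ?thesis .
qed

lemma line_bound:
  fixes f :: "point \<Rightarrow> 'b::real_normed_vector"
  assumes sm: "smooth f" and B: "\<And>x. norm (pd i f x) \<le> B"
  shows "norm (f (x + h *\<^sub>R axis i 1) - f x) \<le> B * \<bar>h\<bar>"
proof -
  have "norm (f (x + h *\<^sub>R axis i 1) - f (x + 0 *\<^sub>R axis i 1)) \<le> B * norm (h - 0)"
  proof (rule differentiable_bound[where f="\<lambda>s. f (x + s *\<^sub>R axis i 1)" and S=UNIV
        and f'="\<lambda>s h. h *\<^sub>R pd i f (x + s *\<^sub>R axis i 1)"])
    fix s :: real
    show "((\<lambda>s. f (x + s *\<^sub>R axis i 1)) has_derivative (\<lambda>h. h *\<^sub>R pd i f (x + s *\<^sub>R axis i 1))) (at s)"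
      using pd_line[OF smooth_differentiable[OF sm], where x=x and s=s and i=i] by (simp add: has_vector_derivative_def)
    show "onorm (\<lambda>h. h *\<^sub>R pd i f (x + s *\<^sub>R axis i 1)) \<le> B"
    proof (rule onorm_le)
      fix a show "norm (a *\<^sub>R pd i f (x + s *\<^sub>R axis i 1)) \<le> B * norm a"
        using mult_right_mono[OF B[of "x + s *\<^sub>R axis i 1"] abs_ge_zero[of a]] by (simp add: mult.commute)
    qed
  qed auto
  then show ?thesis by simp
qed

lemma difference_quotient:
  fixes f :: "point \<Rightarrow> 'b::real_normed_vector"
  assumes "smooth f"
  shows "((\<lambda>h. (f (x + h *\<^sub>R axis i 1) - f x) /\<^sub>R h) \<longlongrightarrow> pd i f x) (at 0)"
proof -
  have "((\<lambda>s. f (x + s *\<^sub>R axis i 1)) has_derivative (\<lambda>h. h *\<^sub>R pd i f x)) (at 0)"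
    using pd_line[OF smooth_differentiable[OF assms], where x=x and s=0 and i=i] by (simp add: has_vector_derivative_def)
  then have "((\<lambda>h. norm (f (x + h *\<^sub>R axis i 1) - f x - h *\<^sub>R pd i f x) / norm h) \<longlongrightarrow> 0) (at 0)"
    by (simp add: has_derivative_at)
  then have "((\<lambda>h. norm ((f (x + h *\<^sub>R axis i 1) - f x) /\<^sub>R h - pd i f x)) \<longlongrightarrow> 0) (at 0)"
  proof (rule Lim_transform_eventually)
    show "\<forall>\<^sub>F h in at 0. norm (f (x + h *\<^sub>R axis i 1) - f x - h *\<^sub>R pd i f x) / norm h
        = norm ((f (x + h *\<^sub>R axis i 1) - f x) /\<^sub>R h - pd i f x)"
      unfolding eventually_at_topological
    proof (intro exI[of _ UNIV], clarsimp)
      fix h :: real assume "h \<noteq> 0"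
      then have "(f (x + h *\<^sub>R axis i 1) - f x) /\<^sub>R h - pd i f x = (f (x + h *\<^sub>R axis i 1) - f x - h *\<^sub>R pd i f x) /\<^sub>R h"
        by (simp add: scaleR_diff_right)
      then show "norm (f (x + h *\<^sub>R axis i 1) - f x - h *\<^sub>R pd i f x) / \<bar>h\<bar> = norm ((f (x + h *\<^sub>R axis i 1) - f x) /\<^sub>R h - pd i f x)"
        by (simp add: divide_inverse mult.commute)
    qed
  qed
  then show ?thesis using Lim_null tendsto_norm_zero_iff by blast
qed

text \<open>Difference quotients have integral zero by translation invariance. They are dominated by
  the maximum of the derivative on a fixed ball, so the integral passes to the limit. Integration by
  parts is this lemma applied to a product.\<close>

lemma integral_pd_eq_0:
  fixes f :: "point \<Rightarrow> complex"
  assumes f: "f \<in> test_fun UNIV"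
  shows "integral\<^sup>L lebesgue (pd i f) = 0"
proof -
  note sm = test_funD(1)[OF f]
  let ?e = "axis i 1 :: point"
  obtain R where R: "\<And>x. f x \<noteq> 0 \<Longrightarrow> norm x \<le> R"
    using compact_imp_bounded[OF test_funD(2)[OF f]] closure_subset[of "{x. f x \<noteq> 0}"]
    by (metis (mono_tags, lifting) bounded_iff mem_Collect_eq subset_iff)
  obtain B where B: "\<And>x. norm (pd i f x) \<le> B" "0 \<le> B" using test_fun_bounded[OF test_fun_pd[OF f]] by blast
  have cf: "continuous_on UNIV f" by (rule smooth_continuous[OF sm])
  have cf': "continuous_on UNIV (\<lambda>x. f (x + c))" for c 
    by (rule continuous_on_compose2[OF cf]) (auto intro: continuous_intros)
  \<comment> \<open>Steps of length at most 1 keep all difference quotients supported in the ball of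
    radius \<open>R + 1\<close>.\<close>
  define h where "h n = 1 / real (Suc n)" for n
  have h: "h n > 0" "h n \<le> 1" for n by (auto simp: h_def)
  define D where "D n x = (f (x + h n *\<^sub>R ?e) - f x) /\<^sub>R h n" for n x
  have cD: "continuous_on UNIV (D n)" for n unfolding D_def by (intro continuous_intros cf cf')
  have Dlim: "(\<lambda>n. D n x) \<longlonglongrightarrow> pd i f x" for x
  proof -
    have "filterlim h (at 0) sequentially"
      unfolding filterlim_at h_def using LIMSEQ_Suc[OF lim_1_over_n[where 'a=real]] by auto
    from filterlim_compose[OF difference_quotient[OF sm] this] show ?thesis unfolding D_def .
  qed
  have Dbound: "norm (D n x) \<le> B * indicator (cball 0 (R + 1)) x" for n x
  proof (cases "x \<in> cball 0 (R + 1)")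
    case True
    have "norm (f (x + h n *\<^sub>R ?e) - f x) \<le> B * h n" using line_bound[OF sm B(1), where h="h n"] h[of n] by simp
    moreover have "norm (D n x) = norm (f (x + h n *\<^sub>R ?e) - f x) / h n"
      using h[of n] by (simp add: D_def divide_inverse mult.commute flip: scaleR_diff_right)
    ultimately show ?thesis using True h[of n] by (simp add: pos_divide_le_eq)
  next
    case False
    have "norm x \<le> norm (x + h n *\<^sub>R ?e) + norm (h n *\<^sub>R ?e)" using norm_triangle_ineq4[of "x + h n *\<^sub>R ?e" "h n *\<^sub>R ?e"] by simp
    moreover have "norm (h n *\<^sub>R ?e) \<le> 1" using h[of n] by (simp add: norm_axis_1)
    ultimately have "\<not> norm (x + h n *\<^sub>R ?e) \<le> R" "\<not> norm x \<le> R" using False by auto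
    then have "f (x + h n *\<^sub>R ?e) = 0" "f x = 0" using R by blast+
    then show ?thesis by (simp add: D_def B(2))
  qed
  have "integral\<^sup>L lebesgue (D n) = 0" for n
  proof -
    have i: "integrable lebesgue g" if "g = (\<lambda>x. f (x + c))" for g c
    proof -
      obtain C where C: "\<And>x. norm (f x) \<le> C" "0 \<le> C" using test_fun_bounded[OF f] by blast
      show ?thesis
      proof (rule Bochner_Integration.integrable_bound)
        show "integrable lebesgue (\<lambda>x. C * indicator (cball (-c) R) x)"
          using integrable_indicator_compact[of "cball (-c) R" UNIV] by (simp add: lebesgue_on_UNIV_eq)
        show "g \<in> borel_measurable lebesgue" using measurable_continuous_lebesgue_on[OF cf'[of c], where G=UNIV] that by (simp add: lebesgue_on_UNIV_eq)
        show "AE x in lebesgue. norm (g x) \<le> norm (C * indicator (cball (- c) R) x)"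
          using C R[of "_ + c"] by (auto simp: that indicator_def dist_norm norm_minus_commute add.commute)
      qed
    qed
    have "integral\<^sup>L lebesgue (D n) = (integral\<^sup>L lebesgue (\<lambda>x. f (x + h n *\<^sub>R ?e)) - integral\<^sup>L lebesgue f) /\<^sub>R h n"
      unfolding D_def using i[OF refl, of "h n *\<^sub>R ?e"] i[of f 0] by simp
    then show ?thesis using lebesgue_integral_translation[OF cf] by simp
  qed
  moreover have "(\<lambda>n. integral\<^sup>L lebesgue (D n)) \<longlonglongrightarrow> integral\<^sup>L lebesgue (pd i f)"
  proof (rule integral_dominated_convergence[where w="\<lambda>x. B * indicator (cball 0 (R + 1)) x"])
    show "integrable lebesgue (\<lambda>x. B * indicator (cball (0::point) (R + 1)) x)"
      using integrable_indicator_compact[of "cball 0 (R + 1)" UNIV] by (simp add: lebesgue_on_UNIV_eq)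
    show "pd i f \<in> borel_measurable lebesgue" "D n \<in> borel_measurable lebesgue" for n
      using measurable_continuous_lebesgue_on[OF smooth_continuous[OF smooth_pd[OF sm]], where G=UNIV]
        measurable_continuous_lebesgue_on[OF cD, where G=UNIV] by (simp_all add: lebesgue_on_UNIV_eq)
  qed (use Dlim Dbound in auto)
  ultimately have "(\<lambda>n. 0) \<longlonglongrightarrow> integral\<^sup>L lebesgue (pd i f)" by simp
  then show ?thesis by (simp add: LIMSEQ_const_iff)
qed

lemma integration_by_parts:
  fixes p q :: "point \<Rightarrow> complex"
  assumes p: "p \<in> test_fun G" and q: "q \<in> test_fun G"
  shows "integral\<^sup>L lebesgue (\<lambda>x. p x * cnj (pd i q x)) = - integral\<^sup>L lebesgue (\<lambda>x. pd i p x * cnj (q x))"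
    and "integrable lebesgue (\<lambda>x. p x * cnj (q x))"
proof -
  have int: "integrable lebesgue (\<lambda>x. p x * cnj (q x))" if "p \<in> test_fun G" "q \<in> test_fun G" for p q :: "point \<Rightarrow> complex"
  proof (rule Bochner_Integration.integrable_bound[OF L2_norm_mult_integrable[where G=UNIV, unfolded lebesgue_on_UNIV_eq]])
    show "p \<in> L2 UNIV" "q \<in> L2 UNIV" by (auto intro: test_fun_L2[OF that(1)] test_fun_L2[OF that(2)])
    have "continuous_on UNIV (\<lambda>x. p x * cnj (q x))" 
      using that by (intro continuous_intros smooth_continuous test_funD(1))
    from measurable_continuous_lebesgue_on[OF this, where G=UNIV]
    show "(\<lambda>x. p x * cnj (q x)) \<in> borel_measurable lebesgue" by (simp add: lebesgue_on_UNIV_eq)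
  qed (auto simp: norm_mult)
  show "integrable lebesgue (\<lambda>x. p x * cnj (q x))" by (rule int[OF p q])
  have blc: "bounded_linear cnj" by (rule bounded_linear_cnj)
  note q' = test_fun_linear[OF blc q]
  have dp: "p differentiable (at x)" "(\<lambda>x. cnj (q x)) differentiable (at x)" "q differentiable (at x)" for x
    using smooth_differentiable test_funD(1) p q q' by blast+
  have "pd i (\<lambda>x. p x * cnj (q x)) = (\<lambda>x. p x * cnj (pd i q x) + pd i p x * cnj (q x))"
    using pd_bilinear[OF bounded_bilinear_mult dp(1,2)] pd_linear[OF blc dp(3)] by (simp add: fun_eq_iff)
  moreover have "(\<lambda>x. p x * cnj (q x)) \<in> test_fun UNIV"
  proof (rule test_fun_mono[THEN subsetD, OF subset_UNIV], rule test_fun_sub[OF p])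
    show "smooth (\<lambda>x. p x * cnj (q x))"
      by (rule smooth_bilinear[OF bounded_bilinear_mult test_funD(1)[OF p] test_funD(1)[OF q']])
    fix x assume "x \<notin> closure {x. p x \<noteq> 0}"
    then have "p x = 0" by (rule notin_support)
    then show "p x * cnj (q x) = 0" by simp
  qed
  ultimately have "integral\<^sup>L lebesgue (\<lambda>x. p x * cnj (pd i q x) + pd i p x * cnj (q x)) = 0"
    using integral_pd_eq_0 by metis
  then show "integral\<^sup>L lebesgue (\<lambda>x. p x * cnj (pd i q x)) = - integral\<^sup>L lebesgue (\<lambda>x. pd i p x * cnj (q x))"
    using int[OF p test_fun_pd[OF q]] int[OF test_fun_pd[OF p] q] by (simp add: eq_neg_iff_add_eq_0)
qed

subsection \<open>Symmetry of second derivatives\<close>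

text \<open>Mean value theorem twice: in direction \<open>i\<close> for the increment in direction
  \<open>j\<close>, then in direction \<open>j\<close>. Each application displaces the intermediate
  point by at most \<open>h\<close>.\<close>

lemma second_difference:
  fixes f :: "point \<Rightarrow> real"
  assumes f: "smooth f" and h: "h > 0"
  shows "\<exists>y. norm (y - x) \<le> 2 * h \<and>
    f (x + h *\<^sub>R axis i 1 + h *\<^sub>R axis j 1) - f (x + h *\<^sub>R axis i 1) - f (x + h *\<^sub>R axis j 1) + f x
      = h * (h * pd j (pd i f) y)"
proof -
  define g where "g s = f ((x + h *\<^sub>R axis j 1) + s *\<^sub>R axis i 1) - f (x + s *\<^sub>R axis i 1)" for s
  have "(g has_real_derivative pd i f ((x + h *\<^sub>R axis j 1) + s *\<^sub>R axis i 1) - pd i f (x + s *\<^sub>R axis i 1)) (at s)" for s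
    unfolding g_def has_real_derivative_iff_has_vector_derivative
    by (intro has_vector_derivative_diff pd_line smooth_differentiable f)
  from MVT2[OF h this] obtain s where s: "0 < s" "s < h" 
    and gs: "g h - g 0 = h * (pd i f ((x + h *\<^sub>R axis j 1) + s *\<^sub>R axis i 1) - pd i f (x + s *\<^sub>R axis i 1))" by auto
  have "((\<lambda>t. pd i f ((x + s *\<^sub>R axis i 1) + t *\<^sub>R axis j 1)) has_real_derivative
      pd j (pd i f) ((x + s *\<^sub>R axis i 1) + t *\<^sub>R axis j 1)) (at t)" for t
    unfolding has_real_derivative_iff_has_vector_derivative
    by (intro pd_line smooth_differentiable smooth_pd f)
  from MVT2[OF h this] obtain t where t: "0 < t" "t < h"
    and "pd i f ((x + s *\<^sub>R axis i 1) + h *\<^sub>R axis j 1) - pd i f (x + s *\<^sub>R axis i 1)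
      = h * pd j (pd i f) ((x + s *\<^sub>R axis i 1) + t *\<^sub>R axis j 1)" by auto
  moreover have "norm (s *\<^sub>R axis i 1 + t *\<^sub>R axis j 1 :: point) \<le> \<bar>s\<bar> + \<bar>t\<bar>"
    using norm_triangle_ineq[of "s *\<^sub>R axis i 1 :: point" "t *\<^sub>R axis j 1"] by (simp add: norm_axis_1)
  ultimately show ?thesis using gs s t
    by (intro exI[of _ "x + s *\<^sub>R axis i 1 + t *\<^sub>R axis j 1"]) (simp add: g_def algebra_simps)
qed

text \<open>The second difference is unchanged when \<open>i\<close> and \<open>j\<close> are
  exchanged, so it equals either mixed derivative at a point within \<open>2 h\<close> of
  \<open>x\<close>; continuity does the rest. That gradients are curl-free rests on this.\<close>

lemma pd_commute_real:
  fixes f :: "point \<Rightarrow> real"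
  assumes f: "smooth f"
  shows "pd i (pd j f) x = pd j (pd i f) x"
proof -
  define h where "h n = 1 / real (Suc n)" for n
  have h: "h n > 0" for n by (auto simp: h_def)
  have hl: "h \<longlonglongrightarrow> 0" unfolding h_def by (rule LIMSEQ_Suc[OF lim_1_over_n])
  have lim: "(\<lambda>n. g (y n)) \<longlonglongrightarrow> g x"
    if "\<And>n. norm (y n - x) \<le> 2 * h n" "smooth g" for y and g :: "point \<Rightarrow> real"
  proof -
    have "(\<lambda>n. 2 * h n) \<longlonglongrightarrow> 0" using tendsto_mult_right_zero[OF hl] by simp
    then have "(\<lambda>n. y n - x) \<longlonglongrightarrow> 0" by (rule Lim_null_comparison[rotated]) (use that in auto)
    then have "y \<longlonglongrightarrow> x" by (rule LIM_zero_cancel)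
    moreover have "isCont g x" using smooth_continuous[OF that(2)] by (simp add: continuous_on_eq_continuous_at)
    ultimately show ?thesis by (rule isCont_tendsto_compose[rotated])
  qed
  let ?D = "\<lambda>n. f (x + h n *\<^sub>R axis i 1 + h n *\<^sub>R axis j 1) - f (x + h n *\<^sub>R axis i 1) - f (x + h n *\<^sub>R axis j 1) + f x"
  have "\<forall>n. \<exists>y. norm (y - x) \<le> 2 * h n \<and> ?D n = h n * (h n * pd j (pd i f) y)"
    using second_difference[OF f h] by blast
  then obtain y where y: "\<And>n. norm (y n - x) \<le> 2 * h n" "\<And>n. ?D n = h n * (h n * pd j (pd i f) (y n))"
    using choice[of "\<lambda>n y. norm (y - x) \<le> 2 * h n \<and> ?D n = h n * (h n * pd j (pd i f) y)"] by blast
  have D: "?D n = f (x + h n *\<^sub>R axis j 1 + h n *\<^sub>R axis i 1) - f (x + h n *\<^sub>R axis j 1) - f (x + h n *\<^sub>R axis i 1) + f x" for n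
    by (simp add: algebra_simps)
  have "\<forall>n. \<exists>y. norm (y - x) \<le> 2 * h n \<and> ?D n = h n * (h n * pd i (pd j f) y)"
    unfolding D using second_difference[OF f h, where x=x and i=j and j=i] by blast
  then obtain z where z: "\<And>n. norm (z n - x) \<le> 2 * h n" "\<And>n. ?D n = h n * (h n * pd i (pd j f) (z n))"
    using choice[of "\<lambda>n y. norm (y - x) \<le> 2 * h n \<and> ?D n = h n * (h n * pd i (pd j f) y)"] by blast
  have "pd j (pd i f) (y n) = pd i (pd j f) (z n)" for n
    using y(2)[of n] z(2)[of n] h[of n] by (metis less_irrefl mult_left_cancel)
  with lim[where y=y and g="pd j (pd i f)", OF y(1) smooth_pd[OF smooth_pd[OF f]]]
    lim[where y=z and g="pd i (pd j f)", OF z(1) smooth_pd[OF smooth_pd[OF f]]]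
  show ?thesis by (simp add: LIMSEQ_unique)
qed

lemma pd_commute:
  fixes f :: "point \<Rightarrow> complex"
  assumes f: "smooth f"
  shows "pd i (pd j f) = pd j (pd i f)"
proof (rule ext)
  fix x
  have *: "pd a (pd b (\<lambda>x. L (f x))) x = L (pd a (pd b f) x)" if "bounded_linear L" for L :: "complex \<Rightarrow> real" and a b
  proof -
    have "pd b (\<lambda>x. L (f x)) = (\<lambda>x. L (pd b f x))"
      using pd_linear[OF that smooth_differentiable[OF f]] by auto
    then show ?thesis using pd_linear[OF that smooth_differentiable[OF smooth_pd[OF f]]] by auto
  qed
  have "L (pd i (pd j f) x) = L (pd j (pd i f) x)" if "bounded_linear L" for L :: "complex \<Rightarrow> real"
    unfolding *[OF that, symmetric] using f C_k_linear[OF that] by (intro pd_commute_real) auto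
  from this[OF bounded_linear_Re] this[OF bounded_linear_Im]
  show "pd i (pd j f) x = pd j (pd i f) x" by (simp add: complex_eq_iff)
qed

lemma ccurl_component:
  assumes "smooth v"
  shows "ccurl v x $ 1 = pd 2 (\<lambda>x. v x $ 3) x - pd 3 (\<lambda>x. v x $ 2) x"
    "ccurl v x $ 2 = pd 3 (\<lambda>x. v x $ 1) x - pd 1 (\<lambda>x. v x $ 3) x"
    "ccurl v x $ 3 = pd 1 (\<lambda>x. v x $ 2) x - pd 2 (\<lambda>x. v x $ 1) x"
  by (simp_all add: ccurl_def pd_component[OF smooth_differentiable[OF assms]])

lemma ccurl_cgrad:
  assumes p: "smooth p" shows "ccurl (cgrad p) = (\<lambda>x. 0)"
proof
  fix x
  have "(\<lambda>x. cgrad p x $ i) = pd i p" for i by (simp add: cgrad_def)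
  then show "ccurl (cgrad p) x = 0"
    using pd_commute[OF p, of 2 1] pd_commute[OF p, of 3 1] pd_commute[OF p, of 3 2]
    by (simp add: vec_eq_iff forall_3 ccurl_component[OF smooth_cgrad[OF p]])
qed

subsection \<open>Bump functions\<close>

text \<open>With \<open>u = 1/t\<close>, the derivative of \<open>p(u) exp(-u)\<close> in
  \<open>t\<close> is \<open>u^2 (p - p')(u) exp(-u)\<close>; the factor \<open>[:0, 0, 1:]\<close>
  is the square of \<open>u\<close>.\<close>

primrec psi_poly :: "nat \<Rightarrow> real poly" where
  "psi_poly 0 = 1"
| "psi_poly (Suc n) = [:0, 0, 1:] * (psi_poly n - pderiv (psi_poly n))"

text \<open>The \<open>n\<close>-th derivative of \<open>exp (-1/t)\<close>, extended by zero.\<close>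

definition psi :: "nat \<Rightarrow> real \<Rightarrow> real"
  where "psi n t = (if t > 0 then poly (psi_poly n) (1/t) * exp (- (1/t)) else 0)"

lemma poly_exp_tendsto_0: "((\<lambda>u::real. poly p u * exp (- u)) \<longlongrightarrow> 0) at_top"
proof -
  have "((\<lambda>u::real. \<Sum>i\<le>degree p. coeff p i * (u ^ i / exp u)) \<longlongrightarrow> (\<Sum>i\<le>degree p. coeff p i * 0)) at_top"
    by (intro tendsto_intros tendsto_power_div_exp_0)
  moreover have "(\<lambda>u::real. \<Sum>i\<le>degree p. coeff p i * (u ^ i / exp u)) = (\<lambda>u. poly p u * exp (- u))"
    by (simp add: poly_altdef sum_distrib_right exp_minus divide_inverse mult.assoc)
  ultimately show ?thesis by simp
qed

lemma psi_DERIV: "(psi n has_real_derivative psi (Suc n) t) (at t)"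
proof -
  consider "t > 0" | "t < 0" | "t = 0" by linarith
  then show ?thesis
  proof cases
    case 1
    have "((\<lambda>t. poly (psi_poly n) (1/t) * exp (- (1/t))) has_real_derivative psi (Suc n) t) (at t)"
      using 1 by (auto intro!: derivative_eq_intros DERIV_chain2[OF poly_DERIV] simp: psi_def field_simps power2_eq_square)
    then show ?thesis
      by (rule has_field_derivative_transform_within_open[where S="{0<..}"]) (use 1 in \<open>auto simp: psi_def\<close>)
  next
    case 2
    have "((\<lambda>t. 0) has_real_derivative psi (Suc n) t) (at t)" using 2 by (simp add: psi_def)
    then show ?thesis
      by (rule has_field_derivative_transform_within_open[where S="{..<0}"]) (use 2 in \<open>auto simp: psi_def\<close>)
  next
    case 3
    have "((\<lambda>h. psi n h / h) \<longlongrightarrow> 0) (at_right 0)"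
    proof (rule Lim_transform_eventually)
      \<comment> \<open>Dividing by \<open>h\<close> is multiplication by \<open>u = 1/h\<close>,
        that is by \<open>[:0, 1:]\<close>; the exponential beats every polynomial.\<close>
      show "((\<lambda>h. poly ([:0, 1:] * psi_poly n) (inverse h) * exp (- inverse h)) \<longlongrightarrow> 0) (at_right (0::real))"
        by (rule filterlim_compose[OF poly_exp_tendsto_0 filterlim_inverse_at_top_right])
      show "\<forall>\<^sub>F h in at_right (0::real). poly ([:0, 1:] * psi_poly n) (inverse h) * exp (- inverse h) = psi n h / h"
        by (rule eventually_at_rightI[of 0 1]) (auto simp: psi_def field_simps)
    qed
    moreover have "((\<lambda>h. psi n h / h) \<longlongrightarrow> 0) (at_left 0)"
      by (rule tendsto_eventually, rule eventually_at_leftI[of "-1"]) (auto simp: psi_def)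
    ultimately have "((\<lambda>h. psi n h / h) \<longlongrightarrow> 0) (at 0)" by (simp add: filterlim_split_at)
    then show ?thesis using 3 by (simp add: DERIV_def psi_def)
  qed
qed

lemma smooth_psi_affine: "smooth (\<lambda>x. psi n (c * x $ i + d))"
proof
  fix k show "C_k k (\<lambda>x. psi n (c * x $ i + d))"
  proof (induction k arbitrary: n)
    case 0
    have "isCont (psi n) t" for t using psi_DERIV DERIV_isCont by blast
    then have "continuous_on UNIV (psi n)" by (simp add: continuous_on_eq_continuous_at)
    then show ?case by (auto intro!: continuous_on_compose2[of UNIV "psi n"] continuous_intros)
  next
    case (Suc k)
    have 1: "((\<lambda>x. c * x $ i + d) has_derivative (\<lambda>h. c * h $ i)) (at x)" for x :: point
      by (auto intro!: derivative_eq_intros bounded_linear.has_derivative[OF bounded_linear_vec_nth])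
    have 2: "(psi n has_derivative (\<lambda>h. psi (Suc n) t * h)) (at t)" for t
      using psi_DERIV by (simp add: has_field_derivative_def)
    have d: "((\<lambda>x. psi n (c * x $ i + d)) has_derivative (\<lambda>h. psi (Suc n) (c * x $ i + d) * (c * h $ i))) (at x)" for x :: point
      by (rule has_derivative_compose[OF 1 2])
    have "pd j (\<lambda>x. psi n (c * x $ i + d)) = (\<lambda>x. (c * axis j 1 $ i) * psi (Suc n) (c * x $ i + d))" for j
      using pd_eq[OF d] by (simp add: fun_eq_iff)
    moreover have "C_k k (\<lambda>x. (c * axis j 1 $ i) * psi (Suc n) (c * x $ i + d))" for j
      by (rule C_k_linear[OF bounded_linear_mult_right Suc.IH])
    moreover have "(\<lambda>x. psi n (c * x $ i + d)) differentiable (at x)" for x using d by (auto simp: differentiable_def)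
    ultimately show ?case by simp
  qed
qed

text \<open>The parameter \<open>s\<close> is a steepness: for all \<open>s > 0\<close> the function
  is nonzero exactly on the same box, and for growing \<open>s\<close> it tends to the indicator of
  that box, since \<open>exp (-1/(s t))\<close> tends to 1 for \<open>t > 0\<close>.\<close>

definition bump :: "point \<Rightarrow> point \<Rightarrow> real \<Rightarrow> point \<Rightarrow> real"
  where "bump a b s x = (\<Prod>i\<in>UNIV. psi 0 (s * x $ i + - (s * a $ i)) * psi 0 (- s * x $ i + s * b $ i))"

lemma smooth_bump: "smooth (bump a b s)"
  unfolding bump_def[abs_def]
  by (intro allI C_k_prod C_k_bilinear[OF bounded_bilinear_mult] spec[OF smooth_psi_affine])

lemma psi_0: "0 \<le> psi 0 t" "psi 0 t \<le> 1" "psi 0 t \<noteq> 0 \<longleftrightarrow> t > 0"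
  by (auto simp: psi_def)

lemma bump_nonneg: "0 \<le> bump a b s x" and bump_le_1: "bump a b s x \<le> 1"
  unfolding bump_def by (auto intro!: prod_nonneg prod_le_1 mult_nonneg_nonneg mult_le_one psi_0)

lemma mem_box_vec: "x \<in> box a b \<longleftrightarrow> (\<forall>i. a $ i < x $ i \<and> x $ i < b $ i)" for x :: point
  by (simp add: mem_box_cart)

lemma bump_pos_iff:
  assumes "s > 0" shows "bump a b s x \<noteq> 0 \<longleftrightarrow> x \<in> box a b"
proof -
  have "0 < s * x $ i + - (s * a $ i) \<longleftrightarrow> a $ i < x $ i" "0 < - s * x $ i + s * b $ i \<longleftrightarrow> x $ i < b $ i" for i
    using assms by (auto simp: algebra_simps)
  then show ?thesis by (simp add: bump_def mem_box_vec psi_0(3))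
qed

lemma bump_tendsto: "(\<lambda>n. bump a b (real (Suc n)) x) \<longlonglongrightarrow> indicator (box a b) x"
proof (cases "x \<in> box a b")
  case True
  have *: "(\<lambda>n. psi 0 (real (Suc n) * t)) \<longlonglongrightarrow> 1" if "t > 0" for t
  proof -
    have "(\<lambda>n. exp (- ((1 / t) * (1 / real (Suc n))))) \<longlonglongrightarrow> exp (- ((1 / t) * 0))"
      by (intro tendsto_intros LIMSEQ_Suc[OF lim_1_over_n])
    moreover have "psi 0 (real (Suc n) * t) = exp (- ((1 / t) * (1 / real (Suc n))))" for n
      using that mult_pos_pos[of "real (Suc n)" t] by (simp add: psi_def mult.commute)
    ultimately show ?thesis by simp
  qed
  have "(\<lambda>n. \<Prod>i\<in>UNIV. psi 0 (real (Suc n) * (x $ i - a $ i)) * psi 0 (real (Suc n) * (b $ i - x $ i))) \<longlonglongrightarrow> (\<Prod>i\<in>(UNIV::3 set). 1 * 1)"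
    using True by (intro tendsto_intros *) (auto simp: mem_box_vec)
  then show ?thesis using True by (simp add: bump_def algebra_simps)
next
  case False
  then show ?thesis using bump_pos_iff[of "real (Suc _)" a b x] by simp
qed

lemma bump_test_fun:
  assumes "cbox a b \<subseteq> G" "s > 0" "bounded_linear L"
  shows "(\<lambda>x. L (bump a b s x)) \<in> test_fun G"
proof (rule test_fun_linear[OF assms(3)], rule test_funI[OF smooth_bump compact_cbox assms(1)])
  show "bump a b s x = 0" if "x \<notin> cbox a b" for x
    using bump_pos_iff[OF assms(2), of a b x] that box_subset_cbox by blast
qed

section \<open>Weak derivatives\<close>

lemma l2ip_subset:
  assumes "G \<in> sets lebesgue" "U \<in> sets lebesgue" "U \<subseteq> G" "\<And>x. x \<notin> U \<Longrightarrow> f x = 0 \<or> \<phi> x = 0"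
  shows "l2ip G f \<phi> = l2ip U f \<phi>"
  unfolding l2ip_def lebesgue_on_integral(1)[OF assms(1)] lebesgue_on_integral(1)[OF assms(2)]
proof (rule Bochner_Integration.integral_cong)
  fix x
  show "indicat_real G x *\<^sub>R (\<Sum>i\<in>UNIV. f x $ i * cnj (\<phi> x $ i)) = indicat_real U x *\<^sub>R (\<Sum>i\<in>UNIV. f x $ i * cnj (\<phi> x $ i))"
    using assms(4)[of x] assms(3) by (auto simp: indicator_def)
qed simp

text \<open>Fundamental lemma of the calculus of variations, componentwise. Bumps tending to the
  indicator of a box show that \<open>c\<close> has integral zero over every box in
  \<open>G\<close>; Lebesgue differentiation along shrinking cubes concludes.\<close>

lemma l2ip_test_fun_orthogonal:
  assumes G: "open G" and c: "c \<in> L2 G" and orth: "\<And>\<phi>. \<phi> \<in> test_fun G \<Longrightarrow> l2ip G c \<phi> = 0"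
  shows "ae_eq G c (\<lambda>x. 0)"
proof -
  have Gs: "G \<in> sets lebesgue" using G by (simp add: borel_open)
  have "AE x in lebesgue. x \<in> G \<longrightarrow> c x $ i = 0" for i
  proof -
    define f where "f = (\<lambda>x. indicator G x *\<^sub>R c x $ i)"
    have cm: "(\<lambda>x. c x $ i) \<in> borel_measurable (lebesgue_on G)" 
      using L2_measurable[OF c] by (simp add: measurable_cvec_cong)
    have fm: "f \<in> borel_measurable lebesgue" unfolding f_def using cm Gs by (simp add: borel_measurable_restrict_space_iff)
    have i2: "integrable lebesgue (\<lambda>x. indicator G x *\<^sub>R (norm (c x))\<^sup>2)"
      using L2_integrable[OF c] Gs by (simp add: lebesgue_on_integral)
    have fi: "set_integrable lebesgue (cbox a b) f" for a b
      unfolding set_integrable_def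
    proof (rule Bochner_Integration.integrable_bound)
      have "integrable lebesgue (\<lambda>x. indicator (cbox a b) x :: real)"
        using integrable_indicator_compact[of "cbox a b" UNIV] by (simp add: lebesgue_on_UNIV_eq)
      then show "integrable lebesgue (\<lambda>x. indicator (cbox a b) x + indicator G x *\<^sub>R (norm (c x))\<^sup>2)" using i2 by simp
      have "cmod z \<le> 1 + (cmod z)\<^sup>2" for z :: complex
        using zero_le_power2[of "cmod z - 1/2"] by (simp add: power2_eq_square algebra_simps)
      moreover have "(cmod (c x $ i))\<^sup>2 \<le> (norm (c x))\<^sup>2" for x
        by (intro power_mono Finite_Cartesian_Product.norm_nth_le) auto
      ultimately have "cmod (c x $ i) \<le> 1 + (norm (c x))\<^sup>2" for x by (meson add_left_mono order_trans)
      then show "AE x in lebesgue. norm (indicat_real (cbox a b) x *\<^sub>R f x) \<le> norm (indicat_real (cbox a b) x + indicat_real G x *\<^sub>R (norm (c x))\<^sup>2)"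
        by (auto simp: indicator_def f_def)
      show "(\<lambda>x. indicat_real (cbox a b) x *\<^sub>R f x) \<in> borel_measurable lebesgue"
        by (intro borel_measurable_scaleR borel_measurable_indicator fm) simp
    qed
    have zero: "integral (cbox a b) f = 0" if ab: "cbox a b \<subseteq> G" for a b
    proof -
      have fb: "set_integrable lebesgue (box a b) f"
        by (rule set_integrable_subset[OF fi[of a b]]) (auto simp: box_subset_cbox)
      define \<phi> where "\<phi> n = (\<lambda>x. axis i (complex_of_real (bump a b (real (Suc n)) x)))" for n
      have "bounded_linear (\<lambda>r. axis i (complex_of_real r))"
        by (rule bounded_linear_compose[OF bounded_linear_axis bounded_linear_of_real])
      then have \<phi>: "\<phi> n \<in> test_fun G" for n unfolding \<phi>_def by (intro bump_test_fun ab) auto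
      have eq: "l2ip G c (\<phi> n) = integral\<^sup>L lebesgue (\<lambda>x. bump a b (real (Suc n)) x *\<^sub>R (indicator (box a b) x *\<^sub>R f x))" for n
      proof -
        have "(\<Sum>j\<in>UNIV. c x $ j * cnj (\<phi> n x $ j)) = bump a b (real (Suc n)) x *\<^sub>R c x $ i" for x
          by (simp add: \<phi>_def axis_def if_distrib[of cnj] if_distrib[of "\<lambda>y. _ * y"] scaleR_conv_of_real mult.commute cong: if_cong)
        moreover have "bump a b (real (Suc n)) x = bump a b (real (Suc n)) x * indicator (box a b) x" for x
          using bump_pos_iff[of "real (Suc n)" a b x] by (cases "x \<in> box a b") auto
        ultimately show ?thesis unfolding l2ip_def lebesgue_on_integral(1)[OF Gs]
          by (intro Bochner_Integration.integral_cong) (auto simp: f_def indicator_def)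
      qed
      have "(\<lambda>n. l2ip G c (\<phi> n)) \<longlonglongrightarrow> integral\<^sup>L lebesgue (\<lambda>x. indicator (box a b) x *\<^sub>R f x)"
        unfolding eq
      proof (rule integral_dominated_convergence[where w="\<lambda>x. norm (indicator (box a b) x *\<^sub>R f x)"])
        show m: "(\<lambda>x. indicator (box a b) x *\<^sub>R f x) \<in> borel_measurable lebesgue" 
          using fb by (auto simp: set_integrable_def)
        have bm: "bump a b s \<in> borel_measurable lebesgue" for s
          using measurable_continuous_lebesgue_on[OF smooth_continuous[OF smooth_bump], where G=UNIV] by (simp add: lebesgue_on_UNIV_eq)
        show "(\<lambda>x. bump a b (real (Suc n)) x *\<^sub>R indicat_real (box a b) x *\<^sub>R f x) \<in> borel_measurable lebesgue" for n
          by (rule borel_measurable_scaleR[OF bm m])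
        show "integrable lebesgue (\<lambda>x. norm (indicator (box a b) x *\<^sub>R f x))"
          using fb unfolding set_integrable_def by (rule integrable_norm)
        have "(\<lambda>n. bump a b (real (Suc n)) x *\<^sub>R indicat_real (box a b) x *\<^sub>R f x) \<longlonglongrightarrow> indicat_real (box a b) x *\<^sub>R indicat_real (box a b) x *\<^sub>R f x" for x
          by (intro tendsto_intros bump_tendsto)
        then show "AE x in lebesgue. (\<lambda>n. bump a b (real (Suc n)) x *\<^sub>R indicat_real (box a b) x *\<^sub>R f x) \<longlonglongrightarrow> indicat_real (box a b) x *\<^sub>R f x"
          by (intro AE_I2) (metis (no_types, lifting) indicator_eq_1_iff indicator_simps(2) scaleR_one scaleR_zero_left)
        show "AE x in lebesgue. norm (bump a b (real (Suc n)) x *\<^sub>R indicat_real (box a b) x *\<^sub>R f x) \<le> norm (indicat_real (box a b) x *\<^sub>R f x)" for n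
          using bump_nonneg[of a b "real (Suc n)"] bump_le_1[of a b "real (Suc n)"]
          by (intro AE_I2) (simp add: mult_left_le_one_le mult.assoc)
      qed
      then have "integral\<^sup>L lebesgue (\<lambda>x. indicator (box a b) x *\<^sub>R f x) = 0"
        by (simp add: orth[OF \<phi>] LIMSEQ_const_iff)
      then have "integral (box a b) f = 0"
        using set_lebesgue_integral_eq_integral(2)[OF fb] by (simp add: set_lebesgue_integral_def)
      then show ?thesis by (simp add: integral_open_interval)
    qed
    \<comment> \<open>Lebesgue differentiation: off a null set, averages over small cubes with
      corner \<open>x\<close> approximate the value at \<open>x\<close>.\<close>
    obtain N where N: "negligible N" and leb: "\<And>x e. x \<notin> N \<Longrightarrow> 0 < e \<Longrightarrow>
        \<exists>d>0. \<forall>h. 0 < h \<and> h < d \<longrightarrow> norm (integral (cbox x (x + h *\<^sub>R One)) f /\<^sub>R h ^ DIM(point) - f x) < e"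
      using integrable_ccontinuous_explicit[of f] set_lebesgue_integral_eq_integral(1)[OF fi] by blast
    have "f x = 0" if x: "x \<in> G" "x \<notin> N" for x
    proof (rule ccontr)
      assume "f x \<noteq> 0"
      then have "norm (f x) > 0" by simp
      from leb[OF x(2) this] obtain d where d: "d > 0" 
        "\<And>h. 0 < h \<Longrightarrow> h < d \<Longrightarrow> norm (integral (cbox x (x + h *\<^sub>R One)) f /\<^sub>R h ^ DIM(point) - f x) < norm (f x)" by blast
      obtain e where e: "e > 0" "ball x e \<subseteq> G" using G x(1) open_contains_ball by blast
      \<comment> \<open>Small enough for the differentiation theorem and for the cube of edge
        \<open>h\<close> to stay in the ball of radius \<open>e\<close>; the added 1 avoids a
        division by zero.\<close>
      define h where "h = min (d / 2) (e / (2 * (1 + norm (One::point))))"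
      have h: "h > 0" "h < d" unfolding h_def using d(1) e(1) by (auto intro!: divide_pos_pos add_pos_nonneg)
      have "h * norm (One::point) < e"
      proof -
        have "h * norm (One::point) \<le> e / (2 * (1 + norm (One::point))) * norm (One::point)"
          unfolding h_def by (intro mult_right_mono) auto
        also have "\<dots> < e" using e(1) by (simp add: field_simps add_pos_nonneg)
        finally show ?thesis .
      qed
      have "cbox x (x + h *\<^sub>R One) \<subseteq> ball x e"
      proof
        fix y assume y: "y \<in> cbox x (x + h *\<^sub>R One)"
        have "norm (y - x) \<le> norm (h *\<^sub>R (One::point))"
          by (rule norm_le_componentwise) (use y h(1) in \<open>auto simp: mem_box inner_diff_left inner_add_left\<close>)
        then show "y \<in> ball x e" using h(1) \<open>h * norm One < e\<close> by (simp add: dist_norm norm_minus_commute)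
      qed
      then have "integral (cbox x (x + h *\<^sub>R One)) f = 0" using e(2) by (intro zero) auto
      with d(2)[OF h] show False by simp
    qed
    moreover have "AE x in lebesgue. x \<notin> N" using N by (simp add: AE_iff_null_sets negligible_iff_null_sets null_setsD2 AE_not_in)
    ultimately show ?thesis by (auto simp: f_def indicator_def elim: AE_mp)
  qed
  then have "AE x in lebesgue. \<forall>i. x \<in> G \<longrightarrow> c x $ i = 0" by (intro iffD2[OF AE_all_countable] allI)
  then show ?thesis unfolding ae_eq_def by eventually_elim (simp add: vec_eq_iff)
qed

lemma open_sets_lebesgue: "open G \<Longrightarrow> G \<in> sets lebesgue" by (simp add: borel_open)

lemma ae_eq_diffI: 
  assumes "G \<in> sets lebesgue" "ae_eq G (\<lambda>x. c x - c' x) (\<lambda>x. 0 :: 'b::real_vector)" shows "ae_eq G c c'"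
  using assms(2) unfolding ae_eq_def by eventually_elim auto

lemma l2ip_test_fun_unique:
  assumes G: "open G" and c: "c \<in> L2 G" "c' \<in> L2 G" and eq: "\<And>\<phi>. \<phi> \<in> test_fun G \<Longrightarrow> l2ip G c \<phi> = l2ip G c' \<phi>"
  shows "ae_eq G c c'"
proof (rule ae_eq_diffI[OF open_sets_lebesgue[OF G]])
  show "ae_eq G (\<lambda>x. c x - c' x) (\<lambda>x. 0)"
  proof (rule l2ip_test_fun_orthogonal[OF G L2_diff[OF c]])
    fix \<phi> :: vfield assume \<phi>: "\<phi> \<in> test_fun G"
    show "l2ip G (\<lambda>x. c x - c' x) \<phi> = 0"
      using eq[OF \<phi>] by (simp add: l2ip_diff_left[OF c test_fun_L2[OF \<phi> open_sets_lebesgue[OF G]]])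
  qed
qed

lemma weak_curl_unique: "open G \<Longrightarrow> weak_curl G v c \<Longrightarrow> weak_curl G v c' \<Longrightarrow> ae_eq G c c'"
  by (rule l2ip_test_fun_unique) (auto simp: weak_curl_def)

lemma weak_curl_test_fun:
  assumes G: "open G" and \<phi>: "\<phi> \<in> test_fun G" shows "weak_curl G \<phi> (ccurl \<phi>)"
  unfolding weak_curl_def
proof (intro conjI ballI)
  note Gs = open_sets_lebesgue[OF G]
  show "ccurl \<phi> \<in> L2 G" by (rule test_fun_L2[OF test_fun_ccurl[OF \<phi>] Gs])
  fix \<psi> :: vfield assume \<psi>: "\<psi> \<in> test_fun G"
  define I where "I p q = integral\<^sup>L lebesgue (\<lambda>x. p x * cnj (q x))" for p q :: sfield
  have ibp: "I (\<lambda>x. \<phi> x $ i) (pd j (\<lambda>x. \<psi> x $ k)) = - I (pd j (\<lambda>x. \<phi> x $ i)) (\<lambda>x. \<psi> x $ k)" for i j k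
    unfolding I_def by (rule integration_by_parts[OF test_fun_component[OF \<phi>] test_fun_component[OF \<psi>]])
  have int1: "integrable lebesgue (\<lambda>x. \<phi> x $ i * cnj (pd j (\<lambda>x. \<psi> x $ k) x))" for i j k
    by (rule integration_by_parts(2)[OF test_fun_component[OF \<phi>] test_fun_pd[OF test_fun_component[OF \<psi>]]])
  have int2: "integrable lebesgue (\<lambda>x. pd j (\<lambda>x. \<phi> x $ i) x * cnj (\<psi> x $ k))" for i j k
    by (rule integration_by_parts(2)[OF test_fun_pd[OF test_fun_component[OF \<phi>]] test_fun_component[OF \<psi>]])
  have "l2ip G \<phi> (ccurl \<psi>) = integral\<^sup>L lebesgue (\<lambda>x. \<Sum>i\<in>UNIV. \<phi> x $ i * cnj (ccurl \<psi> x $ i))"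
    using l2ip_subset[of UNIV G \<phi> "ccurl \<psi>"] Gs test_fun_outside[OF \<phi>] by (simp add: l2ip_def lebesgue_on_UNIV_eq)
  also have "\<dots> = I (\<lambda>x. \<phi> x $ 1) (pd 2 (\<lambda>x. \<psi> x $ 3)) - I (\<lambda>x. \<phi> x $ 1) (pd 3 (\<lambda>x. \<psi> x $ 2))
      + (I (\<lambda>x. \<phi> x $ 2) (pd 3 (\<lambda>x. \<psi> x $ 1)) - I (\<lambda>x. \<phi> x $ 2) (pd 1 (\<lambda>x. \<psi> x $ 3)))
      + (I (\<lambda>x. \<phi> x $ 3) (pd 1 (\<lambda>x. \<psi> x $ 2)) - I (\<lambda>x. \<phi> x $ 3) (pd 2 (\<lambda>x. \<psi> x $ 1)))"
    using int1 by (simp add: I_def sum_3 ccurl_component[OF test_funD(1)[OF \<psi>]] right_diff_distrib)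
  also have "\<dots> = I (pd 2 (\<lambda>x. \<phi> x $ 3)) (\<lambda>x. \<psi> x $ 1) - I (pd 3 (\<lambda>x. \<phi> x $ 2)) (\<lambda>x. \<psi> x $ 1)
      + (I (pd 3 (\<lambda>x. \<phi> x $ 1)) (\<lambda>x. \<psi> x $ 2) - I (pd 1 (\<lambda>x. \<phi> x $ 3)) (\<lambda>x. \<psi> x $ 2))
      + (I (pd 1 (\<lambda>x. \<phi> x $ 2)) (\<lambda>x. \<psi> x $ 3) - I (pd 2 (\<lambda>x. \<phi> x $ 1)) (\<lambda>x. \<psi> x $ 3))"
    by (simp add: ibp)
  also have "\<dots> = integral\<^sup>L lebesgue (\<lambda>x. \<Sum>i\<in>UNIV. ccurl \<phi> x $ i * cnj (\<psi> x $ i))"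
    using int2 by (simp add: I_def sum_3 ccurl_component[OF test_funD(1)[OF \<phi>]] left_diff_distrib)
  also have "\<dots> = l2ip G (ccurl \<phi>) \<psi>"
    using l2ip_subset[of UNIV G "ccurl \<phi>" \<psi>] Gs test_fun_outside[OF \<psi>] by (simp add: l2ip_def lebesgue_on_UNIV_eq)
  finally show "l2ip G \<phi> (ccurl \<psi>) = l2ip G (ccurl \<phi>) \<psi>" .
qed

section \<open>Zero-trace spaces as closures of test functions\<close>

text \<open>Carrying the weak derivative as an argument avoids reasoning about the choice operator in \<open>curl\<close> and \<open>grad\<close>.\<close>

definition H0c :: "point set \<Rightarrow> vfield \<Rightarrow> vfield \<Rightarrow> bool"
  where "H0c G v c \<longleftrightarrow> v \<in> L2 G \<and> c \<in> L2 G \<and> (\<exists>\<phi>. (\<forall>n::nat. \<phi> n \<in> test_fun G)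
           \<and> (\<lambda>n. l2norm G (\<lambda>x. v x - \<phi> n x)) \<longlonglongrightarrow> 0 \<and> (\<lambda>n. l2norm G (\<lambda>x. c x - ccurl (\<phi> n) x)) \<longlonglongrightarrow> 0)"

definition H0g :: "point set \<Rightarrow> sfield \<Rightarrow> vfield \<Rightarrow> bool"
  where "H0g G p g \<longleftrightarrow> p \<in> L2 G \<and> g \<in> L2 G \<and> (\<exists>\<phi>. (\<forall>n::nat. \<phi> n \<in> test_fun G)
           \<and> (\<lambda>n. l2norm G (\<lambda>x. p x - \<phi> n x)) \<longlonglongrightarrow> 0 \<and> (\<lambda>n. l2norm G (\<lambda>x. g x - cgrad (\<phi> n) x)) \<longlonglongrightarrow> 0)"

lemma H0cD: "H0c G v c \<Longrightarrow> v \<in> L2 G" "H0c G v c \<Longrightarrow> c \<in> L2 G" by (auto simp: H0c_def)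

lemma H0gD: "H0g G p g \<Longrightarrow> p \<in> L2 G" "H0g G p g \<Longrightarrow> g \<in> L2 G" by (auto simp: H0g_def)

lemma H0c_weak_curl:
  assumes G: "open G" and v: "H0c G v c" shows "weak_curl G v c"
  unfolding weak_curl_def
proof (intro conjI ballI)
  note Gs = open_sets_lebesgue[OF G]
  show "c \<in> L2 G" using v by (simp add: H0c_def)
  fix \<psi> :: vfield assume \<psi>: "\<psi> \<in> test_fun G"
  obtain \<phi> where \<phi>: "\<And>n. \<phi> n \<in> test_fun G"
    "(\<lambda>n. l2norm G (\<lambda>x. v x - \<phi> n x)) \<longlonglongrightarrow> 0" "(\<lambda>n. l2norm G (\<lambda>x. c x - ccurl (\<phi> n) x)) \<longlonglongrightarrow> 0"
    using v by (auto simp: H0c_def)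
  have "(\<lambda>n. l2ip G (\<phi> n) (ccurl \<psi>)) \<longlonglongrightarrow> l2ip G v (ccurl \<psi>)"
    by (rule l2ip_tendsto_left[OF H0cD(1)[OF v] test_fun_L2[OF \<phi>(1) Gs] test_fun_L2[OF test_fun_ccurl[OF \<psi>] Gs] \<phi>(2)])
  moreover have "(\<lambda>n. l2ip G (ccurl (\<phi> n)) \<psi>) \<longlonglongrightarrow> l2ip G c \<psi>"
    by (rule l2ip_tendsto_left[OF H0cD(2)[OF v] test_fun_L2[OF test_fun_ccurl[OF \<phi>(1)] Gs] test_fun_L2[OF \<psi> Gs] \<phi>(3)])
  moreover have "l2ip G (\<phi> n) (ccurl \<psi>) = l2ip G (ccurl (\<phi> n)) \<psi>" for n
    using weak_curl_test_fun[OF G \<phi>(1)] \<psi> by (simp add: weak_curl_def)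
  ultimately show "l2ip G v (ccurl \<psi>) = l2ip G c \<psi>" by (simp add: LIMSEQ_unique)
qed

lemma l2norm_ae_eq_left:
  fixes c c' f :: "point \<Rightarrow> 'b::euclidean_space"
  assumes "G \<in> sets lebesgue" "c \<in> L2 G" "f \<in> L2 G" "ae_eq G c c'"
  shows "l2norm G (\<lambda>x. c x - f x) = l2norm G (\<lambda>x. c' x - f x)"
  by (rule l2norm_ae_eq[OF assms(1) L2_diff[OF assms(2,3)] ae_eq_comp[OF assms(4), where F="\<lambda>x y. y - f x"]])

lemma H0c_cong:
  assumes G: "open G" and v: "H0c G v c" and eq: "ae_eq G v v'" "ae_eq G c c'"
  shows "H0c G v' c'"
proof -
  note Gs = open_sets_lebesgue[OF G]
  obtain \<phi> where \<phi>: "\<And>n. \<phi> n \<in> test_fun G"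
    "(\<lambda>n. l2norm G (\<lambda>x. v x - \<phi> n x)) \<longlonglongrightarrow> 0" "(\<lambda>n. l2norm G (\<lambda>x. c x - ccurl (\<phi> n) x)) \<longlonglongrightarrow> 0"
    using v by (auto simp: H0c_def)
  have "l2norm G (\<lambda>x. v x - \<phi> n x) = l2norm G (\<lambda>x. v' x - \<phi> n x)" 
    "l2norm G (\<lambda>x. c x - ccurl (\<phi> n) x) = l2norm G (\<lambda>x. c' x - ccurl (\<phi> n) x)" for n
    by (auto intro!: l2norm_ae_eq_left Gs H0cD[OF v] test_fun_L2[OF _ Gs] test_fun_ccurl \<phi> eq)
  then show ?thesis
    unfolding H0c_def using L2_ae_eq[OF Gs H0cD(1)[OF v] eq(1)] L2_ae_eq[OF Gs H0cD(2)[OF v] eq(2)] \<phi> by auto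
qed

lemma weak_curl_curl: "weak_curl G v c \<Longrightarrow> weak_curl G v (curl G v)"
  unfolding curl_def by (rule someI[of "weak_curl G v"])

lemma weak_grad_grad: "weak_grad G p g \<Longrightarrow> weak_grad G p (grad G p)"
  unfolding grad_def by (rule someI[of "weak_grad G p"])

lemma H0curl_H0c: 
  assumes "v \<in> H0curl G" shows "H0c G v (curl G v)"
proof -
  obtain c where "weak_curl G v c" using assms by (auto simp: H0curl_def Hcurl_def)
  from weak_curl_curl[OF this] have "curl G v \<in> L2 G" by (simp add: weak_curl_def)
  then show ?thesis using assms by (auto simp: H0curl_def Hcurl_def H0c_def)
qed

lemma H10_H0g:
  assumes "p \<in> H10 G" shows "H0g G p (grad G p)"
proof -
  obtain c where "weak_grad G p c" using assms by (auto simp: H10_def H1_def)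
  from weak_grad_grad[OF this] have "grad G p \<in> L2 G" by (simp add: weak_grad_def)
  then show ?thesis using assms by (auto simp: H10_def H1_def H0g_def)
qed

text \<open>Way back from \<open>H0c\<close> to the given definitions: uniqueness of the weak curl
  shows that the chosen \<open>curl\<close> agrees with \<open>c\<close> almost everywhere, so the
  same test functions approximate it.\<close>

lemma H0c_curl:
  assumes G: "open G" and v: "H0c G v c"
  shows "v \<in> H0curl G" "ae_eq G (curl G v) c"
proof -
  have w: "weak_curl G v c" by (rule H0c_weak_curl[OF assms])
  then have "weak_curl G v (curl G v)" by (rule weak_curl_curl)
  from weak_curl_unique[OF G this w] show eq: "ae_eq G (curl G v) c" .
  have "H0c G v (curl G v)" by (rule H0c_cong[OF G v ae_eq_refl ae_eq_sym[OF eq]])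
  then show "v \<in> H0curl G" using w unfolding H0curl_def Hcurl_def H0c_def by auto
qed

text \<open>The gradients of the approximating test functions are themselves test functions with
  vanishing curl, hence a gradient from the zero-trace space has zero tangential trace and weak curl
  zero.\<close>

lemma H0g_H0c_gradient:
  assumes "H0g G p g" shows "H0c G g (\<lambda>x. 0)"
proof -
  obtain \<phi> where \<phi>: "\<And>n. \<phi> n \<in> test_fun G" "(\<lambda>n. l2norm G (\<lambda>x. g x - cgrad (\<phi> n) x)) \<longlonglongrightarrow> 0"
    using assms by (auto simp: H0g_def)
  have "ccurl (cgrad (\<phi> n)) = (\<lambda>x. 0)" for n by (rule ccurl_cgrad[OF test_funD(1)[OF \<phi>(1)]])
  then show ?thesis unfolding H0c_def
    using H0gD(2)[OF assms] \<phi> test_fun_cgrad[OF \<phi>(1)] by (auto intro!: exI[of _ "\<lambda>n. cgrad (\<phi> n)"])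
qed

lemma ccurl_add: "smooth u \<Longrightarrow> smooth v \<Longrightarrow> ccurl (\<lambda>x. u x + v x) = (\<lambda>x. ccurl u x + ccurl v x)"
  by (simp add: fun_eq_iff ccurl_def vec_eq_iff forall_3 pd_add smooth_differentiable)

lemma bounded_linear_cmult: "bounded_linear (\<lambda>y::complex ^ 3. c *s y)"
  by (rule bounded_linear_intro[where K="cmod c"]) 
    (auto simp: vec_eq_iff algebra_simps norm_cmult_vec scaleR_conv_of_real)

lemma ccurl_cmult: "smooth u \<Longrightarrow> ccurl (\<lambda>x. c *s u x) = (\<lambda>x. c *s ccurl u x)"
  by (simp add: fun_eq_iff ccurl_def vec_eq_iff forall_3 pd_linear[OF bounded_linear_cmult smooth_differentiable] algebra_simps)

lemma tendsto_l2norm_add: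
  fixes u v :: "point \<Rightarrow> 'b::euclidean_space"
  assumes "u \<in> L2 G" "v \<in> L2 G" "\<And>n. u' n \<in> L2 G" "\<And>n. v' n \<in> L2 G"
    "(\<lambda>n::nat. l2norm G (\<lambda>x. u x - u' n x)) \<longlonglongrightarrow> 0" "(\<lambda>n. l2norm G (\<lambda>x. v x - v' n x)) \<longlonglongrightarrow> 0"
  shows "(\<lambda>n. l2norm G (\<lambda>x. (u x + v x) - (u' n x + v' n x))) \<longlonglongrightarrow> 0"
proof (rule Lim_null_comparison)
  show "\<forall>\<^sub>F n in sequentially. norm (l2norm G (\<lambda>x. (u x + v x) - (u' n x + v' n x))) \<le> l2norm G (\<lambda>x. u x - u' n x) + l2norm G (\<lambda>x. v x - v' n x)"
    using l2norm_triangle[OF L2_diff[OF assms(1,3)] L2_diff[OF assms(2,4)]]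
    by (simp add: algebra_simps)
  show "(\<lambda>n. l2norm G (\<lambda>x. u x - u' n x) + l2norm G (\<lambda>x. v x - v' n x)) \<longlonglongrightarrow> 0"
    using tendsto_add[OF assms(5,6)] by simp
qed

lemma H0c_add:
  assumes G: "G \<in> sets lebesgue" and u: "H0c G u c" and v: "H0c G v d"
  shows "H0c G (\<lambda>x. u x + v x) (\<lambda>x. c x + d x)"
proof -
  obtain \<phi> where \<phi>: "\<And>n. \<phi> n \<in> test_fun G"
    "(\<lambda>n. l2norm G (\<lambda>x. u x - \<phi> n x)) \<longlonglongrightarrow> 0" "(\<lambda>n. l2norm G (\<lambda>x. c x - ccurl (\<phi> n) x)) \<longlonglongrightarrow> 0"
    using u by (auto simp: H0c_def)
  obtain \<psi> where \<psi>: "\<And>n. \<psi> n \<in> test_fun G"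
    "(\<lambda>n. l2norm G (\<lambda>x. v x - \<psi> n x)) \<longlonglongrightarrow> 0" "(\<lambda>n. l2norm G (\<lambda>x. d x - ccurl (\<psi> n) x)) \<longlonglongrightarrow> 0"
    using v by (auto simp: H0c_def)
  note t = H0cD[OF u] H0cD[OF v] test_fun_L2[OF \<phi>(1) G] test_fun_L2[OF \<psi>(1) G] 
    test_fun_L2[OF test_fun_ccurl[OF \<phi>(1)] G] test_fun_L2[OF test_fun_ccurl[OF \<psi>(1)] G]
  show ?thesis unfolding H0c_def
  proof (intro conjI exI[of _ "\<lambda>n x. \<phi> n x + \<psi> n x"] allI L2_add t test_fun_add \<phi>(1) \<psi>(1))
    show "(\<lambda>n. l2norm G (\<lambda>x. u x + v x - (\<phi> n x + \<psi> n x))) \<longlonglongrightarrow> 0"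
      by (intro tendsto_l2norm_add t \<phi> \<psi>)
    show "(\<lambda>n. l2norm G (\<lambda>x. c x + d x - ccurl (\<lambda>x. \<phi> n x + \<psi> n x) x)) \<longlonglongrightarrow> 0"
      unfolding ccurl_add[OF test_funD(1)[OF \<phi>(1)] test_funD(1)[OF \<psi>(1)]]
      by (intro tendsto_l2norm_add t \<phi> \<psi>)
  qed
qed

lemma H0c_cmult:
  assumes u: "H0c G u c" shows "H0c G (\<lambda>x. a *s u x) (\<lambda>x. a *s c x)"
proof -
  obtain \<phi> where \<phi>: "\<And>n. \<phi> n \<in> test_fun G"
    "(\<lambda>n. l2norm G (\<lambda>x. u x - \<phi> n x)) \<longlonglongrightarrow> 0" "(\<lambda>n. l2norm G (\<lambda>x. c x - ccurl (\<phi> n) x)) \<longlonglongrightarrow> 0"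
    using u by (auto simp: H0c_def)
  have eq: "(\<lambda>x. a *s f x - a *s g x) = (\<lambda>x. a *s (f x - g x))" for f g :: vfield
    by (simp add: fun_eq_iff vec_eq_iff right_diff_distrib)
  have lim: "(\<lambda>n. cmod a * f n) \<longlonglongrightarrow> 0" if "f \<longlonglongrightarrow> 0" for f :: "nat \<Rightarrow> real"
    using tendsto_mult_right_zero[OF that] .
  show ?thesis unfolding H0c_def
  proof (intro conjI exI[of _ "\<lambda>n x. a *s \<phi> n x"] allI L2_cmult H0cD[OF u] test_fun_linear[OF bounded_linear_cmult] \<phi>(1))
    show "(\<lambda>n. l2norm G (\<lambda>x. a *s u x - a *s \<phi> n x)) \<longlonglongrightarrow> 0" 
      unfolding eq l2norm_cmult by (rule lim[OF \<phi>(2)])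
    show "(\<lambda>n. l2norm G (\<lambda>x. a *s c x - ccurl (\<lambda>x. a *s \<phi> n x) x)) \<longlonglongrightarrow> 0"
      unfolding ccurl_cmult[OF test_funD(1)[OF \<phi>(1)]] eq l2norm_cmult by (rule lim[OF \<phi>(3)])
  qed
qed

lemma H0c_zero: "H0c G (\<lambda>x. 0) (\<lambda>x. 0)"
proof -
  have "ccurl (\<lambda>x. 0) = (\<lambda>x. 0)" by (simp add: ccurl_def fun_eq_iff vec_eq_iff forall_3)
  then show ?thesis unfolding H0c_def by (auto intro!: exI[of _ "\<lambda>n x. 0"])
qed

lemma H0c_diff:
  assumes "G \<in> sets lebesgue" "H0c G u c" "H0c G v d" shows "H0c G (\<lambda>x. u x - v x) (\<lambda>x. c x - d x)"
  using H0c_add[OF assms(1,2) H0c_cmult[OF assms(3), of "-1"]] by (simp add: vector_smult_lneg)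

text \<open>Diagonal sequence: for the \<open>n\<close>-th element a test function within
  \<open>1/(n+1)\<close> is picked. The operator \<open>\<D>\<close> is kept general so that curl
  and gradient are covered at once.\<close>

lemma test_closure_closed:
  fixes v :: "point \<Rightarrow> 'a::euclidean_space" and c :: "point \<Rightarrow> 'b::euclidean_space" and \<D> :: "(point \<Rightarrow> 'a) \<Rightarrow> point \<Rightarrow> 'b"
  assumes v: "v \<in> L2 G" "c \<in> L2 G" and v': "\<And>n. v' n \<in> L2 G" "\<And>n. c' n \<in> L2 G"
    and T: "\<And>\<phi> :: point \<Rightarrow> 'a. \<phi> \<in> test_fun G \<Longrightarrow> \<phi> \<in> L2 G" "\<And>\<phi>. \<phi> \<in> test_fun G \<Longrightarrow> \<D> \<phi> \<in> L2 G"
    and H: "\<And>n. \<exists>\<phi>. (\<forall>k::nat. \<phi> k \<in> test_fun G) \<and> (\<lambda>k. l2norm G (\<lambda>x. v' n x - \<phi> k x)) \<longlonglongrightarrow> 0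
      \<and> (\<lambda>k. l2norm G (\<lambda>x. c' n x - \<D> (\<phi> k) x)) \<longlonglongrightarrow> 0"
    and lim: "(\<lambda>n::nat. l2norm G (\<lambda>x. v x - v' n x)) \<longlonglongrightarrow> 0" "(\<lambda>n. l2norm G (\<lambda>x. c x - c' n x)) \<longlonglongrightarrow> 0"
  shows "\<exists>\<phi>. (\<forall>n::nat. \<phi> n \<in> test_fun G) \<and> (\<lambda>n. l2norm G (\<lambda>x. v x - \<phi> n x)) \<longlonglongrightarrow> 0
    \<and> (\<lambda>n. l2norm G (\<lambda>x. c x - \<D> (\<phi> n) x)) \<longlonglongrightarrow> 0"
proof -
  have ex: "\<exists>\<phi>. \<phi> \<in> test_fun G \<and> l2norm G (\<lambda>x. v' n x - \<phi> x) < 1 / real (Suc n) \<and> l2norm G (\<lambda>x. c' n x - \<D> \<phi> x) < 1 / real (Suc n)" for n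
  proof -
    obtain \<phi> where \<phi>: "\<And>n. \<phi> n \<in> test_fun G"
      "(\<lambda>k. l2norm G (\<lambda>x. v' n x - \<phi> k x)) \<longlonglongrightarrow> 0" "(\<lambda>k. l2norm G (\<lambda>x. c' n x - \<D> (\<phi> k) x)) \<longlonglongrightarrow> 0"
      using H[of n] by auto
    have "\<forall>\<^sub>F k in sequentially. l2norm G (\<lambda>x. v' n x - \<phi> k x) < 1 / real (Suc n) \<and> l2norm G (\<lambda>x. c' n x - \<D> (\<phi> k) x) < 1 / real (Suc n)"
      by (intro eventually_conj order_tendstoD(2)[OF \<phi>(2)] order_tendstoD(2)[OF \<phi>(3)]) auto
    then show ?thesis using \<phi>(1) by (auto simp: eventually_sequentially)
  qed
  have "\<exists>\<phi>. \<forall>n. \<phi> n \<in> test_fun G \<and> l2norm G (\<lambda>x. v' n x - \<phi> n x) < 1 / real (Suc n) \<and> l2norm G (\<lambda>x. c' n x - \<D> (\<phi> n) x) < 1 / real (Suc n)"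
    by (rule choice, rule allI, rule ex)
  then obtain \<phi> where \<phi>: "\<And>n. \<phi> n \<in> test_fun G" "\<And>n. l2norm G (\<lambda>x. v' n x - \<phi> n x) < 1 / real (Suc n)"
    "\<And>n. l2norm G (\<lambda>x. c' n x - \<D> (\<phi> n) x) < 1 / real (Suc n)" by blast
  have *: "(\<lambda>n. l2norm G (\<lambda>x. u x - g n x)) \<longlonglongrightarrow> 0" 
    if "u \<in> L2 G" "\<And>n. f n \<in> L2 G" "\<And>n. g n \<in> L2 G" "\<And>n. l2norm G (\<lambda>x. f n x - g n x) < 1 / real (Suc n)" 
      "(\<lambda>n. l2norm G (\<lambda>x. u x - f n x)) \<longlonglongrightarrow> 0" for u :: "point \<Rightarrow> 'c::euclidean_space" and f g
  proof (rule Lim_null_comparison)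
    show "\<forall>\<^sub>F n in sequentially. norm (l2norm G (\<lambda>x. u x - g n x)) \<le> l2norm G (\<lambda>x. u x - f n x) + 1 / real (Suc n)"
    proof (intro always_eventually allI)
      fix n
      show "norm (l2norm G (\<lambda>x. u x - g n x)) \<le> l2norm G (\<lambda>x. u x - f n x) + 1 / real (Suc n)"
        using l2norm_triangle_diff[OF that(1) that(2)[of n] that(3)[of n]] that(4)[of n] by simp
    qed
    show "(\<lambda>n. l2norm G (\<lambda>x. u x - f n x) + 1 / real (Suc n)) \<longlonglongrightarrow> 0"
      using tendsto_add[OF that(5) LIMSEQ_Suc[OF lim_1_over_n]] by simp
  qed
  show ?thesis
    using \<phi>(1) *[OF v(1) v'(1) T(1)[OF \<phi>(1)] \<phi>(2) lim(1)] *[OF v(2) v'(2) T(2)[OF \<phi>(1)] \<phi>(3) lim(2)] by auto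
qed

lemma H0c_closed:
  assumes G: "G \<in> sets lebesgue" and v: "v \<in> L2 G" "c \<in> L2 G" and H: "\<And>n. H0c G (v' n) (c' n)"
    and lim: "(\<lambda>n::nat. l2norm G (\<lambda>x. v x - v' n x)) \<longlonglongrightarrow> 0" "(\<lambda>n. l2norm G (\<lambda>x. c x - c' n x)) \<longlonglongrightarrow> 0"
  shows "H0c G v c"
  unfolding H0c_def
  by (intro conjI v test_closure_closed[OF v H0cD(1)[OF H] H0cD(2)[OF H] test_fun_L2[OF _ G] test_fun_L2[OF test_fun_ccurl G] _ lim])
    (use H in \<open>simp_all add: H0c_def\<close>)

lemma H0g_closed:
  assumes G: "G \<in> sets lebesgue" and v: "v \<in> L2 G" "c \<in> L2 G" and H: "\<And>n. H0g G (v' n) (c' n)"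
    and lim: "(\<lambda>n::nat. l2norm G (\<lambda>x. v x - v' n x)) \<longlonglongrightarrow> 0" "(\<lambda>n. l2norm G (\<lambda>x. c x - c' n x)) \<longlonglongrightarrow> 0"
  shows "H0g G v c"
  unfolding H0g_def
  by (intro conjI v test_closure_closed[OF v H0gD(1)[OF H] H0gD(2)[OF H] test_fun_L2[OF _ G] test_fun_L2[OF test_fun_cgrad G] _ lim])
    (use H in \<open>simp_all add: H0g_def\<close>)

text \<open>Locality of the weak curl, by testing with functions supported in \<open>U\<close>.
  Through it, an element energy vanishes exactly when the field vanishes on the element.\<close>

lemma weak_curl_local:
  assumes G: "open G" and U: "open U" "U \<subseteq> G" and w: "weak_curl G v c" and v: "ae_eq U v (\<lambda>x. 0)"
    and vL: "v \<in> L2 G"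
  shows "ae_eq U c (\<lambda>x. 0)"
proof -
  note Gs = open_sets_lebesgue[OF G] and Us = open_sets_lebesgue[OF U(1)]
  have L2U: "f \<in> L2 U" if f: "f \<in> L2 G" for f :: vfield
    unfolding L2_def
  proof (clarify, intro conjI)
    show "f \<in> borel_measurable (lebesgue_on U)" 
      using L2_measurable[OF f] U(2) by (rule measurable_restrict_mono)
    have "integrable lebesgue (\<lambda>x. indicator U x *\<^sub>R (indicator G x *\<^sub>R (norm (f x))\<^sup>2))"
      using L2_integrable[OF f] Us unfolding lebesgue_on_integral(2)[OF Gs] by (rule integrable_mult_indicator[rotated])
    moreover have "(\<lambda>x. indicator U x *\<^sub>R (indicator G x *\<^sub>R (norm (f x))\<^sup>2)) = (\<lambda>x. indicator U x *\<^sub>R (norm (f x))\<^sup>2)"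
      using U(2) by (auto simp: indicator_def fun_eq_iff)
    ultimately show "integrable (lebesgue_on U) (\<lambda>x. (norm (f x))\<^sup>2)" unfolding lebesgue_on_integral(2)[OF Us] by simp
  qed
  have cL: "c \<in> L2 G" using w by (simp add: weak_curl_def)
  show ?thesis
  proof (rule l2ip_test_fun_orthogonal[OF U(1) L2U[OF cL]])
    fix \<phi> :: vfield assume \<phi>: "\<phi> \<in> test_fun U"
    then have \<phi>G: "\<phi> \<in> test_fun G" using test_fun_mono[OF U(2)] by auto
    have "l2ip U c \<phi> = l2ip G c \<phi>"
      by (rule l2ip_subset[OF Gs Us U(2), symmetric]) (use test_fun_outside[OF \<phi>] in auto)
    also have "\<dots> = l2ip G v (ccurl \<phi>)" using w \<phi>G by (simp add: weak_curl_def)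
    also have "\<dots> = l2ip U v (ccurl \<phi>)"
      by (rule l2ip_subset[OF Gs Us U(2)]) (use test_fun_outside[OF test_fun_ccurl[OF \<phi>]] in auto)
    also have "\<dots> = l2ip U (\<lambda>x. 0) (ccurl \<phi>)"
      by (rule l2ip_ae_eq[OF Us L2U[OF vL] test_fun_L2[OF test_fun_ccurl[OF \<phi>] Us] v ae_eq_refl])
    finally show "l2ip U c \<phi> = 0" by (simp add: l2ip_def)
  qed
qed

section \<open>Products with Lipschitz cutoff functions\<close>

text \<open>\<open>d\<close> is the gradient of \<open>\<eta>\<close> almost everywhere; smooth approximation on compact sets is all that the
  product rules need of a piecewise linear \<open>\<eta>\<close>.\<close>

definition cutoff :: "point set \<Rightarrow> (point \<Rightarrow> real) \<Rightarrow> (point \<Rightarrow> point) \<Rightarrow> bool"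
  where "cutoff G \<eta> d \<longleftrightarrow> \<eta> \<in> borel_measurable (lebesgue_on G) \<and> d \<in> borel_measurable (lebesgue_on G)
    \<and> (\<exists>B. \<forall>x\<in>G. \<bar>\<eta> x\<bar> \<le> B \<and> norm (d x) \<le> B)
    \<and> (\<forall>K. compact K \<longrightarrow> K \<subseteq> G \<longrightarrow> (\<exists>e B. (\<forall>n::nat. smooth (e n))
        \<and> (\<forall>n. \<forall>x\<in>K. \<bar>e n x\<bar> \<le> B \<and> (\<forall>i. \<bar>pd i (e n) x\<bar> \<le> B))
        \<and> (AE x in lebesgue. x \<in> K \<longrightarrow> (\<lambda>n. e n x) \<longlonglongrightarrow> \<eta> x \<and> (\<forall>i. (\<lambda>n. pd i (e n) x) \<longlonglongrightarrow> d x $ i))))"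

lemma norm_cvec: "norm (cvec d) = norm d"
  by (simp add: norm_vec_def cvec_def)

lemma norm_ccross_le: "norm (ccross a b) \<le> 6 * (norm a * norm b)"
proof -
  have *: "cmod (a $ i * b $ j - a $ k * b $ l) \<le> 2 * (norm a * norm b)" for i j k l
  proof -
    have "cmod (a $ i * b $ j - a $ k * b $ l) \<le> cmod (a $ i) * cmod (b $ j) + cmod (a $ k) * cmod (b $ l)"
      by (metis norm_mult norm_triangle_ineq4)
    also have "\<dots> \<le> norm a * norm b + norm a * norm b"
      by (intro add_mono mult_mono Finite_Cartesian_Product.norm_nth_le) auto
    finally show ?thesis by simp
  qed
  have "norm (ccross a b) \<le> (\<Sum>i\<in>UNIV. cmod (ccross a b $ i))"
    unfolding norm_vec_def by (rule L2_set_le_sum) simp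
  also have "\<dots> \<le> 6 * (norm a * norm b)"
    using *[of 2 3 3 2] *[of 3 1 1 3] *[of 1 2 2 1] by (simp add: sum_3 ccross_def)
  finally show ?thesis .
qed

lemma AE_lebesgue_on: "G \<in> sets lebesgue \<Longrightarrow> (AE x in lebesgue_on G. P x) \<longleftrightarrow> (AE x in lebesgue. x \<in> G \<longrightarrow> P x)"
  by (subst AE_restrict_space_iff) auto

lemma AE_lebesgue_onI: "G \<in> sets lebesgue \<Longrightarrow> (\<And>x. x \<in> G \<Longrightarrow> P x) \<Longrightarrow> AE x in lebesgue_on G. P x"
  by (subst AE_lebesgue_on) auto

lemma bounded_bilinear_ccross: "bounded_bilinear (\<lambda>a. ccross (cvec a))"
proof
  show "\<exists>K. \<forall>a b. norm (ccross (cvec a) b) \<le> norm a * norm b * K"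
    using norm_ccross_le[of "cvec _"] by (intro exI[of _ 6]) (simp add: norm_cvec mult.commute)
qed (simp_all add: ccross_def cvec_def vec_eq_iff forall_3 scaleR_conv_of_real[where 'a=complex] algebra_simps)

lemma bounded_bilinear_cvec: "bounded_bilinear (\<lambda>a y. y *s cvec a)"
proof
  show "\<exists>K. \<forall>a b. norm (b *s cvec a) \<le> norm a * norm b * K"
    by (intro exI[of _ 1]) (simp add: norm_cmult_vec norm_cvec mult.commute)
qed (simp_all add: cvec_def vec_eq_iff scaleR_conv_of_real[where 'a=complex] algebra_simps)

section \<open>Products of L2 fields with a bounded field\<close>

context
  fixes prod :: "'a::euclidean_space \<Rightarrow> 'b::euclidean_space \<Rightarrow> 'c::euclidean_space" and G :: "point set" and a :: "point \<Rightarrow> 'a" and B :: real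
  assumes bb: "bounded_bilinear prod" and G: "G \<in> sets lebesgue"
    and a: "a \<in> borel_measurable (lebesgue_on G)" "\<And>x. x \<in> G \<Longrightarrow> norm (a x) \<le> B"
begin

lemma measurable_bilinear:
  assumes "a' \<in> borel_measurable (lebesgue_on G)" "f \<in> borel_measurable (lebesgue_on G)"
  shows "(\<lambda>x. prod (a' x) (f x)) \<in> borel_measurable (lebesgue_on G)"
  by (rule borel_measurable_continuous_Pair[OF assms])
    (intro bounded_bilinear.continuous_on[OF bb] continuous_intros)

lemma bilinear_bound: "\<exists>K\<ge>0. \<forall>x\<in>G. \<forall>y. norm (prod (a x) y) \<le> K * norm y"
proof -
  obtain K where K: "K \<ge> 0" "\<And>a b. norm (prod a b) \<le> norm a * norm b * K" using bounded_bilinear.nonneg_bounded[OF bb] by blast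
  have "norm (prod (a x) y) \<le> (\<bar>B\<bar> * K) * norm y" if "x \<in> G" for x y
  proof -
    have "norm (a x) * (norm y * K) \<le> \<bar>B\<bar> * (norm y * K)" using a(2)[OF that] K(1) by (intro mult_right_mono) auto
    then show ?thesis using K(2)[of "a x" y] by (simp add: mult_ac)
  qed
  then show ?thesis using K(1) by (intro exI[of _ "\<bar>B\<bar> * K"]) simp
qed

lemma bilinear_L2:
  assumes f: "f \<in> L2 G" shows "(\<lambda>x. prod (a x) (f x)) \<in> L2 G"
proof -
  obtain K where K: "\<forall>x\<in>G. \<forall>y. norm (prod (a x) y) \<le> K * norm y" using bilinear_bound by blast
  show ?thesis
    by (rule L2_mult_bounded[OF f measurable_bilinear[OF a(1) L2_measurable[OF f]] AE_lebesgue_onI[OF G]]) (use K in blast)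
qed

lemma bilinear_limit:
  assumes f: "f \<in> L2 G" "\<And>n. f' n \<in> L2 G" and lim: "(\<lambda>n::nat. l2norm G (\<lambda>x. f x - f' n x)) \<longlonglongrightarrow> 0"
  shows "(\<lambda>n. l2norm G (\<lambda>x. prod (a x) (f x) - prod (a x) (f' n x))) \<longlonglongrightarrow> 0"
proof -
  obtain K where K: "K \<ge> 0" "\<forall>x\<in>G. \<forall>y. norm (prod (a x) y) \<le> K * norm y" using bilinear_bound by blast
  show ?thesis
    unfolding bounded_bilinear.diff_right[OF bb, symmetric]
  proof (rule Lim_null_comparison)
    note L = L2_diff[OF f]
    show "(\<lambda>n. \<bar>K\<bar> * l2norm G (\<lambda>x. f x - f' n x)) \<longlonglongrightarrow> 0" using tendsto_mult_right_zero[OF lim] .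
    have "l2norm G (\<lambda>x. prod (a x) (f x - f' n x)) \<le> l2norm G (\<lambda>x. K *\<^sub>R (f x - f' n x))" for n
      by (rule l2norm_mono[OF L2_scaleR[OF L] L2_measurable[OF bilinear_L2[OF L]] AE_lebesgue_onI[OF G]]) (use K in simp)
    then show "\<forall>\<^sub>F n in sequentially. norm (l2norm G (\<lambda>x. prod (a x) (f x - f' n x))) \<le> \<bar>K\<bar> * l2norm G (\<lambda>x. f x - f' n x)"
      by (simp add: l2norm_scaleR)
  qed
qed

text \<open>The approximants \<open>a' n\<close> are controlled on \<open>S\<close> only, which
  suffices because \<open>f\<close> vanishes elsewhere; dominated convergence applies.\<close>

lemma bilinear_approx:
  assumes f: "f \<in> L2 G" "\<And>x. x \<notin> S \<Longrightarrow> f x = 0" and a': "\<And>n. a' n \<in> borel_measurable (lebesgue_on G)"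
    and C: "\<And>n x. x \<in> S \<Longrightarrow> norm (a' n x) \<le> C" and lim: "AE x in lebesgue_on G. x \<in> S \<longrightarrow> (\<lambda>n. a' n x) \<longlonglongrightarrow> a x"
  shows "(\<lambda>n. l2norm G (\<lambda>x. prod (a x) (f x) - prod (a' n x) (f x))) \<longlonglongrightarrow> 0"
proof -
  obtain K where K: "K \<ge> 0" "\<And>a b. norm (prod a b) \<le> norm a * norm b * K" using bounded_bilinear.nonneg_bounded[OF bb] by blast
  have z: "prod b 0 = 0" for b by (rule bounded_bilinear.zero_right[OF bb])
  show ?thesis
  proof (rule L2_dominated[OF f(1), where B="(B + C) * K"])
    show "(\<lambda>x. prod (a x) (f x) - prod (a' n x) (f x)) \<in> borel_measurable (lebesgue_on G)" for n
      by (intro borel_measurable_diff measurable_bilinear a a' L2_measurable f)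
    show "AE x in lebesgue_on G. (\<lambda>n. prod (a x) (f x) - prod (a' n x) (f x)) \<longlonglongrightarrow> 0"
      using lim
    proof eventually_elim
      case (elim x)
      show ?case
      proof (cases "x \<in> S")
        case True
        then have "(\<lambda>n. prod (a x) (f x) - prod (a' n x) (f x)) \<longlonglongrightarrow> prod (a x) (f x) - prod (a x) (f x)"
          using elim by (intro tendsto_intros bounded_bilinear.tendsto[OF bb]) auto
        then show ?thesis by simp
      qed (simp add: f(2) z)
    qed
    show "AE x in lebesgue_on G. norm (prod (a x) (f x) - prod (a' n x) (f x)) \<le> (B + C) * K * norm (f x)" for n
    proof (rule AE_lebesgue_onI[OF G])
      fix x assume x: "x \<in> G"
      show "norm (prod (a x) (f x) - prod (a' n x) (f x)) \<le> (B + C) * K * norm (f x)"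
      proof (cases "x \<in> S")
        case True
        have "norm (a x - a' n x) \<le> B + C" using norm_triangle_ineq4[of "a x" "a' n x"] a(2)[OF x] C[OF True, of n] by linarith
        then have "norm (a x - a' n x) * (norm (f x) * K) \<le> (B + C) * (norm (f x) * K)" using K(1) by (intro mult_right_mono) auto
        then show ?thesis using K(2)[of "a x - a' n x" "f x"] unfolding bounded_bilinear.diff_left[OF bb] by (simp add: mult_ac)
      qed (simp add: f(2) z)
    qed
  qed
qed

end

definition gradv :: "(point \<Rightarrow> real) \<Rightarrow> point \<Rightarrow> point" where "gradv e x = (\<chi> i. pd i e x)"

lemma ccurl_scaleR:
  assumes e: "smooth e" and v: "smooth v"
  shows "ccurl (\<lambda>x. e x *\<^sub>R v x) x = e x *\<^sub>R ccurl v x + ccross (cvec (gradv e x)) (v x)"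
proof -
  have pd: "pd i (\<lambda>x. e x *\<^sub>R v x) x = e x *\<^sub>R pd i v x + pd i e x *\<^sub>R v x" for i
    by (rule pd_bilinear[OF bounded_bilinear_scaleR smooth_differentiable[OF e] smooth_differentiable[OF v]])
  show ?thesis unfolding ccurl_def pd
    by (simp add: gradv_def ccross_def cvec_def vec_eq_iff forall_3) (simp add: scaleR_conv_of_real[where 'a=complex] algebra_simps)
qed

lemma cgrad_scaleR:
  assumes e: "smooth e" and v: "smooth v"
  shows "cgrad (\<lambda>x. e x *\<^sub>R v x) x = e x *\<^sub>R cgrad v x + v x *s cvec (gradv e x)"
proof -
  have pd: "pd i (\<lambda>x. e x *\<^sub>R v x) x = e x *\<^sub>R pd i v x + pd i e x *\<^sub>R v x" for i
    by (rule pd_bilinear[OF bounded_bilinear_scaleR smooth_differentiable[OF e] smooth_differentiable[OF v]])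
  show ?thesis unfolding cgrad_def pd
    by (simp add: gradv_def cvec_def vec_eq_iff) (simp add: scaleR_conv_of_real[where 'a=complex])
qed

lemma cutoff_bounds:
  assumes "cutoff G \<eta> d" shows "\<exists>B\<ge>0. \<forall>x\<in>G. \<bar>\<eta> x\<bar> \<le> B \<and> norm (d x) \<le> B"
proof -
  obtain B where "\<forall>x\<in>G. \<bar>\<eta> x\<bar> \<le> B \<and> norm (d x) \<le> B" using assms by (auto simp: cutoff_def)
  then show ?thesis by (intro exI[of _ "max B 0"]) force
qed

context
  fixes G \<eta> d
  assumes G: "open G" and cut: "cutoff G \<eta> d"
begin

lemma cutoff_measurable: "\<eta> \<in> borel_measurable (lebesgue_on G)" "d \<in> borel_measurable (lebesgue_on G)"
  using cut by (auto simp: cutoff_def)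

lemmas cutoff_bilinear = open_sets_lebesgue[OF G] cutoff_measurable

lemma cutoff_L2:
  shows "v \<in> L2 G \<Longrightarrow> (\<lambda>x. \<eta> x *\<^sub>R v x) \<in> L2 G"
    and "w \<in> L2 G \<Longrightarrow> (\<lambda>x. ccross (cvec (d x)) (w x)) \<in> L2 G"
    and "p \<in> L2 G \<Longrightarrow> (\<lambda>x. p x *s cvec (d x)) \<in> L2 G"
proof -
  obtain B where "\<forall>x\<in>G. \<bar>\<eta> x\<bar> \<le> B \<and> norm (d x) \<le> B" using cutoff_bounds[OF cut] by blast
  then show "v \<in> L2 G \<Longrightarrow> (\<lambda>x. \<eta> x *\<^sub>R v x) \<in> L2 G"
    "w \<in> L2 G \<Longrightarrow> (\<lambda>x. ccross (cvec (d x)) (w x)) \<in> L2 G"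
    "p \<in> L2 G \<Longrightarrow> (\<lambda>x. p x *s cvec (d x)) \<in> L2 G"
    using bilinear_L2[OF bounded_bilinear_scaleR cutoff_bilinear(1,2), of B v] bilinear_L2[OF bounded_bilinear_ccross cutoff_bilinear(1,3), of B w]
      bilinear_L2[OF bounded_bilinear_cvec cutoff_bilinear(1,3), of B p] by auto
qed

lemma cutoff_limits:
  shows "v \<in> L2 G \<Longrightarrow> (\<And>n. f n \<in> L2 G) \<Longrightarrow> (\<lambda>n::nat. l2norm G (\<lambda>x. v x - f n x)) \<longlonglongrightarrow> 0 \<Longrightarrow> 
      (\<lambda>n. l2norm G (\<lambda>x. \<eta> x *\<^sub>R v x - \<eta> x *\<^sub>R f n x)) \<longlonglongrightarrow> 0"
    and "w \<in> L2 G \<Longrightarrow> (\<And>n. g n \<in> L2 G) \<Longrightarrow> (\<lambda>n::nat. l2norm G (\<lambda>x. w x - g n x)) \<longlonglongrightarrow> 0 \<Longrightarrow> 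
      (\<lambda>n. l2norm G (\<lambda>x. ccross (cvec (d x)) (w x) - ccross (cvec (d x)) (g n x))) \<longlonglongrightarrow> 0"
    and "p \<in> L2 G \<Longrightarrow> (\<And>n. q n \<in> L2 G) \<Longrightarrow> (\<lambda>n::nat. l2norm G (\<lambda>x. p x - q n x)) \<longlonglongrightarrow> 0 \<Longrightarrow> 
      (\<lambda>n. l2norm G (\<lambda>x. p x *s cvec (d x) - q n x *s cvec (d x))) \<longlonglongrightarrow> 0"
proof -
  obtain B where B: "\<And>x. x \<in> G \<Longrightarrow> norm (\<eta> x) \<le> B" "\<And>x. x \<in> G \<Longrightarrow> norm (d x) \<le> B" using cutoff_bounds[OF cut] by auto
  note b = bilinear_limit[OF bounded_bilinear_scaleR cutoff_bilinear(1,2) B(1)] bilinear_limit[OF bounded_bilinear_ccross cutoff_bilinear(1,3) B(2)]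
    bilinear_limit[OF bounded_bilinear_cvec cutoff_bilinear(1,3) B(2)]
  show "(\<lambda>n. l2norm G (\<lambda>x. \<eta> x *\<^sub>R v x - \<eta> x *\<^sub>R f n x)) \<longlonglongrightarrow> 0"
    if "v \<in> L2 G" "\<And>n. f n \<in> L2 G" "(\<lambda>n::nat. l2norm G (\<lambda>x. v x - f n x)) \<longlonglongrightarrow> 0" by (rule b(1)[OF _ that])
  show "(\<lambda>n. l2norm G (\<lambda>x. ccross (cvec (d x)) (w x) - ccross (cvec (d x)) (g n x))) \<longlonglongrightarrow> 0"
    if "w \<in> L2 G" "\<And>n. g n \<in> L2 G" "(\<lambda>n::nat. l2norm G (\<lambda>x. w x - g n x)) \<longlonglongrightarrow> 0" by (rule b(2)[OF _ that])
  show "(\<lambda>n. l2norm G (\<lambda>x. p x *s cvec (d x) - q n x *s cvec (d x))) \<longlonglongrightarrow> 0"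
    if "p \<in> L2 G" "\<And>n. q n \<in> L2 G" "(\<lambda>n::nat. l2norm G (\<lambda>x. p x - q n x)) \<longlonglongrightarrow> 0" by (rule b(3)[OF _ that])
qed

text \<open>Bundles the convergences that the product rules for curl and gradient call for. They are
  restricted to fields vanishing outside \<open>K\<close>, as a cutoff is approximated by smooth
  functions only on compact sets.\<close>

definition cutoff_approx :: "point set \<Rightarrow> (nat \<Rightarrow> point \<Rightarrow> real) \<Rightarrow> bool"
  where "cutoff_approx K e \<longleftrightarrow> (\<forall>n. smooth (e n))
    \<and> (\<forall>f :: vfield. f \<in> test_fun G \<longrightarrow> (\<forall>x. x \<notin> K \<longrightarrow> f x = 0) \<longrightarrow> (\<lambda>n. l2norm G (\<lambda>x. \<eta> x *\<^sub>R f x - e n x *\<^sub>R f x)) \<longlonglongrightarrow> 0)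
    \<and> (\<forall>f :: sfield. f \<in> test_fun G \<longrightarrow> (\<forall>x. x \<notin> K \<longrightarrow> f x = 0) \<longrightarrow> (\<lambda>n. l2norm G (\<lambda>x. \<eta> x *\<^sub>R f x - e n x *\<^sub>R f x)) \<longlonglongrightarrow> 0)
    \<and> (\<forall>f :: vfield. f \<in> test_fun G \<longrightarrow> (\<forall>x. x \<notin> K \<longrightarrow> f x = 0) \<longrightarrow> (\<lambda>n. l2norm G (\<lambda>x. ccross (cvec (d x)) (f x) - ccross (cvec (gradv (e n) x)) (f x))) \<longlonglongrightarrow> 0)
    \<and> (\<forall>f :: sfield. f \<in> test_fun G \<longrightarrow> (\<forall>x. x \<notin> K \<longrightarrow> f x = 0) \<longrightarrow> (\<lambda>n. l2norm G (\<lambda>x. f x *s cvec (d x) - f x *s cvec (gradv (e n) x))) \<longlonglongrightarrow> 0)"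

lemma cutoff_approxD:
  assumes "cutoff_approx K e"
  shows "smooth (e n)"
    "\<And>f :: vfield. f \<in> test_fun G \<Longrightarrow> (\<And>x. x \<notin> K \<Longrightarrow> f x = 0) \<Longrightarrow> (\<lambda>n. l2norm G (\<lambda>x. \<eta> x *\<^sub>R f x - e n x *\<^sub>R f x)) \<longlonglongrightarrow> 0"
    "\<And>f :: sfield. f \<in> test_fun G \<Longrightarrow> (\<And>x. x \<notin> K \<Longrightarrow> f x = 0) \<Longrightarrow> (\<lambda>n. l2norm G (\<lambda>x. \<eta> x *\<^sub>R f x - e n x *\<^sub>R f x)) \<longlonglongrightarrow> 0"
    "\<And>f :: vfield. f \<in> test_fun G \<Longrightarrow> (\<And>x. x \<notin> K \<Longrightarrow> f x = 0) \<Longrightarrow> (\<lambda>n. l2norm G (\<lambda>x. ccross (cvec (d x)) (f x) - ccross (cvec (gradv (e n) x)) (f x))) \<longlonglongrightarrow> 0"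
    "\<And>f :: sfield. f \<in> test_fun G \<Longrightarrow> (\<And>x. x \<notin> K \<Longrightarrow> f x = 0) \<Longrightarrow> (\<lambda>n. l2norm G (\<lambda>x. f x *s cvec (d x) - f x *s cvec (gradv (e n) x))) \<longlonglongrightarrow> 0"
  using assms unfolding cutoff_approx_def by simp_all

lemma cutoff_test_approx:
  fixes \<phi> :: "point \<Rightarrow> 'b::real_normed_vector"
  assumes \<phi>: "\<phi> \<in> test_fun G"
  shows "\<exists>e. cutoff_approx (closure {x. \<phi> x \<noteq> 0}) e"
proof -
  note Gs = open_sets_lebesgue[OF G]
  let ?K = "closure {x. \<phi> x \<noteq> 0}"
  obtain B where B: "B \<ge> 0" "\<And>x. x \<in> G \<Longrightarrow> \<bar>\<eta> x\<bar> \<le> B" "\<And>x. x \<in> G \<Longrightarrow> norm (d x) \<le> B" using cutoff_bounds[OF cut] by blast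
  obtain e C where e: "\<And>n::nat. smooth (e n)" "\<And>n x. x \<in> ?K \<Longrightarrow> \<bar>e n x\<bar> \<le> C" "\<And>n x i. x \<in> ?K \<Longrightarrow> \<bar>pd i (e n) x\<bar> \<le> C"
    and lim: "AE x in lebesgue. x \<in> ?K \<longrightarrow> (\<lambda>n. e n x) \<longlonglongrightarrow> \<eta> x \<and> (\<forall>i. (\<lambda>n. pd i (e n) x) \<longlonglongrightarrow> d x $ i)"
    using conjunct2[OF conjunct2[OF conjunct2[OF cut[unfolded cutoff_def]]], rule_format, OF test_funD(2,3)[OF \<phi>]] by blast
  have sub: "?K \<subseteq> G" by (rule test_funD(3)[OF \<phi>])
  have ge: "norm (gradv (e n) x) \<le> 3 * C" if "x \<in> ?K" for n x
  proof -
    have "norm (gradv (e n) x) \<le> (\<Sum>i\<in>UNIV. \<bar>gradv (e n) x $ i\<bar>)" by (rule norm_le_l1_cart)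
    also have "\<dots> \<le> 3 * C"
    proof -
      have "\<bar>pd i (e n) x\<bar> \<le> C" for i by (rule e(3)[OF that])
      from this[of 1] this[of 2] this[of 3] show ?thesis by (simp add: gradv_def sum_3)
    qed
    finally show ?thesis .
  qed
  have mg: "(\<lambda>x. gradv (e n) x) \<in> borel_measurable (lebesgue_on G)" for n
    unfolding gradv_def by (intro measurable_continuous_lebesgue_on continuous_on_vec_lambda smooth_continuous smooth_pd e(1))
  have me: "e n \<in> borel_measurable (lebesgue_on G)" for n by (rule measurable_continuous_lebesgue_on[OF smooth_continuous[OF e(1)]])
  have lim_e: "AE x in lebesgue_on G. (x \<in> ?K \<longrightarrow> (\<lambda>n. e n x) \<longlonglongrightarrow> \<eta> x)"
    and lim_g: "AE x in lebesgue_on G. (x \<in> ?K \<longrightarrow> (\<lambda>n. gradv (e n) x) \<longlonglongrightarrow> d x)"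
    using lim unfolding AE_lebesgue_on[OF Gs] by (auto elim!: AE_mp simp: gradv_def intro!: vec_tendstoI)
  note f = test_fun_L2[OF _ Gs]
  have B': "\<And>x. x \<in> G \<Longrightarrow> norm (\<eta> x) \<le> B" "\<And>n x. x \<in> ?K \<Longrightarrow> norm (e n x) \<le> C" using B(2) e(2) by auto
  note A = bilinear_approx[OF bounded_bilinear_scaleR Gs cutoff_measurable(1) B'(1) f _ me B'(2) lim_e]
    and D = bilinear_approx[OF bounded_bilinear_ccross Gs cutoff_measurable(2) B(3) f _ mg ge lim_g]
    and E = bilinear_approx[OF bounded_bilinear_cvec Gs cutoff_measurable(2) B(3) f _ mg ge lim_g]
  show ?thesis unfolding cutoff_approx_def
    by (intro exI[of _ e] conjI allI impI; (rule spec[OF e(1)] | rule A | rule D | rule E); (assumption | (elim allE impE; assumption)))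
qed

text \<open>Two limits. For a test function \<open>\<phi>\<close> the products
  \<open>e n \<phi>\<close> are test functions that converge together with their curls; for general
  \<open>v\<close> the closedness of \<open>H0c\<close> is applied to the products of
  \<open>\<eta>\<close> with the approximants of \<open>v\<close>.\<close>

lemma cutoff_H0c:
  assumes v: "H0c G v c" shows "H0c G (\<lambda>x. \<eta> x *\<^sub>R v x) (\<lambda>x. \<eta> x *\<^sub>R c x + ccross (cvec (d x)) (v x))"
proof -
  note Gs = open_sets_lebesgue[OF G]
  have T: "H0c G (\<lambda>x. \<eta> x *\<^sub>R \<phi> x) (\<lambda>x. \<eta> x *\<^sub>R ccurl \<phi> x + ccross (cvec (d x)) (\<phi> x))" if \<phi>: "\<phi> \<in> test_fun G" for \<phi>
  proof -
    note L = test_fun_L2[OF \<phi> Gs] test_fun_L2[OF test_fun_ccurl[OF \<phi>] Gs] and sm = test_funD(1)[OF \<phi>]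
    obtain e where E: "cutoff_approx (closure {x. \<phi> x \<noteq> 0}) e" using cutoff_test_approx[OF \<phi>] by blast
    note e = cutoff_approxD(1)[OF E] and l1 = cutoff_approxD(2)[OF E] and l2 = cutoff_approxD(4)[OF E]
    have n0: "\<And>x. x \<notin> closure {x. \<phi> x \<noteq> 0} \<Longrightarrow> \<phi> x = 0" by (rule notin_support)
    have s\<phi>: "\<And>x. x \<notin> closure {x. \<phi> x \<noteq> 0} \<Longrightarrow> ccurl \<phi> x = 0"
      by (simp add: ccurl_def vec_eq_iff forall_3 notin_support_pd)
    have eT: "(\<lambda>x. e n x *\<^sub>R \<phi> x) \<in> test_fun G" for n by (rule test_fun_scaleR[OF e \<phi>])
    have cl: "ccross (cvec (gradv (e n) x)) (\<phi> x) = ccurl (\<lambda>x. e n x *\<^sub>R \<phi> x) x - e n x *\<^sub>R ccurl \<phi> x" for n x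
      by (simp add: ccurl_scaleR[OF e sm])
    have Lx: "(\<lambda>x. ccross (cvec (gradv (e n) x)) (\<phi> x)) \<in> L2 G" for n
      unfolding cl by (intro L2_diff test_fun_L2[OF test_fun_ccurl[OF eT] Gs] test_fun_L2[OF test_fun_scaleR[OF e test_fun_ccurl[OF \<phi>]] Gs])
    show ?thesis unfolding H0c_def
    proof (intro conjI exI[of _ "\<lambda>n x. e n x *\<^sub>R \<phi> x"] allI eT)
      show "(\<lambda>x. \<eta> x *\<^sub>R \<phi> x) \<in> L2 G" "(\<lambda>x. \<eta> x *\<^sub>R ccurl \<phi> x + ccross (cvec (d x)) (\<phi> x)) \<in> L2 G"
        by (intro L2_add cutoff_L2 L)+
      show "(\<lambda>n. l2norm G (\<lambda>x. \<eta> x *\<^sub>R \<phi> x - e n x *\<^sub>R \<phi> x)) \<longlonglongrightarrow> 0" by (rule l1[OF \<phi> n0])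
      show "(\<lambda>n. l2norm G (\<lambda>x. \<eta> x *\<^sub>R ccurl \<phi> x + ccross (cvec (d x)) (\<phi> x) - ccurl (\<lambda>x. e n x *\<^sub>R \<phi> x) x)) \<longlonglongrightarrow> 0"
        unfolding ccurl_scaleR[OF e sm]
        by (intro tendsto_l2norm_add cutoff_L2 L Lx test_fun_L2[OF test_fun_scaleR[OF e test_fun_ccurl[OF \<phi>]] Gs]
            l1[OF test_fun_ccurl[OF \<phi>] s\<phi>] l2[OF \<phi> n0])
    qed
  qed
  obtain \<phi> where \<phi>: "\<And>n. \<phi> n \<in> test_fun G"
    "(\<lambda>n. l2norm G (\<lambda>x. v x - \<phi> n x)) \<longlonglongrightarrow> 0" "(\<lambda>n. l2norm G (\<lambda>x. c x - ccurl (\<phi> n) x)) \<longlonglongrightarrow> 0"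
    using v by (auto simp: H0c_def)
  note L = H0cD[OF v] test_fun_L2[OF \<phi>(1) Gs] test_fun_L2[OF test_fun_ccurl[OF \<phi>(1)] Gs]
  show ?thesis
  proof (rule H0c_closed[OF Gs _ _ T[OF \<phi>(1)]])
    show "(\<lambda>x. \<eta> x *\<^sub>R v x) \<in> L2 G" "(\<lambda>x. \<eta> x *\<^sub>R c x + ccross (cvec (d x)) (v x)) \<in> L2 G"
      by (intro L2_add cutoff_L2 L)+
    show "(\<lambda>n. l2norm G (\<lambda>x. \<eta> x *\<^sub>R v x - \<eta> x *\<^sub>R \<phi> n x)) \<longlonglongrightarrow> 0" by (intro cutoff_limits L \<phi>)
    show "(\<lambda>n. l2norm G (\<lambda>x. \<eta> x *\<^sub>R c x + ccross (cvec (d x)) (v x) - (\<eta> x *\<^sub>R ccurl (\<phi> n) x + ccross (cvec (d x)) (\<phi> n x)))) \<longlonglongrightarrow> 0"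
      by (intro tendsto_l2norm_add cutoff_limits cutoff_L2 L \<phi>)
  qed
qed

lemma cutoff_H0g:
  assumes v: "H0g G p g" shows "H0g G (\<lambda>x. \<eta> x *\<^sub>R p x) (\<lambda>x. \<eta> x *\<^sub>R g x + p x *s cvec (d x))"
proof -
  note Gs = open_sets_lebesgue[OF G]
  have T: "H0g G (\<lambda>x. \<eta> x *\<^sub>R \<phi> x) (\<lambda>x. \<eta> x *\<^sub>R cgrad \<phi> x + \<phi> x *s cvec (d x))" if \<phi>: "\<phi> \<in> test_fun G" for \<phi>
  proof -
    note L = test_fun_L2[OF \<phi> Gs] test_fun_L2[OF test_fun_cgrad[OF \<phi>] Gs] and sm = test_funD(1)[OF \<phi>]
    obtain e where E: "cutoff_approx (closure {x. \<phi> x \<noteq> 0}) e" using cutoff_test_approx[OF \<phi>] by blast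
    note e = cutoff_approxD(1)[OF E] and l0 = cutoff_approxD(3)[OF E] and l1 = cutoff_approxD(2)[OF E] and l2 = cutoff_approxD(5)[OF E]
    have n0: "\<And>x. x \<notin> closure {x. \<phi> x \<noteq> 0} \<Longrightarrow> \<phi> x = 0" by (rule notin_support)
    have s\<phi>: "\<And>x. x \<notin> closure {x. \<phi> x \<noteq> 0} \<Longrightarrow> cgrad \<phi> x = 0"
      by (simp add: cgrad_def vec_eq_iff notin_support_pd)
    have eT: "(\<lambda>x. e n x *\<^sub>R \<phi> x) \<in> test_fun G" for n by (rule test_fun_scaleR[OF e \<phi>])
    have cl: "\<phi> x *s cvec (gradv (e n) x) = cgrad (\<lambda>x. e n x *\<^sub>R \<phi> x) x - e n x *\<^sub>R cgrad \<phi> x" for n x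
      by (simp add: cgrad_scaleR[OF e sm])
    have Lx: "(\<lambda>x. \<phi> x *s cvec (gradv (e n) x)) \<in> L2 G" for n
      unfolding cl by (intro L2_diff test_fun_L2[OF test_fun_cgrad[OF eT] Gs] test_fun_L2[OF test_fun_scaleR[OF e test_fun_cgrad[OF \<phi>]] Gs])
    show ?thesis unfolding H0g_def
    proof (intro conjI exI[of _ "\<lambda>n x. e n x *\<^sub>R \<phi> x"] allI eT)
      show "(\<lambda>x. \<eta> x *\<^sub>R \<phi> x) \<in> L2 G" "(\<lambda>x. \<eta> x *\<^sub>R cgrad \<phi> x + \<phi> x *s cvec (d x)) \<in> L2 G"
        by (intro L2_add cutoff_L2 L)+
      show "(\<lambda>n. l2norm G (\<lambda>x. \<eta> x *\<^sub>R \<phi> x - e n x *\<^sub>R \<phi> x)) \<longlonglongrightarrow> 0" by (rule l0[OF \<phi> n0])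
      show "(\<lambda>n. l2norm G (\<lambda>x. \<eta> x *\<^sub>R cgrad \<phi> x + \<phi> x *s cvec (d x) - cgrad (\<lambda>x. e n x *\<^sub>R \<phi> x) x)) \<longlonglongrightarrow> 0"
        unfolding cgrad_scaleR[OF e sm]
        by (intro tendsto_l2norm_add cutoff_L2 L Lx test_fun_L2[OF test_fun_scaleR[OF e test_fun_cgrad[OF \<phi>]] Gs]
            l1[OF test_fun_cgrad[OF \<phi>] s\<phi>] l2[OF \<phi> n0])
    qed
  qed
  obtain \<phi> where \<phi>: "\<And>n. \<phi> n \<in> test_fun G"
    "(\<lambda>n. l2norm G (\<lambda>x. p x - \<phi> n x)) \<longlonglongrightarrow> 0" "(\<lambda>n. l2norm G (\<lambda>x. g x - cgrad (\<phi> n) x)) \<longlonglongrightarrow> 0"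
    using v by (auto simp: H0g_def)
  note L = H0gD[OF v] test_fun_L2[OF \<phi>(1) Gs] test_fun_L2[OF test_fun_cgrad[OF \<phi>(1)] Gs]
  show ?thesis
  proof (rule H0g_closed[OF Gs _ _ T[OF \<phi>(1)]])
    show "(\<lambda>x. \<eta> x *\<^sub>R p x) \<in> L2 G" "(\<lambda>x. \<eta> x *\<^sub>R g x + p x *s cvec (d x)) \<in> L2 G"
      by (intro L2_add cutoff_L2 L)+
    show "(\<lambda>n. l2norm G (\<lambda>x. \<eta> x *\<^sub>R p x - \<eta> x *\<^sub>R \<phi> n x)) \<longlonglongrightarrow> 0" by (intro cutoff_limits L \<phi>)
    show "(\<lambda>n. l2norm G (\<lambda>x. \<eta> x *\<^sub>R g x + p x *s cvec (d x) - (\<eta> x *\<^sub>R cgrad (\<phi> n) x + \<phi> n x *s cvec (d x)))) \<longlonglongrightarrow> 0"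
      by (intro tendsto_l2norm_add cutoff_limits cutoff_L2 L \<phi>)
  qed
qed

end

subsection \<open>Mollification\<close>

lemma lebesgue_integral_cbox:
  fixes g :: "point \<Rightarrow> real"
  assumes "continuous_on UNIV g" "\<And>x. x \<notin> cbox a b \<Longrightarrow> g x = 0"
  shows "integral\<^sup>L lebesgue g = integral (cbox a b) g" "integrable lebesgue g"
proof -
  have s: "set_integrable lebesgue (cbox a b) g"
    by (rule absolutely_integrable_continuous[OF continuous_on_subset[OF assms(1)]]) simp
  have eq: "(\<lambda>x. indicator (cbox a b) x *\<^sub>R g x) = g" using assms(2) by (auto simp: indicator_def fun_eq_iff)
  show "integrable lebesgue g" using s unfolding set_integrable_def eq .
  show "integral\<^sup>L lebesgue g = integral (cbox a b) g"
    using set_lebesgue_integral_eq_integral(2)[OF s] unfolding set_lebesgue_integral_def eq .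
qed

lemma smooth_has_derivative:
  fixes f :: "point \<Rightarrow> real"
  assumes "smooth f" shows "(f has_derivative (\<lambda>h. h \<bullet> gradv f x)) (at x)"
proof -
  have d: "(f has_derivative frechet_derivative f (at x)) (at x)"
    by (rule differentiable_frechet[OF smooth_differentiable[OF assms]])
  note lin = has_derivative_linear[OF d]
  have "frechet_derivative f (at x) h = h \<bullet> gradv f x" for h
  proof -
    have h: "h = (\<Sum>i\<in>UNIV. h $ i *\<^sub>R axis i 1)" by (simp add: vec_eq_iff axis_def if_distrib cong: if_cong)
    have "frechet_derivative f (at x) h = (\<Sum>i\<in>UNIV. h $ i * pd i f x)"
      by (subst h) (simp add: linear_sum[OF lin] linear_scale[OF lin] pd_def)
    then show ?thesis by (simp add: inner_vec_def gradv_def)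
  qed
  then show ?thesis using d by (metis ext)
qed

definition conv :: "(point \<Rightarrow> real) \<Rightarrow> (point \<Rightarrow> real) \<Rightarrow> point \<Rightarrow> real"
  where "conv k f x = integral\<^sup>L lebesgue (\<lambda>y. k (x - y) * f y)"

text \<open>Differentiation under the integral on one fixed box: for all \<open>z\<close> in the
  unit ball around \<open>x\<close> the integrand is supported there. The derivative falls on the
  kernel alone, so \<open>f\<close> need only be continuous.\<close>

lemma conv_pd:
  assumes k: "k \<in> test_fun UNIV" and f: "continuous_on UNIV f"
  shows "(conv k f has_derivative (\<lambda>h. h \<bullet> (\<chi> i. conv (pd i k) f x))) (at x)"
proof -
  note sm = test_funD(1)[OF k]
  obtain R where R: "\<And>z. k z \<noteq> 0 \<Longrightarrow> norm z \<le> R"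
    using compact_imp_bounded[OF test_funD(2)[OF k]] closure_subset[of "{x. k x \<noteq> 0}"]
    by (metis (mono_tags, lifting) bounded_iff mem_Collect_eq subset_iff)
  have R': "z \<notin> cball 0 R \<Longrightarrow> pd i k z = 0" for z i
  proof (rule notin_support_pd)
    assume "z \<notin> cball 0 R"
    moreover have "closure {x. k x \<noteq> 0} \<subseteq> cball 0 R" by (rule closure_minimal) (use R in auto)
    ultimately show "z \<notin> closure {x. k x \<noteq> 0}" by blast
  qed
  obtain b where ab: "cball x (R + 1) \<subseteq> cbox (- b) b" by (rule bounded_subset_cbox_symmetric[OF bounded_cball])
  define a where "a = - b"
  note ab = ab[folded a_def]
  have out: "z - y \<notin> cball 0 R" if "z \<in> ball x 1" "y \<notin> cbox a b" for z y
  proof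
    assume "z - y \<in> cball 0 R"
    then have "norm (y - x) \<le> R + 1" 
      using norm_triangle_ineq[of "y - z" "z - x"] that(1) by (simp add: dist_norm norm_minus_commute)
    then have "y \<in> cball x (R + 1)" by (simp add: dist_norm norm_minus_commute)
    with ab that(2) show False by blast
  qed
  have cont: "continuous_on UNIV (\<lambda>y. g (z - y) * f y)" if "continuous_on UNIV g" for g :: "point \<Rightarrow> real" and z
    by (intro continuous_intros f continuous_on_compose2[OF that]) auto
  \<comment> \<open>Derivative of the integrand as a bounded linear map, the form in which the
    Leibniz rule takes it.\<close>
  define fx where "fx z t = (blinfun_inner_left (f t *\<^sub>R gradv k (z - t)) :: point \<Rightarrow>\<^sub>L real)" for z t
  have cg: "continuous_on UNIV (gradv k)"
    unfolding gradv_def by (intro continuous_on_vec_lambda smooth_continuous smooth_pd sm)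
  have cfx: "continuous_on (S :: (point \<times> point) set) (\<lambda>(z, t). fx z t)" for S
    unfolding fx_def split_def
    by (intro bounded_linear.continuous_on[OF bounded_linear_blinfun_inner_left] continuous_on_scaleR
        continuous_on_compose2[OF f] continuous_on_compose2[OF cg] continuous_intros) auto
  have "((\<lambda>z. integral (cbox a b) (\<lambda>t. k (z - t) * f t)) has_derivative integral (cbox a b) (fx x)) (at x within ball x 1)"
  proof (rule leibniz_rule)
    fix z t assume "z \<in> ball x 1"
    have "((\<lambda>z. k (z - t)) has_derivative (\<lambda>h. h \<bullet> gradv k (z - t))) (at z)"
      by (rule has_derivative_compose[where f="\<lambda>z. z - t" and g=k, OF _ smooth_has_derivative[OF sm]])
        (auto intro!: derivative_eq_intros)
    then have "((\<lambda>z. k (z - t) * f t) has_derivative (\<lambda>h. (h \<bullet> gradv k (z - t)) * f t)) (at z)"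
      by (rule has_derivative_mult_left)
    then show "((\<lambda>z. k (z - t) * f t) has_derivative blinfun_apply (fx z t)) (at z within ball x 1)"
    proof (rule has_derivative_at_withinI[OF has_derivative_eq_rhs])
      show "(\<lambda>h. (h \<bullet> gradv k (z - t)) * f t) = blinfun_apply (fx z t)"
        by (simp add: fx_def blinfun_inner_left.rep_eq fun_eq_iff)
    qed
  next
    fix z show "(\<lambda>t. k (z - t) * f t) integrable_on cbox a b"
      by (rule integrable_continuous, rule continuous_on_subset[OF cont[OF smooth_continuous[OF sm]]]) simp
  qed (use cfx in auto)
  then have "((\<lambda>z. integral (cbox a b) (\<lambda>t. k (z - t) * f t)) has_derivative integral (cbox a b) (fx x)) (at x)"
    by (simp add: at_within_open[of x "ball x 1"])
  then have "(conv k f has_derivative integral (cbox a b) (fx x)) (at x)"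
  proof (rule has_derivative_transform_within_open[of _ _ _ _ "ball x 1"])
    fix z assume z: "z \<in> ball x 1"
    show "integral (cbox a b) (\<lambda>t. k (z - t) * f t) = conv k f z"
      unfolding conv_def
    proof (rule lebesgue_integral_cbox(1)[symmetric, OF cont[OF smooth_continuous[OF sm]]])
      fix y assume "y \<notin> cbox a b"
      from out[OF z this] have "k (z - y) = 0" using R by fastforce
      then show "k (z - y) * f y = 0" by simp
    qed
  qed auto
  moreover have "blinfun_apply (integral (cbox a b) (fx x)) h = h \<bullet> (\<chi> i. conv (pd i k) f x)" for h
  proof -
    have fxi: "fx x integrable_on cbox a b"
      by (rule integrable_continuous)
        (use continuous_on_compose2[OF cfx[of UNIV] continuous_on_Pair[OF continuous_on_const[of "cbox a b" x] continuous_on_id]] in simp)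
    have ci: "conv (pd i k) f x = integral (cbox a b) (\<lambda>t. pd i k (x - t) * f t)" for i
      unfolding conv_def using R' out[of x]
      by (intro lebesgue_integral_cbox(1) cont smooth_continuous smooth_pd sm) auto
    have ii: "(\<lambda>t. pd i k (x - t) * f t) integrable_on cbox a b" for i
      by (rule integrable_continuous, rule continuous_on_subset[OF cont[OF smooth_continuous[OF smooth_pd[OF sm]]]]) simp
    have "blinfun_apply (integral (cbox a b) (fx x)) h = integral (cbox a b) (\<lambda>t. blinfun_apply (fx x t) h)"
      by (rule blinfun_apply_integral[OF fxi])
    also have "\<dots> = integral (cbox a b) (\<lambda>t. \<Sum>i\<in>UNIV. h $ i * (pd i k (x - t) * f t))"
      by (simp add: fx_def blinfun_inner_left.rep_eq inner_vec_def gradv_def sum_distrib_left mult_ac)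
    also have "\<dots> = (\<Sum>i\<in>UNIV. h $ i * integral (cbox a b) (\<lambda>t. pd i k (x - t) * f t))"
      using ii by (subst integral_sum) (auto intro: integrable_on_mult_right)
    finally show ?thesis by (simp add: inner_vec_def ci)
  qed
  ultimately show ?thesis by (metis (no_types, lifting) ext)
qed

lemma smooth_conv:
  assumes k: "k \<in> test_fun UNIV" and f: "continuous_on UNIV f"
  shows "smooth (conv k f)"
proof
  fix n show "C_k n (conv k f)"
    using k
  proof (induction n arbitrary: k)
    case 0
    then show ?case using has_derivative_continuous[OF conv_pd[OF 0 f]] by (simp add: continuous_at_imp_continuous_on)
  next
    case (Suc n)
    have "pd i (conv k f) = conv (pd i k) f" for i
      using pd_eq[OF conv_pd[OF Suc.prems f], of i] by (auto simp: fun_eq_iff inner_axis')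
    then show ?case using conv_pd[OF Suc.prems f] Suc.IH[OF test_fun_pd[OF Suc.prems]] by (auto simp: differentiable_def)
  qed
qed

text \<open>The reflection \<open>u = x - y\<close> moves the dependence on \<open>x\<close> to
  \<open>f\<close>, so that the convolution at \<open>x\<close> becomes a weighted mean of the
  values of \<open>f\<close> near \<open>x\<close>.\<close>

lemma conv_commute:
  assumes k: "k \<in> test_fun UNIV" and f: "continuous_on UNIV f"
  shows "conv k f x = integral\<^sup>L lebesgue (\<lambda>u. k u * f (x - u))"
proof -
  let ?g = "\<lambda>y. k (x - y) * f y"
  have ck: "continuous_on UNIV k" by (rule smooth_continuous[OF test_funD(1)[OF k]])
  have cg: "continuous_on UNIV ?g" by (intro continuous_intros f continuous_on_compose2[OF ck]) auto
  have cg': "continuous_on UNIV (\<lambda>u. k u * f (x - u))" by (intro continuous_intros ck continuous_on_compose2[OF f]) auto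
  have [measurable]: "?g \<in> borel_measurable borel" "(\<lambda>u. k u * f (x - u)) \<in> borel_measurable borel"
    by (intro borel_measurable_continuous_onI cg cg')+
  have d: "distr lborel borel (\<lambda>u::point. x + (-1) *\<^sub>R u) = lborel"
    using lborel_affine[of "-1" x] by (simp add: density_1)
  have "integral\<^sup>L lebesgue ?g = integral\<^sup>L lborel ?g" by (rule integral_completion) simp
  also have "\<dots> = integral\<^sup>L (distr lborel borel (\<lambda>u. x + (-1) *\<^sub>R u)) ?g" unfolding d ..
  also have "\<dots> = integral\<^sup>L lborel (\<lambda>u. k u * f (x - u))" by (subst integral_distr) auto
  also have "\<dots> = integral\<^sup>L lebesgue (\<lambda>u. k u * f (x - u))" by (rule integral_completion[symmetric]) simp
  finally show ?thesis by (simp add: conv_def)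
qed

lemma ex_mollifier:
  assumes "\<epsilon> > 0"
  shows "\<exists>k\<in>test_fun UNIV. (\<forall>u. 0 \<le> k u) \<and> (\<forall>u. k u \<noteq> 0 \<longrightarrow> norm u < \<epsilon>) \<and> integral\<^sup>L lebesgue k = (1::real)"
proof -
  \<comment> \<open>The norm is at most the sum of three coordinates, each below a third of
    \<open>\<epsilon>\<close>.\<close>
  define b :: point where "b = (\<chi> i. \<epsilon> / 3)"
  let ?k = "bump (- b) b 1"
  have bT: "?k \<in> test_fun UNIV" using bump_test_fun[of "- b" b UNIV 1 "\<lambda>x. x"] by (simp add: bounded_linear_ident)
  have small: "norm u < \<epsilon>" if "?k u \<noteq> 0" for u
  proof -
    have "u \<in> box (- b) b" using that bump_pos_iff[of 1 "-b" b u] by simp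
    then have "- (\<epsilon> / 3) < u $ i" "u $ i < \<epsilon> / 3" for i by (simp_all add: mem_box_vec b_def)
    then have "\<bar>u $ i\<bar> < \<epsilon> / 3" for i by (simp only: abs_less_iff minus_less_iff simp_thms)
    then have "(\<Sum>i\<in>UNIV. \<bar>u $ i\<bar>) < (\<Sum>i\<in>(UNIV::3 set). \<epsilon> / 3)" by (intro sum_strict_mono) auto
    then show ?thesis using norm_le_l1_cart[of u] by simp
  qed
  have cont: "continuous_on UNIV ?k" by (rule smooth_continuous[OF smooth_bump])
  have int: "integrable lebesgue ?k"
    by (rule lebesgue_integral_cbox(2)[OF cont, of "- b" b]) (use bump_pos_iff[of 1 "-b" b] box_subset_cbox[of "-b" b] in auto)
  have "integral\<^sup>L lebesgue ?k \<noteq> 0"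
  proof
    assume "integral\<^sup>L lebesgue ?k = 0"
    then have "AE u in lebesgue. ?k u = 0"
      using integral_nonneg_eq_0_iff_AE[OF int] bump_nonneg by simp
    then have "AE u in lebesgue. u \<notin> box (- b) b" using bump_pos_iff[of 1 "-b" b] by (auto elim: AE_mp)
    then have "negligible (box (- b) b)" by (simp add: negligible_iff_null_sets AE_iff_null_sets)
    moreover have "0 \<in> box (- b) b" using assms by (simp add: mem_box_vec b_def)
    ultimately show False using open_not_negligible[of "box (- b) b"] open_box by blast
  qed
  then have pos: "integral\<^sup>L lebesgue ?k > 0" using Bochner_Integration.integral_nonneg[of lebesgue ?k, OF bump_nonneg] by simp
  define c where "c = integral\<^sup>L lebesgue ?k"
  show ?thesis
  proof (rule bexI[of _ "\<lambda>x. (1 / c) * ?k x"], intro conjI allI impI)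
    show "(\<lambda>x. (1 / c) * ?k x) \<in> test_fun UNIV" by (rule test_fun_linear[OF bounded_linear_mult_right bT])
    show "0 \<le> (1 / c) * ?k u" for u using pos bump_nonneg by (simp add: c_def)
    show "norm u < \<epsilon>" if "(1 / c) * ?k u \<noteq> 0" for u using small that by simp
    show "integral\<^sup>L lebesgue (\<lambda>x. (1 / c) * ?k x) = 1" using pos int by (simp add: c_def)
  qed
qed

text \<open>A mean of numbers within \<open>c\<close> of \<open>a\<close> is within \<open>c\<close>
  of \<open>a\<close>. Size, Lipschitz bound, convergence and exactness on affine pieces of the
  mollified function all come from this.\<close>

lemma mollifier_mean:
  assumes k: "k \<in> test_fun UNIV" "\<And>u. 0 \<le> k u" "\<And>u. k u \<noteq> 0 \<Longrightarrow> norm u < \<epsilon>" "integral\<^sup>L lebesgue k = (1::real)"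
    and g: "continuous_on UNIV g" and b: "\<And>u. norm u < \<epsilon> \<Longrightarrow> \<bar>g u - a\<bar> \<le> c"
  shows "\<bar>integral\<^sup>L lebesgue (\<lambda>u. k u * g u) - a\<bar> \<le> c"
proof -
  note sm = test_funD(1)[OF k(1)]
  have "bounded (closure {x. k x \<noteq> 0})" by (rule compact_imp_bounded[OF test_funD(2)[OF k(1)]])
  then obtain B where "closure {x. k x \<noteq> 0} \<subseteq> cbox (-B) B" by (rule bounded_subset_cbox_symmetric)
  then have out: "k x = 0" if "x \<notin> cbox (-B) B" for x using that notin_support[of x k] by blast
  have i: "integrable lebesgue (\<lambda>u. k u * h u)" if "continuous_on UNIV h" for h :: "point \<Rightarrow> real"
    by (rule lebesgue_integral_cbox(2)[OF continuous_on_mult[OF smooth_continuous[OF sm] that], of "-B" B]) (simp add: out)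
  have ik: "integrable lebesgue k" using i[of "\<lambda>_. 1"] by simp
  have "integral\<^sup>L lebesgue (\<lambda>u. k u * g u) - a = integral\<^sup>L lebesgue (\<lambda>u. k u * (g u - a))"
    using i[OF g] ik k(4) by (simp add: right_diff_distrib)
  also have "\<bar>\<dots>\<bar> \<le> integral\<^sup>L lebesgue (\<lambda>u. k u * c)"
  proof (rule order_trans[OF integral_abs_bound], rule integral_mono)
    show "integrable lebesgue (\<lambda>u. \<bar>k u * (g u - a)\<bar>)" by (intro integrable_abs i continuous_intros g)
    show "integrable lebesgue (\<lambda>u. k u * c)" by (intro i continuous_intros)
    show "\<bar>k u * (g u - a)\<bar> \<le> k u * c" for u
    proof (cases "k u = 0")
      case False
      then show ?thesis using b[OF k(3)] k(2)[of u] by (simp add: abs_mult mult_left_mono)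
    qed simp
  qed
  also have "\<dots> = c" using ik k(4) by simp
  finally show ?thesis .
qed

text \<open>Mollification supplies the smooth approximants. Lipschitz continuity is asked for only
  along segments inside \<open>G\<close>, because the domain need not be convex.\<close>

lemma cutoffI:
  fixes f :: "point \<Rightarrow> real" and d :: "point \<Rightarrow> point"
  assumes G: "open G" and cf: "continuous_on UNIV f" and f1: "\<And>x. \<bar>f x\<bar> \<le> M"
    and lip: "\<And>x y. closed_segment x y \<subseteq> G \<Longrightarrow> \<bar>f x - f y\<bar> \<le> L * norm (x - y)"
    and N: "negligible N" and aff: "\<And>x. x \<in> G \<Longrightarrow> x \<notin> N \<Longrightarrow> \<exists>r>0. \<forall>y\<in>ball x r. f y = f x + d x \<bullet> (y - x)"
    and dm: "d \<in> borel_measurable (lebesgue_on G)" and dL: "\<And>x. x \<in> G \<Longrightarrow> norm (d x) \<le> L"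
  shows "cutoff G f d"
  unfolding cutoff_def
proof (intro conjI allI impI)
  show "f \<in> borel_measurable (lebesgue_on G)" by (rule measurable_continuous_lebesgue_on[OF cf])
  show "d \<in> borel_measurable (lebesgue_on G)" by (rule dm)
  show "\<exists>B. \<forall>x\<in>G. \<bar>f x\<bar> \<le> B \<and> norm (d x) \<le> B"
    using f1 dL by (intro exI[of _ "max M L"]) (auto intro: le_max_iff_disj[THEN iffD2])
  fix K assume K: "compact K" "K \<subseteq> G"
  obtain \<delta> where \<delta>: "\<delta> > 0" "\<And>x. x \<in> K \<Longrightarrow> ball x \<delta> \<subseteq> G"
    using compact_subset_open_imp_ball_epsilon_subset[OF K(1) G K(2)] by (metis UN_subset_iff)
  \<comment> \<open>A radius of at most half of \<open>\<delta>\<close> leaves the other half for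
    the increment \<open>h\<close> of a difference quotient, so both shifted points stay in a ball
    inside \<open>G\<close>.\<close>
  define \<epsilon> where "\<epsilon> n = \<delta> / 2 * (1 / real (Suc n))" for n
  have \<epsilon>: "\<epsilon> n > 0" "\<epsilon> n \<le> \<delta> / 2" for n using \<delta>(1) by (auto simp: \<epsilon>_def field_simps)
  have \<epsilon>lim: "\<epsilon> \<longlonglongrightarrow> 0" unfolding \<epsilon>_def by (rule tendsto_mult_right_zero[OF LIMSEQ_Suc[OF lim_1_over_n]])
  have "\<exists>k. \<forall>n. k n \<in> test_fun UNIV \<and> (\<forall>u. 0 \<le> k n u) \<and> (\<forall>u. k n u \<noteq> 0 \<longrightarrow> norm u < \<epsilon> n) \<and> integral\<^sup>L lebesgue (k n) = (1::real)"
    by (rule choice) (use ex_mollifier[OF \<epsilon>(1)] in blast)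
  then obtain k where k: "\<And>n. k n \<in> test_fun UNIV" "\<And>n u. 0 \<le> k n u" "\<And>n u. k n u \<noteq> 0 \<Longrightarrow> norm u < \<epsilon> n"
    "\<And>n. integral\<^sup>L lebesgue (k n) = (1::real)" by blast
  define e where "e n = conv (k n) f" for n
  have sm: "smooth (e n)" for n unfolding e_def by (rule smooth_conv[OF k(1) cf])
  have cfx: "continuous_on UNIV (\<lambda>u. f (x - u))" for x by (intro continuous_on_compose2[OF cf] continuous_intros) auto
  have mean: "\<bar>e n x - a\<bar> \<le> c" if "\<And>u. norm u < \<epsilon> n \<Longrightarrow> \<bar>f (x - u) - a\<bar> \<le> c" for n x a c
    unfolding e_def conv_commute[OF k(1) cf] by (rule mollifier_mean[OF k cfx that])
  have mean2: "\<bar>(e n y - e n x) - a\<bar> \<le> c" if "\<And>u. norm u < \<epsilon> n \<Longrightarrow> \<bar>(f (y - u) - f (x - u)) - a\<bar> \<le> c" for n x y a c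
  proof -
    have "integrable lebesgue (\<lambda>u. k n u * f (z - u))" for z
    proof -
      have "bounded (closure {x. k n x \<noteq> 0})" by (rule compact_imp_bounded[OF test_funD(2)[OF k(1)]])
      then obtain B where "closure {x. k n x \<noteq> 0} \<subseteq> cbox (-B) B" by (rule bounded_subset_cbox_symmetric)
      then have out: "k n x = 0" if "x \<notin> cbox (-B) B" for x using that notin_support[of x "k n"] by blast
      show ?thesis
        by (rule lebesgue_integral_cbox(2)[OF continuous_on_mult[OF smooth_continuous[OF test_funD(1)[OF k(1)]] cfx], of "-B" B])
          (simp add: out)
    qed
    then have "e n y - e n x = integral\<^sup>L lebesgue (\<lambda>u. k n u * (f (y - u) - f (x - u)))"
      unfolding e_def conv_commute[OF k(1) cf] by (simp add: right_diff_distrib)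
    moreover have "\<bar>integral\<^sup>L lebesgue (\<lambda>u. k n u * (f (y - u) - f (x - u))) - a\<bar> \<le> c"
      by (rule mollifier_mean[OF k continuous_on_diff[OF cfx cfx] that])
    ultimately show ?thesis by simp
  qed
  have val: "\<bar>e n x\<bar> \<le> M" for n x using mean[of n x 0 M] f1 by simp
  have quot: "((\<lambda>h. (e n (x + h *\<^sub>R axis i 1) - e n x) /\<^sub>R h) \<longlongrightarrow> pd i (e n) x) (at 0)" for n x i
    by (rule difference_quotient[OF sm])
  have L0: "0 \<le> L" if "x \<in> K" for x using dL[of x] norm_ge_zero[of "d x"] that K(2) by (meson order_trans subsetD)
  \<comment> \<open>A difference quotient of the mollified function is a mean of difference
    quotients of \<open>f\<close>, taken along segments inside \<open>G\<close>.\<close>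
  have grad: "\<bar>pd i (e n) x\<bar> \<le> L" if x: "x \<in> K" for n x i
  proof (rule tendsto_upperbound[OF tendsto_rabs[OF quot[of n x i]]])
    have "\<forall>\<^sub>F h in at 0. h \<noteq> 0 \<and> \<bar>h\<bar> < \<delta> / 2"
      unfolding eventually_at using \<delta>(1) by (intro exI[of _ "\<delta> / 2"]) auto
    then show "\<forall>\<^sub>F h in at 0. \<bar>(e n (x + h *\<^sub>R axis i 1) - e n x) /\<^sub>R h\<bar> \<le> L"
    proof eventually_elim
      case (elim h)
      have "\<bar>(e n (x + h *\<^sub>R axis i 1) - e n x) - 0\<bar> \<le> L * \<bar>h\<bar>"
      proof (rule mean2)
        fix u :: point assume u: "norm u < \<epsilon> n"
        have "norm u < \<delta> / 2" using u \<epsilon>(2)[of n] by simp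
        moreover have "norm (h *\<^sub>R axis i 1 - u) \<le> \<bar>h\<bar> + norm u" using norm_triangle_ineq4[of "h *\<^sub>R axis i 1" u] by (simp add: norm_axis_1)
        ultimately have "norm u < \<delta>" "norm (h *\<^sub>R axis i 1 - u) < \<delta>" using elim \<delta>(1) by linarith+
        moreover have "dist x (x - u) = norm u" by (simp add: dist_norm)
        moreover have "dist x (x + h *\<^sub>R axis i 1 - u) = norm (h *\<^sub>R axis i 1 - u)"
          unfolding dist_norm by (simp add: algebra_simps norm_minus_commute)
        ultimately have "x - u \<in> ball x \<delta>" "x + h *\<^sub>R axis i 1 - u \<in> ball x \<delta>" by (simp_all only: mem_ball)
        then have "closed_segment (x + h *\<^sub>R axis i 1 - u) (x - u) \<subseteq> G"
          using \<delta>(2)[OF x] closed_segment_subset[OF _ _ convex_ball] by (meson order_trans)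
        from lip[OF this] show "\<bar>(f (x + h *\<^sub>R axis i 1 - u) - f (x - u)) - 0\<bar> \<le> L * \<bar>h\<bar>" by (simp add: norm_axis_1)
      qed
      then show ?case using elim by (simp add: abs_mult divide_simps field_simps)
    qed
  qed simp
  have vlim: "(\<lambda>n. e n x) \<longlonglongrightarrow> f x" for x
  proof (rule LIMSEQ_I)
    fix c :: real assume c: "c > 0"
    have "isCont f x" using cf by (simp add: continuous_on_eq_continuous_at)
    then obtain r where r: "r > 0" "\<And>y. dist y x < r \<Longrightarrow> dist (f y) (f x) < c / 2"
      using c unfolding continuous_at_eps_delta by (metis half_gt_zero)
    obtain n0 where n0: "\<And>n. n \<ge> n0 \<Longrightarrow> \<epsilon> n < r"
      using order_tendstoD(2)[OF \<epsilon>lim r(1)] by (auto simp: eventually_sequentially)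
    have "\<bar>e n x - f x\<bar> \<le> c / 2" if "n \<ge> n0" for n
    proof (rule mean)
      fix u :: point assume "norm u < \<epsilon> n"
      then have "dist (x - u) x < r" using n0[OF that] by (simp add: dist_norm)
      from r(2)[OF this] show "\<bar>f (x - u) - f x\<bar> \<le> c / 2" by (simp add: dist_norm)
    qed
    then show "\<exists>no. \<forall>n\<ge>no. norm (e n x - f x) < c" using c by (intro exI[of _ n0]) force
  qed
  \<comment> \<open>Near a point off \<open>N\<close> the function is affine and its increments do
    not depend on the shift, so their mean is exact: the bound in \<open>mean2\<close> is 0, and the
    derivatives agree with \<open>d\<close> from some \<open>n\<close> on.\<close>
  have glim: "(\<lambda>n. pd i (e n) x) \<longlonglongrightarrow> d x $ i" if x: "x \<in> G" "x \<notin> N" for x i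
  proof -
    obtain r where r: "r > 0" "\<And>y. y \<in> ball x r \<Longrightarrow> f y = f x + d x \<bullet> (y - x)" using aff[OF x] by blast
    obtain n0 where n0: "\<And>n. n \<ge> n0 \<Longrightarrow> \<epsilon> n < r / 2"
      using order_tendstoD(2)[OF \<epsilon>lim, of "r/2"] r(1) by (auto simp: eventually_sequentially)
    have "pd i (e n) x = d x $ i" if n: "n \<ge> n0" for n
    proof (rule tendsto_unique[OF _ quot[of n x i]])
      have "\<forall>\<^sub>F h in at 0. h \<noteq> 0 \<and> \<bar>h\<bar> < r / 2"
        unfolding eventually_at using r(1) by (intro exI[of _ "r / 2"]) auto
      then have "\<forall>\<^sub>F h in at 0. d x $ i = (e n (x + h *\<^sub>R axis i 1) - e n x) /\<^sub>R h"
      proof eventually_elim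
        case (elim h)
        have "\<bar>(e n (x + h *\<^sub>R axis i 1) - e n x) - h * d x $ i\<bar> \<le> 0"
        proof (rule mean2)
          fix u :: point assume u: "norm u < \<epsilon> n"
          have ur: "norm u < r / 2" using u n0[OF n] by simp
          have "norm (h *\<^sub>R axis i 1 - u) \<le> \<bar>h\<bar> + norm u" using norm_triangle_ineq4[of "h *\<^sub>R axis i 1" u] by (simp add: norm_axis_1)
          then have "norm ((x + h *\<^sub>R axis i 1 - u) - x) < r" using elim ur by (simp add: algebra_simps)
          then have 1: "x + h *\<^sub>R axis i 1 - u \<in> ball x r" by (simp add: dist_norm norm_minus_commute)
          have 2: "x - u \<in> ball x r" using ur r(1) by (simp add: dist_norm)
          have "f (x + h *\<^sub>R axis i 1 - u) - f (x - u) = d x \<bullet> (h *\<^sub>R axis i 1)"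
            unfolding r(2)[OF 1] r(2)[OF 2] by (simp add: inner_diff_right inner_add_right)
          then show "\<bar>(f (x + h *\<^sub>R axis i 1 - u) - f (x - u)) - h * d x $ i\<bar> \<le> 0" by (simp add: inner_axis)
        qed
        then show ?case using elim by simp
      qed
      then show "((\<lambda>h. (e n (x + h *\<^sub>R axis i 1) - e n x) /\<^sub>R h) \<longlongrightarrow> d x $ i) (at 0)"
        by (rule Lim_transform_eventually[OF tendsto_const])
    qed simp
    then show ?thesis by (intro tendsto_eventually) (auto simp: eventually_sequentially)
  qed
  have "AE x in lebesgue. x \<notin> N" using N by (simp add: negligible_iff_null_sets AE_not_in)
  then have "AE x in lebesgue. x \<in> K \<longrightarrow> (\<lambda>n. e n x) \<longlonglongrightarrow> f x \<and> (\<forall>i. (\<lambda>n. pd i (e n) x) \<longlonglongrightarrow> d x $ i)"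
    by eventually_elim (use vlim glim K(2) in auto)
  then show "\<exists>e B. (\<forall>n::nat. smooth (e n)) \<and> (\<forall>n. \<forall>x\<in>K. \<bar>e n x\<bar> \<le> B \<and> (\<forall>i. \<bar>pd i (e n) x\<bar> \<le> B))
        \<and> (AE x in lebesgue. x \<in> K \<longrightarrow> (\<lambda>n. e n x) \<longlonglongrightarrow> f x \<and> (\<forall>i. (\<lambda>n. pd i (e n) x) \<longlonglongrightarrow> d x $ i))"
    using sm val grad by (intro exI[of _ e] exI[of _ "max M L"]) (auto intro: le_max_iff_disj[THEN iffD2])
qed

section \<open>Geometry of the mesh\<close>

text \<open>Combinatorial form of \<open>nbhm\<close>: the elements reached from \<open>T\<close> by
  at most \<open>k\<close> steps between touching elements. Sums over layers replace integrals over
  neighbourhoods.\<close>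

primrec layer :: "point set set \<Rightarrow> nat \<Rightarrow> point set \<Rightarrow> point set set" where
  "layer \<T> 0 T = {T}"
| "layer \<T> (Suc k) T = {K \<in> \<T>. \<exists>K'\<in>layer \<T> k T. K \<inter> K' \<noteq> {}}"

text \<open>Moving one vertex to the origin makes the others linearly independent; a linear
  extension of the shifted values exists and is represented by a vector.\<close>

lemma affine_interpolation:
  fixes C :: "'a::euclidean_space set"
  assumes "\<not> affine_dependent C"
  shows "\<exists>g c. \<forall>v\<in>C. g \<bullet> v + c = (val v :: real)"
proof (cases "C = {}")
  case False
  then obtain a where a: "a \<in> C" by blast
  then have "independent ((\<lambda>x. - a + x) ` (C - {a}))" using assms affine_dependent_iff_dependent2[of a C] by simp
  from linear_independent_extend[OF this, of "\<lambda>y. val (a + y) - val a"]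
  obtain f where f: "linear f" "\<And>y. y \<in> (\<lambda>x. - a + x) ` (C - {a}) \<Longrightarrow> f y = val (a + y) - val a" by blast
  have fv: "f (v - a) = val v - val a" if "v \<in> C" for v
    using f(2)[of "- a + v"] that linear_0[OF f(1)] by (cases "v = a") auto
  have fr: "f x = adjoint f 1 \<bullet> x" for x using adjoint_works[OF f(1), of x 1] by (simp add: inner_commute)
  have "adjoint f 1 \<bullet> v + (val a - adjoint f 1 \<bullet> a) = val v" if "v \<in> C" for v
    using fv[OF that] fr[of "v - a"] by (simp add: inner_diff_right)
  then show ?thesis by blast
qed simp

text \<open>The local estimates have the same constant and compare each point with its neighbours.
  An interval around \<open>t\<close> is split at \<open>t\<close>, and bisection patches the short
  intervals together without loss in the constant.\<close>

lemma lipschitz_on_segment: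
  fixes f :: "'a::real_normed_vector \<Rightarrow> real"
  assumes loc: "\<And>z. z \<in> closed_segment x y \<Longrightarrow> \<exists>r>0. \<forall>w\<in>closed_segment x y. dist w z < r \<longrightarrow> \<bar>f w - f z\<bar> \<le> L * dist w z"
  shows "\<bar>f x - f y\<bar> \<le> L * norm (x - y)"
proof -
  define g where "g t = x + t *\<^sub>R (y - x)" for t
  have gseg: "g t \<in> closed_segment x y" if "0 \<le> t" "t \<le> 1" for t
    using that by (auto simp: g_def closed_segment_def algebra_simps intro!: exI[of _ t])
  have dg: "dist (g s) (g t) = \<bar>s - t\<bar> * norm (y - x)" for s t
    by (simp add: g_def dist_norm flip: scaleR_diff_left)
  define P where "P s t \<longleftrightarrow> (0 \<le> s \<longrightarrow> s \<le> t \<longrightarrow> t \<le> 1 \<longrightarrow> \<bar>f (g t) - f (g s)\<bar> \<le> L * ((t - s) * norm (y - x)))" for s t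
  have "P 0 1"
    using zero_le_one
  proof (induction rule: Bolzano)
    case (trans a b c)
    then show ?case unfolding P_def by (auto simp: algebra_simps abs_if split: if_splits)
  next
    case (local t)
    obtain r where r: "r > 0" "\<And>w. w \<in> closed_segment x y \<Longrightarrow> dist w (g t) < r \<Longrightarrow> \<bar>f w - f (g t)\<bar> \<le> L * dist w (g t)"
      using loc[OF gseg[OF local]] by blast
    define d where "d = r / (norm (y - x) + 1)"
    have d: "d > 0" unfolding d_def using r(1) by (intro divide_pos_pos add_nonneg_pos) auto
    have close: "dist (g s) (g t) < r" if "\<bar>s - t\<bar> < d" for s
    proof -
      have "\<bar>s - t\<bar> * norm (y - x) \<le> \<bar>s - t\<bar> * (norm (y - x) + 1)" by (intro mult_left_mono) auto
      also have "\<dots> < d * (norm (y - x) + 1)" using that by (intro mult_strict_right_mono add_nonneg_pos) auto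
      also have "\<dots> = r" unfolding d_def using add_nonneg_pos[of "norm (y - x)" 1] by simp
      finally show ?thesis by (simp add: dg)
    qed
    show ?case
    proof (intro exI[of _ d] conjI d allI impI)
      fix a b assume ab: "a \<le> t \<and> t \<le> b \<and> b - a < d"
      show "P a b" unfolding P_def
      proof (intro impI)
        assume h: "0 \<le> a" "a \<le> b" "b \<le> 1"
        have "\<bar>f (g a) - f (g t)\<bar> \<le> L * ((t - a) * norm (y - x))"
          using r(2)[OF gseg close, of a] ab h by (simp add: dg)
        moreover have "\<bar>f (g b) - f (g t)\<bar> \<le> L * ((b - t) * norm (y - x))"
          using r(2)[OF gseg close, of b] ab h by (simp add: dg)
        moreover have "L * ((b - a) * norm (y - x)) = L * ((t - a) * norm (y - x)) + L * ((b - t) * norm (y - x))"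
          by (simp add: algebra_simps)
        ultimately show "\<bar>f (g b) - f (g a)\<bar> \<le> L * ((b - a) * norm (y - x))" by linarith
      qed
    qed
  qed
  then show ?thesis by (simp add: P_def g_def norm_minus_commute abs_minus_commute)
qed

locale mesh =
  fixes \<Omega> :: "point set" and \<sigma> \<kappa> :: real and \<T> :: "point set set"
  assumes domain: "admissible_domain \<Omega>" and mesh: "tet_mesh \<Omega> \<sigma> \<kappa> \<T>" and \<sigma>: "0 < \<sigma>" and \<kappa>: "0 < \<kappa>"
begin

abbreviation H :: real where "H \<equiv> mesh_size \<T>"

lemma open_\<Omega>: "open \<Omega>" and \<Omega>_nonempty: "\<Omega> \<noteq> {}" using domain by (auto simp: admissible_domain_def)

lemma \<Omega>_sets: "\<Omega> \<in> sets lebesgue" by (rule open_sets_lebesgue[OF open_\<Omega>])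

lemma finite_mesh: "finite \<T>" and mesh_simplex: "T \<in> \<T> \<Longrightarrow> 3 simplex T" and mesh_union: "\<Union>\<T> = closure \<Omega>"
  and mesh_face: "T \<in> \<T> \<Longrightarrow> T' \<in> \<T> \<Longrightarrow> (T \<inter> T') face_of T"
  using mesh by (auto simp: tet_mesh_def triangulation_def)

lemma element_compact: "T \<in> \<T> \<Longrightarrow> compact T" by (rule compact_simplex[OF mesh_simplex])
lemma element_closed: "T \<in> \<T> \<Longrightarrow> closed T" by (rule closed_simplex[OF mesh_simplex])
lemma element_convex: "T \<in> \<T> \<Longrightarrow> convex T" by (rule convex_simplex[OF mesh_simplex])
lemma element_bounded: "T \<in> \<T> \<Longrightarrow> bounded T" by (rule compact_imp_bounded[OF element_compact])

lemma element_interior: 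
  assumes T: "T \<in> \<T>" shows "interior T \<noteq> {}"
proof -
  obtain C where C: "\<not> affine_dependent C" "int (card C) = 3 + 1" "T = convex hull C"
    using mesh_simplex[OF T] by (auto simp: simplex_def)
  then have "card C = Suc (DIM(point))" by simp
  from interior_convex_hull_eq_empty[OF this] C show ?thesis by simp
qed

lemma element_nonempty: "T \<in> \<T> \<Longrightarrow> T \<noteq> {}" using element_interior interior_subset by blast

lemma mesh_nonempty: "\<T> \<noteq> {}" using mesh_union \<Omega>_nonempty closure_subset[of \<Omega>] by auto

lemma diameter_le_H: "T \<in> \<T> \<Longrightarrow> diameter T \<le> H"
  unfolding mesh_size_def using finite_mesh by (intro Max_ge) auto

lemma H_pos: "0 < H"
proof -
  obtain T where T: "T \<in> \<T>" using mesh_nonempty by blast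
  obtain x where x: "x \<in> interior T" using element_interior[OF T] by blast
  then obtain r where r: "r > 0" "cball x r \<subseteq> T" by (auto simp: mem_interior_cball)
  let ?y = "x + r *\<^sub>R axis 1 1"
  have "?y \<in> cball x r" "x \<in> cball x r" using r(1) by (auto simp: dist_norm norm_axis_1)
  then have "dist x ?y \<le> diameter T" using r(2) by (intro diameter_bounded_bound[OF element_bounded[OF T]]) auto
  moreover have "dist x ?y = r" using r(1) by (simp add: dist_norm norm_axis_1)
  ultimately show ?thesis using r(1) diameter_le_H[OF T] by linarith
qed

text \<open>Uniform radius of inscribed balls: shape regularity gives
  \<open>diameter T / \<sigma>\<close>, and quasi-uniformity gives
  \<open>diameter T \<ge> H / \<kappa>\<close>.\<close>

definition \<rho> :: real where "\<rho> = H / (\<kappa> * \<sigma>)"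

lemma \<rho>_pos: "\<rho> > 0" using H_pos \<sigma> \<kappa> by (simp add: \<rho>_def)

lemma element_ball: 
  assumes "T \<in> \<T>" shows "\<exists>x. cball x \<rho> \<subseteq> T"
proof -
  obtain x where "cball x (diameter T / \<sigma>) \<subseteq> T" using mesh assms by (auto simp: tet_mesh_def)
  moreover have "H \<le> \<kappa> * diameter T" using mesh assms by (auto simp: tet_mesh_def)
  then have "\<rho> \<le> diameter T / \<sigma>" using \<sigma> \<kappa> by (simp add: \<rho>_def field_simps)
  ultimately show ?thesis by (meson order_trans subset_cball)
qed

text \<open>The intersection is a face of both tetrahedra. Were it all of \<open>T\<close>, then
  \<open>T\<close> would be a proper face of \<open>T'\<close>, against equal dimensions; and a
  proper face misses the interior.\<close>

lemma interior_disjoint: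
  assumes "T \<in> \<T>" "T' \<in> \<T>" "T \<noteq> T'" shows "interior T \<inter> T' = {}"
proof -
  have "T \<inter> T' \<noteq> T"
  proof
    assume eq: "T \<inter> T' = T"
    then have "T face_of T'" using mesh_face[OF assms(2,1)] by (simp add: Int_commute)
    then have "aff_dim T < aff_dim T'" using face_of_aff_dim_lt[OF element_convex[OF assms(2)]] assms(3) by blast
    then show False using aff_dim_simplex[OF mesh_simplex[OF assms(1)]] aff_dim_simplex[OF mesh_simplex[OF assms(2)]] by simp
  qed
  from face_of_disjoint_interior[OF mesh_face[OF assms(1,2)] this] interior_subset[of T] show ?thesis by blast
qed

text \<open>A null set off which every point lies in at most one element, so that indicators of
  elements add up there.\<close>

definition skeleton :: "point set" where "skeleton = (\<Union>T\<in>\<T>. frontier T)"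

lemma negligible_skeleton: "negligible skeleton"
  unfolding skeleton_def using finite_mesh element_convex negligible_convex_frontier by auto

lemma notin_skeleton:
  assumes "x \<in> T" "T \<in> \<T>" "x \<notin> skeleton" shows "x \<in> interior T"
  using assms closure_subset by (auto simp: skeleton_def frontier_def)

lemma unique_element: 
  assumes "x \<notin> skeleton" "x \<in> T" "x \<in> T'" "T \<in> \<T>" "T' \<in> \<T>" shows "T = T'"
  using interior_disjoint[OF assms(4,5)] notin_skeleton[OF assms(2,4,1)] assms(3) by blast

lemma subset_Union_elements:
  assumes "\<A> \<subseteq> \<T>" "K \<in> \<T>" "K \<subseteq> \<Union>\<A>" shows "K \<in> \<A>"
proof (rule ccontr)
  assume "K \<notin> \<A>"
  then have "interior K \<inter> \<Union>\<A> = {}" using interior_disjoint[OF assms(2)] assms(1) by blast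
  then show False using element_interior[OF assms(2)] interior_subset[of K] assms(3) by blast
qed

lemma closure_interior_Union:
  assumes "\<A> \<subseteq> \<T>" shows "closure (interior (\<Union>\<A>)) = \<Union>\<A>"
proof
  have fin: "finite \<A>" using assms finite_mesh finite_subset by blast
  have "closed (\<Union>\<A>)" using assms fin element_closed by (intro closed_Union) auto
  then show "closure (interior (\<Union>\<A>)) \<subseteq> \<Union>\<A>" by (simp add: closure_minimal interior_subset)
  show "\<Union>\<A> \<subseteq> closure (interior (\<Union>\<A>))"
  proof
    fix x assume "x \<in> \<Union>\<A>"
    then obtain K where K: "K \<in> \<A>" "x \<in> K" by blast
    have KT: "K \<in> \<T>" using K assms by blast
    have "x \<in> closure (interior K)"
      using convex_closure_interior[OF element_convex[OF KT] element_interior[OF KT]] K(2) closure_subset[of K] by auto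
    moreover have "interior K \<subseteq> interior (\<Union>\<A>)" using K(1) by (intro interior_mono) auto
    ultimately show "x \<in> closure (interior (\<Union>\<A>))" using closure_mono by blast
  qed
qed

section \<open>Layers of elements and their cardinality\<close>

lemma layer_subset: "T \<in> \<T> \<Longrightarrow> layer \<T> k T \<subseteq> \<T>" by (cases k) auto

lemma layer_finite: "T \<in> \<T> \<Longrightarrow> finite (layer \<T> k T)" using layer_subset finite_mesh finite_subset by blast

text \<open>The operator \<open>nbh\<close> sees only the closure of its argument, so the interior
  taken in one step is invisible to the next. For \<open>k = 0\<close> the neighbourhood is the
  closed element itself.\<close>

lemma closure_nbhm: 
  assumes T: "T \<in> \<T>" shows "closure (nbhm \<T> k T) = \<Union>(layer \<T> k T)"
proof (induction k)
  case 0
  then show ?case using element_closed[OF T] by (simp add: nbhm_def)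
next
  case (Suc k)
  have "nbhm \<T> (Suc k) T = interior (\<Union>{K \<in> \<T>. K \<inter> \<Union>(layer \<T> k T) \<noteq> {}})"
    using Suc.IH by (simp add: nbhm_def nbh_def)
  also have "{K \<in> \<T>. K \<inter> \<Union>(layer \<T> k T) \<noteq> {}} = layer \<T> (Suc k) T" by auto
  finally have eq: "nbhm \<T> (Suc k) T = interior (\<Union>(layer \<T> (Suc k) T))" .
  show ?case unfolding eq by (rule closure_interior_Union[OF layer_subset[OF T]])
qed

lemma nbhm_Suc:
  assumes T: "T \<in> \<T>" shows "nbhm \<T> (Suc k) T = interior (\<Union>(layer \<T> (Suc k) T))"
proof -
  have "nbhm \<T> (Suc k) T = interior (\<Union>{K \<in> \<T>. K \<inter> \<Union>(layer \<T> k T) \<noteq> {}})"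
    using closure_nbhm[OF T] by (simp add: nbhm_def nbh_def)
  also have "{K \<in> \<T>. K \<inter> \<Union>(layer \<T> k T) \<noteq> {}} = layer \<T> (Suc k) T" by auto
  finally show ?thesis .
qed

lemma nbhm_layer:
  assumes T: "T \<in> \<T>" "m \<ge> 1" shows "nbhm \<T> m T = interior (\<Union>(layer \<T> m T))"
  using nbhm_Suc[OF T(1), of "m - 1"] T(2) by simp

lemma nbhm_subset_layer: "T \<in> \<T> \<Longrightarrow> nbhm \<T> k T \<subseteq> \<Union>(layer \<T> k T)"
  using closure_nbhm closure_subset by blast

lemma submesh_nbhm:
  assumes T: "T \<in> \<T>" shows "submesh \<T> (nbhm \<T> m T) = layer \<T> m T"
  unfolding submesh_def closure_nbhm[OF T]
  using subset_Union_elements[OF layer_subset[OF T]] layer_subset[OF T] by blast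

text \<open>The estimates of a local operator are stated with neighbourhoods in its submesh;
  enlarging them to neighbourhoods in the full mesh makes local and global operators alike.\<close>

lemma nbhm_submesh_subset:
  assumes "\<A> \<subseteq> \<T>" shows "nbhm \<A> k K \<subseteq> nbhm \<T> k K"
proof (induction k)
  case (Suc k)
  have "nbh \<A> (nbhm \<A> k K) \<subseteq> nbh \<T> (nbhm \<T> k K)"
    unfolding nbh_def using closure_mono[OF Suc.IH] assms by (intro interior_mono Union_mono) blast
  then show ?case by (simp add: nbhm_def)
qed (simp add: nbhm_def)

lemma layer_mono_Suc: "T \<in> \<T> \<Longrightarrow> layer \<T> k T \<subseteq> layer \<T> (Suc k) T"
  using layer_subset[of T k] element_nonempty by (auto intro!: bexI)

lemma layer_mono: "T \<in> \<T> \<Longrightarrow> j \<le> k \<Longrightarrow> layer \<T> j T \<subseteq> layer \<T> k T"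
  by (rule lift_Suc_mono_le[of "\<lambda>k. layer \<T> k T"]) (auto simp only: layer_mono_Suc)

lemma layer_self: "T \<in> \<T> \<Longrightarrow> T \<in> layer \<T> k T" using layer_mono[of T 0 k] by simp

lemma layer_trans: "K \<in> layer \<T> j T \<Longrightarrow> K' \<in> layer \<T> k K \<Longrightarrow> K' \<in> layer \<T> (j + k) T"
  by (induction k arbitrary: K') auto

lemma layer_sym: "T \<in> \<T> \<Longrightarrow> K \<in> layer \<T> k T \<Longrightarrow> T \<in> layer \<T> k K"
proof (induction k arbitrary: K)
  case (Suc k)
  then obtain K' where K': "K' \<in> layer \<T> k T" "K \<inter> K' \<noteq> {}" "K \<in> \<T>" by auto
  then have "T \<in> layer \<T> k K'" using Suc by blast
  moreover have "K' \<in> layer \<T> 1 K" using K' layer_subset[OF Suc.prems(1)] by auto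
  ultimately show ?case using layer_trans[of K' 1 K T k] by simp
qed simp

lemma layer_dist:
  assumes T: "T \<in> \<T>" and x: "x \<in> T" 
  shows "K \<in> layer \<T> k T \<Longrightarrow> y \<in> K \<Longrightarrow> dist x y \<le> (real k + 1) * H"
proof (induction k arbitrary: K y)
  case 0
  then show ?case using diameter_bounded_bound[OF element_bounded[OF T] x, of y] diameter_le_H[OF T] by simp
next
  case (Suc k)
  then obtain K' z where K': "K' \<in> layer \<T> k T" "z \<in> K" "z \<in> K'" "K \<in> \<T>" by auto
  have "dist x z \<le> (real k + 1) * H" by (rule Suc.IH[OF K'(1,3)])
  moreover have "dist z y \<le> H"
    using diameter_bounded_bound[OF element_bounded[OF K'(4)] K'(2) Suc.prems(2)] diameter_le_H[OF K'(4)] by simp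
  ultimately show ?case using dist_triangle[of x y z] by (simp add: algebra_simps)
qed

text \<open>Volume comparison: the inscribed balls of radius \<open>\<rho>\<close> are disjoint and
  lie in a ball of radius \<open>(k + 1) H\<close>. The ratio of the volumes does not depend on
  \<open>H\<close>.\<close>

lemma card_layer:
  assumes T: "T \<in> \<T>" shows "real (card (layer \<T> k T)) \<le> (\<kappa> * \<sigma>) ^ 3 * (real k + 1) ^ 3"
proof -
  obtain x where x: "x \<in> T" using element_nonempty[OF T] by blast
  obtain c where c: "\<And>K. K \<in> \<T> \<Longrightarrow> cball (c K) \<rho> \<subseteq> K" using element_ball by metis
  define V where "V = unit_ball_vol (DIM(point))"
  have V: "V > 0" unfolding V_def by simp
  have sub: "K \<in> layer \<T> k T \<Longrightarrow> K \<in> \<T>" for K using layer_subset[OF T] by blast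
  have dis: "ball (c K) \<rho> \<inter> ball (c K') \<rho> = {}" if "K \<in> layer \<T> k T" "K' \<in> layer \<T> k T" "K \<noteq> K'" for K K'
  proof -
    have "ball (c K) \<rho> \<subseteq> interior K" using c[OF sub[OF that(1)]] ball_subset_cball by (intro interior_maximal) (blast, simp)
    moreover have "ball (c K') \<rho> \<subseteq> K'" using c[OF sub[OF that(2)]] ball_subset_cball by blast
    ultimately show ?thesis using interior_disjoint[OF sub[OF that(1)] sub[OF that(2)] that(3)] by blast
  qed
  have "measure lebesgue (\<Union>((\<lambda>K. ball (c K) \<rho>) ` layer \<T> k T)) = (\<Sum>K\<in>layer \<T> k T. measure lebesgue (ball (c K) \<rho>))"
    by (rule measure_negligible_finite_Union_image[OF layer_finite[OF T]]) (auto simp: pairwise_def dis)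
  also have "\<dots> = real (card (layer \<T> k T)) * (V * \<rho> ^ 3)"
    using \<rho>_pos by (simp add: content_ball V_def)
  finally have eq: "real (card (layer \<T> k T)) * (V * \<rho> ^ 3) = measure lebesgue (\<Union>((\<lambda>K. ball (c K) \<rho>) ` layer \<T> k T))" by simp
  have "(\<Union>((\<lambda>K. ball (c K) \<rho>) ` layer \<T> k T)) \<subseteq> cball x ((real k + 1) * H)"
  proof clarify
    fix y K assume K: "K \<in> layer \<T> k T" and y: "y \<in> ball (c K) \<rho>"
    then have "y \<in> K" using c[OF sub[OF K]] ball_subset_cball by blast
    from layer_dist[OF T x K this] show "y \<in> cball x ((real k + 1) * H)" by simp
  qed
  then have "measure lebesgue (\<Union>((\<lambda>K. ball (c K) \<rho>) ` layer \<T> k T)) \<le> measure lebesgue (cball x ((real k + 1) * H))"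
    by (intro measure_mono_fmeasurable) (auto intro!: sets.finite_UN layer_finite[OF T])
  also have "\<dots> = V * ((real k + 1) * H) ^ 3"
    using H_pos by (simp add: content_cball_conv_ball content_ball V_def)
  finally have "real (card (layer \<T> k T)) * (V * \<rho> ^ 3) \<le> V * ((real k + 1) * H) ^ 3" unfolding eq .
  then have "real (card (layer \<T> k T)) * \<rho> ^ 3 \<le> ((real k + 1) * H) ^ 3" using V by (simp add: mult.left_commute)
  moreover have "((real k + 1) * H) ^ 3 = ((\<kappa> * \<sigma>) ^ 3 * (real k + 1) ^ 3) * \<rho> ^ 3"
    using \<sigma> \<kappa> by (simp add: \<rho>_def power_mult_distrib power_divide)
  ultimately show ?thesis using \<rho>_pos by (simp add: mult_le_cancel_right)
qed

text \<open>Continuous piecewise affine function with vertex values \<open>p\<close> on the elements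
  of \<open>\<A>\<close> and \<open>1 - p\<close> at all other vertices. The choice of
  \<open>p\<close> decides whether the cutoff is 1 inside or outside; the transition takes place in
  the elements that touch \<open>\<A>\<close> without belonging to it.\<close>

lemma mesh_cutoff:
  assumes A: "\<A> \<subseteq> \<T>" and p: "p \<in> {0, 1::real}"
  shows "\<exists>\<eta> d. cutoff \<Omega> \<eta> d \<and> (\<forall>x\<in>\<Omega>. \<bar>\<eta> x\<bar> \<le> 1 \<and> norm (d x) \<le> \<kappa> * \<sigma> / H)
    \<and> (\<forall>K\<in>\<A>. \<forall>x\<in>K. \<eta> x = p \<and> d x = 0) \<and> (\<forall>K\<in>\<T>. K \<inter> \<Union>\<A> = {} \<longrightarrow> (\<forall>x\<in>K. \<eta> x = 1 - p \<and> d x = 0))"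
proof -
  define val where "val v = (if v \<in> \<Union>\<A> then p else 1 - p)" for v
  have val01: "0 \<le> val v" "val v \<le> 1" for v using p by (auto simp: val_def)
  have "\<forall>K\<in>\<T>. \<exists>C. \<not> affine_dependent C \<and> K = convex hull C"
    using mesh_simplex by (auto simp: simplex_def)
  then obtain C where C: "\<And>K. K \<in> \<T> \<Longrightarrow> \<not> affine_dependent (C K)" "\<And>K. K \<in> \<T> \<Longrightarrow> K = convex hull (C K)" by metis
  have "\<forall>K\<in>\<T>. \<exists>g c. \<forall>v\<in>C K. g \<bullet> v + c = val v" using affine_interpolation[OF C(1)] by blast
  then obtain g where "\<forall>K\<in>\<T>. \<exists>c. \<forall>v\<in>C K. g K \<bullet> v + c = val v" using bchoice[of \<T> "\<lambda>K g. \<exists>c. \<forall>v\<in>C K. g \<bullet> v + c = val v"] by blast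
  then obtain c where "\<forall>K\<in>\<T>. \<forall>v\<in>C K. g K \<bullet> v + c K = val v" using bchoice[of \<T> "\<lambda>K c. \<forall>v\<in>C K. g K \<bullet> v + c = val v"] by blast
  then have gc: "\<And>K v. K \<in> \<T> \<Longrightarrow> v \<in> C K \<Longrightarrow> g K \<bullet> v + c K = val v" by blast
  define a where "a K x = g K \<bullet> x + c K" for K x
  have aff_conv: "convex {x. a K x \<in> S}" if "convex S" for K S
  proof -
    have "a K (u *\<^sub>R x + v *\<^sub>R y) = u *\<^sub>R a K x + v *\<^sub>R a K y" if "u + v = 1" for u v x y
    proof -
      have "c K = u * c K + v * c K" using that by (metis distrib_right mult_1)
      then show ?thesis by (simp add: a_def inner_add_right distrib_left)
    qed
    then show ?thesis using that unfolding convex_def by simp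
  qed
  have CK: "v \<in> K" if "K \<in> \<T>" "v \<in> C K" for K v using C(2)[OF that(1)] that(2) hull_inc by metis
  have hullK: "a K x \<in> S" if "K \<in> \<T>" "x \<in> K" "convex S" "\<And>v. v \<in> C K \<Longrightarrow> val v \<in> S" for K x S
  proof -
    have "convex hull (C K) \<subseteq> {x. a K x \<in> S}"
      by (rule hull_minimal) (use that gc[OF that(1)] aff_conv[OF that(3)] in \<open>auto simp: a_def\<close>)
    then show ?thesis using C(2)[OF that(1)] that(2) by blast
  qed
  have a01: "0 \<le> a K x" "a K x \<le> 1" if "K \<in> \<T>" "x \<in> K" for K x
    using hullK[OF that convex_closed_interval[of 0 1]]  hullK[OF that, of "{0..1}"] val01 by auto
  have aA: "a K x = p" if "K \<in> \<A>" "x \<in> K" for K x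
  proof -
    have KT: "K \<in> \<T>" using that A by blast
    have "val v = p" if "v \<in> C K" for v using CK[OF KT that] \<open>K \<in> \<A>\<close> by (auto simp: val_def)
    then show ?thesis using hullK[OF KT that(2), of "{p}"] by auto
  qed
  have aB: "a K x = 1 - p" if "K \<in> \<T>" "K \<inter> \<Union>\<A> = {}" "x \<in> K" for K x
  proof -
    have "val v = 1 - p" if "v \<in> C K" for v using CK[OF \<open>K \<in> \<T>\<close> that] \<open>K \<inter> \<Union>\<A> = {}\<close> by (auto simp: val_def)
    then show ?thesis using hullK[OF that(1,3), of "{1 - p}"] by auto
  qed
  \<comment> \<open>A common face is the hull of vertices of either simplex; as extreme points of
    the face these vertex sets coincide, so both affine functions interpolate the same data on
    it.\<close>
  have compat: "a K x = a K' x" if K: "K \<in> \<T>" "x \<in> K" and K': "K' \<in> \<T>" "x \<in> K'" for K K' x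
  proof -
    have fin: "finite (C K)" if "K \<in> \<T>" for K using aff_independent_finite[OF C(1)[OF that]] .
    have f1: "(K \<inter> K') face_of (convex hull (C K))" using mesh_face[OF K(1) K'(1)] C(2)[OF K(1)] by simp
    have f2: "(K \<inter> K') face_of (convex hull (C K'))" using mesh_face[OF K'(1) K(1)] C(2)[OF K'(1)] by (simp add: Int_commute)
    obtain E where E: "E \<subseteq> C K" "K \<inter> K' = convex hull E"
      using face_of_convex_hull_subset[OF finite_imp_compact[OF fin[OF K(1)]] f1] by blast
    obtain E' where E': "E' \<subseteq> C K'" "K \<inter> K' = convex hull E'"
      using face_of_convex_hull_subset[OF finite_imp_compact[OF fin[OF K'(1)]] f2] by blast
    have iE: "\<not> affine_dependent E" "\<not> affine_dependent E'"
      using affine_independent_subset[OF C(1)[OF K(1)] E(1)] affine_independent_subset[OF C(1)[OF K'(1)] E'(1)] by auto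
    have "E = E'"
      using extreme_point_of_convex_hull_affine_independent[OF iE(1)] extreme_point_of_convex_hull_affine_independent[OF iE(2)] E(2) E'(2)
      by auto
    have "convex hull E \<subseteq> {x. a K x - a K' x = 0}"
    proof (rule hull_minimal)
      show "E \<subseteq> {x. a K x - a K' x = 0}"
        using gc[OF K(1)] gc[OF K'(1)] E(1) E'(1) \<open>E = E'\<close> by (auto simp: a_def subset_iff)
      have "{x. a K x - a K' x = 0} = {x. (g K - g K') \<bullet> x = c K' - c K}"
        by (auto simp: a_def inner_diff_left algebra_simps)
      then show "convex {x. a K x - a K' x = 0}" by (simp add: convex_hyperplane)
    qed
    then show ?thesis using E(2) K K' by auto
  qed
  \<comment> \<open>Inside an element the function moves within the unit interval; a step of length
    \<open>\<rho>\<close> from the centre of the inscribed ball along \<open>g K\<close> shows that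
    the slope is at most \<open>1/\<rho>\<close>.\<close>
  have slope: "norm (g K) \<le> \<kappa> * \<sigma> / H" if K: "K \<in> \<T>" for K
  proof (cases "g K = 0")
    case True
    then show ?thesis using H_pos \<sigma> \<kappa> by simp
  next
    case False
    obtain x where x: "cball x \<rho> \<subseteq> K" using element_ball[OF K] by blast
    define e where "e = (\<rho> / norm (g K)) *\<^sub>R g K"
    have "norm e = \<rho>" using False \<rho>_pos by (simp add: e_def)
    then have "x + e \<in> K" "x \<in> K" using x \<rho>_pos by (auto simp: subset_iff dist_norm)
    then have "a K (x + e) - a K x \<le> 1" using a01[OF K] by (smt (verit))
    moreover have "a K (x + e) - a K x = \<rho> * norm (g K)"
      using False by (simp add: a_def e_def inner_add_right dot_square_norm power2_eq_square)
    ultimately have "norm (g K) \<le> 1 / \<rho>" using \<rho>_pos by (simp add: field_simps)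
    then show ?thesis by (simp add: \<rho>_def)
  qed
  define L where "L = \<kappa> * \<sigma> / H"
  have L: "L \<ge> 0" using H_pos \<sigma> \<kappa> by (simp add: L_def)
  define f0 where "f0 x = a (SOME K. K \<in> \<T> \<and> x \<in> K) x" for x
  have f0: "f0 x = a K x" if "K \<in> \<T>" "x \<in> K" for K x
  proof -
    have "(SOME K. K \<in> \<T> \<and> x \<in> K) \<in> \<T> \<and> x \<in> (SOME K. K \<in> \<T> \<and> x \<in> K)" by (rule someI[of _ K]) (use that in blast)
    then show ?thesis unfolding f0_def using compat[OF _ _ that] by blast
  qed
  have adiff: "\<bar>a K y - a K x\<bar> \<le> L * dist y x" if "K \<in> \<T>" for K x y
  proof -
    have "a K y - a K x = g K \<bullet> (y - x)" by (simp add: a_def inner_diff_right)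
    also have "\<bar>\<dots>\<bar> \<le> norm (g K) * norm (y - x)" by (rule Cauchy_Schwarz_ineq2)
    also have "\<dots> \<le> L * norm (y - x)" using slope[OF that] by (intro mult_right_mono) (auto simp: L_def)
    finally show ?thesis by (simp add: dist_norm)
  qed
  \<comment> \<open>Close to \<open>x\<close> only elements containing \<open>x\<close> occur, and
    on each of them the function is affine with slope at most \<open>L\<close>.\<close>
  have local: "\<exists>r>0. \<forall>y\<in>\<Union>\<T>. dist y x < r \<longrightarrow> \<bar>f0 y - f0 x\<bar> \<le> L * dist y x" if x: "x \<in> \<Union>\<T>" for x
  proof -
    let ?F = "\<Union>{K \<in> \<T>. x \<notin> K}"
    have "closed ?F" using finite_mesh element_closed by (intro closed_Union) auto
    then have "open (- ?F)" "x \<in> - ?F" by auto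
    then obtain r where r: "r > 0" "ball x r \<subseteq> - ?F" using open_contains_ball by blast
    have "\<bar>f0 y - f0 x\<bar> \<le> L * dist y x" if y: "y \<in> \<Union>\<T>" "dist y x < r" for y
    proof -
      obtain K where K: "K \<in> \<T>" "y \<in> K" using y(1) by blast
      have "y \<in> ball x r" using y(2) by (simp add: dist_commute)
      then have "x \<in> K" using r(2) K by blast
      then show ?thesis using f0[OF K] f0[OF K(1)] adiff[OF K(1)] by simp
    qed
    then show ?thesis using r(1) by blast
  qed
  have cont: "continuous_on (\<Union>\<T>) f0"
    unfolding continuous_on_iff
  proof (intro ballI allI impI)
    fix x and e :: real assume x: "x \<in> \<Union>\<T>" and e: "e > 0"
    obtain r where r: "r > 0" "\<And>y. y \<in> \<Union>\<T> \<Longrightarrow> dist y x < r \<Longrightarrow> \<bar>f0 y - f0 x\<bar> \<le> L * dist y x" using local[OF x] by blast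
    define q where "q = min r (e / (L + 1))"
    have q: "q > 0" "q \<le> r" "q \<le> e / (L + 1)" unfolding q_def using r(1) e L by (auto intro!: divide_pos_pos)
    show "\<exists>q>0. \<forall>y\<in>\<Union>\<T>. dist y x < q \<longrightarrow> dist (f0 y) (f0 x) < e"
    proof (intro exI[of _ q] conjI ballI impI q(1))
      fix y assume y: "y \<in> \<Union>\<T>" "dist y x < q"
      have "\<bar>f0 y - f0 x\<bar> \<le> L * dist y x" using r(2)[OF y(1)] y(2) q(2) by simp
      also have "\<dots> \<le> L * q" using y(2) L by (intro mult_left_mono) auto
      also have "\<dots> < (L + 1) * q" using q(1) by (intro mult_strict_right_mono) auto
      also have "\<dots> \<le> e" using q(3) L by (simp add: field_simps)
      finally show "dist (f0 y) (f0 x) < e" by (simp add: dist_norm)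
    qed
  qed
  have clo: "closed (\<Union>\<T>)" by (simp add: mesh_union)
  have b0: "norm (f0 x) \<le> 1" if x: "x \<in> \<Union>\<T>" for x
  proof -
    obtain K where K: "K \<in> \<T>" "x \<in> K" using x by blast
    show ?thesis using f0[OF K] a01[OF K] by simp
  qed
  \<comment> \<open>Mollification integrates over all of space, so the function is extended
    continuously beyond the closure of the domain with the same bound.\<close>
  have "closedin (top_of_set UNIV) (\<Union>\<T>)" using clo by simp
  from Tietze[OF cont this zero_le_one b0]
  obtain f where f: "continuous_on UNIV f" "\<And>x. x \<in> \<Union>\<T> \<Longrightarrow> f x = f0 x" "\<And>x. norm (f x) \<le> 1" by auto
  have \<Omega>T: "\<Omega> \<subseteq> \<Union>\<T>" using mesh_union closure_subset by blast
  have fK: "f x = a K x" if "K \<in> \<T>" "x \<in> K" for K x using f(2)[of x] f0[OF that] that by auto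
  \<comment> \<open>Set to zero on the skeleton. Then \<open>d\<close> vanishes at every point of a
    closed element with constant values, its boundary included.\<close>
  define d where "d x = (\<Sum>K\<in>\<T>. indicator (interior K) x *\<^sub>R g K)" for x :: point
  have dK: "d x = g K" if "K \<in> \<T>" "x \<in> interior K" for K x
  proof -
    have "indicator (interior K') x *\<^sub>R g K' = (if K' = K then g K else 0)" if "K' \<in> \<T>" for K'
      using interior_disjoint[OF that \<open>K \<in> \<T>\<close>] \<open>x \<in> interior K\<close> interior_subset[of K] by (auto simp: indicator_def)
    then show ?thesis unfolding d_def using finite_mesh that(1) by (simp add: sum.delta cong: sum.cong)
  qed
  have gzero: "g K = 0" if K: "K \<in> \<T>" and const: "\<And>x. x \<in> K \<Longrightarrow> a K x = t" for K t
  proof (rule ccontr)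
    assume g0: "g K \<noteq> 0"
    obtain x where x: "x \<in> interior K" using element_interior[OF K] by blast
    then obtain r where r: "r > 0" "cball x r \<subseteq> K" by (auto simp: mem_interior_cball)
    define e where "e = (r / norm (g K)) *\<^sub>R g K"
    have "norm e = r" using g0 r(1) by (simp add: e_def)
    then have "x + e \<in> K" "x \<in> K" using r by (auto simp: subset_iff dist_norm)
    then have "a K (x + e) - a K x = 0" using const by simp
    moreover have "a K (x + e) - a K x = r * norm (g K)"
      using g0 by (simp add: a_def e_def inner_add_right dot_square_norm power2_eq_square)
    ultimately show False using g0 r(1) by simp
  qed
  have dzero: "d x = 0" if "K \<in> \<T>" "x \<in> K" "g K = 0" for K x
  proof -
    have "indicator (interior K') x *\<^sub>R g K' = 0" if "K' \<in> \<T>" for K'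
      using interior_disjoint[OF that \<open>K \<in> \<T>\<close>] \<open>x \<in> K\<close> \<open>g K = 0\<close> by (cases "K' = K") (auto simp: indicator_def)
    then show ?thesis unfolding d_def by (intro sum.neutral ballI)
  qed
  have d_le: "norm (d x) \<le> L" for x
  proof (cases "\<exists>K\<in>\<T>. x \<in> interior K")
    case True
    then show ?thesis using dK slope by (auto simp: L_def)
  next
    case False
    then have "d x = 0" by (simp add: d_def)
    then show ?thesis using L by simp
  qed
  have "cutoff \<Omega> f d"
  proof (rule cutoffI[OF open_\<Omega> f(1), where M=1 and L=L and N=skeleton])
    show "\<bar>f x\<bar> \<le> 1" for x using f(3)[of x] by simp
    show "\<bar>f x - f y\<bar> \<le> L * norm (x - y)" if "closed_segment x y \<subseteq> \<Omega>" for x y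
    proof (rule lipschitz_on_segment)
      fix z assume z: "z \<in> closed_segment x y"
      have zT: "closed_segment x y \<subseteq> \<Union>\<T>" using that \<Omega>T by (rule subset_trans)
      obtain r where r: "r > 0" "\<forall>y\<in>\<Union>\<T>. dist y z < r \<longrightarrow> \<bar>f0 y - f0 z\<bar> \<le> L * dist y z" using local[of z] z zT by blast
      then have "\<forall>w\<in>closed_segment x y. dist w z < r \<longrightarrow> \<bar>f w - f z\<bar> \<le> L * dist w z"
        using f(2) z zT by (metis subsetD)
      with r(1) show "\<exists>r>0. \<forall>w\<in>closed_segment x y. dist w z < r \<longrightarrow> \<bar>f w - f z\<bar> \<le> L * dist w z" by blast
    qed
    show "negligible skeleton" by (rule negligible_skeleton)
    show "\<exists>r>0. \<forall>y\<in>ball x r. f y = f x + d x \<bullet> (y - x)" if x: "x \<in> \<Omega>" "x \<notin> skeleton" for x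
    proof -
      obtain K where K: "K \<in> \<T>" "x \<in> K" using x(1) \<Omega>T by blast
      have i: "x \<in> interior K" by (rule notin_skeleton[OF K(2,1) x(2)])
      then obtain r where r: "r > 0" "ball x r \<subseteq> K" by (auto simp: mem_interior)
      have "f y = f x + d x \<bullet> (y - x)" if "y \<in> ball x r" for y
        using fK[OF K] fK[OF K(1), of y] r(2) that dK[OF K(1) i] by (auto simp: a_def inner_diff_right)
      then show ?thesis using r(1) by blast
    qed
    show "d \<in> borel_measurable (lebesgue_on \<Omega>)"
      unfolding d_def[abs_def] by (intro measurable_restrict_space1 borel_measurable_sum borel_measurable_scaleR borel_measurable_indicator borel_measurable_const) (simp add: borel_open)
    show "norm (d x) \<le> L" for x by (rule d_le)
  qed
  moreover have "f x = p \<and> d x = 0" if "K \<in> \<A>" "x \<in> K" for K x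
    using fK[of K x] aA[OF that] A that dzero[of K x, OF _ _ gzero[OF _ aA]] by auto
  moreover have "f x = 1 - p \<and> d x = 0" if "K \<in> \<T>" "K \<inter> \<Union>\<A> = {}" "x \<in> K" for K x
    using fK[OF that(1,3)] aB[OF that] dzero[OF that(1,3) gzero[OF that(1) aB[OF that(1,2)]]] by simp
  ultimately show ?thesis using f(3) d_le by (intro exI[of _ f] exI[of _ d]) (auto simp: L_def)
qed

end

section \<open>Coefficients\<close>

text \<open>A real matrix acts separately on real and imaginary parts, which carries the real
  ellipticity and the real bound over to complex vectors.\<close>

definition rvec :: "complex ^ 3 \<Rightarrow> real ^ 3" where "rvec \<xi> = (\<chi> i. Re (\<xi> $ i))"
definition ivec :: "complex ^ 3 \<Rightarrow> real ^ 3" where "ivec \<xi> = (\<chi> i. Im (\<xi> $ i))"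
definition capp :: "real ^ 3 ^ 3 \<Rightarrow> complex ^ 3 \<Rightarrow> complex ^ 3"
  where "capp A \<xi> = (\<chi> i j. complex_of_real (A $ i $ j)) *v \<xi>"

lemma mat_app_capp: "mat_app A v x = capp (A x) (v x)" by (simp add: mat_app_def capp_def)

lemma norm_rvec_ivec: "(norm \<xi>)\<^sup>2 = (norm (rvec \<xi>))\<^sup>2 + (norm (ivec \<xi>))\<^sup>2"
  by (simp add: norm_vec_def L2_set_def rvec_def ivec_def sum_nonneg cmod_power2 sum.distrib)

lemma rvec_capp: "rvec (capp A \<xi>) = A *v rvec \<xi>" and ivec_capp: "ivec (capp A \<xi>) = A *v ivec \<xi>"
  by (simp_all add: rvec_def ivec_def capp_def matrix_vector_mult_def vec_eq_iff)

lemma inner_rvec_ivec: "(\<xi> :: complex ^ 3) \<bullet> \<zeta> = rvec \<xi> \<bullet> rvec \<zeta> + ivec \<xi> \<bullet> ivec \<zeta>"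
  by (simp add: inner_vec_def rvec_def ivec_def inner_complex_def sum.distrib)

lemma capp_add: "capp A (\<xi> + \<zeta>) = capp A \<xi> + capp A \<zeta>"
  by (simp add: capp_def matrix_vector_right_distrib)

lemma capp_cmult: "capp A (c *s \<xi>) = c *s capp A \<xi>"
  by (simp add: capp_def matrix_vector_mult_def vec_eq_iff sum_distrib_left mult.left_commute)

context
  fixes A :: "real ^ 3 ^ 3" and \<alpha> \<Lambda> :: real
  assumes ell: "\<And>\<xi>. \<alpha> * (norm \<xi>)\<^sup>2 \<le> \<xi> \<bullet> (A *v \<xi>)" and bd: "\<And>\<xi>. norm (A *v \<xi>) \<le> \<Lambda> * norm \<xi>"
    and \<alpha>: "\<alpha> > 0" and \<Lambda>: "\<Lambda> \<ge> 0"
begin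

lemma capp_elliptic: "\<alpha> * (norm \<xi>)\<^sup>2 \<le> capp A \<xi> \<bullet> \<xi>"
  using ell[of "rvec \<xi>"] ell[of "ivec \<xi>"]
  by (simp add: norm_rvec_ivec inner_rvec_ivec rvec_capp ivec_capp inner_commute distrib_left)

lemma capp_bounded: "norm (capp A \<xi>) \<le> \<Lambda> * norm \<xi>"
proof (rule power2_le_imp_le)
  have "(norm (capp A \<xi>))\<^sup>2 \<le> (\<Lambda> * norm (rvec \<xi>))\<^sup>2 + (\<Lambda> * norm (ivec \<xi>))\<^sup>2"
    unfolding norm_rvec_ivec[of "capp A \<xi>"] rvec_capp ivec_capp by (intro add_mono power_mono bd) auto
  then show "(norm (capp A \<xi>))\<^sup>2 \<le> (\<Lambda> * norm \<xi>)\<^sup>2"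
    by (simp add: power_mult_distrib norm_rvec_ivec[of \<xi>] distrib_left)
qed (use \<Lambda> in simp)

lemma capp_inner_le: "\<bar>capp A \<xi> \<bullet> \<zeta>\<bar> \<le> \<Lambda> * (norm \<xi> * norm \<zeta>)"
proof -
  have "\<bar>capp A \<xi> \<bullet> \<zeta>\<bar> \<le> norm (capp A \<xi>) * norm \<zeta>" by (rule Cauchy_Schwarz_ineq2)
  also have "\<dots> \<le> (\<Lambda> * norm \<xi>) * norm \<zeta>" by (intro mult_right_mono capp_bounded) auto
  finally show ?thesis by simp
qed

text \<open>Flipping the sign of the gradient part turns the indefinite zeroth-order term into a coercive one,
  up to the small part \<open>z\<close>.\<close>

lemma capp_sign_flip:
  assumes "s = 1 \<or> s = (-1::real)"
  shows "capp A (z + s *\<^sub>R g) \<bullet> (z - s *\<^sub>R g) \<le> (\<Lambda> + 2 * \<Lambda>\<^sup>2 / \<alpha> + \<alpha> / 2) * (norm z)\<^sup>2 - \<alpha> / 4 * (norm (z + g))\<^sup>2"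
proof -
  let ?x = "norm z" and ?y = "norm g"
  have sc: "capp A (s *\<^sub>R g) = s *\<^sub>R capp A g" by (simp add: capp_def matrix_vector_mult_scaleR vec_eq_iff matrix_vector_mult_def scaleR_sum_right)
  have "capp A (z + s *\<^sub>R g) \<bullet> (z - s *\<^sub>R g) = capp A z \<bullet> z - s * (capp A z \<bullet> g) + s * (capp A g \<bullet> z) - (s * s) * (capp A g \<bullet> g)"
    by (simp add: capp_add sc inner_add_left inner_diff_right algebra_simps)
  also have "\<dots> \<le> \<Lambda> * (?x * ?x) + 2 * (\<Lambda> * (?x * ?y)) - \<alpha> * ?y\<^sup>2"
    using capp_inner_le[of z z] capp_inner_le[of z g] capp_inner_le[of g z] capp_elliptic[of g] assms
    by (auto simp: mult.commute[of ?y ?x])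
  also have "\<dots> \<le> (\<Lambda> + 2 * \<Lambda>\<^sup>2 / \<alpha>) * ?x\<^sup>2 - \<alpha> / 2 * ?y\<^sup>2"
  proof -
    \<comment> \<open>Young's inequality, weighted so that half of the ellipticity on
      \<open>g\<close> survives; passing from \<open>g\<close> to \<open>z + g\<close> costs another
      half and leaves \<open>\<alpha> / 4\<close>. The cross terms have opposite signs but do not
      cancel for a general \<open>A\<close>.\<close>
    have "2 * (\<Lambda> * (?x * ?y)) \<le> 2 * \<Lambda>\<^sup>2 / \<alpha> * ?x\<^sup>2 + \<alpha> / 2 * ?y\<^sup>2"
    proof -
      have "0 \<le> (2 * \<Lambda> * ?x - \<alpha> * ?y)\<^sup>2 / (2 * \<alpha>)" using \<alpha> by simp
      also have "\<dots> = 2 * \<Lambda>\<^sup>2 / \<alpha> * ?x\<^sup>2 + \<alpha> / 2 * ?y\<^sup>2 - 2 * (\<Lambda> * (?x * ?y))"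
        using \<alpha> by (simp add: power2_eq_square field_simps)
      finally show ?thesis by simp
    qed
    then show ?thesis by (simp add: power2_eq_square algebra_simps)
  qed
  also have "\<dots> \<le> (\<Lambda> + 2 * \<Lambda>\<^sup>2 / \<alpha> + \<alpha> / 2) * ?x\<^sup>2 - \<alpha> / 4 * (norm (z + g))\<^sup>2"
  proof -
    have "\<alpha> / 4 * (norm (z + g))\<^sup>2 \<le> \<alpha> / 4 * (2 * ?x\<^sup>2 + 2 * ?y\<^sup>2)" using sum_norm_le_sq[of z g] \<alpha> by (intro mult_left_mono) auto
    then show ?thesis by (simp add: algebra_simps)
  qed
  finally show ?thesis .
qed

end

section \<open>Local energies\<close>

context mesh
begin

text \<open>Elements are closed and reach the boundary, where representatives of fields are
  arbitrary. A polyhedral boundary is a finite union of flat pieces, hence null, and integrals over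
  elements may be restricted to the open domain.\<close>

lemma negligible_boundary: "negligible (closure \<Omega> - \<Omega>)"
proof -
  obtain F where F: "finite F" "\<And>P. P \<in> F \<Longrightarrow> polytope P \<and> aff_dim P = 2" "frontier \<Omega> = \<Union>F"
    using domain by (auto simp: admissible_domain_def polyhedral_boundary_def)
  have "negligible P" if "P \<in> F" for P
  proof -
    have "interior P = {}" using F(2)[OF that] by (intro low_dim_interior) simp
    then show ?thesis using negligible_convex_interior polytope_imp_convex F(2)[OF that] by blast
  qed
  then have "negligible (frontier \<Omega>)" using F(1,3) by auto
  then show ?thesis using open_\<Omega> by (simp add: frontier_def interior_open)
qed

lemma integral_on_subset:
  fixes F :: "point \<Rightarrow> 'b::euclidean_space"
  assumes F: "F \<in> borel_measurable (lebesgue_on \<Omega>)" and S: "S \<in> sets lebesgue" "S \<subseteq> closure \<Omega>"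
  shows "integral\<^sup>L (lebesgue_on S) F = integral\<^sup>L (lebesgue_on \<Omega>) (\<lambda>x. indicator S x *\<^sub>R F x)"
proof -
  have m0: "(\<lambda>x. indicator \<Omega> x *\<^sub>R F x) \<in> borel_measurable lebesgue"
    using F \<Omega>_sets by (simp add: borel_measurable_restrict_space_iff)
  have m1: "(\<lambda>x. indicator S x *\<^sub>R (indicator \<Omega> x *\<^sub>R F x)) \<in> borel_measurable lebesgue"
    by (rule borel_measurable_scaleR[OF borel_measurable_indicator[OF S(1)] m0])
  have "AE x in lebesgue. x \<notin> closure \<Omega> - \<Omega>"
    using AE_not_in[of "closure \<Omega> - \<Omega>" lebesgue] negligible_boundary unfolding negligible_iff_null_sets by blast
  then have ae: "AE x in lebesgue. indicator S x *\<^sub>R (indicator \<Omega> x *\<^sub>R F x) = indicator S x *\<^sub>R F x"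
    by eventually_elim (use S(2) in \<open>auto simp: indicator_def\<close>)
  have m2: "(\<lambda>x. indicator S x *\<^sub>R F x) \<in> borel_measurable lebesgue" by (rule borel_measurable_AE[OF m1 ae])
  have "integral\<^sup>L (lebesgue_on S) F = integral\<^sup>L lebesgue (\<lambda>x. indicator S x *\<^sub>R (indicator \<Omega> x *\<^sub>R F x))"
    unfolding lebesgue_on_integral(1)[OF S(1)] by (rule integral_cong_AE[OF m2 m1]) (use ae in \<open>auto elim: AE_mp\<close>)
  then show ?thesis unfolding lebesgue_on_integral(1)[OF \<Omega>_sets] by (simp add: mult.commute)
qed

text \<open>Squared L2 norm on \<open>S\<close>, written as an integral over the whole domain, so
  that integrability comes from \<open>L2 \<Omega>\<close> once and for all and sums over elements
  are sums of integrals on one measure space.\<close>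

definition nrm :: "point set \<Rightarrow> (point \<Rightarrow> 'b::euclidean_space) \<Rightarrow> real"
  where "nrm S f = integral\<^sup>L (lebesgue_on \<Omega>) (\<lambda>x. indicator S x * (norm (f x))\<^sup>2)"

lemma nrm_nonneg [simp]: "0 \<le> nrm S f"
  unfolding nrm_def by (rule Bochner_Integration.integral_nonneg) simp

lemma element_sets: "T \<in> \<T> \<Longrightarrow> T \<in> sets lebesgue"
  using element_closed by (simp add: borel_closed)

lemma element_subset: "T \<in> \<T> \<Longrightarrow> T \<subseteq> closure \<Omega>" using mesh_union by blast

lemma l2norm_nrm:
  assumes "f \<in> L2 \<Omega>" "S \<in> sets lebesgue" "S \<subseteq> closure \<Omega>" shows "(l2norm S f)\<^sup>2 = nrm S f"
  unfolding l2norm_sq nrm_def using L2_measurable[OF assms(1)]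
  by (subst integral_on_subset[OF _ assms(2,3)]) auto

lemma l2norm_\<Omega>: "(l2norm \<Omega> f)\<^sup>2 = nrm \<Omega> f"
  unfolding l2norm_sq nrm_def by (rule Bochner_Integration.integral_cong) (auto simp: indicator_def)

lemma indicator_measurable: "S \<in> sets lebesgue \<Longrightarrow> (\<lambda>x. indicator S x :: real) \<in> borel_measurable (lebesgue_on \<Omega>)"
  by (intro measurable_restrict_space1 borel_measurable_indicator)

lemma nrm_integrable:
  assumes "f \<in> L2 \<Omega>" "S \<in> sets lebesgue"
  shows "integrable (lebesgue_on \<Omega>) (\<lambda>x. indicator S x * (norm (f x))\<^sup>2)"
proof (rule Bochner_Integration.integrable_bound[OF L2_integrable[OF assms(1)]])
  show "(\<lambda>x. indicator S x * (norm (f x))\<^sup>2) \<in> borel_measurable (lebesgue_on \<Omega>)"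
    using L2_measurable[OF assms(1)] indicator_measurable[OF assms(2)] by measurable
qed (auto simp: indicator_def)

lemma nrm_le3:
  fixes f :: "point \<Rightarrow> 'a::euclidean_space" and g :: "point \<Rightarrow> 'b::euclidean_space" and k :: "point \<Rightarrow> 'c::euclidean_space"
  assumes "h \<in> L2 \<Omega>" "f \<in> L2 \<Omega>" "g \<in> L2 \<Omega>" "k \<in> L2 \<Omega>" and S: "S \<in> sets lebesgue"
    and "AE x in lebesgue. x \<in> \<Omega> \<longrightarrow> x \<in> S \<longrightarrow> (norm (h x))\<^sup>2 \<le> a * (norm (f x))\<^sup>2 + b * (norm (g x))\<^sup>2 + c * (norm (k x))\<^sup>2"
  shows "nrm S h \<le> a * nrm S f + b * nrm S g + c * nrm S k"
proof -
  note i = nrm_integrable[OF assms(1) S] nrm_integrable[OF assms(2) S] nrm_integrable[OF assms(3) S] nrm_integrable[OF assms(4) S]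
  have "nrm S h \<le> integral\<^sup>L (lebesgue_on \<Omega>) (\<lambda>x. a * (indicator S x * (norm (f x))\<^sup>2) + b * (indicator S x * (norm (g x))\<^sup>2) + c * (indicator S x * (norm (k x))\<^sup>2))"
    unfolding nrm_def
  proof (rule integral_mono_AE)
    show "AE x in lebesgue_on \<Omega>. indicator S x * (norm (h x))\<^sup>2 \<le> a * (indicator S x * (norm (f x))\<^sup>2) + b * (indicator S x * (norm (g x))\<^sup>2) + c * (indicator S x * (norm (k x))\<^sup>2)"
      unfolding AE_lebesgue_on[OF \<Omega>_sets] using assms(6) by eventually_elim (auto simp: indicator_def)
  qed (use i in auto)
  also have "\<dots> = a * nrm S f + b * nrm S g + c * nrm S k" unfolding nrm_def using i by simp
  finally show ?thesis .
qed

lemma nrm_add: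
  assumes "f \<in> L2 \<Omega>" "g \<in> L2 \<Omega>" "S \<in> sets lebesgue"
  shows "nrm S (\<lambda>x. f x + g x) \<le> 2 * nrm S f + 2 * nrm S g"
  using nrm_le3[OF L2_add[OF assms(1,2)] assms(1,2,2,3), of 2 2 0] by (simp add: sum_norm_le_sq)

lemma nrm_minus: "nrm S (\<lambda>x. - f x) = nrm S f" by (simp add: nrm_def)

lemma nrm_diff:
  assumes "f \<in> L2 \<Omega>" "g \<in> L2 \<Omega>" "S \<in> sets lebesgue"
  shows "nrm S (\<lambda>x. f x - g x) \<le> 2 * nrm S f + 2 * nrm S g"
  using nrm_add[OF assms(1) L2_uminus[OF assms(2)] assms(3)] by (simp add: nrm_minus)

lemma nrm_ae_eq:
  assumes "f \<in> L2 \<Omega>" "g \<in> L2 \<Omega>" "S \<in> sets lebesgue" "ae_eq (S \<inter> \<Omega>) f g"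
  shows "nrm S f = nrm S g"
proof (rule antisym)
  have "AE x in lebesgue. x \<in> \<Omega> \<longrightarrow> x \<in> S \<longrightarrow> (norm (f x))\<^sup>2 \<le> 1 * (norm (g x))\<^sup>2 + 0 * (norm (g x))\<^sup>2 + 0 * (norm (g x))\<^sup>2"
    using assms(4) unfolding ae_eq_def by eventually_elim auto
  from nrm_le3[OF assms(1,2,2,2,3) this] show "nrm S f \<le> nrm S g" by simp
  have "AE x in lebesgue. x \<in> \<Omega> \<longrightarrow> x \<in> S \<longrightarrow> (norm (g x))\<^sup>2 \<le> 1 * (norm (f x))\<^sup>2 + 0 * (norm (f x))\<^sup>2 + 0 * (norm (f x))\<^sup>2"
    using assms(4) unfolding ae_eq_def by eventually_elim auto
  from nrm_le3[OF assms(2,1,1,1,3) this] show "nrm S g \<le> nrm S f" by simp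
qed

lemma nrm_0_iff:
  assumes "f \<in> L2 \<Omega>" "S \<in> sets lebesgue"
  shows "nrm S f = 0 \<longleftrightarrow> ae_eq (S \<inter> \<Omega>) f (\<lambda>x. 0)"
proof -
  have "nrm S f = 0 \<longleftrightarrow> (AE x in lebesgue_on \<Omega>. indicator S x * (norm (f x))\<^sup>2 = 0)"
    unfolding nrm_def by (rule integral_nonneg_eq_0_iff_AE[OF nrm_integrable[OF assms]]) simp
  also have "\<dots> \<longleftrightarrow> ae_eq (S \<inter> \<Omega>) f (\<lambda>x. 0)"
    unfolding AE_lebesgue_on[OF \<Omega>_sets] ae_eq_def by (intro AE_cong) (auto simp: indicator_def)
  finally show ?thesis .
qed

lemma AE_skeleton: "AE x in lebesgue. x \<notin> skeleton"
  using negligible_skeleton by (simp add: negligible_iff_null_sets AE_not_in)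

lemma indicator_Union_elements:
  assumes "\<A> \<subseteq> \<T>" "x \<notin> skeleton" shows "indicator (\<Union>\<A>) x = (\<Sum>K\<in>\<A>. indicator K x :: real)"
proof (cases "x \<in> \<Union>\<A>")
  case True
  then obtain K where K: "K \<in> \<A>" "x \<in> K" by blast
  have "(\<Sum>K'\<in>\<A>. indicator K' x :: real) = (\<Sum>K'\<in>\<A>. if K' = K then 1 else 0)"
  proof (intro sum.cong refl)
    fix K' assume "K' \<in> \<A>"
    then show "indicator K' x = (if K' = K then 1 else 0 :: real)"
      using unique_element[OF assms(2), of K' K] K assms(1) by (auto simp: indicator_def)
  qed
  also have "\<dots> = 1" using K(1) finite_subset[OF assms(1) finite_mesh] by simp
  finally show ?thesis using True by simp
next
  case False
  then show ?thesis by (auto simp: indicator_def intro!: sum.neutral[symmetric])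
qed

lemma integral_Union_elements:
  fixes F :: "point \<Rightarrow> 'b::euclidean_space"
  assumes \<A>: "\<A> \<subseteq> \<T>" and F: "integrable (lebesgue_on \<Omega>) F"
  shows "integral\<^sup>L (lebesgue_on \<Omega>) (\<lambda>x. indicator (\<Union>\<A>) x *\<^sub>R F x) = (\<Sum>K\<in>\<A>. integral\<^sup>L (lebesgue_on \<Omega>) (\<lambda>x. indicator K x *\<^sub>R F x))"
    and "\<And>S. S \<in> sets lebesgue \<Longrightarrow> integrable (lebesgue_on \<Omega>) (\<lambda>x. indicator S x *\<^sub>R F x)"
proof -
  show i: "integrable (lebesgue_on \<Omega>) (\<lambda>x. indicator S x *\<^sub>R F x)" if "S \<in> sets lebesgue" for S
  proof (rule Bochner_Integration.integrable_bound[OF F])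
    show "(\<lambda>x. indicator S x *\<^sub>R F x) \<in> borel_measurable (lebesgue_on \<Omega>)"
      using indicator_measurable[OF that] F by (intro borel_measurable_scaleR) auto
  qed (auto simp: indicator_def)
  have s: "K \<in> sets lebesgue" if "K \<in> \<A>" for K using \<A> that element_sets by blast
  have U: "\<Union>\<A> \<in> sets lebesgue" by (rule sets.finite_Union[OF finite_subset[OF \<A> finite_mesh]]) (use s in blast)
  have "integral\<^sup>L (lebesgue_on \<Omega>) (\<lambda>x. indicator (\<Union>\<A>) x *\<^sub>R F x) = integral\<^sup>L (lebesgue_on \<Omega>) (\<lambda>x. \<Sum>K\<in>\<A>. indicator K x *\<^sub>R F x)"
  proof (rule integral_cong_AE)
    show "AE x in lebesgue_on \<Omega>. indicator (\<Union>\<A>) x *\<^sub>R F x = (\<Sum>K\<in>\<A>. indicator K x *\<^sub>R F x)"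
      unfolding AE_lebesgue_on[OF \<Omega>_sets] using AE_skeleton
      by eventually_elim (simp add: indicator_Union_elements[OF \<A>] scaleR_sum_left)
    show "(\<lambda>x. indicator (\<Union>\<A>) x *\<^sub>R F x) \<in> borel_measurable (lebesgue_on \<Omega>)"
      by (rule borel_measurable_integrable[OF i[OF U]])
    show "(\<lambda>x. \<Sum>K\<in>\<A>. indicator K x *\<^sub>R F x) \<in> borel_measurable (lebesgue_on \<Omega>)"
      by (rule borel_measurable_sum, rule borel_measurable_integrable[OF i[OF s]])
  qed
  then show "integral\<^sup>L (lebesgue_on \<Omega>) (\<lambda>x. indicator (\<Union>\<A>) x *\<^sub>R F x) = (\<Sum>K\<in>\<A>. integral\<^sup>L (lebesgue_on \<Omega>) (\<lambda>x. indicator K x *\<^sub>R F x))"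
    by (simp only: Bochner_Integration.integral_sum[OF i[OF s]])
qed

lemma nrm_Union: "f \<in> L2 \<Omega> \<Longrightarrow> \<A> \<subseteq> \<T> \<Longrightarrow> nrm (\<Union>\<A>) f = (\<Sum>K\<in>\<A>. nrm K f)"
  using integral_Union_elements(1)[OF _ L2_integrable] by (simp add: nrm_def)

lemma integral_elements:
  fixes F :: "point \<Rightarrow> 'b::euclidean_space"
  assumes "integrable (lebesgue_on \<Omega>) F"
  shows "integral\<^sup>L (lebesgue_on \<Omega>) F = (\<Sum>K\<in>\<T>. integral\<^sup>L (lebesgue_on \<Omega>) (\<lambda>x. indicator K x *\<^sub>R F x))"
proof -
  have "integral\<^sup>L (lebesgue_on \<Omega>) F = integral\<^sup>L (lebesgue_on \<Omega>) (\<lambda>x. indicator (\<Union>\<T>) x *\<^sub>R F x)"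
    using mesh_union closure_subset[of \<Omega>] by (intro Bochner_Integration.integral_cong) (auto simp: indicator_def)
  then show ?thesis using integral_Union_elements(1)[OF order_refl assms] by simp
qed

lemma nrm_\<Omega>: "f \<in> L2 \<Omega> \<Longrightarrow> nrm \<Omega> f = (\<Sum>K\<in>\<T>. nrm K f)"
  unfolding l2norm_\<Omega>[symmetric] l2norm_sq using integral_elements[OF L2_integrable] by (simp add: nrm_def)

lemma nrm_mono_set:
  assumes "f \<in> L2 \<Omega>" "S \<in> sets lebesgue" "S' \<in> sets lebesgue" "S \<subseteq> S'" shows "nrm S f \<le> nrm S' f"
  unfolding nrm_def
  by (rule integral_mono[OF nrm_integrable[OF assms(1,2)] nrm_integrable[OF assms(1,3)]])
    (use assms(4) in \<open>auto simp: indicator_def\<close>)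

lemma l2norm_nbhm_le:
  assumes f: "f \<in> L2 \<Omega>" and D: "\<D> \<subseteq> \<T>" and K: "K \<in> \<T>" and k: "k \<ge> 1"
  shows "(l2norm (nbhm \<D> k K) f)\<^sup>2 \<le> (\<Sum>K'\<in>layer \<T> k K. nrm K' f)"
proof -
  have sub: "nbhm \<D> k K \<subseteq> \<Union>(layer \<T> k K)"
    using nbhm_submesh_subset[OF D] nbhm_subset_layer[OF K] by blast
  have "open (nbhm \<D> k K)" using k by (cases k) (auto simp: nbhm_def nbh_def)
  then have s: "nbhm \<D> k K \<in> sets lebesgue" by (rule open_sets_lebesgue)
  have U: "\<Union>(layer \<T> k K) \<in> sets lebesgue"
    by (rule sets.finite_Union[OF layer_finite[OF K]]) (use element_sets layer_subset[OF K] in blast)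
  have "\<Union>(layer \<T> k K) \<subseteq> closure \<Omega>" using layer_subset[OF K] element_subset by blast
  then have "(l2norm (nbhm \<D> k K) f)\<^sup>2 = nrm (nbhm \<D> k K) f" using sub by (intro l2norm_nrm f s) auto
  also have "\<dots> \<le> nrm (\<Union>(layer \<T> k K)) f" by (rule nrm_mono_set[OF f s U sub])
  finally show ?thesis by (simp add: nrm_Union[OF f layer_subset[OF K]])
qed

subsection \<open>Subdomains\<close>

text \<open>Treats the domain with its full mesh and a patch with its layer of elements alike.
  \<open>D\<close> is pinned down off the skeleton only, which suffices almost everywhere.\<close>

definition subdomain :: "point set \<Rightarrow> point set set \<Rightarrow> bool"
  where "subdomain D \<D> \<longleftrightarrow> \<D> \<subseteq> \<T> \<and> (\<forall>K\<in>\<D>. interior K \<inter> \<Omega> \<subseteq> D) \<and> (\<forall>K\<in>\<T> - \<D>. interior K \<inter> D = {})"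

lemma subdomain_\<Omega>: "subdomain \<Omega> \<T>" by (auto simp: subdomain_def)

lemma subdomain_nbhm:
  assumes T: "T \<in> \<T>" and m: "m \<ge> 1" shows "subdomain (nbhm \<T> m T) (layer \<T> m T)"
  unfolding subdomain_def nbhm_layer[OF T m]
proof (intro conjI ballI layer_subset[OF T])
  show "interior K \<inter> \<Omega> \<subseteq> interior (\<Union>(layer \<T> m T))" if "K \<in> layer \<T> m T" for K
    using interior_mono[of K "\<Union>(layer \<T> m T)"] that by blast
  show "interior K \<inter> interior (\<Union>(layer \<T> m T)) = {}" if "K \<in> \<T> - layer \<T> m T" for K
  proof -
    have "interior K \<inter> K' = {}" if "K' \<in> layer \<T> m T" for K'
      using layer_subset[OF T, of m] that \<open>K \<in> \<T> - layer \<T> m T\<close> by (intro interior_disjoint) auto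
    then show ?thesis using interior_subset[of "\<Union>(layer \<T> m T)"] by blast
  qed
qed

text \<open>Off the skeleton every point of the domain is interior to one element, so vanishing
  outside \<open>D\<close> amounts to finitely many vanishing element norms.\<close>

lemma vanishing_outside_iff:
  assumes D: "subdomain D \<D>" and S: "\<And>f. f \<in> S \<Longrightarrow> f \<in> L2 \<Omega>"
  shows "v \<in> vanishing_outside \<Omega> D S \<longleftrightarrow> v \<in> S \<and> (\<forall>K\<in>\<T> - \<D>. nrm K (v :: point \<Rightarrow> 'b::euclidean_space) = 0)"
proof -
  have "ae_eq (\<Omega> - D) v (\<lambda>x. 0) \<longleftrightarrow> (\<forall>K\<in>\<T> - \<D>. nrm K v = 0)" if v: "v \<in> S"
  proof
    assume a: "ae_eq (\<Omega> - D) v (\<lambda>x. 0)"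
    show "\<forall>K\<in>\<T> - \<D>. nrm K v = 0"
    proof
      fix K assume K: "K \<in> \<T> - \<D>"
      have "ae_eq (K \<inter> \<Omega>) v (\<lambda>x. 0)"
        using AE_conjI[OF a[unfolded ae_eq_def] AE_skeleton] unfolding ae_eq_def
      proof eventually_elim
        case (elim x)
        show ?case
        proof
          assume x: "x \<in> K \<inter> \<Omega>"
          then have "x \<in> interior K" using notin_skeleton[of x K] K elim by blast
          then have "x \<notin> D" using D K by (auto simp: subdomain_def)
          then show "v x = 0" using elim x by blast
        qed
      qed
      then show "nrm K v = 0" using nrm_0_iff[OF S[OF v] element_sets] K by blast
    qed
  next
    assume a: "\<forall>K\<in>\<T> - \<D>. nrm K v = 0"
    have "AE x in lebesgue. \<forall>K\<in>\<T> - \<D>. x \<in> K \<inter> \<Omega> \<longrightarrow> v x = 0"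
    proof (rule AE_finite_allI)
      fix K assume K: "K \<in> \<T> - \<D>"
      then show "AE x in lebesgue. x \<in> K \<inter> \<Omega> \<longrightarrow> v x = 0"
        using nrm_0_iff[OF S[OF v] element_sets, of K] a by (simp add: ae_eq_def)
    qed (use finite_mesh in simp)
    then show "ae_eq (\<Omega> - D) v (\<lambda>x. 0)"
      using AE_skeleton unfolding ae_eq_def
    proof eventually_elim
      case (elim x)
      show ?case
      proof
        assume x: "x \<in> \<Omega> - D"
        then obtain K where K: "K \<in> \<T>" "x \<in> K" using mesh_union closure_subset[of \<Omega>] by blast
        then have "x \<in> interior K" using notin_skeleton elim by blast
        then have "K \<notin> \<D>" using D x by (auto simp: subdomain_def)
        then show "v x = 0" using elim K x by blast
      qed
    qed
  qed
  then show ?thesis by (auto simp: vanishing_outside_def)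
qed

lemma H0curl_L2: "v \<in> H0curl \<Omega> \<Longrightarrow> v \<in> L2 \<Omega>" "v \<in> H0curl \<Omega> \<Longrightarrow> curl \<Omega> v \<in> L2 \<Omega>"
  using H0curl_H0c H0cD by blast+

lemma H10_L2: "p \<in> H10 \<Omega> \<Longrightarrow> p \<in> L2 \<Omega>" "p \<in> H10 \<Omega> \<Longrightarrow> grad \<Omega> p \<in> L2 \<Omega>"
  using H10_H0g H0gD by blast+

abbreviation V :: "point set \<Rightarrow> vfield set" where "V D \<equiv> vanishing_outside \<Omega> D (H0curl \<Omega>)"

lemma V_iff: "subdomain D \<D> \<Longrightarrow> v \<in> V D \<longleftrightarrow> v \<in> H0curl \<Omega> \<and> (\<forall>K\<in>\<T> - \<D>. nrm K v = 0)"
  by (rule vanishing_outside_iff) (auto intro: H0curl_L2)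

lemma H0curl_V: "H0curl \<Omega> = V \<Omega>" by (auto simp: vanishing_outside_def ae_eq_def)

lemma curl_local:
  assumes K: "K \<in> \<T>" and v: "v \<in> H0curl \<Omega>" and 0: "nrm K v = 0" shows "nrm K (curl \<Omega> v) = 0"
proof -
  have "ae_eq (K \<inter> \<Omega>) v (\<lambda>x. 0)" using nrm_0_iff[OF H0curl_L2(1)[OF v] element_sets[OF K]] 0 by simp
  then have "ae_eq (interior K \<inter> \<Omega>) v (\<lambda>x. 0)" by (rule ae_eq_mono) (use interior_subset in blast)
  then have "ae_eq (interior K \<inter> \<Omega>) (curl \<Omega> v) (\<lambda>x. 0)"
    by (rule weak_curl_local[OF open_\<Omega> _ _ H0c_weak_curl[OF open_\<Omega> H0curl_H0c[OF v]] _ H0curl_L2(1)[OF v], rotated 2])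
      (use open_\<Omega> in auto)
  then have "ae_eq (K \<inter> \<Omega>) (curl \<Omega> v) (\<lambda>x. 0)"
    using AE_skeleton unfolding ae_eq_def by eventually_elim (use notin_skeleton K in blast)
  then show ?thesis using nrm_0_iff[OF H0curl_L2(2)[OF v] element_sets[OF K]] by simp
qed

lemma curl_eq:
  assumes "H0c \<Omega> v c" "S \<in> sets lebesgue" shows "v \<in> H0curl \<Omega>" "nrm S (curl \<Omega> v) = nrm S c" "ae_eq \<Omega> (curl \<Omega> v) c"
proof -
  show v: "v \<in> H0curl \<Omega>" and eq: "ae_eq \<Omega> (curl \<Omega> v) c" using H0c_curl[OF open_\<Omega> assms(1)] by auto
  show "nrm S (curl \<Omega> v) = nrm S c"
    by (rule nrm_ae_eq[OF H0curl_L2(2)[OF v] H0cD(2)[OF assms(1)] assms(2) ae_eq_mono[OF eq]]) auto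
qed

end

lemma square_le_square_mult:
  fixes x C y :: real assumes "x \<le> C * y" "0 \<le> x" shows "x\<^sup>2 \<le> C\<^sup>2 * y\<^sup>2"
  using power_mono[OF assms, of 2] by (simp add: power_mult_distrib)

lemma square_add_le: "(a + h * b)\<^sup>2 \<le> 2 * a\<^sup>2 + 2 * h\<^sup>2 * (b::real)\<^sup>2"
  using sum_norm_le_sq[of a "h * b"] by (simp add: power_mult_distrib)

context mesh
begin

definition N :: "nat \<Rightarrow> real" where "N j = (\<kappa> * \<sigma>) ^ 3 * (real j + 1) ^ 3"

text \<open>Double counting: by symmetry of layers an element \<open>K'\<close> occurs in the layers
  of at most \<open>card (layer \<T> j K')\<close> elements, and that number is bounded by
  \<open>N j\<close>.\<close>

lemma sum_layers:
  assumes A: "\<A> \<subseteq> \<T>" and B: "\<B> \<subseteq> \<T>" and AB: "\<And>K. K \<in> \<A> \<Longrightarrow> layer \<T> j K \<subseteq> \<B>" and f: "\<And>K. 0 \<le> f K"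
  shows "(\<Sum>K\<in>\<A>. \<Sum>K'\<in>layer \<T> j K. f K') \<le> N j * (\<Sum>K\<in>\<B>. f K)"
proof -
  have fin: "finite \<A>" "finite \<B>" using A B finite_mesh finite_subset by blast+
  have "(\<Sum>K\<in>\<A>. \<Sum>K'\<in>layer \<T> j K. f K') = (\<Sum>K\<in>\<A>. \<Sum>K'\<in>\<B>. if K' \<in> layer \<T> j K then f K' else 0)"
  proof (rule sum.cong[OF refl])
    fix K assume "K \<in> \<A>"
    then have "\<B> \<inter> layer \<T> j K = layer \<T> j K" using AB by blast
    then show "(\<Sum>K'\<in>layer \<T> j K. f K') = (\<Sum>K'\<in>\<B>. if K' \<in> layer \<T> j K then f K' else 0)"
      using sum.inter_restrict[OF fin(2), of f "layer \<T> j K"] by simp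
  qed
  also have "\<dots> = (\<Sum>K'\<in>\<B>. \<Sum>K\<in>\<A>. if K' \<in> layer \<T> j K then f K' else 0)" by (rule sum.swap)
  also have "\<dots> \<le> (\<Sum>K'\<in>\<B>. N j * f K')"
  proof (rule sum_mono)
    fix K' assume K': "K' \<in> \<B>"
    have "(\<Sum>K\<in>\<A>. if K' \<in> layer \<T> j K then f K' else 0) = real (card {K \<in> \<A>. K' \<in> layer \<T> j K}) * f K'"
      using fin(1) by (simp add: sum.If_cases Int_def)
    also have "\<dots> \<le> real (card (layer \<T> j K')) * f K'"
      using layer_sym A B K' by (intro mult_right_mono f) (auto intro!: card_mono layer_finite)
    also have "\<dots> \<le> N j * f K'" unfolding N_def using K' B by (intro mult_right_mono f card_layer) auto
    finally show "(\<Sum>K\<in>\<A>. if K' \<in> layer \<T> j K then f K' else 0) \<le> N j * f K'" .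
  qed
  finally show ?thesis by (simp add: sum_distrib_left)
qed

lemma N_ge_1: "1 \<le> N j"
proof -
  obtain T where T: "T \<in> \<T>" using mesh_nonempty by blast
  have "card (layer \<T> j T) \<noteq> 0" using layer_self[OF T] layer_finite[OF T] by (metis card_eq_0_iff empty_iff)
  then show ?thesis using card_layer[OF T, of j] by (simp add: N_def)
qed

text \<open>Regular decomposition in squared form, with \<open>g\<close> the gradient of
  \<open>\<theta>\<close>. The curl of \<open>w\<close> is carried by \<open>z\<close> alone, and
  neighbourhoods are taken in the full mesh even when \<open>D\<close> is a patch.\<close>

definition decomp :: "point set \<Rightarrow> point set set \<Rightarrow> real \<Rightarrow> vfield \<Rightarrow> vfield \<Rightarrow> sfield \<Rightarrow> vfield \<Rightarrow> bool"
  where "decomp D \<D> A w z \<theta> g \<longleftrightarrow> H0c \<Omega> z (curl \<Omega> w) \<and> z \<in> V D \<and> H0g \<Omega> \<theta> g \<and> g \<in> V D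
    \<and> ae_eq \<Omega> w (\<lambda>x. z x + g x) \<and> (\<forall>K\<in>\<T> - \<D>. nrm K \<theta> = 0)
    \<and> (\<forall>K\<in>\<T>. nrm K z \<le> A * H\<^sup>2 * (\<Sum>K'\<in>layer \<T> 3 K. nrm K' (curl \<Omega> w))
        \<and> nrm K \<theta> \<le> 2 * A * H\<^sup>2 * (\<Sum>K'\<in>layer \<T> 3 K. nrm K' w + H\<^sup>2 * nrm K' (curl \<Omega> w))
        \<and> nrm K g \<le> 2 * A * (\<Sum>K'\<in>layer \<T> 3 K. nrm K' w + H\<^sup>2 * nrm K' (curl \<Omega> w)))"

end

section \<open>Falk--Winther operators\<close>

text \<open>\<open>A\<close> stands in for the square of \<open>C\<close> in the squared estimates;
  keeping it at least 1 makes it a factor of known sign, whatever \<open>C\<close> is.\<close>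

locale fw = mesh +
  fixes D :: "point set" and \<D> :: "point set set" and C A :: real and \<pi> :: "vfield \<Rightarrow> vfield"
  assumes sub: "subdomain D \<D>" and fw: "falk_winther \<Omega> D \<D> H C \<pi>" and CA: "C\<^sup>2 \<le> A" and A1: "1 \<le> A"
begin

lemma \<D>_subset: "\<D> \<subseteq> \<T>" using sub by (simp add: subdomain_def)

lemma V_D: "v \<in> V D \<longleftrightarrow> v \<in> H0curl \<Omega> \<and> (\<forall>K\<in>\<T> - \<D>. nrm K v = 0)" by (rule V_iff[OF sub])

lemma fw_linear: "linear_vop \<Omega> (H0curl \<Omega>) \<pi>" and fw_range: "v \<in> H0curl \<Omega> \<Longrightarrow> \<pi> v \<in> nedelec \<Omega> D \<D>"
  and fw_proj: "v \<in> nedelec \<Omega> D \<D> \<Longrightarrow> ae_eq \<Omega> (\<pi> v) v" and fw_commuting: "commuting \<Omega> D \<D> \<pi>"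
  and fw_stable: "v \<in> V D \<Longrightarrow> T \<in> \<D> \<Longrightarrow> l2norm T (\<pi> v) \<le> C * (l2norm (nbh \<D> T) v + H * l2norm (nbh \<D> T) (curl \<Omega> v))"
    "v \<in> V D \<Longrightarrow> T \<in> \<D> \<Longrightarrow> l2norm T (curl \<Omega> (\<pi> v)) \<le> C * l2norm (nbh \<D> T) (curl \<Omega> v)"
  and fw_decomp: "v \<in> V D \<Longrightarrow> \<exists>z \<theta>.
          (\<forall>i. (\<lambda>x. z x $ i) \<in> vanishing_outside \<Omega> D (H10 \<Omega>)) \<and> \<theta> \<in> vanishing_outside \<Omega> D (H10 \<Omega>)
          \<and> ae_eq \<Omega> (\<lambda>x. v x - \<pi> v x) (\<lambda>x. z x + grad \<Omega> \<theta> x)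
          \<and> (\<forall>T\<in>\<D>. l2norm T z / H + l2norm T (jac \<Omega> z) \<le> C * l2norm (nbhm \<D> 3 T) (curl \<Omega> v)
               \<and> l2norm T \<theta> / H + l2norm T (grad \<Omega> \<theta>)
                   \<le> C * (l2norm (nbhm \<D> 3 T) v + H * l2norm (nbhm \<D> 3 T) (curl \<Omega> v)))"
  using fw by (simp_all add: falk_winther_def)

lemma \<pi>_add: "u \<in> H0curl \<Omega> \<Longrightarrow> v \<in> H0curl \<Omega> \<Longrightarrow> ae_eq \<Omega> (\<pi> (\<lambda>x. u x + v x)) (\<lambda>x. \<pi> u x + \<pi> v x)"
  and \<pi>_cong: "u \<in> H0curl \<Omega> \<Longrightarrow> v \<in> H0curl \<Omega> \<Longrightarrow> ae_eq \<Omega> u v \<Longrightarrow> ae_eq \<Omega> (\<pi> u) (\<pi> v)"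
  and \<pi>_cmult: "u \<in> H0curl \<Omega> \<Longrightarrow> ae_eq \<Omega> (\<pi> (\<lambda>x. c *s u x)) (\<lambda>x. c *s \<pi> u x)"
  using fw_linear by (auto simp: linear_vop_def)

lemma \<pi>_V: "v \<in> H0curl \<Omega> \<Longrightarrow> \<pi> v \<in> V D" using fw_range by (auto simp: nedelec_def)

lemma \<pi>_H0curl: "v \<in> H0curl \<Omega> \<Longrightarrow> \<pi> v \<in> H0curl \<Omega>" using \<pi>_V V_D by blast

lemma V_H0curl: "v \<in> V D \<Longrightarrow> v \<in> H0curl \<Omega>" using V_D by blast

lemma \<pi>_stable:
  assumes v: "v \<in> V D" and K: "K \<in> \<T>"
  shows "nrm K (\<pi> v) \<le> 2 * A * (\<Sum>K'\<in>layer \<T> 1 K. nrm K' v + H\<^sup>2 * nrm K' (curl \<Omega> v))" (is ?A)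
    and "nrm K (curl \<Omega> (\<pi> v)) \<le> A * (\<Sum>K'\<in>layer \<T> 1 K. nrm K' (curl \<Omega> v))" (is ?B)
proof -
  note vL = H0curl_L2[OF V_H0curl[OF v]] and pL = H0curl_L2[OF \<pi>_H0curl[OF V_H0curl[OF v]]]
  have "?A \<and> ?B"
  proof (cases "K \<in> \<D>")
    case True
    let ?a = "l2norm (nbh \<D> K) v" and ?b = "l2norm (nbh \<D> K) (curl \<Omega> v)"
    have nb: "nbh \<D> K = nbhm \<D> 1 K" by (simp add: nbhm_def)
    have a: "?a\<^sup>2 \<le> (\<Sum>K'\<in>layer \<T> 1 K. nrm K' v)" and b: "?b\<^sup>2 \<le> (\<Sum>K'\<in>layer \<T> 1 K. nrm K' (curl \<Omega> v))"
      unfolding nb by (intro l2norm_nbhm_le vL \<D>_subset K; simp)+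
    have "nrm K (\<pi> v) = (l2norm K (\<pi> v))\<^sup>2" by (rule l2norm_nrm[OF pL(1) element_sets[OF K] element_subset[OF K], symmetric])
    also have "\<dots> \<le> C\<^sup>2 * (?a + H * ?b)\<^sup>2" by (rule square_le_square_mult[OF fw_stable(1)[OF v True]]) simp
    also have "\<dots> \<le> A * (2 * ?a\<^sup>2 + 2 * H\<^sup>2 * ?b\<^sup>2)" using CA A1 by (intro mult_mono square_add_le) auto
    also have "\<dots> \<le> A * (2 * (\<Sum>K'\<in>layer \<T> 1 K. nrm K' v) + 2 * H\<^sup>2 * (\<Sum>K'\<in>layer \<T> 1 K. nrm K' (curl \<Omega> v)))"
      using A1 a b by (intro mult_left_mono add_mono) auto
    also have "\<dots> = 2 * A * (\<Sum>K'\<in>layer \<T> 1 K. nrm K' v + H\<^sup>2 * nrm K' (curl \<Omega> v))"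
      by (simp add: sum.distrib sum_distrib_left distrib_left mult_ac)
    finally have 1: ?A .
    have "nrm K (curl \<Omega> (\<pi> v)) = (l2norm K (curl \<Omega> (\<pi> v)))\<^sup>2" by (rule l2norm_nrm[OF pL(2) element_sets[OF K] element_subset[OF K], symmetric])
    also have "\<dots> \<le> C\<^sup>2 * ?b\<^sup>2" by (rule square_le_square_mult[OF fw_stable(2)[OF v True]]) simp
    also have "\<dots> \<le> A * (\<Sum>K'\<in>layer \<T> 1 K. nrm K' (curl \<Omega> v))" using CA A1 b by (intro mult_mono) auto
    finally show ?thesis using 1 by blast
  next
    \<comment> \<open>The operator maps into fields that vanish outside \<open>D\<close>, so the
      estimate is trivial on the remaining elements and may be used on the whole mesh.\<close>
    case False
    then have 0: "nrm K (\<pi> v) = 0" using \<pi>_V[OF V_H0curl[OF v]] V_D K by blast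
    then have "nrm K (curl \<Omega> (\<pi> v)) = 0" using curl_local[OF K \<pi>_H0curl[OF V_H0curl[OF v]]] by blast
    then show ?thesis using 0 A1 by (auto intro!: mult_nonneg_nonneg sum_nonneg add_nonneg_nonneg)
  qed
  then show ?A ?B by auto
qed

text \<open>The commuting diagram identifies the projected gradient with the gradient of a Lagrange
  function, so it is curl-free. Hence the kernel part \<open>g - \<pi> g\<close> of a gradient is
  curl-free as well.\<close>

lemma \<pi>_grad:
  assumes p: "p \<in> vanishing_outside \<Omega> D (H10 \<Omega>)" shows "H0c \<Omega> (\<pi> (grad \<Omega> p)) (\<lambda>x. 0)"
proof -
  obtain \<pi>V where V: "\<forall>p\<in>vanishing_outside \<Omega> D (H10 \<Omega>). \<pi>V p \<in> lagrange \<Omega> D \<D>"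
    "\<forall>p\<in>vanishing_outside \<Omega> D (H10 \<Omega>). ae_eq \<Omega> (\<pi> (grad \<Omega> p)) (grad \<Omega> (\<pi>V p))"
    using fw_commuting unfolding commuting_def by blast
  have "\<pi>V p \<in> H10 \<Omega>" using V(1) p by (auto simp: lagrange_def vanishing_outside_def)
  then have "H0c \<Omega> (grad \<Omega> (\<pi>V p)) (\<lambda>x. 0)" by (rule H0g_H0c_gradient[OF H10_H0g])
  then show ?thesis by (rule H0c_cong[OF open_\<Omega>]) (use V(2) p ae_eq_sym in auto)
qed

lemma decomposition:
  assumes w: "w \<in> V D" and w0: "ae_eq \<Omega> (\<pi> w) (\<lambda>x. 0)"
  shows "\<exists>z \<theta> g. decomp D \<D> A w z \<theta> g \<and> H0c \<Omega> (\<pi> g) (\<lambda>x. 0)"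
proof -
  note wH = V_H0curl[OF w] and wL = H0curl_L2[OF V_H0curl[OF w]]
  obtain z0 \<theta> where z0: "\<forall>i. (\<lambda>x. z0 x $ i) \<in> vanishing_outside \<Omega> D (H10 \<Omega>)" and \<theta>: "\<theta> \<in> vanishing_outside \<Omega> D (H10 \<Omega>)"
    and eq: "ae_eq \<Omega> (\<lambda>x. w x - \<pi> w x) (\<lambda>x. z0 x + grad \<Omega> \<theta> x)"
    and est: "\<And>T. T \<in> \<D> \<Longrightarrow> l2norm T z0 / H + l2norm T (jac \<Omega> z0) \<le> C * l2norm (nbhm \<D> 3 T) (curl \<Omega> w)"
      "\<And>T. T \<in> \<D> \<Longrightarrow> l2norm T \<theta> / H + l2norm T (grad \<Omega> \<theta>)
                   \<le> C * (l2norm (nbhm \<D> 3 T) w + H * l2norm (nbhm \<D> 3 T) (curl \<Omega> w))"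
    using fw_decomp[OF w] by blast
  have \<theta>H: "\<theta> \<in> H10 \<Omega>" using \<theta> by (simp add: vanishing_outside_def)
  note \<theta>L = H10_L2[OF \<theta>H] and \<theta>g = H10_H0g[OF \<theta>H]
  have \<theta>0: "nrm K \<theta> = 0" if "K \<in> \<T> - \<D>" for K
    using vanishing_outside_iff[OF sub H10_L2(1), of "H10 \<Omega>" \<theta>] \<theta> that by blast
  have eq': "ae_eq \<Omega> w (\<lambda>x. z0 x + grad \<Omega> \<theta> x)"
    using eq w0 unfolding ae_eq_def by eventually_elim auto
  \<comment> \<open>Defined by subtraction, so that its weak curl is at once that of
    \<open>w\<close>; it agrees with \<open>z0\<close> almost everywhere and inherits the bound of
    size \<open>H\<close>.\<close>
  define z where "z x = w x - grad \<Omega> \<theta> x" for x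
  have zc: "H0c \<Omega> z (curl \<Omega> w)"
    using H0c_diff[OF \<Omega>_sets H0curl_H0c[OF wH] H0g_H0c_gradient[OF \<theta>g]] unfolding z_def by simp
  note zL = H0cD(1)[OF zc]
  have zz0: "ae_eq \<Omega> z z0" using eq' unfolding ae_eq_def z_def by eventually_elim auto
  have z0L: "z0 \<in> L2 \<Omega>" by (rule L2_ae_eq[OF \<Omega>_sets zL zz0])
  have z_nrm: "nrm K z = nrm K z0" if "K \<in> \<T>" for K
    by (rule nrm_ae_eq[OF zL z0L element_sets[OF that] ae_eq_mono[OF zz0]]) auto
  have z0out: "ae_eq (\<Omega> - D) z0 (\<lambda>x. 0)"
  proof -
    have "AE x in lebesgue. \<forall>i. x \<in> \<Omega> - D \<longrightarrow> z0 x $ i = 0"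
      by (rule iffD2[OF AE_all_countable]) (use z0 in \<open>auto simp: vanishing_outside_def ae_eq_def\<close>)
    then show ?thesis unfolding ae_eq_def by eventually_elim (simp add: vec_eq_iff)
  qed
  have zout: "ae_eq (\<Omega> - D) z (\<lambda>x. 0)" using ae_eq_trans[OF ae_eq_mono[OF zz0] z0out] by auto
  have zV: "z \<in> V D" using zout H0c_curl(1)[OF open_\<Omega> zc] by (simp add: vanishing_outside_def)
  have "ae_eq (\<Omega> - D) w (\<lambda>x. 0)" using w by (simp add: vanishing_outside_def)
  then have "ae_eq (\<Omega> - D) (grad \<Omega> \<theta>) (\<lambda>x. 0)" using zout unfolding ae_eq_def z_def by eventually_elim auto
  then have gV: "grad \<Omega> \<theta> \<in> V D" using H0c_curl(1)[OF open_\<Omega> H0g_H0c_gradient[OF \<theta>g]] by (simp add: vanishing_outside_def)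
  have bounds: "nrm K z \<le> A * H\<^sup>2 * (\<Sum>K'\<in>layer \<T> 3 K. nrm K' (curl \<Omega> w))
        \<and> nrm K \<theta> \<le> 2 * A * H\<^sup>2 * (\<Sum>K'\<in>layer \<T> 3 K. nrm K' w + H\<^sup>2 * nrm K' (curl \<Omega> w))
        \<and> nrm K (grad \<Omega> \<theta>) \<le> 2 * A * (\<Sum>K'\<in>layer \<T> 3 K. nrm K' w + H\<^sup>2 * nrm K' (curl \<Omega> w))" if K: "K \<in> \<T>" for K
  proof (cases "K \<in> \<D>")
    case True
    let ?a = "l2norm (nbhm \<D> 3 K) w" and ?b = "l2norm (nbhm \<D> 3 K) (curl \<Omega> w)"
    let ?Sb = "\<Sum>K'\<in>layer \<T> 3 K. nrm K' (curl \<Omega> w)" and ?S = "\<Sum>K'\<in>layer \<T> 3 K. nrm K' w + H\<^sup>2 * nrm K' (curl \<Omega> w)"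
    have a: "?a\<^sup>2 \<le> (\<Sum>K'\<in>layer \<T> 3 K. nrm K' w)" and b: "?b\<^sup>2 \<le> ?Sb"
      by (intro l2norm_nbhm_le wL \<D>_subset K; simp)+
    note ns = element_sets[OF K] element_subset[OF K]
    have "l2norm K z0 / H \<le> C * ?b" using est(1)[OF True] l2norm_nonneg[of K "jac \<Omega> z0"] by linarith
    then have "l2norm K z0 \<le> (C * H) * ?b" using H_pos by (simp add: field_simps)
    then have "(l2norm K z0)\<^sup>2 \<le> (C * H)\<^sup>2 * ?b\<^sup>2" by (rule square_le_square_mult) simp
    also have "\<dots> \<le> (A * H\<^sup>2) * ?Sb" using CA A1 b by (intro mult_mono) (auto simp: power_mult_distrib intro: mult_right_mono)
    finally have 1: "nrm K z \<le> A * H\<^sup>2 * ?Sb" unfolding z_nrm[OF K] l2norm_nrm[OF z0L ns, symmetric] .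
    have S: "(?a + H * ?b)\<^sup>2 \<le> 2 * ?S"
    proof -
      have "2 * ?a\<^sup>2 + 2 * H\<^sup>2 * ?b\<^sup>2 \<le> 2 * (\<Sum>K'\<in>layer \<T> 3 K. nrm K' w) + 2 * H\<^sup>2 * ?Sb"
        using a b by (intro add_mono mult_left_mono) auto
      also have "\<dots> = 2 * ?S" by (simp add: sum.distrib sum_distrib_left distrib_left mult_ac)
      finally show ?thesis using square_add_le[of ?a H ?b] by linarith
    qed
    have "l2norm K \<theta> / H \<le> C * (?a + H * ?b)" using est(2)[OF True] l2norm_nonneg[of K "grad \<Omega> \<theta>"] by linarith
    then have "l2norm K \<theta> \<le> (C * H) * (?a + H * ?b)" using H_pos by (simp add: field_simps)
    then have "(l2norm K \<theta>)\<^sup>2 \<le> (C * H)\<^sup>2 * (?a + H * ?b)\<^sup>2" by (rule square_le_square_mult) simp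
    also have "\<dots> \<le> (A * H\<^sup>2) * (2 * ?S)" using CA A1 S by (intro mult_mono) (auto simp: power_mult_distrib intro: mult_right_mono)
    finally have 2: "nrm K \<theta> \<le> 2 * A * H\<^sup>2 * ?S" unfolding l2norm_nrm[OF \<theta>L(1) ns, symmetric] by (simp add: mult_ac)
    have "0 \<le> l2norm K \<theta> / H" using H_pos by simp
    then have "l2norm K (grad \<Omega> \<theta>) \<le> C * (?a + H * ?b)" using est(2)[OF True] by linarith
    then have "(l2norm K (grad \<Omega> \<theta>))\<^sup>2 \<le> C\<^sup>2 * (?a + H * ?b)\<^sup>2" by (rule square_le_square_mult) simp
    also have "\<dots> \<le> A * (2 * ?S)" using CA A1 S by (intro mult_mono) auto
    finally have 3: "nrm K (grad \<Omega> \<theta>) \<le> 2 * A * ?S" unfolding l2norm_nrm[OF \<theta>L(2) ns, symmetric] by (simp add: mult_ac)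
    show ?thesis using 1 2 3 by blast
  next
    case False
    then have "nrm K z = 0" "nrm K (grad \<Omega> \<theta>) = 0" "nrm K \<theta> = 0" using zV gV V_D \<theta>0 K by blast+
    then show ?thesis using A1 by (auto intro!: mult_nonneg_nonneg sum_nonneg add_nonneg_nonneg)
  qed
  have "decomp D \<D> A w z \<theta> (grad \<Omega> \<theta>)"
    unfolding decomp_def using zc zV \<theta>g gV \<theta>0 bounds by (auto simp: z_def)
  then show ?thesis using \<pi>_grad[OF \<theta>] by blast
qed

end

section \<open>Frequency-weighted element energies\<close>

locale mesh_freq = mesh +
  fixes \<omega> :: real
  assumes \<omega>: "\<omega> > 0" and \<omega>H: "\<omega> * H \<le> 1"
begin

definition en :: "point set \<Rightarrow> vfield \<Rightarrow> real" where "en K v = nrm K (curl \<Omega> v) + \<omega>\<^sup>2 * nrm K v"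

lemma en_nonneg [simp]: "0 \<le> en K v" by (simp add: en_def)

lemma curl_add: "u \<in> H0curl \<Omega> \<Longrightarrow> v \<in> H0curl \<Omega> \<Longrightarrow> H0c \<Omega> (\<lambda>x. u x + v x) (\<lambda>x. curl \<Omega> u x + curl \<Omega> v x)"
  by (intro H0c_add \<Omega>_sets H0curl_H0c)

lemma curl_diff: "u \<in> H0curl \<Omega> \<Longrightarrow> v \<in> H0curl \<Omega> \<Longrightarrow> H0c \<Omega> (\<lambda>x. u x - v x) (\<lambda>x. curl \<Omega> u x - curl \<Omega> v x)"
  by (intro H0c_diff \<Omega>_sets H0curl_H0c)

lemma H0curl_add: "u \<in> H0curl \<Omega> \<Longrightarrow> v \<in> H0curl \<Omega> \<Longrightarrow> (\<lambda>x. u x + v x) \<in> H0curl \<Omega>"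
  using H0c_curl(1)[OF open_\<Omega> curl_add] .

lemma H0curl_diff: "u \<in> H0curl \<Omega> \<Longrightarrow> v \<in> H0curl \<Omega> \<Longrightarrow> (\<lambda>x. u x - v x) \<in> H0curl \<Omega>"
  using H0c_curl(1)[OF open_\<Omega> curl_diff] .

lemma H0curl_cmult: "u \<in> H0curl \<Omega> \<Longrightarrow> (\<lambda>x. c *s u x) \<in> H0curl \<Omega>"
  using H0c_curl(1)[OF open_\<Omega> H0c_cmult[OF H0curl_H0c]] .

lemma H0curl_cong: 
  assumes "u \<in> H0curl \<Omega>" "ae_eq \<Omega> u v" shows "v \<in> H0curl \<Omega>" "ae_eq \<Omega> (curl \<Omega> v) (curl \<Omega> u)"
  using H0c_curl[OF open_\<Omega> H0c_cong[OF open_\<Omega> H0curl_H0c[OF assms(1)] assms(2) ae_eq_refl]] by auto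

lemma en_cong:
  assumes u: "u \<in> H0curl \<Omega>" and uv: "ae_eq \<Omega> u v" and K: "K \<in> \<T>" shows "en K v = en K u"
proof -
  note v = H0curl_cong[OF assms(1,2)]
  have "nrm K v = nrm K u"
    by (rule nrm_ae_eq[OF H0curl_L2(1)[OF v(1)] H0curl_L2(1)[OF u] element_sets[OF K] ae_eq_mono[OF ae_eq_sym[OF uv]]]) auto
  moreover have "nrm K (curl \<Omega> v) = nrm K (curl \<Omega> u)"
    by (rule nrm_ae_eq[OF H0curl_L2(2)[OF v(1)] H0curl_L2(2)[OF u] element_sets[OF K] ae_eq_mono[OF v(2)]]) auto
  ultimately show ?thesis by (simp add: en_def)
qed

lemma en_diff:
  assumes u: "u \<in> H0curl \<Omega>" and v: "v \<in> H0curl \<Omega>" and K: "K \<in> \<T>"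
  shows "en K (\<lambda>x. u x - v x) \<le> 2 * en K u + 2 * en K v"
proof -
  note s = element_sets[OF K]
  have "nrm K (curl \<Omega> (\<lambda>x. u x - v x)) \<le> 2 * nrm K (curl \<Omega> u) + 2 * nrm K (curl \<Omega> v)"
    unfolding curl_eq(2)[OF curl_diff[OF u v] s] by (rule nrm_diff[OF H0curl_L2(2)[OF u] H0curl_L2(2)[OF v] s])
  moreover have "\<omega>\<^sup>2 * nrm K (\<lambda>x. u x - v x) \<le> \<omega>\<^sup>2 * (2 * nrm K u + 2 * nrm K v)"
    by (intro mult_left_mono nrm_diff H0curl_L2 u v s) simp
  ultimately show ?thesis by (simp add: en_def algebra_simps)
qed

lemma en_eq_0: "K \<in> \<T> \<Longrightarrow> v \<in> H0curl \<Omega> \<Longrightarrow> en K v = 0 \<longleftrightarrow> nrm K v = 0"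
  using curl_local[of K v] \<omega> nrm_nonneg[of K v] nrm_nonneg[of K "curl \<Omega> v"]
  by (auto simp: en_def add_nonneg_eq_0_iff)

lemma \<omega>H_square: "\<omega>\<^sup>2 * H\<^sup>2 \<le> 1"
  using power_mono[OF \<omega>H, of 2] \<omega> H_pos by (simp add: power_mult_distrib)

lemma curl_ip_en:
  assumes v: "v \<in> H0curl \<Omega>" shows "Re (curl_ip \<omega> \<Omega> v v) = (\<Sum>K\<in>\<T>. en K v)"
proof -
  have re: "Re (l2ip \<Omega> f f) = (l2norm \<Omega> f)\<^sup>2" if "f \<in> L2 \<Omega>" for f :: vfield
  proof -
    have "Re (l2ip \<Omega> f f) = integral\<^sup>L (lebesgue_on \<Omega>) (\<lambda>x. Re (\<Sum>i\<in>UNIV. f x $ i * cnj (f x $ i)))"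
      unfolding l2ip_def by (rule integral_Re[symmetric, OF l2ip_integrable[OF that that]])
    also have "\<dots> = (l2norm \<Omega> f)\<^sup>2" unfolding l2norm_sq inner_vec_complex[symmetric] by (simp add: power2_norm_eq_inner)
    finally show ?thesis .
  qed
  have "Re (curl_ip \<omega> \<Omega> v v) = (l2norm \<Omega> (curl \<Omega> v))\<^sup>2 + \<omega>\<^sup>2 * (l2norm \<Omega> v)\<^sup>2"
    using re[OF H0curl_L2(1)[OF v]] re[OF H0curl_L2(2)[OF v]] by (simp add: curl_ip_def flip: of_real_power)
  also have "\<dots> = (\<Sum>K\<in>\<T>. en K v)"
    unfolding l2norm_\<Omega> nrm_\<Omega>[OF H0curl_L2(1)[OF v]] nrm_\<Omega>[OF H0curl_L2(2)[OF v]]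
    by (simp add: en_def sum.distrib sum_distrib_left)
  finally show ?thesis .
qed

end

lemma cutoff_one: "open \<Omega> \<Longrightarrow> cutoff \<Omega> (\<lambda>_. 1) (\<lambda>_. 0)"
  unfolding cutoff_def
  by (auto intro!: exI[of _ "1::real"] exI[of _ "\<lambda>_ _. 1 :: real"])

section \<open>Cut-off decompositions and their energies\<close>

context mesh_freq
begin

definition cut :: "(point \<Rightarrow> real) \<Rightarrow> (point \<Rightarrow> point) \<Rightarrow> bool"
  where "cut \<eta> d \<longleftrightarrow> cutoff \<Omega> \<eta> d \<and> (\<forall>x\<in>\<Omega>. \<bar>\<eta> x\<bar> \<le> 1 \<and> norm (d x) \<le> \<kappa> * \<sigma> / H)"

lemma cut_one: "cut (\<lambda>_. 1) (\<lambda>_. 0)"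
  unfolding cut_def using cutoff_one[OF open_\<Omega>] H_pos \<sigma> \<kappa> by simp

text \<open>This is \<open>\<eta>z + s \<nabla>(\<eta>\<theta>)\<close> when \<open>g\<close> and \<open>d\<close> are the gradients of \<open>\<theta>\<close> and \<open>\<eta>\<close>.\<close>

definition Xf :: "real \<Rightarrow> (point \<Rightarrow> real) \<Rightarrow> (point \<Rightarrow> point) \<Rightarrow> vfield \<Rightarrow> sfield \<Rightarrow> vfield \<Rightarrow> vfield"
  where "Xf s \<eta> d z \<theta> g x = \<eta> x *\<^sub>R z x + s *\<^sub>R (\<eta> x *\<^sub>R g x + \<theta> x *s cvec (d x))"

lemma Xf_H0c:
  assumes dc: "decomp D \<D> A w z \<theta> g" and c: "cut \<eta> d"
  shows "H0c \<Omega> (Xf s \<eta> d z \<theta> g) (\<lambda>x. \<eta> x *\<^sub>R curl \<Omega> w x + ccross (cvec (d x)) (z x))"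
proof -
  have z: "H0c \<Omega> z (curl \<Omega> w)" and \<theta>: "H0g \<Omega> \<theta> g" using dc by (auto simp: decomp_def)
  have cc: "cutoff \<Omega> \<eta> d" using c by (simp add: cut_def)
  have "(\<lambda>x. complex_of_real s *s (\<eta> x *\<^sub>R g x + \<theta> x *s cvec (d x))) = (\<lambda>x. s *\<^sub>R (\<eta> x *\<^sub>R g x + \<theta> x *s cvec (d x)))"
    by (simp add: fun_eq_iff vec_eq_iff scaleR_conv_of_real[where 'a=complex] distrib_left mult.assoc)
  with H0c_cmult[OF H0g_H0c_gradient[OF cutoff_H0g[OF open_\<Omega> cc \<theta>]], of "complex_of_real s"]
  have "H0c \<Omega> (\<lambda>x. s *\<^sub>R (\<eta> x *\<^sub>R g x + \<theta> x *s cvec (d x))) (\<lambda>x. 0)" by simp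
  from H0c_add[OF \<Omega>_sets cutoff_H0c[OF open_\<Omega> cc z] this] show ?thesis unfolding Xf_def[abs_def] by simp
qed

lemma Xf_nrm_0:
  assumes "\<And>x. x \<in> K \<Longrightarrow> \<eta> x = 0 \<and> d x = 0" shows "nrm K (Xf s \<eta> d z \<theta> g) = 0"
proof -
  have "(\<lambda>x. indicator K x * (norm (Xf s \<eta> d z \<theta> g x))\<^sup>2) = (\<lambda>x. 0)"
    using assms by (auto simp: fun_eq_iff indicator_def Xf_def cvec_def zero_vec_def[symmetric])
  then show ?thesis by (simp add: nrm_def)
qed

lemma Xf_nrm_eq:
  assumes "\<And>x. x \<in> K \<Longrightarrow> \<eta> x = \<eta>' x \<and> d x = d' x" shows "nrm K (\<lambda>x. Xf s \<eta> d z \<theta> g x - Xf s \<eta>' d' z \<theta> g x) = 0"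
proof -
  have "(\<lambda>x. indicator K x * (norm (Xf s \<eta> d z \<theta> g x - Xf s \<eta>' d' z \<theta> g x))\<^sup>2) = (\<lambda>x. 0)"
    using assms by (auto simp: fun_eq_iff indicator_def Xf_def)
  then show ?thesis by (simp add: nrm_def)
qed

lemma layer_sum_en:
  assumes K: "K \<in> \<T>"
  shows "(\<Sum>K'\<in>layer \<T> j K. nrm K' (curl \<Omega> w)) \<le> (\<Sum>K'\<in>layer \<T> j K. en K' w)"
    and "\<omega>\<^sup>2 * (\<Sum>K'\<in>layer \<T> j K. nrm K' w + H\<^sup>2 * nrm K' (curl \<Omega> w)) \<le> (\<Sum>K'\<in>layer \<T> j K. en K' w)"
proof -
  show "(\<Sum>K'\<in>layer \<T> j K. nrm K' (curl \<Omega> w)) \<le> (\<Sum>K'\<in>layer \<T> j K. en K' w)"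
    by (intro sum_mono) (simp add: en_def)
  have "\<omega>\<^sup>2 * (nrm K' w + H\<^sup>2 * nrm K' (curl \<Omega> w)) \<le> en K' w" for K'
    using mult_right_mono[OF \<omega>H_square nrm_nonneg[of K' "curl \<Omega> w"]] by (simp add: en_def distrib_left mult.assoc)
  then show "\<omega>\<^sup>2 * (\<Sum>K'\<in>layer \<T> j K. nrm K' w + H\<^sup>2 * nrm K' (curl \<Omega> w)) \<le> (\<Sum>K'\<in>layer \<T> j K. en K' w)"
    unfolding sum_distrib_left by (intro sum_mono)
qed

text \<open>The first two terms bound the curl: 72 is twice the square of the 6 in
  \<open>norm_ccross_le\<close>. The bracket bounds the mass term: \<open>9 A\<close> is
  \<open>3 A\<close> from \<open>z\<close> and \<open>6 A\<close> from \<open>g\<close>, and the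
  last term comes from \<open>\<theta>\<close>.\<close>

definition D1 :: "real \<Rightarrow> real" where "D1 A = 2 + 72 * (\<kappa> * \<sigma>)\<^sup>2 * A + (9 * A + 6 * (\<kappa> * \<sigma>)\<^sup>2 * A)"

lemma Xf_nrm_le:
  assumes dc: "decomp D \<D> A w z \<theta> g" and c: "cut \<eta> d" and s: "s = 1 \<or> s = -1" and K: "K \<in> \<T>"
  shows "nrm K (Xf s \<eta> d z \<theta> g) \<le> 3 * nrm K z + 3 * nrm K g + 3 * (\<kappa> * \<sigma> / H)\<^sup>2 * nrm K \<theta>"
proof -
  let ?L = "\<kappa> * \<sigma> / H"
  note ks = element_sets[OF K]
  have zc: "H0c \<Omega> z (curl \<Omega> w)" and \<theta>g: "H0g \<Omega> \<theta> g" using dc by (auto simp: decomp_def)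
  have \<eta>1: "\<And>x. x \<in> \<Omega> \<Longrightarrow> \<bar>\<eta> x\<bar> \<le> 1" and dL: "\<And>x. x \<in> \<Omega> \<Longrightarrow> norm (d x) \<le> ?L" using c by (auto simp: cut_def)
  have \<eta>sq: "\<And>x. x \<in> \<Omega> \<Longrightarrow> (\<eta> x)\<^sup>2 \<le> 1" using \<eta>1 by (simp add: abs_square_le_1)
  have dsq: "\<And>x. x \<in> \<Omega> \<Longrightarrow> (norm (d x))\<^sup>2 \<le> ?L\<^sup>2" using dL by (intro power_mono) auto
  note X = Xf_H0c[OF dc c, of s]
  show ?thesis
    proof (rule nrm_le3[OF H0cD(1)[OF X] H0cD(1)[OF zc] H0gD(2)[OF \<theta>g] H0gD(1)[OF \<theta>g] ks], rule AE_I2, intro impI)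
      fix x assume x: "x \<in> \<Omega>"
      define p q r where "p = \<eta> x *\<^sub>R z x" and "q = \<eta> x *\<^sub>R g x" and "r = \<theta> x *s cvec (d x)"
      have p: "(norm p)\<^sup>2 \<le> (norm (z x))\<^sup>2" unfolding p_def
        using mult_right_mono[OF \<eta>sq[OF x], of "(norm (z x))\<^sup>2"] by (simp add: power_mult_distrib)
      have q: "(norm q)\<^sup>2 \<le> (norm (g x))\<^sup>2" unfolding q_def
        using mult_right_mono[OF \<eta>sq[OF x], of "(norm (g x))\<^sup>2"] by (simp add: power_mult_distrib)
      have r: "(norm r)\<^sup>2 \<le> ?L\<^sup>2 * (norm (\<theta> x))\<^sup>2" unfolding r_def
        using mult_right_mono[OF dsq[OF x], of "(norm (\<theta> x))\<^sup>2"] by (simp add: norm_cmult_vec norm_cvec power_mult_distrib mult.commute)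
      have "norm (p + s *\<^sub>R (q + r)) \<le> norm p + norm (s *\<^sub>R (q + r))" by (rule norm_triangle_ineq)
      also have "norm (s *\<^sub>R (q + r)) = norm (q + r)" using s by auto
      also have "norm (q + r) \<le> norm q + norm r" by (rule norm_triangle_ineq)
      finally have "(norm (p + s *\<^sub>R (q + r)))\<^sup>2 \<le> (norm p + (norm q + norm r))\<^sup>2" by (intro power_mono) auto
      also have "\<dots> \<le> 3 * (norm p)\<^sup>2 + 3 * (norm q)\<^sup>2 + 3 * (norm r)\<^sup>2"
        using zero_le_power2[of "norm p - norm q"] zero_le_power2[of "norm p - norm r"] zero_le_power2[of "norm q - norm r"]
        by (simp add: power2_eq_square algebra_simps)
      finally show "(norm (Xf s \<eta> d z \<theta> g x))\<^sup>2 \<le> 3 * (norm (z x))\<^sup>2 + 3 * (norm (g x))\<^sup>2 + 3 * ?L\<^sup>2 * (norm (\<theta> x))\<^sup>2"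
        using p q r unfolding Xf_def p_def q_def r_def by linarith
    qed
qed

lemma Xf_V:
  assumes dc: "decomp D \<D> A w z \<theta> g" and c: "cut \<eta> d" and s: "s = 1 \<or> s = -1" and D: "subdomain D \<D>"
  shows "Xf s \<eta> d z \<theta> g \<in> V D"
proof -
  have "nrm K (Xf s \<eta> d z \<theta> g) = 0" if "K \<in> \<T> - \<D>" for K
  proof (rule antisym)
    show "nrm K (Xf s \<eta> d z \<theta> g) \<le> 0"
      using Xf_nrm_le[OF dc c s, of K] that dc by (auto simp: decomp_def V_iff[OF D])
  qed simp
  then show ?thesis using V_iff[OF D] curl_eq(1)[OF Xf_H0c[OF dc c] \<Omega>_sets] by blast
qed

text \<open>The cutoff gradient has size \<open>\<kappa> \<sigma> / H\<close>, but it multiplies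
  only \<open>z\<close> and \<open>\<theta>\<close>, which are of size \<open>H\<close>. Thus the
  constant is free of the mesh size; \<open>\<omega> H \<le> 1\<close> handles the mass term of
  \<open>z\<close>.\<close>

lemma Xf_en:
  assumes dc: "decomp D \<D> A w z \<theta> g" and A: "1 \<le> A" and c: "cut \<eta> d" and s: "s = 1 \<or> s = -1" and w: "w \<in> H0curl \<Omega>" and K: "K \<in> \<T>"
  shows "en K (Xf s \<eta> d z \<theta> g) \<le> D1 A * (\<Sum>K'\<in>layer \<T> 3 K. en K' w)"
proof -
  let ?L = "\<kappa> * \<sigma> / H" and ?S = "\<Sum>K'\<in>layer \<T> 3 K. en K' w"
  note ks = element_sets[OF K]
  have zc: "H0c \<Omega> z (curl \<Omega> w)" and \<theta>g: "H0g \<Omega> \<theta> g" using dc by (auto simp: decomp_def)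
  have b: "nrm K z \<le> A * H\<^sup>2 * (\<Sum>K'\<in>layer \<T> 3 K. nrm K' (curl \<Omega> w))"
    "nrm K \<theta> \<le> 2 * A * H\<^sup>2 * (\<Sum>K'\<in>layer \<T> 3 K. nrm K' w + H\<^sup>2 * nrm K' (curl \<Omega> w))"
    "nrm K g \<le> 2 * A * (\<Sum>K'\<in>layer \<T> 3 K. nrm K' w + H\<^sup>2 * nrm K' (curl \<Omega> w))"
    using dc K by (auto simp: decomp_def)
  have S0: "0 \<le> ?S" by (intro sum_nonneg) simp
  have \<eta>1: "\<And>x. x \<in> \<Omega> \<Longrightarrow> \<bar>\<eta> x\<bar> \<le> 1" and dL: "\<And>x. x \<in> \<Omega> \<Longrightarrow> norm (d x) \<le> ?L" using c by (auto simp: cut_def)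
  have \<eta>sq: "\<And>x. x \<in> \<Omega> \<Longrightarrow> (\<eta> x)\<^sup>2 \<le> 1" using \<eta>1 by (simp add: abs_square_le_1)
  have dsq: "\<And>x. x \<in> \<Omega> \<Longrightarrow> (norm (d x))\<^sup>2 \<le> ?L\<^sup>2" using dL by (intro power_mono) auto
  note X = Xf_H0c[OF dc c, of s]
  have LH: "?L\<^sup>2 * H\<^sup>2 = (\<kappa> * \<sigma>)\<^sup>2" using H_pos by (simp add: power_divide)
  have zS: "nrm K z \<le> A * H\<^sup>2 * ?S"
    by (rule order_trans[OF b(1)], rule mult_left_mono[OF layer_sum_en(1)[OF K]]) (use A in simp)
  have mono3: "\<omega>\<^sup>2 * (t * (\<Sum>K'\<in>layer \<T> 3 K. nrm K' w + H\<^sup>2 * nrm K' (curl \<Omega> w))) \<le> t * ?S" if "t \<ge> 0" for t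
    using mult_left_mono[OF layer_sum_en(2)[OF K, where j=3 and w=w] that] by (simp add: mult.left_commute)
  have 1: "nrm K (curl \<Omega> (Xf s \<eta> d z \<theta> g)) \<le> (2 + 72 * (\<kappa> * \<sigma>)\<^sup>2 * A) * ?S"
  proof -
    have "nrm K (curl \<Omega> (Xf s \<eta> d z \<theta> g)) \<le> 2 * nrm K (curl \<Omega> w) + 72 * ?L\<^sup>2 * nrm K z + 0 * nrm K z"
      unfolding curl_eq(2)[OF X ks]
    proof (rule nrm_le3[OF H0cD(2)[OF X] H0curl_L2(2)[OF w] H0cD(1)[OF zc] H0cD(1)[OF zc] ks], rule AE_I2, intro impI)
      fix x assume x: "x \<in> \<Omega>"
      have "(norm (ccross (cvec (d x)) (z x)))\<^sup>2 \<le> (6 * (norm (d x) * norm (z x)))\<^sup>2"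
        using norm_ccross_le[of "cvec (d x)" "z x"] by (intro power_mono) (auto simp: norm_cvec)
      also have "\<dots> = 36 * ((norm (d x))\<^sup>2 * (norm (z x))\<^sup>2)" by (simp add: power_mult_distrib)
      also have "\<dots> \<le> 36 * (?L\<^sup>2 * (norm (z x))\<^sup>2)" using dsq[OF x] by (intro mult_left_mono mult_right_mono) auto
      finally have a: "(norm (ccross (cvec (d x)) (z x)))\<^sup>2 \<le> 36 * (?L\<^sup>2 * (norm (z x))\<^sup>2)" .
      have b: "(norm (\<eta> x *\<^sub>R curl \<Omega> w x))\<^sup>2 \<le> (norm (curl \<Omega> w x))\<^sup>2"
        using mult_right_mono[OF \<eta>sq[OF x], of "(norm (curl \<Omega> w x))\<^sup>2"] by (simp add: power_mult_distrib)
      show "(norm (\<eta> x *\<^sub>R curl \<Omega> w x + ccross (cvec (d x)) (z x)))\<^sup>2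
          \<le> 2 * (norm (curl \<Omega> w x))\<^sup>2 + 72 * ?L\<^sup>2 * (norm (z x))\<^sup>2 + 0 * (norm (z x))\<^sup>2"
        using sum_norm_le_sq[of "\<eta> x *\<^sub>R curl \<Omega> w x" "ccross (cvec (d x)) (z x)"] a b by (simp only: mult_zero_left mult.assoc)
    qed
    also have "\<dots> \<le> 2 * ?S + 72 * ?L\<^sup>2 * (A * H\<^sup>2 * ?S)"
    proof -
      have "nrm K (curl \<Omega> w) \<le> en K w" using \<omega> by (simp add: en_def)
      also have "\<dots> \<le> ?S" using layer_self[OF K] layer_finite[OF K] by (intro member_le_sum) auto
      finally show ?thesis using mult_left_mono[OF zS, of "72 * ?L\<^sup>2"] by simp
    qed
    also have "72 * ?L\<^sup>2 * (A * H\<^sup>2 * ?S) = 72 * (?L\<^sup>2 * H\<^sup>2) * A * ?S" by (simp add: mult_ac)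
    finally show ?thesis unfolding LH by (simp add: algebra_simps)
  qed
  have 2: "\<omega>\<^sup>2 * nrm K (Xf s \<eta> d z \<theta> g) \<le> (9 * A + 6 * (\<kappa> * \<sigma>)\<^sup>2 * A) * ?S"
  proof -
    have "nrm K (Xf s \<eta> d z \<theta> g) \<le> 3 * nrm K z + 3 * nrm K g + 3 * ?L\<^sup>2 * nrm K \<theta>"
      by (rule Xf_nrm_le[OF dc c s K])
    then have "\<omega>\<^sup>2 * nrm K (Xf s \<eta> d z \<theta> g) \<le> \<omega>\<^sup>2 * (3 * nrm K z + 3 * nrm K g + 3 * ?L\<^sup>2 * nrm K \<theta>)"
      by (rule mult_left_mono) simp
    also have "\<dots> = 3 * (\<omega>\<^sup>2 * nrm K z) + 3 * (\<omega>\<^sup>2 * nrm K g) + 3 * (?L\<^sup>2 * (\<omega>\<^sup>2 * nrm K \<theta>))" by (simp add: algebra_simps)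
    also have "\<omega>\<^sup>2 * nrm K z \<le> A * ?S"
    proof -
      have "\<omega>\<^sup>2 * nrm K z \<le> \<omega>\<^sup>2 * (A * H\<^sup>2 * ?S)" using zS by (rule mult_left_mono) simp
      also have "\<dots> = (\<omega>\<^sup>2 * H\<^sup>2) * (A * ?S)" by (simp add: mult_ac)
      also have "\<dots> \<le> 1 * (A * ?S)" using A S0 by (intro mult_right_mono \<omega>H_square) auto
      finally show ?thesis by simp
    qed
    also have "\<omega>\<^sup>2 * nrm K g \<le> 2 * A * ?S"
      by (rule order_trans[OF mult_left_mono[OF b(3) zero_le_power2[of \<omega>]] mono3[of "2 * A"]]) (use A in simp)
    also have "?L\<^sup>2 * (\<omega>\<^sup>2 * nrm K \<theta>) \<le> ?L\<^sup>2 * (2 * A * H\<^sup>2 * ?S)"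
      by (rule mult_left_mono[OF order_trans[OF mult_left_mono[OF b(2) zero_le_power2[of \<omega>]] mono3[of "2 * A * H\<^sup>2"]]]) (use A in auto)
    also have "?L\<^sup>2 * (2 * A * H\<^sup>2 * ?S) = (?L\<^sup>2 * H\<^sup>2) * (2 * A * ?S)" by (simp add: mult_ac)
    finally show ?thesis unfolding LH by (simp add: algebra_simps)
  qed
  show ?thesis using 1 2 unfolding en_def D1_def by (simp only: distrib_right)
qed

end

section \<open>The kernel of a Falk-Winther operator and the projection onto it\<close>

locale fw_freq = mesh_freq + fw
begin

text \<open>Complementary projection; because \<open>\<pi>\<close> is idempotent, it returns fields
  of \<open>V D\<close> to the kernel \<open>W\<close>.\<close>

definition P :: "vfield \<Rightarrow> vfield" where "P X x = X x - \<pi> X x"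

lemma V_diff: "u \<in> V D \<Longrightarrow> v \<in> V D \<Longrightarrow> (\<lambda>x. u x - v x) \<in> V D"
proof -
  assume u: "u \<in> V D" and v: "v \<in> V D"
  have "nrm K (\<lambda>x. u x - v x) = 0" if "K \<in> \<T> - \<D>" for K
  proof -
    have "nrm K u = 0" "nrm K v = 0" using u v that V_D by blast+
    then show ?thesis
      using nrm_diff[OF H0curl_L2(1)[OF V_H0curl[OF u]] H0curl_L2(1)[OF V_H0curl[OF v]] element_sets, of K] that
        nrm_nonneg[of K "\<lambda>x. u x - v x"] by simp
  qed
  then show ?thesis using H0curl_diff u v V_D by blast
qed

lemma V_cmult: "u \<in> V D \<Longrightarrow> (\<lambda>x. c *s u x) \<in> V D"
proof -
  assume u: "u \<in> V D"
  have "ae_eq (\<Omega> - D) (\<lambda>x. c *s u x) (\<lambda>x. 0)"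
    using u unfolding vanishing_outside_def ae_eq_def by (auto elim: AE_mp)
  then show ?thesis using H0curl_cmult[OF V_H0curl[OF u]] by (simp add: vanishing_outside_def)
qed

lemma V_add: "u \<in> V D \<Longrightarrow> v \<in> V D \<Longrightarrow> (\<lambda>x. u x + v x) \<in> V D"
  using V_diff[OF _ V_cmult[of v "-1"], of u] by (simp add: vector_smult_lneg)

lemma \<pi>_diff:
  assumes u: "u \<in> H0curl \<Omega>" and v: "v \<in> H0curl \<Omega>"
  shows "ae_eq \<Omega> (\<pi> (\<lambda>x. u x - v x)) (\<lambda>x. \<pi> u x - \<pi> v x)"
proof -
  have "ae_eq \<Omega> (\<pi> (\<lambda>x. u x + (-1) *s v x)) (\<lambda>x. \<pi> u x + \<pi> (\<lambda>x. (-1) *s v x) x)"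
    by (rule \<pi>_add[OF u H0curl_cmult[OF v]])
  then show ?thesis using \<pi>_cmult[OF v, of "-1"] unfolding ae_eq_def
    by (rule AE_mp[OF AE_conjI]) (auto simp: vector_smult_lneg)
qed

definition W :: "vfield set" where "W = {w \<in> V D. ae_eq \<Omega> (\<pi> w) (\<lambda>x. 0)}"

lemma P_W:
  assumes X: "X \<in> H0curl \<Omega>" and XV: "X \<in> V D" shows "P X \<in> W"
proof -
  have "ae_eq \<Omega> (\<pi> (\<lambda>x. X x - \<pi> X x)) (\<lambda>x. \<pi> X x - \<pi> (\<pi> X) x)" by (rule \<pi>_diff[OF X \<pi>_H0curl[OF X]])
  then have "ae_eq \<Omega> (\<pi> (P X)) (\<lambda>x. 0)"
    using fw_proj[OF fw_range[OF X]] unfolding P_def[abs_def] ae_eq_def by (rule AE_mp[OF AE_conjI]) auto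
  moreover have "P X \<in> V D" unfolding P_def[abs_def] by (rule V_diff[OF XV \<pi>_V[OF X]])
  ultimately show ?thesis by (simp add: W_def)
qed

lemma en_\<pi>:
  assumes v: "v \<in> V D" and K: "K \<in> \<T>" shows "en K (\<pi> v) \<le> 3 * A * (\<Sum>K'\<in>layer \<T> 1 K. en K' v)"
proof -
  have "nrm K (curl \<Omega> (\<pi> v)) \<le> A * (\<Sum>K'\<in>layer \<T> 1 K. en K' v)"
    using \<pi>_stable(2)[OF v K] mult_left_mono[OF layer_sum_en(1)[OF K, where j=1 and w=v], of A] A1 by linarith
  moreover have "\<omega>\<^sup>2 * nrm K (\<pi> v) \<le> 2 * A * (\<Sum>K'\<in>layer \<T> 1 K. en K' v)"
  proof -
    have "\<omega>\<^sup>2 * nrm K (\<pi> v) \<le> \<omega>\<^sup>2 * (2 * A * (\<Sum>K'\<in>layer \<T> 1 K. nrm K' v + H\<^sup>2 * nrm K' (curl \<Omega> v)))"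
      by (rule mult_left_mono[OF \<pi>_stable(1)[OF v K]]) simp
    also have "\<dots> = 2 * A * (\<omega>\<^sup>2 * (\<Sum>K'\<in>layer \<T> 1 K. nrm K' v + H\<^sup>2 * nrm K' (curl \<Omega> v)))" by (simp only: mult.left_commute)
    also have "\<dots> \<le> 2 * A * (\<Sum>K'\<in>layer \<T> 1 K. en K' v)"
      using A1 by (intro mult_left_mono layer_sum_en(2)[OF K]) auto
    finally show ?thesis .
  qed
  ultimately show ?thesis unfolding en_def[of K] by linarith
qed

lemma en_P:
  assumes v: "v \<in> V D" and K: "K \<in> \<T>" shows "en K (P v) \<le> 2 * en K v + 6 * A * (\<Sum>K'\<in>layer \<T> 1 K. en K' v)"
  using en_diff[OF V_H0curl[OF v] \<pi>_H0curl[OF V_H0curl[OF v]] K] en_\<pi>[OF v K] unfolding P_def[abs_def] by linarith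

lemma \<pi>_local_0:
  assumes v: "v \<in> V D" and K: "K \<in> \<T>" and 0: "\<And>K'. K' \<in> layer \<T> 1 K \<Longrightarrow> nrm K' v = 0" shows "nrm K (\<pi> v) = 0"
proof -
  have "en K' v = 0" if "K' \<in> layer \<T> 1 K" for K'
    using 0[OF that] en_eq_0[OF _ V_H0curl[OF v]] layer_subset[OF K] that by blast
  then have "en K (\<pi> v) \<le> 0" using en_\<pi>[OF v K] by simp
  then show ?thesis using en_eq_0[OF K \<pi>_H0curl[OF V_H0curl[OF v]]] en_nonneg[of K "\<pi> v"] by simp
qed

text \<open>Locality of the projection up to one layer: where a cut-off field coincides with the
  uncut one on all neighbours, so do their kernel parts.\<close>

lemma P_agree:
  assumes X: "X \<in> V D" and Y: "Y \<in> V D" and K: "K \<in> \<T>"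
    and eq: "\<And>K'. K' \<in> layer \<T> 1 K \<Longrightarrow> nrm K' (\<lambda>x. X x - Y x) = 0"
  shows "nrm K (\<lambda>x. P X x - P Y x) = 0"
proof -
  note XH = V_H0curl[OF X] and YH = V_H0curl[OF Y]
  note d = \<pi>_diff[OF XH YH]
  have 1: "nrm K (\<pi> (\<lambda>x. X x - Y x)) = 0" by (rule \<pi>_local_0[OF V_diff[OF X Y] K eq])
  have L: "\<pi> (\<lambda>x. X x - Y x) \<in> L2 \<Omega>" "(\<lambda>x. X x - Y x) \<in> L2 \<Omega>"
    using H0curl_L2(1) \<pi>_H0curl H0curl_diff[OF XH YH] by blast+
  have PL: "(\<lambda>x. P X x - P Y x) \<in> L2 \<Omega>"
    unfolding P_def by (intro L2_diff H0curl_L2 \<pi>_H0curl XH YH)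
  have "nrm K (\<lambda>x. P X x - P Y x) = nrm K (\<lambda>x. (X x - Y x) - \<pi> (\<lambda>x. X x - Y x) x)"
  proof (rule nrm_ae_eq[OF PL L2_diff[OF L(2,1)] element_sets[OF K]])
    show "ae_eq (K \<inter> \<Omega>) (\<lambda>x. P X x - P Y x) (\<lambda>x. X x - Y x - \<pi> (\<lambda>x. X x - Y x) x)"
      by (rule ae_eq_mono[of \<Omega>]) (use d in \<open>auto simp: ae_eq_def P_def elim!: AE_mp\<close>)
  qed
  also have "\<dots> \<le> 2 * nrm K (\<lambda>x. X x - Y x) + 2 * nrm K (\<pi> (\<lambda>x. X x - Y x))"
    by (rule nrm_diff[OF L(2,1) element_sets[OF K]])
  also have "\<dots> = 0" using 1 eq[OF layer_self[OF K]] by simp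
  finally show ?thesis using nrm_nonneg[of K "\<lambda>x. P X x - P Y x"] by linarith
qed

text \<open>The first term is the energy of the field itself, the second that of its projection,
  which sums over one layer of neighbours and so picks up the overlap \<open>N 3\<close>.\<close>

definition D2 :: real where "D2 = 2 * D1 A + 6 * A * D1 A * N 3"

lemma D1_pos: "D1 A > 0" unfolding D1_def using A1 by (intro add_pos_nonneg) auto

lemma D2_pos: "D2 > 0" unfolding D2_def using A1 D1_pos N_ge_1[of 3] by (intro add_pos_nonneg) auto

text \<open>Three layers come from the decomposition and a fourth from \<open>\<pi>\<close>. It is
  stated for an arbitrary \<open>X\<close> with the energy bound, so that it also serves when the
  decomposition belongs to another operator than \<open>\<pi>\<close>.\<close>

lemma P_Xf_en:
  assumes X: "X \<in> V D" and en: "\<And>K. K \<in> \<T> \<Longrightarrow> en K X \<le> D1 A * (\<Sum>K'\<in>layer \<T> 3 K. en K' w)" and K: "K \<in> \<T>"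
  shows "en K (P X) \<le> D2 * (\<Sum>K'\<in>layer \<T> 4 K. en K' w)"
proof -
  let ?S = "\<Sum>K'\<in>layer \<T> 4 K. en K' w"
  have "(\<Sum>K'\<in>layer \<T> 3 K. en K' w) \<le> ?S" by (intro sum_mono2 layer_finite[OF K] layer_mono[OF K]) auto
  then have 1: "en K X \<le> D1 A * ?S" using order_trans[OF en[OF K] mult_left_mono[of _ ?S "D1 A"]] D1_pos by simp
  have "(\<Sum>K'\<in>layer \<T> 1 K. en K' X) \<le> (\<Sum>K'\<in>layer \<T> 1 K. D1 A * (\<Sum>K''\<in>layer \<T> 3 K'. en K'' w))"
    using layer_subset[OF K] by (intro sum_mono en) blast
  also have "\<dots> = D1 A * (\<Sum>K'\<in>layer \<T> 1 K. \<Sum>K''\<in>layer \<T> 3 K'. en K'' w)" by (simp only: sum_distrib_left)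
  also have "\<dots> \<le> D1 A * (N 3 * ?S)"
  proof (rule mult_left_mono[OF sum_layers[OF layer_subset[OF K] layer_subset[OF K]]])
    show "layer \<T> 3 K' \<subseteq> layer \<T> 4 K" if "K' \<in> layer \<T> 1 K" for K' using layer_trans[OF that, of _ 3] by auto
  qed (use D1_pos in auto)
  finally have "6 * A * (\<Sum>K'\<in>layer \<T> 1 K. en K' X) \<le> 6 * A * (D1 A * (N 3 * ?S))" using A1 by (intro mult_left_mono) auto
  then have "en K (P X) \<le> 2 * (D1 A * ?S) + 6 * A * (D1 A * (N 3 * ?S))" using en_P[OF X K] 1 by linarith
  also have "\<dots> = D2 * ?S" by (simp add: D2_def algebra_simps)
  finally show ?thesis .
qed

end

lemma cauchy_schwarz_2: "(a * b + c * d :: real)\<^sup>2 \<le> (a\<^sup>2 + c\<^sup>2) * (b\<^sup>2 + d\<^sup>2)"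
  using zero_le_power2[of "a * d - b * c"] by (simp add: power2_eq_square algebra_simps)

section \<open>The sesquilinear form\<close>

locale lodform = mesh_freq +
  fixes \<mu> \<epsilon> :: "point \<Rightarrow> real ^ 3 ^ 3" and \<alpha> \<Lambda> :: real
  assumes coef_\<mu>: "coefficient \<Omega> \<alpha> \<Lambda> \<mu>" and coef_\<epsilon>: "coefficient \<Omega> \<alpha> \<Lambda> \<epsilon>" and \<alpha>: "0 < \<alpha>" and \<Lambda>0: "0 \<le> \<Lambda>"
begin

text \<open>As with \<open>nrm\<close>, restriction to an element is a factor in the integrand, so
  inner products over elements live on one measure space.\<close>

definition res :: "point set \<Rightarrow> vfield \<Rightarrow> vfield" where "res K f x = indicator K x *\<^sub>R f x"

definition ip :: "point set \<Rightarrow> vfield \<Rightarrow> vfield \<Rightarrow> complex" where "ip K f g = l2ip \<Omega> (res K f) g"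

lemma res_L2:
  assumes "f \<in> L2 \<Omega>" "K \<in> sets lebesgue" shows "res K f \<in> L2 \<Omega>"
  by (rule L2_mult_bounded[OF assms(1), where B=1])
    (use L2_measurable[OF assms(1)] indicator_measurable[OF assms(2)] in \<open>auto simp: res_def[abs_def] indicator_def[of K] intro!: borel_measurable_scaleR\<close>)

lemma l2norm_res: "l2norm \<Omega> (res K f) = sqrt (nrm K f)"
proof -
  have "(norm (res K f x))\<^sup>2 = indicator K x * (norm (f x))\<^sup>2" for x by (simp add: res_def indicator_def)
  then show ?thesis by (simp add: l2norm_def nrm_def)
qed

lemma ip_bound:
  assumes "f \<in> L2 \<Omega>" "g \<in> L2 \<Omega>" "K \<in> sets lebesgue" shows "cmod (ip K f g) \<le> sqrt (nrm K f) * sqrt (nrm K g)"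
proof -
  have "ip K f g = l2ip \<Omega> (res K f) (res K g)"
    unfolding ip_def l2ip_def by (rule Bochner_Integration.integral_cong) (auto simp: res_def indicator_def)
  also have "cmod \<dots> \<le> l2norm \<Omega> (res K f) * l2norm \<Omega> (res K g)" by (rule cmod_l2ip_le[OF res_L2 res_L2]) (use assms in auto)
  finally show ?thesis by (simp add: l2norm_res)
qed

lemma l2ip_eq_ip:
  assumes f: "f \<in> L2 \<Omega>" "g \<in> L2 \<Omega>" and K: "K \<in> sets lebesgue" "K \<subseteq> closure \<Omega>" shows "l2ip K f g = ip K f g"
proof -
  have "l2ip K f g = integral\<^sup>L (lebesgue_on \<Omega>) (\<lambda>x. indicator K x *\<^sub>R (\<Sum>i\<in>UNIV. f x $ i * cnj (g x $ i)))"
    unfolding l2ip_def by (rule integral_on_subset[OF borel_measurable_integrable[OF l2ip_integrable[OF f]] K])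
  also have "\<dots> = ip K f g"
    unfolding ip_def l2ip_def by (rule Bochner_Integration.integral_cong) (auto simp: res_def indicator_def)
  finally show ?thesis .
qed

lemma Re_ip:
  assumes f: "f \<in> L2 \<Omega>" "g \<in> L2 \<Omega>" and K: "K \<in> sets lebesgue"
  shows "Re (ip K f g) = integral\<^sup>L (lebesgue_on \<Omega>) (\<lambda>x. indicator K x * (f x \<bullet> g x))"
    and "integrable (lebesgue_on \<Omega>) (\<lambda>x. indicator K x * (f x \<bullet> g x))"
proof -
  note i = l2ip_integrable[OF res_L2[OF f(1) K] f(2)]
  have eq: "Re (\<Sum>i\<in>UNIV. res K f x $ i * cnj (g x $ i)) = indicator K x * (f x \<bullet> g x)" for x
    unfolding inner_vec_complex[symmetric] by (simp add: res_def)
  show "Re (ip K f g) = integral\<^sup>L (lebesgue_on \<Omega>) (\<lambda>x. indicator K x * (f x \<bullet> g x))"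
    unfolding ip_def l2ip_def eq[symmetric] by (rule integral_Re[symmetric, OF i])
  show "integrable (lebesgue_on \<Omega>) (\<lambda>x. indicator K x * (f x \<bullet> g x))"
    unfolding eq[symmetric] by (rule integrable_Re[OF i])
qed

lemma ip_sum: 
  assumes f: "f \<in> L2 \<Omega>" "g \<in> L2 \<Omega>" shows "ip \<Omega> f g = (\<Sum>K\<in>\<T>. ip K f g)"
proof -
  have r: "integral\<^sup>L (lebesgue_on \<Omega>) (\<lambda>x. indicator K x *\<^sub>R (\<Sum>i\<in>UNIV. f x $ i * cnj (g x $ i))) = ip K f g" for K
    unfolding ip_def l2ip_def by (rule Bochner_Integration.integral_cong) (auto simp: res_def indicator_def)
  have "ip \<Omega> f g = integral\<^sup>L (lebesgue_on \<Omega>) (\<lambda>x. \<Sum>i\<in>UNIV. f x $ i * cnj (g x $ i))"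
    unfolding r[symmetric] by (rule Bochner_Integration.integral_cong) (auto simp: indicator_def)
  also have "\<dots> = (\<Sum>K\<in>\<T>. ip K f g)" unfolding integral_elements[OF l2ip_integrable[OF f]] r ..
  finally show ?thesis .
qed

lemma mat_app_add: "mat_app M (\<lambda>x. f x + g x) = (\<lambda>x. mat_app M f x + mat_app M g x)"
  by (simp add: mat_app_capp capp_add fun_eq_iff)

lemma mat_app_cmult: "mat_app M (\<lambda>x. c *s f x) = (\<lambda>x. c *s mat_app M f x)"
  by (simp add: mat_app_capp capp_cmult fun_eq_iff)

lemma coefficientD:
  assumes "coefficient \<Omega> \<alpha> \<Lambda> M"
  shows "AE x in lebesgue. x \<in> \<Omega> \<longrightarrow> (\<forall>\<xi>. \<alpha> * (norm \<xi>)\<^sup>2 \<le> \<xi> \<bullet> (M x *v \<xi>)) \<and> (\<forall>\<xi>. norm (M x *v \<xi>) \<le> \<Lambda> * norm \<xi>)"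
    and "M \<in> borel_measurable (lebesgue_on \<Omega>)"
  using assms unfolding coefficient_def by (auto elim: AE_mp)

lemma mat_app_bound:
  assumes "coefficient \<Omega> \<alpha> \<Lambda> M"
  shows "AE x in lebesgue. x \<in> \<Omega> \<longrightarrow> norm (mat_app M f x) \<le> \<Lambda> * norm (f x)"
  using coefficientD(1)[OF assms]
proof eventually_elim
  case (elim x)
  then show ?case unfolding mat_app_capp using capp_bounded[of \<alpha> "M x" \<Lambda> "f x"] \<alpha> \<Lambda>0 by blast
qed

lemma mat_app_L2:
  assumes M: "coefficient \<Omega> \<alpha> \<Lambda> M" and f: "f \<in> L2 \<Omega>" shows "mat_app M f \<in> L2 \<Omega>"
proof (rule L2_mult_bounded[OF f, where B=\<Lambda>])
  have fm: "(\<lambda>x. f x $ j) \<in> borel_measurable (lebesgue_on \<Omega>)" for j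
    using L2_measurable[OF f] unfolding measurable_cvec_cong by blast
  have Mm: "(\<lambda>x. complex_of_real (M x $ i $ j)) \<in> borel_measurable (lebesgue_on \<Omega>)" for i j
    by (rule measurable_compose[OF coefficientD(2)[OF M]], rule borel_measurable_continuous_onI) (intro continuous_intros)
  show "mat_app M f \<in> borel_measurable (lebesgue_on \<Omega>)"
    unfolding measurable_cvec_cong
  proof
    fix i
    have "(\<lambda>x. mat_app M f x $ i) = (\<lambda>x. \<Sum>j\<in>UNIV. complex_of_real (M x $ i $ j) * f x $ j)"
      by (simp add: mat_app_def matrix_vector_mult_def)
    moreover have "(\<lambda>x. \<Sum>j\<in>UNIV. complex_of_real (M x $ i $ j) * f x $ j) \<in> borel_measurable (lebesgue_on \<Omega>)"
      by (intro borel_measurable_sum borel_measurable_times Mm fm)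
    ultimately show "(\<lambda>x. mat_app M f x $ i) \<in> borel_measurable (lebesgue_on \<Omega>)" by simp
  qed
  show "AE x in lebesgue_on \<Omega>. norm (mat_app M f x) \<le> \<Lambda> * norm (f x)"
    unfolding AE_lebesgue_on[OF \<Omega>_sets] by (rule mat_app_bound[OF M])
qed

lemma nrm_mat_app:
  assumes M: "coefficient \<Omega> \<alpha> \<Lambda> M" and f: "f \<in> L2 \<Omega>" and K: "K \<in> sets lebesgue" shows "nrm K (mat_app M f) \<le> \<Lambda>\<^sup>2 * nrm K f"
proof -
  have "AE x in lebesgue. x \<in> \<Omega> \<longrightarrow> x \<in> K \<longrightarrow> (norm (mat_app M f x))\<^sup>2 \<le> \<Lambda>\<^sup>2 * (norm (f x))\<^sup>2 + 0 * (norm (f x))\<^sup>2 + 0 * (norm (f x))\<^sup>2"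
    using mat_app_bound[OF M, of f]
  proof eventually_elim
    case (elim x)
    then show ?case using square_le_square_mult[of "norm (mat_app M f x)" \<Lambda> "norm (f x)"] by simp
  qed
  from nrm_le3[OF mat_app_L2[OF M f] f f f K this] show ?thesis by simp
qed

abbreviation B :: "point set \<Rightarrow> vfield \<Rightarrow> vfield \<Rightarrow> complex" where "B \<equiv> Bform \<mu> \<epsilon> \<omega> \<Omega>"

text \<open>The chosen \<open>curl\<close> is additive only almost everywhere. With arbitrary weak
  curls \<open>c\<close> and \<open>d\<close> in its place, the form inherits sesquilinearity from
  \<open>ip\<close>.\<close>

lemma B_repr:
  assumes v: "H0c \<Omega> v c" and \<psi>: "H0c \<Omega> \<psi> d" and K: "K = \<Omega> \<or> K \<in> \<T>"
  shows "B K v \<psi> = ip K (mat_app \<mu> c) d - complex_of_real (\<omega>\<^sup>2) * ip K (mat_app \<epsilon> v) \<psi>"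
proof -
  have Ks: "K \<in> sets lebesgue" "K \<subseteq> closure \<Omega>" using K \<Omega>_sets element_sets element_subset closure_subset by auto
  note ev = curl_eq(1,3)[OF v \<Omega>_sets] and e\<psi> = curl_eq(1,3)[OF \<psi> \<Omega>_sets]
  note L = H0cD[OF v] H0cD[OF \<psi>] H0curl_L2[OF ev(1)] H0curl_L2[OF e\<psi>(1)]
  have "ip K (mat_app \<mu> (curl \<Omega> v)) (curl \<Omega> \<psi>) = ip K (mat_app \<mu> c) d"
    unfolding ip_def
  proof (rule l2ip_ae_eq[OF \<Omega>_sets res_L2[OF mat_app_L2[OF coef_\<mu>] Ks(1)] _ _ e\<psi>(2)])
    show "ae_eq \<Omega> (res K (mat_app \<mu> (curl \<Omega> v))) (res K (mat_app \<mu> c))"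
      using ev(2) unfolding ae_eq_def res_def mat_app_def by (auto elim: AE_mp)
  qed (use L in auto)
  then show ?thesis unfolding Bform_def
    using l2ip_eq_ip[OF mat_app_L2[OF coef_\<mu> L(6)] L(8) Ks] l2ip_eq_ip[OF mat_app_L2[OF coef_\<epsilon> L(1)] L(3) Ks] by simp
qed

lemma element_or_sets: "K = \<Omega> \<or> K \<in> \<T> \<Longrightarrow> K \<in> sets lebesgue" using \<Omega>_sets element_sets by auto

lemma ip_add_left: "f \<in> L2 \<Omega> \<Longrightarrow> g \<in> L2 \<Omega> \<Longrightarrow> h \<in> L2 \<Omega> \<Longrightarrow> K \<in> sets lebesgue \<Longrightarrow> ip K (\<lambda>x. f x + g x) h = ip K f h + ip K g h"
  unfolding ip_def using l2ip_add_left[OF res_L2 res_L2, of f K g K h] by (simp add: res_def[abs_def] scaleR_add_right)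

lemma ip_add_right: "f \<in> L2 \<Omega> \<Longrightarrow> g \<in> L2 \<Omega> \<Longrightarrow> h \<in> L2 \<Omega> \<Longrightarrow> K \<in> sets lebesgue \<Longrightarrow> ip K h (\<lambda>x. f x + g x) = ip K h f + ip K h g"
  unfolding ip_def using l2ip_add_right[OF _ _ res_L2, of f g h K] by simp

lemma ip_cmult_left: "ip K (\<lambda>x. c *s f x) h = c * ip K f h"
proof -
  have "res K (\<lambda>x. c *s f x) = (\<lambda>x. c *s res K f x)" by (simp add: res_def fun_eq_iff indicator_def)
  then show ?thesis unfolding ip_def by (simp add: l2ip_cmult_left)
qed

lemma ip_cmult_right: "ip K h (\<lambda>x. c *s f x) = cnj c * ip K h f"
  unfolding ip_def by (simp add: l2ip_cmult_right)

lemma B_add_left: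
  assumes "u \<in> H0curl \<Omega>" "v \<in> H0curl \<Omega>" "\<psi> \<in> H0curl \<Omega>" "K = \<Omega> \<or> K \<in> \<T>"
  shows "B K (\<lambda>x. u x + v x) \<psi> = B K u \<psi> + B K v \<psi>"
  unfolding B_repr[OF curl_add[OF assms(1,2)] H0curl_H0c[OF assms(3)] assms(4)]
    B_repr[OF H0curl_H0c[OF assms(1)] H0curl_H0c[OF assms(3)] assms(4)] B_repr[OF H0curl_H0c[OF assms(2)] H0curl_H0c[OF assms(3)] assms(4)]
    mat_app_add
  by (simp add: ip_add_left mat_app_L2[OF coef_\<mu>] mat_app_L2[OF coef_\<epsilon>] H0curl_L2 assms element_or_sets[OF assms(4)] algebra_simps)

lemma B_add_right:
  assumes "u \<in> H0curl \<Omega>" "v \<in> H0curl \<Omega>" "\<psi> \<in> H0curl \<Omega>" "K = \<Omega> \<or> K \<in> \<T>"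
  shows "B K \<psi> (\<lambda>x. u x + v x) = B K \<psi> u + B K \<psi> v"
  unfolding B_repr[OF H0curl_H0c[OF assms(3)] curl_add[OF assms(1,2)] assms(4)]
    B_repr[OF H0curl_H0c[OF assms(3)] H0curl_H0c[OF assms(1)] assms(4)] B_repr[OF H0curl_H0c[OF assms(3)] H0curl_H0c[OF assms(2)] assms(4)]
  by (simp add: ip_add_right mat_app_L2[OF coef_\<mu>] mat_app_L2[OF coef_\<epsilon>] H0curl_L2 assms element_or_sets[OF assms(4)] algebra_simps)

lemma B_cmult_left:
  assumes "u \<in> H0curl \<Omega>" "\<psi> \<in> H0curl \<Omega>" "K = \<Omega> \<or> K \<in> \<T>" shows "B K (\<lambda>x. c *s u x) \<psi> = c * B K u \<psi>"
  unfolding B_repr[OF H0c_cmult[OF H0curl_H0c[OF assms(1)]] H0curl_H0c[OF assms(2)] assms(3)]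
    B_repr[OF H0curl_H0c[OF assms(1)] H0curl_H0c[OF assms(2)] assms(3)] mat_app_cmult
  by (simp add: ip_cmult_left algebra_simps)

lemma B_cmult_right:
  assumes "u \<in> H0curl \<Omega>" "\<psi> \<in> H0curl \<Omega>" "K = \<Omega> \<or> K \<in> \<T>" shows "B K \<psi> (\<lambda>x. c *s u x) = cnj c * B K \<psi> u"
  unfolding B_repr[OF H0curl_H0c[OF assms(2)] H0c_cmult[OF H0curl_H0c[OF assms(1)]] assms(3)]
    B_repr[OF H0curl_H0c[OF assms(2)] H0curl_H0c[OF assms(1)] assms(3)]
  by (simp add: ip_cmult_right algebra_simps)

lemma B_diff_left:
  assumes "u \<in> H0curl \<Omega>" "v \<in> H0curl \<Omega>" "\<psi> \<in> H0curl \<Omega>" "K = \<Omega> \<or> K \<in> \<T>"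
  shows "B K (\<lambda>x. u x - v x) \<psi> = B K u \<psi> - B K v \<psi>"
  using B_add_left[OF assms(1) H0curl_cmult[OF assms(2), of "-1"] assms(3,4)] B_cmult_left[OF assms(2,3,4), of "-1"]
  by (simp add: vector_smult_lneg)

lemma B_diff_right:
  assumes "u \<in> H0curl \<Omega>" "v \<in> H0curl \<Omega>" "\<psi> \<in> H0curl \<Omega>" "K = \<Omega> \<or> K \<in> \<T>"
  shows "B K \<psi> (\<lambda>x. u x - v x) = B K \<psi> u - B K \<psi> v"
  using B_add_right[OF assms(1) H0curl_cmult[OF assms(2), of "-1"] assms(3,4)] B_cmult_right[OF assms(2,3,4), of "-1"]
  by (simp add: vector_smult_lneg)

lemma B_sum:
  assumes "v \<in> H0curl \<Omega>" "\<psi> \<in> H0curl \<Omega>" shows "B \<Omega> v \<psi> = (\<Sum>K\<in>\<T>. B K v \<psi>)"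
proof -
  note h = H0curl_H0c[OF assms(1)] H0curl_H0c[OF assms(2)]
  have "B \<Omega> v \<psi> = (\<Sum>K\<in>\<T>. ip K (mat_app \<mu> (curl \<Omega> v)) (curl \<Omega> \<psi>) - complex_of_real (\<omega>\<^sup>2) * ip K (mat_app \<epsilon> v) \<psi>)"
    using ip_sum[OF mat_app_L2[OF coef_\<mu>] _, of "curl \<Omega> v" "curl \<Omega> \<psi>"] ip_sum[OF mat_app_L2[OF coef_\<epsilon>] _, of v \<psi>] H0curl_L2 assms
    by (simp add: B_repr[OF h] sum_subtractf sum_distrib_left)
  also have "\<dots> = (\<Sum>K\<in>\<T>. B K v \<psi>)" by (rule sum.cong[OF refl]) (simp add: B_repr[OF h])
  finally show ?thesis .
qed

lemma B_bound:
  assumes v: "v \<in> H0curl \<Omega>" and \<psi>: "\<psi> \<in> H0curl \<Omega>" and K: "K \<in> \<T>"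
  shows "cmod (B K v \<psi>) \<le> \<Lambda> * (sqrt (en K v) * sqrt (en K \<psi>))"
proof -
  note L = H0curl_L2[OF v] H0curl_L2[OF \<psi>] and s = element_sets[OF K]
  have b: "cmod (ip K (mat_app M f) g) \<le> \<Lambda> * (sqrt (nrm K f) * sqrt (nrm K g))" 
    if "coefficient \<Omega> \<alpha> \<Lambda> M" "f \<in> L2 \<Omega>" "g \<in> L2 \<Omega>" for M f g
  proof -
    have "cmod (ip K (mat_app M f) g) \<le> sqrt (nrm K (mat_app M f)) * sqrt (nrm K g)"
      by (rule ip_bound[OF mat_app_L2[OF that(1,2)] that(3) s])
    also have "\<dots> \<le> sqrt (\<Lambda>\<^sup>2 * nrm K f) * sqrt (nrm K g)"
      by (intro mult_right_mono real_sqrt_le_mono nrm_mat_app that s) simp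
    finally show ?thesis using \<Lambda>0 by (simp add: real_sqrt_mult)
  qed
  let ?a = "sqrt (nrm K (curl \<Omega> v))" and ?b = "sqrt (nrm K (curl \<Omega> \<psi>))" and ?c = "\<omega> * sqrt (nrm K v)" and ?d = "\<omega> * sqrt (nrm K \<psi>)"
  have "cmod (B K v \<psi>) \<le> cmod (ip K (mat_app \<mu> (curl \<Omega> v)) (curl \<Omega> \<psi>)) + cmod (complex_of_real (\<omega>\<^sup>2) * ip K (mat_app \<epsilon> v) \<psi>)"
    unfolding B_repr[OF H0curl_H0c[OF v] H0curl_H0c[OF \<psi>] disjI2[OF K]] by (rule norm_triangle_ineq4)
  also have "\<dots> \<le> \<Lambda> * (?a * ?b) + \<omega>\<^sup>2 * (\<Lambda> * (sqrt (nrm K v) * sqrt (nrm K \<psi>)))"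
    using b[OF coef_\<mu> L(2,4)] mult_left_mono[OF b[OF coef_\<epsilon> L(1,3)], of "\<omega>\<^sup>2"] by (simp add: norm_mult norm_power)
  also have "\<dots> = \<Lambda> * (?a * ?b + ?c * ?d)" by (simp add: power2_eq_square algebra_simps)
  also have "\<dots> \<le> \<Lambda> * (sqrt (en K v) * sqrt (en K \<psi>))"
  proof (rule mult_left_mono[OF _ \<Lambda>0])
    have "(?a * ?b + ?c * ?d)\<^sup>2 \<le> (?a\<^sup>2 + ?c\<^sup>2) * (?b\<^sup>2 + ?d\<^sup>2)"
      by (rule cauchy_schwarz_2)
    also have "\<dots> = en K v * en K \<psi>" by (simp add: en_def power_mult_distrib)
    finally have "?a * ?b + ?c * ?d \<le> sqrt (en K v * en K \<psi>)" by (rule real_le_rsqrt)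
    then show "?a * ?b + ?c * ?d \<le> sqrt (en K v) * sqrt (en K \<psi>)" by (simp add: real_sqrt_mult)
  qed
  finally show ?thesis .
qed

lemma B_cong:
  assumes "u \<in> H0curl \<Omega>" "v \<in> H0curl \<Omega>" "K \<in> \<T>" "\<psi> \<in> H0curl \<Omega>" "nrm K (\<lambda>x. u x - v x) = 0"
  shows "B K u \<psi> = B K v \<psi>" "B K \<psi> u = B K \<psi> v"
proof -
  have e: "en K (\<lambda>x. u x - v x) = 0" using en_eq_0[OF assms(3) H0curl_diff[OF assms(1,2)]] assms(5) by simp
  have "cmod (B K (\<lambda>x. u x - v x) \<psi>) \<le> 0" "cmod (B K \<psi> (\<lambda>x. u x - v x)) \<le> 0"
    using B_bound[OF H0curl_diff[OF assms(1,2)] assms(4,3)] B_bound[OF assms(4) H0curl_diff[OF assms(1,2)] assms(3)] e by auto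
  then show "B K u \<psi> = B K v \<psi>" "B K \<psi> u = B K \<psi> v"
    using B_diff_left[OF assms(1,2,4) disjI2[OF assms(3)]] B_diff_right[OF assms(1,2,4) disjI2[OF assms(3)]] by auto
qed

definition C2 :: real where "C2 = \<Lambda> + 2 * \<Lambda>\<^sup>2 / \<alpha> + \<alpha> / 2"

lemma C2_pos: "C2 > 0" unfolding C2_def using \<alpha> \<Lambda>0 by (intro add_nonneg_pos) auto

text \<open>The two fields share their curl, so the curl term is elliptic. In the mass term their
  gradient parts have opposite signs and \<open>capp_sign_flip\<close> applies, at the price of the
  \<open>z\<close> term. Both orders of the arguments are covered since the coefficients may be
  nonsymmetric.\<close>

lemma B_coercive:
  assumes w: "w \<in> H0curl \<Omega>" and \<psi>: "\<psi> \<in> H0curl \<Omega>" and z: "z \<in> L2 \<Omega>" and g: "g \<in> L2 \<Omega>"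
    and wz: "ae_eq \<Omega> w (\<lambda>x. z x + g x)" and \<psi>z: "ae_eq \<Omega> \<psi> (\<lambda>x. z x - g x)" and c: "ae_eq \<Omega> (curl \<Omega> \<psi>) (curl \<Omega> w)"
    and K: "K \<in> \<T>"
  shows "\<alpha> / 4 * en K w \<le> Re (B K w \<psi>) + C2 * \<omega>\<^sup>2 * nrm K z" (is ?A)
    and "\<alpha> / 4 * en K w \<le> Re (B K \<psi> w) + C2 * \<omega>\<^sup>2 * nrm K z" (is ?B)
proof -
  note s = element_sets[OF K]
  let ?c = "curl \<Omega> w"
  note wL = H0curl_L2[OF w] and \<psi>L = H0curl_L2[OF \<psi>]
  note Lmc = mat_app_L2[OF coef_\<mu> wL(2)]
  have h\<psi>: "H0c \<Omega> \<psi> ?c" by (rule H0c_cong[OF open_\<Omega> H0curl_H0c[OF \<psi>] ae_eq_refl c])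
  have 1: "\<alpha> / 4 * nrm K ?c \<le> Re (ip K (mat_app \<mu> ?c) ?c)"
  proof -
    have "\<alpha> / 4 * nrm K ?c = integral\<^sup>L (lebesgue_on \<Omega>) (\<lambda>x. \<alpha> / 4 * (indicator K x * (norm (?c x))\<^sup>2))" by (simp add: nrm_def)
    also have "\<dots> \<le> integral\<^sup>L (lebesgue_on \<Omega>) (\<lambda>x. indicator K x * (mat_app \<mu> ?c x \<bullet> ?c x))"
    proof (rule integral_mono_AE)
      show "AE x in lebesgue_on \<Omega>. \<alpha> / 4 * (indicator K x * (norm (?c x))\<^sup>2) \<le> indicator K x * (mat_app \<mu> ?c x \<bullet> ?c x)"
        unfolding AE_lebesgue_on[OF \<Omega>_sets] using coefficientD(1)[OF coef_\<mu>]
      proof eventually_elim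
        case (elim x)
        show ?case
        proof
          assume x: "x \<in> \<Omega>"
          have "\<alpha> * (norm (?c x))\<^sup>2 \<le> mat_app \<mu> ?c x \<bullet> ?c x"
            unfolding mat_app_capp using elim x \<alpha> \<Lambda>0 by (intro capp_elliptic[of \<alpha> _ \<Lambda>]) auto
          moreover have "\<alpha> / 4 * (norm (?c x))\<^sup>2 \<le> \<alpha> * (norm (?c x))\<^sup>2" using \<alpha> by (intro mult_right_mono) auto
          ultimately show "\<alpha> / 4 * (indicator K x * (norm (?c x))\<^sup>2) \<le> indicator K x * (mat_app \<mu> ?c x \<bullet> ?c x)"
            by (auto simp: indicator_def)
        qed
      qed
    qed (use Re_ip(2)[OF Lmc wL(2) s] nrm_integrable[OF wL(2) s] in auto)
    finally show ?thesis unfolding Re_ip(1)[OF Lmc wL(2) s] .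
  qed
  \<comment> \<open>The sign \<open>t\<close> is 1 for the pair \<open>w, \<psi>\<close> and -1 for
    the reversed pair.\<close>
  have 2: "Re (ip K (mat_app \<epsilon> f) h) \<le> C2 * nrm K z - \<alpha> / 4 * nrm K w"
    if t: "t = 1 \<or> t = -1" and f: "f \<in> L2 \<Omega>" and h: "h \<in> L2 \<Omega>" and fh: "ae_eq \<Omega> f (\<lambda>x. z x + t *\<^sub>R g x)" "ae_eq \<Omega> h (\<lambda>x. z x - t *\<^sub>R g x)" for t f h
  proof -
    note Lf = mat_app_L2[OF coef_\<epsilon> f]
    have "Re (ip K (mat_app \<epsilon> f) h) \<le> integral\<^sup>L (lebesgue_on \<Omega>) (\<lambda>x. C2 * (indicator K x * (norm (z x))\<^sup>2) - \<alpha> / 4 * (indicator K x * (norm (w x))\<^sup>2))"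
      unfolding Re_ip(1)[OF Lf h s]
    proof (rule integral_mono_AE)
      show "AE x in lebesgue_on \<Omega>. indicator K x * (mat_app \<epsilon> f x \<bullet> h x) \<le> C2 * (indicator K x * (norm (z x))\<^sup>2) - \<alpha> / 4 * (indicator K x * (norm (w x))\<^sup>2)"
        unfolding AE_lebesgue_on[OF \<Omega>_sets]
        using coefficientD(1)[OF coef_\<epsilon>] fh[unfolded ae_eq_def] wz[unfolded ae_eq_def]
      proof eventually_elim
        case (elim x)
        show ?case
        proof
          assume x: "x \<in> \<Omega>"
          have "mat_app \<epsilon> f x \<bullet> h x \<le> C2 * (norm (z x))\<^sup>2 - \<alpha> / 4 * (norm (w x))\<^sup>2"
            using capp_sign_flip[of \<alpha> "\<epsilon> x" \<Lambda> t "z x" "g x"] elim x \<alpha> \<Lambda>0 t by (simp add: mat_app_capp C2_def)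
          then show "indicator K x * (mat_app \<epsilon> f x \<bullet> h x) \<le> C2 * (indicator K x * (norm (z x))\<^sup>2) - \<alpha> / 4 * (indicator K x * (norm (w x))\<^sup>2)"
            by (auto simp: indicator_def)
        qed
      qed
    qed (use Re_ip(2)[OF Lf h s] nrm_integrable[OF wL(1) s] nrm_integrable[OF z s] in auto)
    also have "\<dots> = C2 * nrm K z - \<alpha> / 4 * nrm K w"
      using nrm_integrable[OF wL(1) s] nrm_integrable[OF z s] by (simp add: nrm_def)
    finally show ?thesis .
  qed
  have i1: "Re (ip K (mat_app \<epsilon> w) \<psi>) \<le> C2 * nrm K z - \<alpha> / 4 * nrm K w"
    by (rule 2[of 1]) (use wL \<psi>L wz \<psi>z in auto)
  have i2: "Re (ip K (mat_app \<epsilon> \<psi>) w) \<le> C2 * nrm K z - \<alpha> / 4 * nrm K w"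
    by (rule 2[of "-1"]) (use wL \<psi>L wz \<psi>z in auto)
  have r: "Re (complex_of_real (\<omega>\<^sup>2) * y) = \<omega>\<^sup>2 * Re y" for y by simp
  have m: "\<omega>\<^sup>2 * y \<le> \<omega>\<^sup>2 * (C2 * nrm K z - \<alpha> / 4 * nrm K w)" if "y \<le> C2 * nrm K z - \<alpha> / 4 * nrm K w" for y
    using that by (rule mult_left_mono) simp
  show ?A unfolding B_repr[OF H0curl_H0c[OF w] h\<psi> disjI2[OF K]] en_def minus_complex.sel r
    using 1 m[OF i1] by (simp add: algebra_simps)
  show ?B unfolding B_repr[OF h\<psi> H0curl_H0c[OF w] disjI2[OF K]] en_def minus_complex.sel r
    using 1 m[OF i2] by (simp add: algebra_simps)
qed

end

lemma sum_sqrt_mult_le: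
  fixes f g :: "'a \<Rightarrow> real" assumes "\<And>i. i \<in> I \<Longrightarrow> 0 \<le> f i" "\<And>i. i \<in> I \<Longrightarrow> 0 \<le> g i"
  shows "(\<Sum>i\<in>I. sqrt (f i) * sqrt (g i)) \<le> sqrt (\<Sum>i\<in>I. f i) * sqrt (\<Sum>i\<in>I. g i)"
  using L2_set_mult_ineq[of "\<lambda>i. sqrt (f i)" "\<lambda>i. sqrt (g i)" I] assms by (simp add: L2_set_def cong: sum.cong)

section \<open>Energies over sets of elements\<close>

context mesh_freq
begin

definition es :: "point set set \<Rightarrow> vfield \<Rightarrow> real" where "es \<A> v = (\<Sum>K\<in>\<A>. en K v)"

lemma es_nonneg [simp]: "0 \<le> es \<A> v" by (simp add: es_def sum_nonneg)

lemma es_mono: "\<A> \<subseteq> \<B> \<Longrightarrow> \<B> \<subseteq> \<T> \<Longrightarrow> es \<A> v \<le> es \<B> v"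
  unfolding es_def by (rule sum_mono2) (auto intro: finite_subset[OF _ finite_mesh])

lemma es_member: "K \<in> \<A> \<Longrightarrow> \<A> \<subseteq> \<T> \<Longrightarrow> en K v \<le> es \<A> v"
  using es_mono[of "{K}" \<A> v] by (simp add: es_def)

lemma es_layers:
  "\<A> \<subseteq> \<T> \<Longrightarrow> \<B> \<subseteq> \<T> \<Longrightarrow> (\<And>K. K \<in> \<A> \<Longrightarrow> layer \<T> j K \<subseteq> \<B>) \<Longrightarrow> (\<Sum>K\<in>\<A>. es (layer \<T> j K) v) \<le> N j * es \<B> v"
  unfolding es_def by (rule sum_layers) auto

lemma es_layers_all: "(\<Sum>K\<in>\<T>. es (layer \<T> j K) v) \<le> N j * es \<T> v"
  by (rule es_layers) (use layer_subset in auto)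

lemma es_bound_layers:
  assumes "\<And>K. K \<in> \<A> \<Longrightarrow> en K u \<le> c * es (layer \<T> j K) v" "0 \<le> c" "\<A> \<subseteq> \<T>" "\<B> \<subseteq> \<T>"
    "\<And>K. K \<in> \<A> \<Longrightarrow> layer \<T> j K \<subseteq> \<B>"
  shows "es \<A> u \<le> c * N j * es \<B> v"
proof -
  have "es \<A> u \<le> (\<Sum>K\<in>\<A>. c * es (layer \<T> j K) v)" unfolding es_def[of _ u] by (intro sum_mono assms(1))
  also have "\<dots> = c * (\<Sum>K\<in>\<A>. es (layer \<T> j K) v)" by (simp only: sum_distrib_left)
  also have "\<dots> \<le> c * (N j * es \<B> v)" by (intro mult_left_mono es_layers assms)
  finally show ?thesis by (simp only: mult.assoc)
qed

lemma H0curl_zero: "(\<lambda>x. 0) \<in> H0curl \<Omega>" using curl_eq(1)[OF H0c_zero \<Omega>_sets] .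

lemma en_zero [simp]: "en K (\<lambda>x. 0) = 0" if "K \<in> \<T>"
  using en_eq_0[OF that H0curl_zero] by (simp add: nrm_def)

lemma H0curl_sum: "finite I \<Longrightarrow> (\<And>i. i \<in> I \<Longrightarrow> f i \<in> H0curl \<Omega>) \<Longrightarrow> (\<lambda>x. \<Sum>i\<in>I. f i x) \<in> H0curl \<Omega>"
  by (induction I rule: finite_induct) (auto intro: H0curl_zero H0curl_add)

end

context lodform
begin

lemma sqrt_nrm_add:
  fixes f g :: vfield
  assumes "f \<in> L2 \<Omega>" "g \<in> L2 \<Omega>" "K \<in> sets lebesgue" shows "sqrt (nrm K (\<lambda>x. f x + g x)) \<le> sqrt (nrm K f) + sqrt (nrm K g)"
  using l2norm_triangle[OF res_L2[OF assms(1,3)] res_L2[OF assms(2,3)]] unfolding l2norm_res[symmetric]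
  by (simp add: res_def[abs_def] scaleR_add_right)

lemma sqrt_en_add:
  assumes u: "u \<in> H0curl \<Omega>" and v: "v \<in> H0curl \<Omega>" and K: "K \<in> \<T>"
  shows "sqrt (en K (\<lambda>x. u x + v x)) \<le> sqrt (en K u) + sqrt (en K v)"
proof -
  note s = element_sets[OF K] and uL = H0curl_L2[OF u] and vL = H0curl_L2[OF v]
  have e: "en K w = (sqrt (nrm K (curl \<Omega> w)))\<^sup>2 + (\<omega> * sqrt (nrm K w))\<^sup>2" for w by (simp add: en_def power_mult_distrib)
  have c: "sqrt (nrm K (curl \<Omega> (\<lambda>x. u x + v x))) \<le> sqrt (nrm K (curl \<Omega> u)) + sqrt (nrm K (curl \<Omega> v))"
    unfolding curl_eq(2)[OF curl_add[OF u v] s] by (rule sqrt_nrm_add[OF uL(2) vL(2) s])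
  have l: "\<omega> * sqrt (nrm K (\<lambda>x. u x + v x)) \<le> \<omega> * sqrt (nrm K u) + \<omega> * sqrt (nrm K v)"
    using mult_left_mono[OF sqrt_nrm_add[OF uL(1) vL(1) s], of \<omega>] \<omega> by (simp add: distrib_left)
  have "en K (\<lambda>x. u x + v x) \<le> (sqrt (nrm K (curl \<Omega> u)) + sqrt (nrm K (curl \<Omega> v)))\<^sup>2 + (\<omega> * sqrt (nrm K u) + \<omega> * sqrt (nrm K v))\<^sup>2"
    unfolding e[of "\<lambda>x. u x + v x"] using c l \<omega> by (intro add_mono power_mono) auto
  then have "sqrt (en K (\<lambda>x. u x + v x)) \<le> sqrt ((sqrt (nrm K (curl \<Omega> u)) + sqrt (nrm K (curl \<Omega> v)))\<^sup>2 + (\<omega> * sqrt (nrm K u) + \<omega> * sqrt (nrm K v))\<^sup>2)"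
    by (rule real_sqrt_le_mono)
  also have "\<dots> \<le> sqrt (en K u) + sqrt (en K v)" unfolding e[of u] e[of v] by (rule real_sqrt_sum_squares_triangle_ineq)
  finally show ?thesis .
qed

lemma sqrt_es_add:
  assumes u: "u \<in> H0curl \<Omega>" and v: "v \<in> H0curl \<Omega>" and A: "\<A> \<subseteq> \<T>"
  shows "sqrt (es \<A> (\<lambda>x. u x + v x)) \<le> sqrt (es \<A> u) + sqrt (es \<A> v)"
proof -
  have e: "sqrt (es \<A> w) = L2_set (\<lambda>K. sqrt (en K w)) \<A>" for w by (simp add: es_def L2_set_def)
  have "L2_set (\<lambda>K. sqrt (en K (\<lambda>x. u x + v x))) \<A> \<le> L2_set (\<lambda>K. sqrt (en K u) + sqrt (en K v)) \<A>"
    using sqrt_en_add[OF u v] A by (intro L2_set_mono) auto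
  also have "\<dots> \<le> L2_set (\<lambda>K. sqrt (en K u)) \<A> + L2_set (\<lambda>K. sqrt (en K v)) \<A>" by (rule L2_set_triangle_ineq)
  finally show ?thesis unfolding e .
qed

lemma en_minus:
  assumes u: "u \<in> H0curl \<Omega>" and K: "K \<in> \<T>" shows "en K (\<lambda>x. - u x) = en K u"
  using curl_eq(2)[OF H0c_cmult[OF H0curl_H0c[OF u], where a="-1"] element_sets[OF K]] 
  by (simp add: en_def nrm_minus vector_smult_lneg)

lemma H0curl_minus: "u \<in> H0curl \<Omega> \<Longrightarrow> (\<lambda>x. - u x) \<in> H0curl \<Omega>"
  using H0curl_cmult[of u "-1"] by (simp add: vector_smult_lneg)

lemma es_minus: "u \<in> H0curl \<Omega> \<Longrightarrow> \<A> \<subseteq> \<T> \<Longrightarrow> es \<A> (\<lambda>x. - u x) = es \<A> u"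
  unfolding es_def by (intro sum.cong refl en_minus) auto

lemma sqrt_es_diff:
  assumes u: "u \<in> H0curl \<Omega>" and v: "v \<in> H0curl \<Omega>" and A: "\<A> \<subseteq> \<T>"
  shows "sqrt (es \<A> (\<lambda>x. u x - v x)) \<le> sqrt (es \<A> u) + sqrt (es \<A> v)"
  using sqrt_es_add[OF u H0curl_minus[OF v] A] es_minus[OF v A] by simp

lemma sqrt_en_sum:
  assumes "finite I" "\<And>i. i \<in> I \<Longrightarrow> f i \<in> H0curl \<Omega>" "K \<in> \<T>"
  shows "sqrt (en K (\<lambda>x. \<Sum>i\<in>I. f i x)) \<le> (\<Sum>i\<in>I. sqrt (en K (f i)))"
  using assms(1,2)
proof (induction I rule: finite_induct)
  case empty
  then show ?case using assms(3) by simp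
next
  case (insert i I)
  have "sqrt (en K (\<lambda>x. f i x + (\<Sum>i\<in>I. f i x))) \<le> sqrt (en K (f i)) + sqrt (en K (\<lambda>x. \<Sum>i\<in>I. f i x))"
    using insert by (intro sqrt_en_add H0curl_sum assms(3)) auto
  also have "\<dots> \<le> sqrt (en K (f i)) + (\<Sum>i\<in>I. sqrt (en K (f i)))" using insert by auto
  finally show ?case using insert(1,2) by simp
qed

text \<open>On a given element only the fields of at most \<open>N j\<close> elements are nonzero;
  Cauchy-Schwarz for that many summands gives the factor.\<close>

lemma es_sum_overlap:
  assumes f: "\<And>T. T \<in> \<T> \<Longrightarrow> f T \<in> H0curl \<Omega>" and z: "\<And>T K. T \<in> \<T> \<Longrightarrow> K \<in> \<T> - layer \<T> j T \<Longrightarrow> nrm K (f T) = 0"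
  shows "es \<T> (\<lambda>x. \<Sum>T\<in>\<T>. f T x) \<le> N j * (\<Sum>T\<in>\<T>. es \<T> (f T))"
proof -
  have "en K (\<lambda>x. \<Sum>T\<in>\<T>. f T x) \<le> N j * (\<Sum>T\<in>\<T>. en K (f T))" if K: "K \<in> \<T>" for K
  proof -
    have "sqrt (en K (\<lambda>x. \<Sum>T\<in>\<T>. f T x)) \<le> (\<Sum>T\<in>\<T>. sqrt (en K (f T)))" by (rule sqrt_en_sum[OF finite_mesh f K])
    also have "\<dots> = (\<Sum>T\<in>layer \<T> j K. sqrt (en K (f T)))"
    proof (rule sum.mono_neutral_right[OF finite_mesh layer_subset[OF K]], rule ballI)
      fix T assume T: "T \<in> \<T> - layer \<T> j K"
      then have "K \<notin> layer \<T> j T" using layer_sym[of T K j] by blast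
      then show "sqrt (en K (f T)) = 0" using z[of T K] en_eq_0[OF K f, of T] T K by simp
    qed
    finally have "(sqrt (en K (\<lambda>x. \<Sum>T\<in>\<T>. f T x)))\<^sup>2 \<le> (\<Sum>T\<in>layer \<T> j K. sqrt (en K (f T)))\<^sup>2" by (intro power_mono) auto
    also have "\<dots> \<le> (\<Sum>T\<in>layer \<T> j K. (sqrt (en K (f T)))\<^sup>2) * card (layer \<T> j K)" by (rule sum_squared_le_sum_of_squares)
    also have "\<dots> \<le> (\<Sum>T\<in>\<T>. en K (f T)) * N j" unfolding N_def
      using layer_subset[OF K] finite_mesh by (intro mult_mono card_layer[OF K] sum_nonneg) (auto intro!: sum_mono2)
    finally show ?thesis by (simp add: mult.commute)
  qed
  then have "es \<T> (\<lambda>x. \<Sum>T\<in>\<T>. f T x) \<le> (\<Sum>K\<in>\<T>. N j * (\<Sum>T\<in>\<T>. en K (f T)))" unfolding es_def by (rule sum_mono)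
  also have "\<dots> = N j * (\<Sum>T\<in>\<T>. es \<T> (f T))" unfolding es_def sum_distrib_left[symmetric] by (subst sum.swap) simp
  finally show ?thesis .
qed

lemma B_zero: "K \<in> \<T> \<Longrightarrow> v \<in> H0curl \<Omega> \<Longrightarrow> \<psi> \<in> H0curl \<Omega> \<Longrightarrow> nrm K v = 0 \<or> nrm K \<psi> = 0 \<Longrightarrow> B K v \<psi> = 0"
  using B_bound[of v \<psi> K] en_eq_0[of K v] en_eq_0[of K \<psi>] by auto

lemma B_sum_bound:
  assumes "v \<in> H0curl \<Omega>" "\<psi> \<in> H0curl \<Omega>" "\<A> \<subseteq> \<T>"
  shows "cmod (\<Sum>K\<in>\<A>. B K v \<psi>) \<le> \<Lambda> * (sqrt (es \<A> v) * sqrt (es \<A> \<psi>))"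
proof -
  have "cmod (\<Sum>K\<in>\<A>. B K v \<psi>) \<le> (\<Sum>K\<in>\<A>. \<Lambda> * (sqrt (en K v) * sqrt (en K \<psi>)))"
    by (rule order_trans[OF norm_sum]) (use B_bound[OF assms(1,2)] assms(3) in \<open>auto intro!: sum_mono\<close>)
  also have "\<dots> = \<Lambda> * (\<Sum>K\<in>\<A>. sqrt (en K v) * sqrt (en K \<psi>))" by (simp add: sum_distrib_left)
  also have "\<dots> \<le> \<Lambda> * (sqrt (es \<A> v) * sqrt (es \<A> \<psi>))"
    unfolding es_def by (intro mult_left_mono[OF _ \<Lambda>0] sum_sqrt_mult_le) auto
  finally show ?thesis .
qed

lemma B_bound_all: "v \<in> H0curl \<Omega> \<Longrightarrow> \<psi> \<in> H0curl \<Omega> \<Longrightarrow> cmod (B \<Omega> v \<psi>) \<le> \<Lambda> * (sqrt (es \<T> v) * sqrt (es \<T> \<psi>))"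
  using B_sum_bound[of v \<psi> \<T>] B_sum by simp

lemma B_zero_left: "\<psi> \<in> H0curl \<Omega> \<Longrightarrow> B \<Omega> (\<lambda>x. 0) \<psi> = 0"
  using B_cmult_left[OF H0curl_zero, of \<psi> \<Omega> 0] by simp

lemma B_sum_left:
  assumes "finite I" "\<And>i. i \<in> I \<Longrightarrow> f i \<in> H0curl \<Omega>" "\<psi> \<in> H0curl \<Omega>"
  shows "B \<Omega> (\<lambda>x. \<Sum>i\<in>I. f i x) \<psi> = (\<Sum>i\<in>I. B \<Omega> (f i) \<psi>)"
  using assms(1,2)
proof (induction I rule: finite_induct)
  case empty
  then show ?case using B_zero_left[OF assms(3)] by simp
next
  case (insert i I)
  then show ?case using B_add_left[of "f i" "\<lambda>x. \<Sum>i\<in>I. f i x" \<psi> \<Omega>] H0curl_sum[of I f] assms(3) by simp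
qed

end

context fw_freq
begin

lemma es_\<pi>:
  assumes v: "v \<in> V D" and A: "\<A> \<subseteq> \<T>" "\<B> \<subseteq> \<T>" "\<And>K. K \<in> \<A> \<Longrightarrow> layer \<T> 1 K \<subseteq> \<B>"
  shows "es \<A> (\<pi> v) \<le> 3 * A * N 1 * es \<B> v"
  by (rule es_bound_layers) (use en_\<pi>[OF v] A A1 in \<open>auto simp: es_def\<close>)

text \<open>\<open>2 A\<close> bounds the contribution of \<open>z\<close>, the rest that of
  \<open>\<pi> z\<close>: inside the bracket \<open>A * N 3\<close> stems from \<open>z\<close> on
  the neighbours and 1 from \<open>H\<close> times its curl.\<close>

definition D3 :: real where "D3 = 2 * A + 4 * A * (A * N 3 + 1)"

lemma D3_pos: "D3 > 0" unfolding D3_def using A1 N_ge_1[of 3] by (intro add_pos_nonneg mult_nonneg_nonneg) auto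

lemma P_H0curl: "X \<in> H0curl \<Omega> \<Longrightarrow> P X \<in> H0curl \<Omega>"
  unfolding P_def[abs_def] by (intro H0curl_diff \<pi>_H0curl)

text \<open>Not only \<open>z\<close> but also its projection is of size \<open>H\<close>, as the
  stability of \<open>\<pi>\<close> carries a factor \<open>H\<close> in front of the curl. This is
  where the small factor \<open>(\<omega> H)^2\<close> arises.\<close>

lemma P_z_bound:
  assumes dc: "decomp D \<D> A w z \<theta> g" and w: "w \<in> H0curl \<Omega>" and K: "K \<in> \<T>"
  shows "\<omega>\<^sup>2 * nrm K (P z) \<le> D3 * (\<omega> * H)\<^sup>2 * es (layer \<T> 4 K) w"
proof -
  let ?n = "\<lambda>K. nrm K (curl \<Omega> w)"
  let ?S = "\<Sum>K'\<in>layer \<T> 4 K. ?n K'"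
  have zc: "H0c \<Omega> z (curl \<Omega> w)" and zV: "z \<in> V D" and zb: "\<And>K. K \<in> \<T> \<Longrightarrow> nrm K z \<le> A * H\<^sup>2 * (\<Sum>K'\<in>layer \<T> 3 K. ?n K')"
    using dc by (auto simp: decomp_def)
  note zH = V_H0curl[OF zV]
  have "(\<Sum>K'\<in>layer \<T> 3 K. ?n K') \<le> ?S" by (intro sum_mono2 layer_finite[OF K] layer_mono[OF K]) auto
  then have 1: "nrm K z \<le> A * H\<^sup>2 * ?S" using order_trans[OF zb[OF K] mult_left_mono[of _ ?S "A * H\<^sup>2"]] A1 by simp
  have "(\<Sum>K'\<in>layer \<T> 1 K. nrm K' z) \<le> (\<Sum>K'\<in>layer \<T> 1 K. A * H\<^sup>2 * (\<Sum>K''\<in>layer \<T> 3 K'. ?n K''))"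
    using layer_subset[OF K] by (intro sum_mono zb) blast
  also have "\<dots> = A * H\<^sup>2 * (\<Sum>K'\<in>layer \<T> 1 K. \<Sum>K''\<in>layer \<T> 3 K'. ?n K'')" by (simp only: sum_distrib_left)
  also have "\<dots> \<le> A * H\<^sup>2 * (N 3 * ?S)"
  proof (rule mult_left_mono[OF sum_layers[OF layer_subset[OF K] layer_subset[OF K]]])
    show "layer \<T> 3 K' \<subseteq> layer \<T> 4 K" if "K' \<in> layer \<T> 1 K" for K' using layer_trans[OF that, of _ 3] by auto
  qed (use A1 in auto)
  finally have 2: "(\<Sum>K'\<in>layer \<T> 1 K. nrm K' z) \<le> A * H\<^sup>2 * (N 3 * ?S)" .
  have "(\<Sum>K'\<in>layer \<T> 1 K. nrm K' (curl \<Omega> z)) = (\<Sum>K'\<in>layer \<T> 1 K. ?n K')"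
    using curl_eq(2)[OF zc element_sets] layer_subset[OF K] by (intro sum.cong) auto
  also have "\<dots> \<le> ?S" by (intro sum_mono2 layer_finite[OF K] layer_mono[OF K]) auto
  finally have 3: "H\<^sup>2 * (\<Sum>K'\<in>layer \<T> 1 K. nrm K' (curl \<Omega> z)) \<le> H\<^sup>2 * ?S" by (intro mult_left_mono) auto
  have "nrm K (\<pi> z) \<le> 2 * A * (\<Sum>K'\<in>layer \<T> 1 K. nrm K' z + H\<^sup>2 * nrm K' (curl \<Omega> z))" by (rule \<pi>_stable(1)[OF zV K])
  also have "\<dots> = 2 * A * ((\<Sum>K'\<in>layer \<T> 1 K. nrm K' z) + H\<^sup>2 * (\<Sum>K'\<in>layer \<T> 1 K. nrm K' (curl \<Omega> z)))"
    by (simp add: sum.distrib sum_distrib_left)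
  also have "\<dots> \<le> 2 * A * (A * H\<^sup>2 * (N 3 * ?S) + H\<^sup>2 * ?S)" using A1 by (intro mult_left_mono[OF add_mono[OF 2 3]]) auto
  finally have 4: "nrm K (\<pi> z) \<le> 2 * A * (A * H\<^sup>2 * (N 3 * ?S) + H\<^sup>2 * ?S)" .
  have "nrm K (P z) \<le> 2 * nrm K z + 2 * nrm K (\<pi> z)"
    unfolding P_def[abs_def] by (rule nrm_diff[OF H0curl_L2(1)[OF zH] H0curl_L2(1)[OF \<pi>_H0curl[OF zH]] element_sets[OF K]])
  also have "\<dots> \<le> 2 * (A * H\<^sup>2 * ?S) + 2 * (2 * A * (A * H\<^sup>2 * (N 3 * ?S) + H\<^sup>2 * ?S))" using 1 4 by linarith
  also have "\<dots> = D3 * H\<^sup>2 * ?S" by (simp add: D3_def algebra_simps)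
  finally have "\<omega>\<^sup>2 * nrm K (P z) \<le> \<omega>\<^sup>2 * (D3 * H\<^sup>2 * ?S)" by (rule mult_left_mono) simp
  also have "\<dots> = D3 * (\<omega> * H)\<^sup>2 * ?S" by (simp add: power_mult_distrib)
  also have "\<dots> \<le> D3 * (\<omega> * H)\<^sup>2 * es (layer \<T> 4 K) w"
    unfolding es_def using D3_pos layer_sum_en(1)[OF K] by (intro mult_left_mono) auto
  finally show ?thesis .
qed

end

section \<open>Correctors and their decay\<close>

text \<open>The resolution condition. Summed over overlapping layers, the perturbation costs at most
  a sixteenth of \<open>\<alpha>\<close> against the coercivity \<open>\<alpha> / 4\<close>; this
  leaves at least \<open>\<alpha> / 8\<close> and makes the decay factor below 1.\<close>

locale corrector = lodform + fw_freq +
  assumes small: "C2 * D3 * N 4 * (\<omega> * H)\<^sup>2 \<le> \<alpha> / 16"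
begin

abbreviation "X0 \<equiv> Xf (-1) (\<lambda>_. 1) (\<lambda>_. 0)"

definition \<delta> :: real where "\<delta> = C2 * (D3 * (\<omega> * H)\<^sup>2)"

lemma \<delta>: "0 \<le> \<delta>" "\<delta> * N 4 \<le> \<alpha> / 16"
  using small D3_pos C2_pos by (auto simp: \<delta>_def mult_ac)

text \<open>The field \<open>w\<close> is its own kernel part, so it equals
  \<open>P z + P g\<close>, while the test function is \<open>P z - P g\<close>. As
  \<open>P g\<close> is curl-free, both have the curl of \<open>w\<close> and
  \<open>B_coercive\<close> applies with \<open>P z\<close> in the role of the small part.\<close>

lemma coercive_local:
  assumes w: "w \<in> W" and dc: "decomp D \<D> A w z \<theta> g" and g0: "H0c \<Omega> (\<pi> g) (\<lambda>x. 0)" and K: "K \<in> \<T>"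
  shows "\<alpha> / 4 * en K w \<le> Re (B K w (P (X0 z \<theta> g))) + \<delta> * es (layer \<T> 4 K) w"
    and "\<alpha> / 4 * en K w \<le> Re (B K (P (X0 z \<theta> g)) w) + \<delta> * es (layer \<T> 4 K) w"
proof -
  let ?X = "X0 z \<theta> g" let ?\<psi> = "P ?X"
  have wV: "w \<in> V D" and w0: "ae_eq \<Omega> (\<pi> w) (\<lambda>x. 0)" using w by (auto simp: W_def)
  have zV: "z \<in> V D" and gV: "g \<in> V D" and wz: "ae_eq \<Omega> w (\<lambda>x. z x + g x)" and \<theta>g: "H0g \<Omega> \<theta> g" using dc by (auto simp: decomp_def)
  note wH = V_H0curl[OF wV] and zH = V_H0curl[OF zV] and gH = V_H0curl[OF gV]
  have X: "?X = (\<lambda>x. z x - g x)" by (simp add: Xf_def[abs_def] cvec_def zero_vec_def[symmetric])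
  have XV: "?X \<in> V D" by (rule Xf_V[OF dc cut_one _ sub]) simp
  have \<psi>H: "?\<psi> \<in> H0curl \<Omega>" by (rule P_H0curl[OF V_H0curl[OF XV]])
  have \<pi>w: "ae_eq \<Omega> (\<pi> w) (\<lambda>x. \<pi> z x + \<pi> g x)"
    by (rule ae_eq_trans[OF \<pi>_cong[OF wH H0curl_add[OF zH gH] wz] \<pi>_add[OF zH gH]])
  have wP: "ae_eq \<Omega> w (\<lambda>x. P z x + P g x)"
    using wz w0 \<pi>w unfolding ae_eq_def P_def by eventually_elim (auto simp: algebra_simps)
  have \<psi>P: "ae_eq \<Omega> ?\<psi> (\<lambda>x. P z x - P g x)"
    using \<pi>_diff[OF zH gH] unfolding X ae_eq_def P_def by eventually_elim auto
  have Pg: "H0c \<Omega> (P g) (\<lambda>x. 0)"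
    using H0c_diff[OF \<Omega>_sets H0g_H0c_gradient[OF \<theta>g] g0] by (simp add: P_def[abs_def])
  \<comment> \<open>Writing the test function as \<open>w - 2 P g\<close> reads off its
    curl.\<close>
  have "H0c \<Omega> (\<lambda>x. w x - 2 *s P g x) (\<lambda>x. curl \<Omega> w x - 2 *s 0)"
    by (rule H0c_diff[OF \<Omega>_sets H0curl_H0c[OF wH] H0c_cmult[OF Pg]])
  moreover have "ae_eq \<Omega> (\<lambda>x. w x - 2 *s P g x) ?\<psi>"
    using wP \<psi>P unfolding ae_eq_def 
    by eventually_elim (auto simp: vec_eq_iff)
  ultimately have "H0c \<Omega> ?\<psi> (curl \<Omega> w)" using H0c_cong[OF open_\<Omega> _ _ ae_eq_refl] by fastforce
  then have c: "ae_eq \<Omega> (curl \<Omega> ?\<psi>) (curl \<Omega> w)" by (rule curl_eq(3)[OF _ \<Omega>_sets])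
  have PL: "P z \<in> L2 \<Omega>" "P g \<in> L2 \<Omega>" using H0curl_L2(1) P_H0curl zH gH by blast+
  have "C2 * \<omega>\<^sup>2 * nrm K (P z) \<le> \<delta> * es (layer \<T> 4 K) w"
    using mult_left_mono[OF P_z_bound[OF dc wH K], of C2] C2_pos by (simp add: \<delta>_def mult.assoc)
  then show "\<alpha> / 4 * en K w \<le> Re (B K w ?\<psi>) + \<delta> * es (layer \<T> 4 K) w"
    "\<alpha> / 4 * en K w \<le> Re (B K ?\<psi> w) + \<delta> * es (layer \<T> 4 K) w"
    using B_coercive[OF wH \<psi>H PL wP \<psi>P c K] by linarith+
qed

lemma P_X_bound:
  assumes w: "w \<in> H0curl \<Omega>" and dc: "decomp D \<D> A w z \<theta> g" and c: "cut \<eta> d" and K: "K \<in> \<T>"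
  shows "en K (P (Xf (-1) \<eta> d z \<theta> g)) \<le> D2 * es (layer \<T> 4 K) w"
  unfolding es_def by (rule P_Xf_en[OF Xf_V[OF dc c _ sub] Xf_en[OF dc A1 c _ w] K]) auto

text \<open>One test function serves both orders of the arguments: the first gives the energy bound
  for correctors, the second the inf-sup hypothesis of \<open>necas\<close>.\<close>

lemma coercive:
  assumes w: "w \<in> W"
  shows "\<exists>\<psi>\<in>W. \<alpha> / 8 * es \<T> w \<le> Re (B \<Omega> w \<psi>) \<and> \<alpha> / 8 * es \<T> w \<le> Re (B \<Omega> \<psi> w) \<and> es \<T> \<psi> \<le> D2 * N 4 * es \<T> w"
proof -
  have wV: "w \<in> V D" and w0: "ae_eq \<Omega> (\<pi> w) (\<lambda>x. 0)" using w by (auto simp: W_def)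
  note wH = V_H0curl[OF wV]
  obtain z \<theta> g where dc: "decomp D \<D> A w z \<theta> g" and g0: "H0c \<Omega> (\<pi> g) (\<lambda>x. 0)" using decomposition[OF wV w0] by blast
  let ?\<psi> = "P (X0 z \<theta> g)"
  have XV: "X0 z \<theta> g \<in> V D" by (rule Xf_V[OF dc cut_one _ sub]) simp
  have \<psi>W: "?\<psi> \<in> W" by (rule P_W[OF V_H0curl[OF XV] XV])
  have \<psi>H: "?\<psi> \<in> H0curl \<Omega>" by (rule P_H0curl[OF V_H0curl[OF XV]])
  have e: "\<alpha> / 8 * es \<T> w \<le> Re (b \<Omega>)"
    if "\<And>K. K \<in> \<T> \<Longrightarrow> \<alpha> / 4 * en K w \<le> Re (b K) + \<delta> * es (layer \<T> 4 K) w" and s: "b \<Omega> = (\<Sum>K\<in>\<T>. b K)" for b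
  proof -
    have "\<alpha> / 4 * es \<T> w \<le> (\<Sum>K\<in>\<T>. Re (b K) + \<delta> * es (layer \<T> 4 K) w)"
      unfolding es_def[of \<T>] sum_distrib_left by (rule sum_mono[OF that(1)])
    also have "\<dots> = Re (b \<Omega>) + \<delta> * (\<Sum>K\<in>\<T>. es (layer \<T> 4 K) w)" by (simp add: s sum.distrib sum_distrib_left)
    also have "\<dots> \<le> Re (b \<Omega>) + \<delta> * (N 4 * es \<T> w)" using mult_left_mono[OF es_layers_all \<delta>(1)] by simp
    also have "\<dots> \<le> Re (b \<Omega>) + \<alpha> / 16 * es \<T> w" using mult_right_mono[OF \<delta>(2), of "es \<T> w"] by (simp add: mult.assoc)
    finally show ?thesis using mult_nonneg_nonneg[OF less_imp_le[OF \<alpha>] es_nonneg, of \<T> w] by (simp add: algebra_simps)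
  qed
  have 1: "\<alpha> / 8 * es \<T> w \<le> Re (B \<Omega> w ?\<psi>)"
    by (rule e[of "\<lambda>K. B K w ?\<psi>"]) (use coercive_local(1)[OF w dc g0] B_sum[OF wH \<psi>H] in auto)
  have 2: "\<alpha> / 8 * es \<T> w \<le> Re (B \<Omega> ?\<psi> w)"
    by (rule e[of "\<lambda>K. B K ?\<psi> w"]) (use coercive_local(2)[OF w dc g0] B_sum[OF \<psi>H wH] in auto)
  have 3: "es \<T> ?\<psi> \<le> D2 * N 4 * es \<T> w"
    by (rule es_bound_layers) (use P_X_bound[OF wH dc cut_one] D2_pos layer_subset in auto)
  show ?thesis using \<psi>W 1 2 3 by blast
qed

end

lemma scaleR_cvec: "c *\<^sub>R (u :: complex ^ 3) = complex_of_real c *s u"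
  by (simp add: vec_eq_iff scaleR_conv_of_real[where 'a=complex])

section \<open>Completeness of the energy space and of the kernel\<close>

context mesh_freq
begin

lemma es_H0c:
  assumes v: "H0c \<Omega> v c" shows "es \<T> v = (l2norm \<Omega> c)\<^sup>2 + \<omega>\<^sup>2 * (l2norm \<Omega> v)\<^sup>2"
proof -
  note e = curl_eq[OF v \<Omega>_sets]
  show ?thesis unfolding l2norm_\<Omega> e(2)[symmetric] nrm_\<Omega>[OF H0curl_L2(1)[OF e(1)]] nrm_\<Omega>[OF H0curl_L2(2)[OF e(1)]]
    by (simp add: es_def en_def sum.distrib sum_distrib_left)
qed

lemma es_eq_0: 
  assumes v: "v \<in> H0curl \<Omega>" shows "es \<T> v = 0 \<longleftrightarrow> ae_eq \<Omega> v (\<lambda>x. 0)"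
proof -
  have "es \<T> v = 0 \<longleftrightarrow> (\<forall>K\<in>\<T>. nrm K v = 0)"
    unfolding es_def using en_eq_0[OF _ v] finite_mesh by (simp add: sum_nonneg_eq_0_iff)
  also have "\<dots> \<longleftrightarrow> nrm \<Omega> v = 0" unfolding nrm_\<Omega>[OF H0curl_L2(1)[OF v]] using finite_mesh by (simp add: sum_nonneg_eq_0_iff)
  finally show ?thesis using nrm_0_iff[OF H0curl_L2(1)[OF v] \<Omega>_sets] by simp
qed

lemma es_cong: "u \<in> H0curl \<Omega> \<Longrightarrow> ae_eq \<Omega> u v \<Longrightarrow> \<A> \<subseteq> \<T> \<Longrightarrow> es \<A> v = es \<A> u"
  unfolding es_def by (intro sum.cong refl en_cong) auto

lemma curl_norm_es: "v \<in> H0curl \<Omega> \<Longrightarrow> curl_norm \<omega> \<Omega> v = sqrt (es \<T> v)"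
  by (simp add: curl_norm_def curl_ip_en es_def)

lemma curl_ip_H0c:
  assumes u: "H0c \<Omega> u c" and v: "H0c \<Omega> v d"
  shows "curl_ip \<omega> \<Omega> u v = l2ip \<Omega> c d + complex_of_real (\<omega>\<^sup>2) * l2ip \<Omega> u v"
  using l2ip_ae_eq[OF \<Omega>_sets _ _ curl_eq(3)[OF u \<Omega>_sets] curl_eq(3)[OF v \<Omega>_sets]]
    H0curl_L2(2) curl_eq(1)[OF u \<Omega>_sets] curl_eq(1)[OF v \<Omega>_sets]
  by (simp add: curl_ip_def)

lemma H0curl_complete:
  assumes X: "\<And>n. X n \<in> H0curl \<Omega>" and Cauchy: "\<And>e. e > 0 \<Longrightarrow> \<exists>N. \<forall>n\<ge>N. \<forall>m\<ge>N. es \<T> (\<lambda>x. X n x - X m x) < e"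
  shows "\<exists>x\<in>H0curl \<Omega>. (\<lambda>n. es \<T> (\<lambda>y. X n y - x y)) \<longlonglongrightarrow> 0"
proof -
  have e: "es \<T> (\<lambda>x. X n x - X m x) = (l2norm \<Omega> (\<lambda>x. curl \<Omega> (X n) x - curl \<Omega> (X m) x))\<^sup>2 + \<omega>\<^sup>2 * (l2norm \<Omega> (\<lambda>x. X n x - X m x))\<^sup>2" for n m
    by (rule es_H0c[OF curl_diff[OF X X]])
  have Cv: "\<exists>N. \<forall>n\<ge>N. \<forall>m\<ge>N. l2norm \<Omega> (\<lambda>x. X n x - X m x) < \<epsilon>" if "\<epsilon> > 0" for \<epsilon>
  proof -
    obtain N where N: "\<And>n m. n \<ge> N \<Longrightarrow> m \<ge> N \<Longrightarrow> es \<T> (\<lambda>x. X n x - X m x) < \<omega>\<^sup>2 * \<epsilon>\<^sup>2"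
      using Cauchy[of "\<omega>\<^sup>2 * \<epsilon>\<^sup>2"] \<omega> \<open>\<epsilon> > 0\<close> by auto
    have "l2norm \<Omega> (\<lambda>x. X n x - X m x) < \<epsilon>" if "n \<ge> N" "m \<ge> N" for n m
    proof (rule power2_less_imp_less)
      have "\<omega>\<^sup>2 * (l2norm \<Omega> (\<lambda>x. X n x - X m x))\<^sup>2 < \<omega>\<^sup>2 * \<epsilon>\<^sup>2" 
        using N[OF that] unfolding e by (rule le_less_trans[rotated]) simp
      then show "(l2norm \<Omega> (\<lambda>x. X n x - X m x))\<^sup>2 < \<epsilon>\<^sup>2" using \<omega> by simp
    qed (use \<open>\<epsilon> > 0\<close> in simp)
    then show ?thesis by blast
  qed
  have Cc: "\<exists>N. \<forall>n\<ge>N. \<forall>m\<ge>N. l2norm \<Omega> (\<lambda>x. curl \<Omega> (X n) x - curl \<Omega> (X m) x) < \<epsilon>" if "\<epsilon> > 0" for \<epsilon>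
  proof -
    obtain N where N: "\<And>n m. n \<ge> N \<Longrightarrow> m \<ge> N \<Longrightarrow> es \<T> (\<lambda>x. X n x - X m x) < \<epsilon>\<^sup>2"
      using Cauchy[of "\<epsilon>\<^sup>2"] \<open>\<epsilon> > 0\<close> by auto
    have "l2norm \<Omega> (\<lambda>x. curl \<Omega> (X n) x - curl \<Omega> (X m) x) < \<epsilon>" if "n \<ge> N" "m \<ge> N" for n m
    proof (rule power2_less_imp_less)
      show "(l2norm \<Omega> (\<lambda>x. curl \<Omega> (X n) x - curl \<Omega> (X m) x))\<^sup>2 < \<epsilon>\<^sup>2"
        using N[OF that] unfolding e by (rule le_less_trans[rotated]) simp
    qed (use \<open>\<epsilon> > 0\<close> in simp)
    then show ?thesis by blast
  qed
  obtain v where v: "v \<in> L2 \<Omega>" "(\<lambda>n. l2norm \<Omega> (\<lambda>x. v x - X n x)) \<longlonglongrightarrow> 0"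
    using L2_complete[of X \<Omega>, OF H0curl_L2(1)[OF X] Cv] by blast
  obtain c where c: "c \<in> L2 \<Omega>" "(\<lambda>n. l2norm \<Omega> (\<lambda>x. c x - curl \<Omega> (X n) x)) \<longlonglongrightarrow> 0"
    using L2_complete[of "\<lambda>n. curl \<Omega> (X n)" \<Omega>, OF H0curl_L2(2)[OF X] Cc] by blast
  have vc: "H0c \<Omega> v c" by (rule H0c_closed[OF \<Omega>_sets v(1) c(1) H0curl_H0c[OF X] v(2) c(2)])
  have "(\<lambda>n. (l2norm \<Omega> (\<lambda>x. c x - curl \<Omega> (X n) x))\<^sup>2 + \<omega>\<^sup>2 * (l2norm \<Omega> (\<lambda>x. v x - X n x))\<^sup>2) \<longlonglongrightarrow> 0\<^sup>2 + \<omega>\<^sup>2 * 0\<^sup>2"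
    by (intro tendsto_intros v c)
  moreover have "es \<T> (\<lambda>y. X n y - v y) = (l2norm \<Omega> (\<lambda>x. c x - curl \<Omega> (X n) x))\<^sup>2 + \<omega>\<^sup>2 * (l2norm \<Omega> (\<lambda>x. v x - X n x))\<^sup>2" for n
    unfolding es_H0c[OF H0c_diff[OF \<Omega>_sets H0curl_H0c[OF X] vc]] by (simp add: l2norm_minus_commute)
  ultimately show ?thesis using curl_eq(1)[OF vc \<Omega>_sets] by (intro bexI[of _ v]) simp_all
qed

end

context fw_freq
begin

lemma W_H0curl: "w \<in> W \<Longrightarrow> w \<in> H0curl \<Omega>" using V_D by (auto simp: W_def)

lemma W_cmult: "w \<in> W \<Longrightarrow> (\<lambda>x. c *s w x) \<in> W"
  using V_cmult[of w c] \<pi>_cmult[of w c] V_D[of w] unfolding W_def ae_eq_def by (auto elim: AE_mp)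

lemma W_add:
  assumes u: "u \<in> W" and v: "v \<in> W" shows "(\<lambda>x. u x + v x) \<in> W"
proof -
  have "ae_eq \<Omega> (\<lambda>x. \<pi> u x + \<pi> v x) (\<lambda>x. 0)"
    using ae_eq_comp2[of \<Omega> "\<pi> u" "\<lambda>x. 0" "\<pi> v" "\<lambda>x. 0" "\<lambda>x a b. a + b"] u v by (simp add: W_def)
  then show ?thesis
    using ae_eq_trans[OF \<pi>_add[OF W_H0curl[OF u] W_H0curl[OF v]]] V_add u v by (simp add: W_def)
qed

lemma W_zero: "(\<lambda>x. 0) \<in> W"
proof -
  have z: "(\<lambda>x. 0) \<in> V D" using H0curl_zero by (simp add: vanishing_outside_def)
  show ?thesis using W_cmult[OF P_W[OF V_H0curl[OF z] z], of 0] by simp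
qed

text \<open>Both defining conditions of \<open>W\<close> pass to energy limits: the energy outside
  \<open>D\<close> is bounded by that of \<open>X n - x\<close>, and so is the energy of
  \<open>\<pi> x\<close>, by stability of \<open>\<pi>\<close>.\<close>

lemma W_closed:
  assumes X: "\<And>n. X n \<in> W" and x: "x \<in> H0curl \<Omega>" and lim: "(\<lambda>n. es \<T> (\<lambda>y. X n y - x y)) \<longlonglongrightarrow> 0"
  shows "x \<in> W"
proof -
  note XH = W_H0curl[OF X]
  have le0: "a \<le> 0" if "\<And>n. a \<le> c * es \<T> (\<lambda>y. X n y - x y)" for a c
    using tendsto_le[OF _ tendsto_mult_left[OF lim, of c] tendsto_const[of a]] that by (simp add: eventually_sequentially)
  have "en K x = 0" if K: "K \<in> \<T> - \<D>" for K
  proof -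
    have "en K x \<le> 2 * es \<T> (\<lambda>y. X n y - x y)" for n
    proof -
      have "nrm K (X n) = 0" using X[of n] K by (auto simp: W_def V_D)
      then have "en K (X n) = 0" using en_eq_0[OF _ XH] K by blast
      moreover have "en K (\<lambda>y. X n y - (X n y - x y)) \<le> 2 * en K (X n) + 2 * en K (\<lambda>y. X n y - x y)"
        using en_diff[OF XH H0curl_diff[OF XH x]] K by blast
      ultimately show ?thesis using es_member[of K \<T> "\<lambda>y. X n y - x y"] K by auto
    qed
    from le0[OF this] show ?thesis using en_nonneg[of K x] by linarith
  qed
  then have xV: "x \<in> V D" using V_D x en_eq_0 by blast
  have "es \<T> (\<pi> x) \<le> 3 * A * N 1 * es \<T> (\<lambda>y. X n y - x y)" for n
  proof -
    have d: "(\<lambda>y. x y - X n y) \<in> V D" using V_diff[OF xV] X by (auto simp: W_def)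
    have "ae_eq \<Omega> (\<pi> (\<lambda>y. x y - X n y)) (\<pi> x)"
      using \<pi>_diff[OF x XH, of n] X[of n] unfolding W_def ae_eq_def by (auto elim: AE_mp[OF AE_conjI])
    then have "es \<T> (\<pi> x) = es \<T> (\<pi> (\<lambda>y. x y - X n y))" by (intro es_cong \<pi>_H0curl H0curl_diff x XH) auto
    also have "\<dots> \<le> 3 * A * N 1 * es \<T> (\<lambda>y. x y - X n y)" using layer_subset by (intro es_\<pi>[OF d]) auto
    also have "es \<T> (\<lambda>y. x y - X n y) = es \<T> (\<lambda>y. X n y - x y)"
      unfolding es_H0c[OF curl_diff[OF x XH]] es_H0c[OF curl_diff[OF XH x]] 
      by (simp add: l2norm_minus_commute)
    finally show ?thesis .
  qed
  from le0[OF this] have "es \<T> (\<pi> x) = 0" using es_nonneg[of \<T> "\<pi> x"] by linarith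
  then show ?thesis using xV es_eq_0[OF \<pi>_H0curl[OF x]] by (simp add: W_def)
qed

lemma W_form: "complete_psd_form W (\<lambda>u v. Re (curl_ip \<omega> \<Omega> u v))"
proof
  show "(\<lambda>x. 0) \<in> W" by (rule W_zero)
  show "(\<lambda>x. u x + v x) \<in> W" if "u \<in> W" "v \<in> W" for u v by (rule W_add[OF that])
  show "(\<lambda>x. c *\<^sub>R u x) \<in> W" if "u \<in> W" for u c unfolding scaleR_cvec by (rule W_cmult[OF that])
  fix u v assume u: "u \<in> W" and v: "v \<in> W"
  note h = H0curl_H0c[OF W_H0curl[OF u]] H0curl_H0c[OF W_H0curl[OF v]]
  note L = H0cD[OF h(1)] H0cD[OF h(2)]
  have sym: "Re (l2ip \<Omega> f g) = Re (l2ip \<Omega> g f)" if "f \<in> L2 \<Omega>" "g \<in> L2 \<Omega>" for f g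
    unfolding l2ip_def integral_Re[symmetric, OF l2ip_integrable[OF that]] integral_Re[symmetric, OF l2ip_integrable[OF that(2,1)]]
      inner_vec_complex[symmetric] by (simp add: inner_commute)
  show "Re (curl_ip \<omega> \<Omega> u v) = Re (curl_ip \<omega> \<Omega> v u)"
    unfolding curl_ip_def using sym[of u v] sym[of "curl \<Omega> u" "curl \<Omega> v"] L by simp
  show "Re (curl_ip \<omega> \<Omega> (\<lambda>x. c *\<^sub>R u x) v) = c * Re (curl_ip \<omega> \<Omega> u v)" for c
    unfolding scaleR_cvec curl_ip_H0c[OF H0c_cmult[OF h(1)] h(2)] curl_ip_H0c[OF h] l2ip_cmult_left by (simp add: algebra_simps)
  show "0 \<le> Re (curl_ip \<omega> \<Omega> u u)" unfolding curl_ip_en[OF W_H0curl[OF u]] by (simp add: sum_nonneg)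
  fix w assume w: "w \<in> W"
  note hw = H0curl_H0c[OF W_H0curl[OF w]]
  note Lw = H0cD[OF hw]
  show "Re (curl_ip \<omega> \<Omega> (\<lambda>x. u x + v x) w) = Re (curl_ip \<omega> \<Omega> u w) + Re (curl_ip \<omega> \<Omega> v w)"
    unfolding curl_ip_H0c[OF H0c_add[OF \<Omega>_sets h] hw] curl_ip_H0c[OF h(1) hw] curl_ip_H0c[OF h(2) hw]
    using l2ip_add_left L Lw by (simp add: algebra_simps)
next
  fix X :: "nat \<Rightarrow> vfield"
  assume X: "\<And>n. X n \<in> W"
    and C: "\<And>e. e > 0 \<Longrightarrow> \<exists>N. \<forall>n\<ge>N. \<forall>m\<ge>N. Re (curl_ip \<omega> \<Omega> (\<lambda>x. X n x - X m x) (\<lambda>x. X n x - X m x)) < e"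
  have e: "Re (curl_ip \<omega> \<Omega> u u) = es \<T> u" if "u \<in> H0curl \<Omega>" for u using curl_ip_en[OF that] by (simp add: es_def)
  have cc: "\<exists>N. \<forall>n\<ge>N. \<forall>m\<ge>N. es \<T> (\<lambda>x. X n x - X m x) < \<epsilon>" if "\<epsilon> > 0" for \<epsilon>
    using C[OF that] unfolding e[OF H0curl_diff[OF W_H0curl[OF X] W_H0curl[OF X]]] .
  obtain x where x: "x \<in> H0curl \<Omega>" "(\<lambda>n. es \<T> (\<lambda>y. X n y - x y)) \<longlonglongrightarrow> 0"
    by (rule bexE[OF H0curl_complete[OF W_H0curl[OF X] cc]])
  then have "x \<in> W" by (rule W_closed[OF X])
  moreover have "(\<lambda>n. Re (curl_ip \<omega> \<Omega> (\<lambda>y. X n y - x y) (\<lambda>y. X n y - x y))) \<longlonglongrightarrow> 0"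
    using x(2) unfolding e[OF H0curl_diff[OF W_H0curl[OF X] x(1)]] .
  ultimately show "\<exists>x\<in>W. (\<lambda>n. Re (curl_ip \<omega> \<Omega> (\<lambda>y. X n y - x y) (\<lambda>y. X n y - x y))) \<longlonglongrightarrow> 0" by blast
qed

end

context corrector
begin

text \<open>The Babuska-Necas lemma is applied to the real parts of the form and of the right-hand
  side, with real scalars.\<close>

lemma corrector_exists:
  assumes T: "T \<in> \<T>" and v: "v \<in> H0curl \<Omega>" shows "\<exists>g\<in>W. \<forall>w\<in>W. B \<Omega> g w = B T v w"
proof -
  let ?p = "\<lambda>u v. Re (curl_ip \<omega> \<Omega> u v)"
  interpret W: complete_psd_form W ?p by (rule W_form)
  have e: "?p u u = es \<T> u" if "u \<in> W" for u using curl_ip_en[OF W_H0curl[OF that]] by (simp add: es_def)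
  note H = W_H0curl
  have F: "\<bar>Re (B T v w)\<bar> \<le> \<Lambda> * sqrt (en T v) * sqrt (?p w w)" if w: "w \<in> W" for w
  proof -
    have "\<bar>Re (B T v w)\<bar> \<le> \<Lambda> * (sqrt (en T v) * sqrt (en T w))" by (rule order_trans[OF abs_Re_le_cmod B_bound[OF v H[OF w] T]])
    also have "\<dots> \<le> \<Lambda> * (sqrt (en T v) * sqrt (es \<T> w))" using \<Lambda>0 es_member[OF T, of w] by (intro mult_left_mono) auto
    finally show ?thesis unfolding e[OF w] by (simp add: mult.assoc)
  qed
  have "\<exists>g\<in>W. \<forall>w\<in>W. Re (B \<Omega> g w) = Re (B T v w)"
  proof (rule W.necas[where K=\<Lambda> and c="\<alpha> / 8" and D="D2 * N 4", OF _ _ _ _ _ _ _ _ _ F])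
    fix u w assume u: "u \<in> W" and w: "w \<in> W"
    show "Re (B \<Omega> (\<lambda>x. c *\<^sub>R u x) w) = c * Re (B \<Omega> u w)" for c
      unfolding scaleR_cvec B_cmult_left[OF H[OF u] H[OF w] disjI1[OF refl]] by simp
    show "Re (B \<Omega> w (\<lambda>x. c *\<^sub>R u x)) = c * Re (B \<Omega> w u)" for c
      unfolding scaleR_cvec B_cmult_right[OF H[OF u] H[OF w] disjI1[OF refl]] by simp
    show "\<bar>Re (B \<Omega> u w)\<bar> \<le> \<Lambda> * sqrt (?p u u) * sqrt (?p w w)"
      unfolding e[OF u] e[OF w] using order_trans[OF abs_Re_le_cmod B_bound_all[OF H[OF u] H[OF w]]] by (simp add: mult.assoc)
    show "Re (B T v (\<lambda>x. u x + w x)) = Re (B T v u) + Re (B T v w)"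
      using B_add_right[OF H[OF u] H[OF w] v disjI2[OF T]] by simp
    show "Re (B T v (\<lambda>x. c *\<^sub>R u x)) = c * Re (B T v u)" for c
      unfolding scaleR_cvec B_cmult_right[OF H[OF u] v disjI2[OF T]] by simp
    show "\<exists>u\<in>W. \<alpha> / 8 * ?p w w \<le> Re (B \<Omega> u w) \<and> ?p u u \<le> D2 * N 4 * ?p w w"
      using coercive[OF w] e w by auto
    fix f assume f: "f \<in> W"
    show "Re (B \<Omega> (\<lambda>x. u x + f x) w) = Re (B \<Omega> u w) + Re (B \<Omega> f w)"
      using B_add_left[OF H[OF u] H[OF f] H[OF w]] by simp
    show "Re (B \<Omega> w (\<lambda>x. u x + f x)) = Re (B \<Omega> w u) + Re (B \<Omega> w f)"
      using B_add_right[OF H[OF u] H[OF f] H[OF w]] by simp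
  qed (use \<alpha> in simp)
  then obtain g where g: "g \<in> W" and eq: "\<And>w. w \<in> W \<Longrightarrow> Re (B \<Omega> g w) = Re (B T v w)" by blast
  \<comment> \<open>Testing with \<open>\<i>\<close> times \<open>w\<close>, which again lies in
    \<open>W\<close>, recovers the imaginary parts.\<close>
  have "B \<Omega> g w = B T v w" if w: "w \<in> W" for w
  proof (rule complex_eqI)
    show "Im (B \<Omega> g w) = Im (B T v w)"
      using eq[OF W_cmult[OF w, of \<i>]] B_cmult_right[OF H[OF w] H[OF g], of \<Omega> \<i>] B_cmult_right[OF H[OF w] v disjI2[OF T], of \<i>] by simp
  qed (rule eq[OF w])
  then show ?thesis using g by blast
qed

end

section \<open>Exponential decay of correctors\<close>

lemma (in mesh) layer_far:
  assumes "K \<in> \<T>" "K \<notin> layer \<T> (i + k) T" "K' \<in> layer \<T> k K" shows "K' \<notin> layer \<T> i T"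
  using layer_trans[of K' i T K k] layer_sym[OF assms(1,3)] assms(2) by blast

lemma (in mesh) layer_disjoint: "K \<in> \<T> \<Longrightarrow> K \<notin> layer \<T> (Suc k) T \<Longrightarrow> K \<inter> \<Union>(layer \<T> k T) = {}"
  by auto

text \<open>The step is iterated \<open>j div p\<close> times and monotonicity covers the remainder;
  rounding down costs the factor \<open>1/q\<close>.\<close>

lemma iterate_decay:
  fixes a :: "nat \<Rightarrow> real"
  assumes step: "\<And>j. a (j + p) \<le> q * a j" and mono: "\<And>i j. i \<le> j \<Longrightarrow> a j \<le> a i" and a: "\<And>j. 0 \<le> a j"
    and q: "0 < q" "q < 1" and p: "0 < p"
  shows "a j \<le> (root p q) ^ j / q * a 0"
proof -
  let ?b = "root p q"
  have b: "0 < ?b" "?b \<le> 1" "?b ^ p = q" using q p by (auto simp: real_root_le_1_iff)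
  have s: "a (i * p) \<le> q ^ i * a 0" for i
  proof (induction i)
    case (Suc i)
    have "a (Suc i * p) \<le> q * a (i * p)" using step[of "i * p"] by (simp add: add.commute)
    also have "\<dots> \<le> q * (q ^ i * a 0)" using Suc.IH q by (intro mult_left_mono) auto
    finally show ?case by simp
  qed simp
  have "a j \<le> q ^ (j div p) * a 0"
    by (rule order_trans[OF mono s]) simp
  also have "q ^ (j div p) \<le> ?b ^ j / q"
  proof -
    have "?b ^ p \<le> ?b ^ (j mod p)" using b p by (intro power_decreasing) auto
    then have "?b ^ (p * (j div p)) * q \<le> ?b ^ (p * (j div p)) * ?b ^ (j mod p)" using b by (intro mult_left_mono) auto
    also have "\<dots> = ?b ^ j" by (simp add: power_add[symmetric])
    finally show ?thesis using q b(3) by (simp add: field_simps power_mult)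
  qed
  finally show ?thesis using a[of 0] by (simp add: mult_right_mono)
qed

context corrector
begin

text \<open>From coercivity \<open>\<alpha> / 8\<close> against continuity \<open>\<Lambda>\<close>,
  with the energy of the test function at most \<open>D2 * N 4\<close> times that of the
  corrector.\<close>

definition Cg :: real where "Cg = (8 * \<Lambda> / \<alpha>)\<^sup>2 * (D2 * N 4)"

definition Cm :: real where "Cm = \<Lambda> * sqrt (D2 * N 4)"

text \<open>Hole filling: the ring energy is bounded by \<open>Cm\<close> times the difference of
  two outer energies. Moving the subtracted one to the left adds \<open>Cm\<close> on both sides, so
  the quotient is below 1 by \<open>\<alpha> / 16 < \<alpha> / 4\<close>.\<close>

definition qd :: real where "qd = (\<alpha> / 16 + Cm) / (\<alpha> / 4 + Cm)"

lemma D2N: "0 < D2 * N 4" using D2_pos N_ge_1[of 4] by auto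

lemma Cm_nonneg: "0 \<le> Cm" unfolding Cm_def using \<Lambda>0 D2N by auto

lemma qd: "0 < qd" "qd < 1"
  using \<alpha> Cm_nonneg by (auto simp: qd_def divide_simps)

context
  fixes T v g assumes T: "T \<in> \<T>" and v: "v \<in> H0curl \<Omega>" and g: "g \<in> W" and eq: "\<And>w. w \<in> W \<Longrightarrow> B \<Omega> g w = B T v w"
begin

lemma corrector_bound: "es \<T> g \<le> Cg * en T v"
proof -
  note gH = W_H0curl[OF g]
  obtain \<psi> where \<psi>: "\<psi> \<in> W" "\<alpha> / 8 * es \<T> g \<le> Re (B \<Omega> g \<psi>)" "es \<T> \<psi> \<le> D2 * N 4 * es \<T> g" using coercive[OF g] by blast
  define x where "x = sqrt (es \<T> g)"
  have x: "x\<^sup>2 = es \<T> g" "x \<ge> 0" by (auto simp: x_def)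
  have "\<alpha> / 8 * x\<^sup>2 \<le> Re (B T v \<psi>)" using \<psi>(2) eq[OF \<psi>(1)] by (simp add: x)
  also have "\<dots> \<le> \<Lambda> * (sqrt (en T v) * sqrt (en T \<psi>))"
    by (rule order_trans[OF complex_Re_le_cmod B_bound[OF v W_H0curl[OF \<psi>(1)] T]])
  also have "\<dots> \<le> \<Lambda> * (sqrt (en T v) * (sqrt (D2 * N 4) * x))"
    unfolding x_def real_sqrt_mult[symmetric, of "D2 * N 4"] using \<Lambda>0 es_member[OF T, of \<psi>] \<psi>(3) by (intro mult_left_mono real_sqrt_le_mono) auto
  finally have "x * x \<le> (8 * \<Lambda> / \<alpha> * (sqrt (D2 * N 4) * sqrt (en T v))) * x" using \<alpha> by (simp add: field_simps power2_eq_square)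
  then have "x \<le> 8 * \<Lambda> / \<alpha> * (sqrt (D2 * N 4) * sqrt (en T v))"
  proof (cases "x = 0")
    case True
    then show ?thesis using \<Lambda>0 \<alpha> D2N by simp
  next
    case False
    then have "0 < x" using x(2) by simp
    show ?thesis by (rule mult_right_le_imp_le) fact+
  qed
  then have "x\<^sup>2 \<le> (8 * \<Lambda> / \<alpha> * (sqrt (D2 * N 4) * sqrt (en T v)))\<^sup>2" using x(2) by (rule power_mono)
  also have "\<dots> = Cg * en T v" using D2N unfolding Cg_def power_mult_distrib by (simp add: mult.assoc)
  finally show ?thesis unfolding x(1) .
qed

abbreviation "out j \<equiv> es (\<T> - layer \<T> j T) g"

lemma out_mono: "i \<le> j \<Longrightarrow> out j \<le> out i"
  using layer_mono[OF T, of i j] by (intro es_mono) auto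

text \<open>The cutoff lives in the ring of layers \<open>j + 5\<close> and \<open>j + 6\<close>; applying the projection blurs it by one layer,
  and the estimates on an element involve four more layers.\<close>

lemma decay_step: "out (j + 11) \<le> qd * out j"
proof -
  note gH = W_H0curl[OF g]
  let ?A = "layer \<T> (j + 5) T"
  obtain \<eta> d where "cutoff \<Omega> \<eta> d" "\<forall>x\<in>\<Omega>. \<bar>\<eta> x\<bar> \<le> 1 \<and> norm (d x) \<le> \<kappa> * \<sigma> / H"
    and \<eta>0: "\<And>K x. K \<in> ?A \<Longrightarrow> x \<in> K \<Longrightarrow> \<eta> x = 0 \<and> d x = 0"
    and \<eta>1: "\<And>K x. K \<in> \<T> \<Longrightarrow> K \<inter> \<Union>?A = {} \<Longrightarrow> x \<in> K \<Longrightarrow> \<eta> x = 1 \<and> d x = 0"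
    using mesh_cutoff[OF layer_subset[OF T], of 0 "j + 5"] by auto
  then have c: "cut \<eta> d" by (simp add: cut_def)
  obtain z \<theta> gg where dc: "decomp D \<D> A g z \<theta> gg" and g0: "H0c \<Omega> (\<pi> gg) (\<lambda>x. 0)"
    using decomposition[of g] g by (auto simp: W_def)
  let ?X = "Xf (-1) \<eta> d z \<theta> gg"
  have XV: "?X \<in> V D" "X0 z \<theta> gg \<in> V D" using Xf_V[OF dc _ _ sub, of _ _ "-1"] c cut_one by auto
  note PH = P_H0curl[OF V_H0curl[OF XV(1)]] P_H0curl[OF V_H0curl[OF XV(2)]]
  have \<psi>W: "P ?X \<in> W" by (rule P_W[OF V_H0curl[OF XV(1)] XV(1)])
  let ?\<psi> = "P ?X"
  have sub\<T>: "layer \<T> i T \<subseteq> \<T>" for i by (rule layer_subset[OF T])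
  \<comment> \<open>Within \<open>j + 4\<close> layers all neighbours lie within
    \<open>j + 5\<close> layers, where the cutoff vanishes; so does the projected field.\<close>
  have near: "nrm K ?\<psi> = 0" if K: "K \<in> layer \<T> (j + 4) T" for K
  proof -
    have K\<T>: "K \<in> \<T>" using K sub\<T> by blast
    have X0: "nrm K' ?X = 0" if "K' \<in> layer \<T> 1 K" for K'
      using layer_trans[OF K that] \<eta>0 by (intro Xf_nrm_0) (auto simp: numeral_eq_Suc)
    have "nrm K ?\<psi> \<le> 2 * nrm K ?X + 2 * nrm K (\<pi> ?X)" unfolding P_def[abs_def]
      by (rule nrm_diff[OF H0curl_L2(1)[OF V_H0curl[OF XV(1)]] H0curl_L2(1)[OF \<pi>_H0curl[OF V_H0curl[OF XV(1)]]] element_sets[OF K\<T>]])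
    then show ?thesis using X0[OF layer_self[OF K\<T>]] \<pi>_local_0[OF XV(1) K\<T> X0] nrm_nonneg[of K ?\<psi>] by linarith
  qed
  \<comment> \<open>Beyond \<open>j + 7\<close> layers the neighbours avoid \<open>j + 6\<close>
    layers, the cutoff is 1 on them, and the test function is the one of
    \<open>coercive_local\<close>.\<close>
  have far: "\<alpha> / 4 * en K g - \<delta> * es (layer \<T> 4 K) g \<le> Re (B K g ?\<psi>)" if K: "K \<in> \<T> - layer \<T> (j + 7) T" for K
  proof -
    have "nrm K' (\<lambda>x. ?X x - X0 z \<theta> gg x) = 0" if K': "K' \<in> layer \<T> 1 K" for K'
    proof (rule Xf_nrm_eq)
      have "K' \<notin> layer \<T> (j + 6) T" by (rule layer_far[OF _ _ K']) (use K in \<open>auto simp: numeral_eq_Suc\<close>)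
      moreover have K'\<T>: "K' \<in> \<T>" using layer_subset[of K 1] K' K by blast
      ultimately have "K' \<inter> \<Union>?A = {}" using layer_disjoint[of K' "j + 5" T] by (simp add: numeral_eq_Suc)
      from \<eta>1[OF K'\<T> this] show "\<eta> x = 1 \<and> d x = 0" if "x \<in> K'" for x using that by blast
    qed
    then have "nrm K (\<lambda>x. ?\<psi> x - P (X0 z \<theta> gg) x) = 0" using P_agree[OF XV] K by blast
    then have "B K g ?\<psi> = B K g (P (X0 z \<theta> gg))" using B_cong(2)[OF PH _ gH] K by blast
    then show ?thesis using coercive_local(1)[OF g dc g0, of K] K by simp
  qed
  \<comment> \<open>\<open>?M\<close> is the transition zone, on which nothing but size is known;
    \<open>?R\<close> enlarges it by four layers on either side, the reach of the energy bound for
    the test function.\<close>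
  let ?F = "\<T> - layer \<T> (j + 7) T" and ?M = "layer \<T> (j + 7) T - layer \<T> (j + 4) T" and ?R = "layer \<T> (j + 11) T - layer \<T> j T"
  have "T \<in> layer \<T> (j + 4) T" by (rule layer_self[OF T])
  \<comment> \<open>The right-hand side lives on \<open>T\<close>, where the test function
    vanishes.\<close>
  then have "0 = B \<Omega> g ?\<psi>" using eq[OF \<psi>W] B_zero[OF T v PH(1)] near by simp
  also have "\<dots> = (\<Sum>K\<in>\<T>. B K g ?\<psi>)" by (rule B_sum[OF gH PH(1)])
  also have "\<dots> = (\<Sum>K\<in>?F \<union> ?M. B K g ?\<psi>)"
    using finite_mesh sub\<T> B_zero[OF _ gH PH(1)] near by (intro sum.mono_neutral_right) auto
  also have "\<dots> = (\<Sum>K\<in>?F. B K g ?\<psi>) + (\<Sum>K\<in>?M. B K g ?\<psi>)"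
    using finite_mesh layer_finite[OF T] by (intro sum.union_disjoint) auto
  finally have "0 = Re (\<Sum>K\<in>?F. B K g ?\<psi>) + Re (\<Sum>K\<in>?M. B K g ?\<psi>)" by (metis plus_complex.sel(1) zero_complex.sel(1))
  moreover have "\<alpha> / 4 * out (j + 7) - \<alpha> / 16 * out j \<le> Re (\<Sum>K\<in>?F. B K g ?\<psi>)"
  proof -
    have "(\<Sum>K\<in>?F. es (layer \<T> 4 K) g) \<le> N 4 * out j"
    proof (rule es_layers)
      show "layer \<T> 4 K \<subseteq> \<T> - layer \<T> j T" if K: "K \<in> ?F" for K
      proof
        fix K' assume K': "K' \<in> layer \<T> 4 K"
        have "K \<notin> layer \<T> (j + 4) T" using K layer_mono[OF T, of "j + 4" "j + 7"] by auto
        then show "K' \<in> \<T> - layer \<T> j T" using layer_far[of K j 4 T K'] K' K layer_subset[of K 4] by auto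
      qed
    qed auto
    then have "\<delta> * (\<Sum>K\<in>?F. es (layer \<T> 4 K) g) \<le> \<delta> * (N 4 * out j)" by (rule mult_left_mono[OF _ \<delta>(1)])
    also have "\<dots> \<le> \<alpha> / 16 * out j" using mult_right_mono[OF \<delta>(2), of "out j"] by (simp add: mult.assoc)
    finally have "\<alpha> / 4 * out (j + 7) - \<alpha> / 16 * out j \<le> (\<Sum>K\<in>?F. \<alpha> / 4 * en K g - \<delta> * es (layer \<T> 4 K) g)"
      unfolding es_def[of ?F] by (simp add: sum_subtractf sum_distrib_left)
    also have "\<dots> \<le> (\<Sum>K\<in>?F. Re (B K g ?\<psi>))" by (rule sum_mono[OF far])
    finally show ?thesis by simp
  qed
  moreover have "\<bar>Re (\<Sum>K\<in>?M. B K g ?\<psi>)\<bar> \<le> Cm * es ?R g"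
  proof -
    have \<psi>b: "es ?M ?\<psi> \<le> D2 * N 4 * es ?R g"
    proof (rule es_bound_layers)
      show "en K ?\<psi> \<le> D2 * es (layer \<T> 4 K) g" if "K \<in> ?M" for K
        using P_X_bound[OF gH dc c, of K] that sub\<T> by blast
      show "layer \<T> 4 K \<subseteq> ?R" if K: "K \<in> ?M" for K
      proof
        fix K' assume K': "K' \<in> layer \<T> 4 K"
        have "K' \<in> layer \<T> (j + 11) T" using layer_trans[of K "j + 7" T K' 4] K K' by (simp add: add.commute)
        then show "K' \<in> ?R" using layer_far[of K j 4 T K'] K' K sub\<T> by auto
      qed
    qed (use D2_pos sub\<T> in auto)
    have MR: "es ?M g \<le> es ?R g"
      using layer_mono[OF T, of "j + 7" "j + 11"] layer_mono[OF T, of j "j + 4"] sub\<T> by (intro es_mono) auto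
    have "\<bar>Re (\<Sum>K\<in>?M. B K g ?\<psi>)\<bar> \<le> \<Lambda> * (sqrt (es ?M g) * sqrt (es ?M ?\<psi>))"
      using sub\<T> by (intro order_trans[OF abs_Re_le_cmod B_sum_bound[OF gH PH(1)]]) auto
    also have "\<dots> \<le> \<Lambda> * (sqrt (es ?R g) * sqrt (D2 * N 4 * es ?R g))"
      using MR \<psi>b \<Lambda>0 by (intro mult_left_mono mult_mono real_sqrt_le_mono) auto
    also have "\<dots> = \<Lambda> * sqrt (D2 * N 4) * (sqrt (es ?R g) * sqrt (es ?R g))" by (simp only: real_sqrt_mult mult_ac)
    also have "\<dots> = Cm * es ?R g" by (simp add: Cm_def)
    finally show ?thesis .
  qed
  moreover have "out j = es ?R g + out (j + 11)"
  proof -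
    have "\<T> - layer \<T> j T = ?R \<union> (\<T> - layer \<T> (j + 11) T)" using layer_mono[OF T, of j "j + 11"] sub\<T> by auto
    then show ?thesis unfolding es_def using finite_mesh layer_finite[OF T] by (auto intro!: sum.union_disjoint)
  qed
  moreover have "\<alpha> / 4 * out (j + 11) \<le> \<alpha> / 4 * out (j + 7)" using \<alpha> by (intro mult_left_mono out_mono) auto
  \<comment> \<open>Hole filling starts here: the ring energy is next rewritten as
    \<open>out j - out (j + 11)\<close>.\<close>
  ultimately have "\<alpha> / 4 * out (j + 11) \<le> \<alpha> / 16 * out j + Cm * es ?R g" by linarith
  also have "Cm * es ?R g = Cm * out j - Cm * out (j + 11)" using \<open>out j = es ?R g + out (j + 11)\<close> by (simp add: algebra_simps)
  finally have "(\<alpha> / 4 + Cm) * out (j + 11) \<le> (\<alpha> / 16 + Cm) * out j" by (simp add: algebra_simps)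
  then show ?thesis using \<alpha> Cm_nonneg by (simp add: qd_def field_simps add_pos_nonneg)
qed

lemma decay: "out j \<le> Cg / qd * (root 11 qd) ^ j * en T v"
proof -
  have "out j \<le> (root 11 qd) ^ j / qd * out 0"
    by (rule iterate_decay[where a="\<lambda>j. out j", OF decay_step out_mono es_nonneg qd]) auto
  also have "\<dots> \<le> (root 11 qd) ^ j / qd * (Cg * en T v)"
    using qd order_trans[OF es_mono[of "\<T> - layer \<T> 0 T" \<T> g] corrector_bound] by (intro mult_left_mono) auto
  finally show ?thesis by (simp add: mult_ac)
qed

end

end

context fw_freq
begin

lemma \<pi>_zero: "ae_eq \<Omega> (\<pi> (\<lambda>x. 0)) (\<lambda>x. 0)" using W_zero by (simp add: W_def)

lemma \<pi>_sum:
  assumes "finite I" "\<And>i. i \<in> I \<Longrightarrow> f i \<in> H0curl \<Omega>"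
  shows "ae_eq \<Omega> (\<pi> (\<lambda>x. \<Sum>i\<in>I. f i x)) (\<lambda>x. \<Sum>i\<in>I. \<pi> (f i) x)"
  using assms
proof (induction I rule: finite_induct)
  case empty
  then show ?case using \<pi>_zero by simp
next
  case (insert i I)
  have "ae_eq \<Omega> (\<pi> (\<lambda>x. f i x + (\<Sum>i\<in>I. f i x))) (\<lambda>x. \<pi> (f i) x + \<pi> (\<lambda>x. \<Sum>i\<in>I. f i x) x)"
    using insert by (intro \<pi>_add H0curl_sum) auto
  moreover have "ae_eq \<Omega> (\<pi> (\<lambda>x. \<Sum>i\<in>I. f i x)) (\<lambda>x. \<Sum>i\<in>I. \<pi> (f i) x)" using insert by simp
  ultimately have "ae_eq \<Omega> (\<pi> (\<lambda>x. f i x + (\<Sum>i\<in>I. f i x))) (\<lambda>x. \<pi> (f i) x + (\<Sum>i\<in>I. \<pi> (f i) x))"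
    unfolding ae_eq_def by eventually_elim auto
  then show ?case using insert(1,2) by simp
qed

end

section \<open>Stability of the localized method\<close>

text \<open>The inequality \<open>r + 2 \<le> m\<close> makes the truncated subtraction in
  \<open>j0\<close> exact. Smallness is stated through \<open>fw_freq.D3\<close>, which involves
  only \<open>\<sigma>\<close>, \<open>\<kappa>\<close> and \<open>A\<close>, so one condition
  serves the global and all local operators.\<close>

locale lod = lodform +
  fixes A C :: real and r m :: nat and \<pi> :: "vfield \<Rightarrow> vfield" and \<pi>loc :: "point set \<Rightarrow> vfield \<Rightarrow> vfield"
  assumes fwg: "falk_winther \<Omega> \<Omega> \<T> H C \<pi>" and fwl: "local_falk_winther \<Omega> \<T> m C r \<pi> \<pi>loc"
    and C_A: "C\<^sup>2 \<le> A" and A_1: "1 \<le> A" and r: "1 \<le> r" and mr: "r + 2 \<le> m"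
    and small: "C2 * fw_freq.D3 \<sigma> \<kappa> A * N 4 * (\<omega> * H)\<^sup>2 \<le> \<alpha> / 16"
begin

sublocale glob: corrector \<Omega> \<sigma> \<kappa> \<T> \<omega> \<mu> \<epsilon> \<alpha> \<Lambda> \<Omega> \<T> C A \<pi>
proof unfold_locales
  show "subdomain \<Omega> \<T>" by (rule subdomain_\<Omega>)
  show "falk_winther \<Omega> \<Omega> \<T> H C \<pi>" by (rule fwg)
qed (use C_A A_1 small in auto)

lemma local_corrector:
  assumes T: "T \<in> \<T>"
  shows "corrector \<Omega> \<sigma> \<kappa> \<T> \<omega> \<mu> \<epsilon> \<alpha> \<Lambda> (nbhm \<T> m T) (layer \<T> m T) C A (\<pi>loc T)"
proof unfold_locales
  show "subdomain (nbhm \<T> m T) (layer \<T> m T)" by (rule subdomain_nbhm[OF T]) (use mr in simp)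
  show "falk_winther \<Omega> (nbhm \<T> m T) (layer \<T> m T) H C (\<pi>loc T)"
    using fwl T unfolding local_falk_winther_def submesh_nbhm[OF T, symmetric] by blast
qed (use C_A A_1 small in auto)

abbreviation "WT \<equiv> W_loc \<Omega> \<T> m \<pi>loc"

definition G :: "vfield \<Rightarrow> point set \<Rightarrow> vfield" where "G v T = G_loc \<Omega> \<T> m \<pi>loc (B \<Omega>) T (B T v)"

lemma WT_eq: "T \<in> \<T> \<Longrightarrow> WT T = fw_freq.W \<Omega> (nbhm \<T> m T) (\<pi>loc T)"
proof -
  assume T: "T \<in> \<T>"
  interpret L: corrector \<Omega> \<sigma> \<kappa> \<T> \<omega> \<mu> \<epsilon> \<alpha> \<Lambda> "nbhm \<T> m T" "layer \<T> m T" C A "\<pi>loc T" by (rule local_corrector[OF T])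
  show ?thesis by (simp add: W_loc_def L.W_def)
qed

text \<open>The corrector is a \<open>SOME\<close>, so its defining problem is available only
  through \<open>corrector_exists\<close>. The constants do not mention the patch, which is why
  bounds from local interpretations can be stated with those of \<open>glob\<close>.\<close>

lemma G:
  assumes T: "T \<in> \<T>" and v: "v \<in> H0curl \<Omega>"
  shows "G v T \<in> WT T" and "w \<in> WT T \<Longrightarrow> B \<Omega> (G v T) w = B T v w" and "es \<T> (G v T) \<le> glob.Cg * en T v"
    and "es (\<T> - layer \<T> j T) (G v T) \<le> glob.Cg / glob.qd * (root 11 glob.qd) ^ j * en T v"
    and "G v T \<in> H0curl \<Omega>" and "K \<in> \<T> - layer \<T> m T \<Longrightarrow> nrm K (G v T) = 0"
proof -
  interpret L: corrector \<Omega> \<sigma> \<kappa> \<T> \<omega> \<mu> \<epsilon> \<alpha> \<Lambda> "nbhm \<T> m T" "layer \<T> m T" C A "\<pi>loc T" by (rule local_corrector[OF T])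
  have "\<exists>g. g \<in> WT T \<and> (\<forall>w\<in>WT T. B \<Omega> g w = B T v w)"
    using L.corrector_exists[OF T v] by (auto simp: WT_eq[OF T])
  then have s: "G v T \<in> WT T \<and> (\<forall>w\<in>WT T. B \<Omega> (G v T) w = B T v w)"
    unfolding G_def G_loc_def by (rule someI_ex)
  then show "G v T \<in> WT T" "w \<in> WT T \<Longrightarrow> B \<Omega> (G v T) w = B T v w" by auto
  have g: "G v T \<in> L.W" and e: "\<And>w. w \<in> L.W \<Longrightarrow> B \<Omega> (G v T) w = B T v w" using s by (auto simp: WT_eq[OF T])
  show "es \<T> (G v T) \<le> glob.Cg * en T v" by (rule L.corrector_bound[OF T v g e])
  show "es (\<T> - layer \<T> j T) (G v T) \<le> glob.Cg / glob.qd * (root 11 glob.qd) ^ j * en T v" by (rule L.decay[OF T v g e])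
  show "G v T \<in> H0curl \<Omega>" by (rule L.W_H0curl[OF g])
  show "K \<in> \<T> - layer \<T> m T \<Longrightarrow> nrm K (G v T) = 0" using g L.V_D by (auto simp: L.W_def)
qed

text \<open>The local and the global operator agree on the first \<open>m - r = j0 + 2\<close> layers.\<close>

definition j0 :: nat where "j0 = m - r - 2"

lemma local_agree:
  assumes T: "T \<in> \<T>" and X: "X \<in> V (nbhm \<T> m T)" and K: "K \<in> layer \<T> (j0 + 2) T"
  shows "ae_eq K (\<pi>loc T X) (\<pi> X)"
proof -
  have K\<T>: "K \<in> \<T>" using K layer_subset[OF T] by blast
  have "j0 + 2 + r = m" using mr by (simp add: j0_def)
  then have "layer \<T> r K \<subseteq> layer \<T> m T" using layer_trans[OF K, of _ r] by (intro subsetI) (simp only:)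
  then have "nbhm \<T> r K \<subseteq> nbhm \<T> m T"
    using nbhm_layer[OF K\<T> r] nbhm_layer[OF T, of m] mr by (simp add: interior_mono Union_mono)
  then show ?thesis using fwl T X K\<T> unfolding local_falk_winther_def by blast
qed

definition Cr :: real where "Cr = \<Lambda> * sqrt (2 + 2 * (glob.D2 * N 4))"

lemma Cr_nonneg: "0 \<le> Cr" unfolding Cr_def using \<Lambda>0 glob.D2N by auto

text \<open>A kernel function \<open>w\<close> is cut off inside the patch and projected by the
  local operator, giving an admissible \<open>\<psi>\<close> that equals \<open>w\<close> on the
  first \<open>j0\<close> layers. The local problem with \<open>\<psi>\<close> leaves only
  \<open>\<B>(G v T, w - \<psi>)\<close>, which sees the corrector beyond \<open>j0\<close>
  layers.\<close>

lemma residual: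
  assumes T: "T \<in> \<T>" and v: "v \<in> H0curl \<Omega>" and w: "w \<in> glob.W"
  shows "cmod (B T v w - B \<Omega> (G v T) w) \<le> Cr * (sqrt (es (\<T> - layer \<T> j0 T) (G v T)) * sqrt (es (layer \<T> (m + 4) T) w))"
proof -
  interpret L: corrector \<Omega> \<sigma> \<kappa> \<T> \<omega> \<mu> \<epsilon> \<alpha> \<Lambda> "nbhm \<T> m T" "layer \<T> m T" C A "\<pi>loc T" by (rule local_corrector[OF T])
  note wH = glob.W_H0curl[OF w] and gH = G(5)[OF T v]
  let ?g = "G v T"
  have sub\<T>: "layer \<T> i T \<subseteq> \<T>" for i by (rule layer_subset[OF T])
  let ?A = "layer \<T> (j0 + 1) T"
  obtain \<eta> d where "cutoff \<Omega> \<eta> d" "\<forall>x\<in>\<Omega>. \<bar>\<eta> x\<bar> \<le> 1 \<and> norm (d x) \<le> \<kappa> * \<sigma> / H"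
    \<comment> \<open>Here the cutoff is 1 inside, opposite to the decay argument.\<close>
    and \<eta>1: "\<And>K x. K \<in> ?A \<Longrightarrow> x \<in> K \<Longrightarrow> \<eta> x = 1 \<and> d x = 0"
    and \<eta>0: "\<And>K x. K \<in> \<T> \<Longrightarrow> K \<inter> \<Union>?A = {} \<Longrightarrow> x \<in> K \<Longrightarrow> \<eta> x = 0 \<and> d x = 0"
    using mesh_cutoff[OF sub\<T>, of 1 "j0 + 1"] by auto
  then have c: "cut \<eta> d" by (simp add: cut_def)
  obtain z \<theta> gg where dc: "decomp \<Omega> \<T> A w z \<theta> gg" using glob.decomposition[of w] w by (auto simp: glob.W_def)
  \<comment> \<open>Sign \<open>+1\<close> instead of the flip: \<open>?Y\<close> recombines to
    \<open>w\<close>, and \<open>?X\<close> is its cut-off version, whose energy does not blow up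
    for small \<open>H\<close>.\<close>
  let ?X = "Xf 1 \<eta> d z \<theta> gg" and ?Y = "Xf 1 (\<lambda>_. 1) (\<lambda>_. 0) z \<theta> gg"
  have XV: "?X \<in> V \<Omega>" "?Y \<in> V \<Omega>" using Xf_V[OF dc _ _ subdomain_\<Omega>, of _ _ 1] c cut_one by auto
  note XH = glob.V_H0curl[OF XV(1)] and YH = glob.V_H0curl[OF XV(2)]
  have j0m: "j0 + 2 \<le> m" "j0 \<le> m" using mr by (auto simp: j0_def)
  have XL: "?X \<in> V (nbhm \<T> m T)"
  proof -
    have "nrm K ?X = 0" if K: "K \<in> \<T> - layer \<T> m T" for K
    proof -
      have "K \<notin> layer \<T> (Suc (j0 + 1)) T" using layer_mono[OF T j0m(1)] K by auto
      then show ?thesis using \<eta>0[of K] layer_disjoint[of K "j0 + 1" T] K by (intro Xf_nrm_0) auto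
    qed
    then show ?thesis using L.V_D XH by blast
  qed
  let ?\<psi> = "L.P ?X"
  have \<psi>W: "?\<psi> \<in> L.W" by (rule L.P_W[OF XH XL])
  note \<psi>H = L.P_H0curl[OF XH]
  have wY: "ae_eq \<Omega> w ?Y" using dc by (simp add: decomp_def Xf_def[abs_def] cvec_def zero_vec_def[symmetric])
  have \<pi>Y: "ae_eq \<Omega> (\<pi> ?Y) (\<lambda>x. 0)"
    using ae_eq_trans[OF ae_eq_sym[OF glob.\<pi>_cong[OF wH YH wY]]] w by (simp add: glob.W_def)
  \<comment> \<open>On these elements both operators give the same projection of \<open>?X\<close>,
    which agrees with \<open>?Y\<close> on all neighbours; \<open>?Y\<close> is \<open>w\<close>,
    which \<open>\<pi>\<close> annihilates.\<close>
  have near: "nrm K (\<lambda>x. w x - ?\<psi> x) = 0" if K: "K \<in> layer \<T> j0 T" for K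
  proof -
    have K\<T>: "K \<in> \<T>" using K sub\<T> by blast
    have "nrm K' (\<lambda>x. ?X x - ?Y x) = 0" if "K' \<in> layer \<T> 1 K" for K'
      using layer_trans[OF K that] \<eta>1 by (intro Xf_nrm_eq) auto
    then have "nrm K (\<lambda>x. glob.P ?X x - glob.P ?Y x) = 0" by (rule glob.P_agree[OF XV K\<T>])
    then have 1: "ae_eq (K \<inter> \<Omega>) (\<lambda>x. glob.P ?X x - glob.P ?Y x) (\<lambda>x. 0)"
      using nrm_0_iff[OF _ element_sets[OF K\<T>]] H0curl_L2(1)[OF H0curl_diff[OF glob.P_H0curl[OF XH] glob.P_H0curl[OF YH]]] by blast
    have 2: "ae_eq K (\<pi>loc T ?X) (\<pi> ?X)" using layer_mono[OF T, of j0 "j0 + 2"] K by (intro local_agree[OF T XL]) auto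
    have "ae_eq (K \<inter> \<Omega>) (\<lambda>x. w x - ?\<psi> x) (\<lambda>x. 0)"
      using 1 2 wY \<pi>Y unfolding ae_eq_def glob.P_def L.P_def by eventually_elim auto
    then show ?thesis using nrm_0_iff[OF _ element_sets[OF K\<T>]] H0curl_L2(1)[OF H0curl_diff[OF wH \<psi>H]] by blast
  qed
  let ?M = "layer \<T> m T - layer \<T> j0 T" and ?R = "layer \<T> (m + 4) T"
  note dH = H0curl_diff[OF wH \<psi>H]
  \<comment> \<open>On \<open>T\<close> the functions \<open>w\<close> and \<open>\<psi>\<close>
    coincide, so \<open>\<B>\<close> over \<open>T\<close> does not distinguish them and the
    corrector equation for \<open>\<psi>\<close> may be inserted.\<close>
  have "B T v w - B \<Omega> ?g w = - (B \<Omega> ?g w - B \<Omega> ?g ?\<psi>)"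
    using B_cong(2)[OF wH \<psi>H T v near[OF layer_self[OF T]]] G(2)[OF T v] \<psi>W by (simp add: WT_eq[OF T])
  also have "\<dots> = - B \<Omega> ?g (\<lambda>x. w x - ?\<psi> x)" using B_diff_right[OF wH \<psi>H gH] by simp
  also have "B \<Omega> ?g (\<lambda>x. w x - ?\<psi> x) = (\<Sum>K\<in>\<T>. B K ?g (\<lambda>x. w x - ?\<psi> x))" by (rule B_sum[OF gH dH])
  also have "\<dots> = (\<Sum>K\<in>?M. B K ?g (\<lambda>x. w x - ?\<psi> x))"
  proof (rule sum.mono_neutral_right[OF finite_mesh], use sub\<T> in blast, rule ballI)
    fix K assume "K \<in> \<T> - ?M"
    then show "B K ?g (\<lambda>x. w x - ?\<psi> x) = 0" using B_zero[OF _ gH dH, of K] near[of K] G(6)[OF T v, of K] by blast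
  qed
  finally have "cmod (B T v w - B \<Omega> ?g w) = cmod (\<Sum>K\<in>?M. B K ?g (\<lambda>x. w x - ?\<psi> x))" by simp
  also have "\<dots> \<le> \<Lambda> * (sqrt (es ?M ?g) * sqrt (es ?M (\<lambda>x. w x - ?\<psi> x)))"
    using sub\<T> by (intro B_sum_bound[OF gH dH]) auto
  also have "\<dots> \<le> \<Lambda> * (sqrt (es (\<T> - layer \<T> j0 T) ?g) * (sqrt (2 + 2 * (glob.D2 * N 4)) * sqrt (es ?R w)))"
  proof -
    have "es ?M (\<lambda>x. w x - ?\<psi> x) \<le> (\<Sum>K\<in>?M. 2 * en K w + 2 * en K ?\<psi>)"
      unfolding es_def using sub\<T> by (intro sum_mono en_diff wH \<psi>H) auto
    also have "\<dots> = 2 * es ?M w + 2 * es ?M ?\<psi>" unfolding es_def by (simp add: sum.distrib sum_distrib_left)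
    also have "\<dots> \<le> 2 * es ?R w + 2 * (glob.D2 * N 4 * es ?R w)"
    proof (intro add_mono mult_left_mono)
      show "es ?M w \<le> es ?R w" using layer_mono[OF T, of m "m + 4"] sub\<T> by (intro es_mono) auto
      show "es ?M ?\<psi> \<le> glob.D2 * N 4 * es ?R w"
      proof (rule es_bound_layers)
        show "en K ?\<psi> \<le> glob.D2 * es (layer \<T> 4 K) w" if "K \<in> ?M" for K
          unfolding es_def using that sub\<T> by (intro L.P_Xf_en[OF XL Xf_en[OF dc A_1 c _ wH]]) auto
        show "layer \<T> 4 K \<subseteq> ?R" if K: "K \<in> ?M" for K
          using layer_trans[of K m T _ 4] K by blast
      qed (use glob.D2_pos sub\<T> in auto)
    qed auto
    also have "\<dots> = (2 + 2 * (glob.D2 * N 4)) * es ?R w" by (simp add: algebra_simps)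
    finally have "sqrt (es ?M (\<lambda>x. w x - ?\<psi> x)) \<le> sqrt (2 + 2 * (glob.D2 * N 4)) * sqrt (es ?R w)"
      unfolding real_sqrt_mult[symmetric] by (rule real_sqrt_le_mono)
    moreover have "es ?M ?g \<le> es (\<T> - layer \<T> j0 T) ?g" using sub\<T> by (intro es_mono) auto
    ultimately show ?thesis using \<Lambda>0 by (intro mult_left_mono mult_mono real_sqrt_le_mono) auto
  qed
  also have "\<dots> = Cr * (sqrt (es (\<T> - layer \<T> j0 T) ?g) * sqrt (es ?R w))" by (simp add: Cr_def mult_ac)
  finally show ?thesis .
qed

text \<open>Squared decay factor of a corrector across \<open>j0\<close> layers; its root enters the
  estimates for norms.\<close>

definition Cd :: real where "Cd = glob.Cg / glob.qd * (root 11 glob.qd) ^ j0"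

lemma Cd_nonneg: "0 \<le> Cd"
proof -
  have "0 \<le> glob.Cg" unfolding glob.Cg_def by (rule mult_nonneg_nonneg[OF zero_le_power2 less_imp_le[OF glob.D2N]])
  then show ?thesis unfolding Cd_def using glob.qd by (intro mult_nonneg_nonneg divide_nonneg_nonneg zero_le_power) auto
qed

definition SG :: "vfield \<Rightarrow> vfield" where "SG v x = (\<Sum>T\<in>\<T>. G v T x)"

lemma SG_H0curl: "v \<in> H0curl \<Omega> \<Longrightarrow> SG v \<in> H0curl \<Omega>"
  unfolding SG_def[abs_def] by (rule H0curl_sum[OF finite_mesh G(5)])

text \<open>Galerkin orthogonality up to an exponentially small error: the ideal corrected function
  would make this vanish. Cauchy-Schwarz over the elements brings in the overlap of the enlarged
  patches.\<close>

lemma residual_sum: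
  assumes v: "v \<in> H0curl \<Omega>" and w: "w \<in> glob.W"
  shows "cmod (B \<Omega> (\<lambda>x. v x - SG v x) w) \<le> Cr * sqrt (Cd * N (m + 4)) * (sqrt (es \<T> v) * sqrt (es \<T> w))"
proof -
  note wH = glob.W_H0curl[OF w]
  have "B \<Omega> (\<lambda>x. v x - SG v x) w = B \<Omega> v w - (\<Sum>T\<in>\<T>. B \<Omega> (G v T) w)"
    using B_diff_left[OF v SG_H0curl[OF v] wH] B_sum_left[OF finite_mesh G(5)[OF _ v] wH] by (simp add: SG_def[abs_def])
  also have "\<dots> = (\<Sum>T\<in>\<T>. B T v w - B \<Omega> (G v T) w)" unfolding B_sum[OF v wH] by (simp add: sum_subtractf)
  finally have "cmod (B \<Omega> (\<lambda>x. v x - SG v x) w) \<le> (\<Sum>T\<in>\<T>. cmod (B T v w - B \<Omega> (G v T) w))" by (simp add: norm_sum)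
  also have "\<dots> \<le> (\<Sum>T\<in>\<T>. Cr * sqrt Cd * (sqrt (en T v) * sqrt (es (layer \<T> (m + 4) T) w)))"
  proof (rule sum_mono)
    fix T assume T: "T \<in> \<T>"
    have "sqrt (es (\<T> - layer \<T> j0 T) (G v T)) \<le> sqrt Cd * sqrt (en T v)"
      unfolding real_sqrt_mult[symmetric] Cd_def by (rule real_sqrt_le_mono[OF G(4)[OF T v]])
    then have "Cr * (sqrt (es (\<T> - layer \<T> j0 T) (G v T)) * sqrt (es (layer \<T> (m + 4) T) w))
        \<le> Cr * ((sqrt Cd * sqrt (en T v)) * sqrt (es (layer \<T> (m + 4) T) w))"
      using Cr_nonneg by (intro mult_left_mono mult_right_mono) auto
    then show "cmod (B T v w - B \<Omega> (G v T) w) \<le> Cr * sqrt Cd * (sqrt (en T v) * sqrt (es (layer \<T> (m + 4) T) w))"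
      using residual[OF T v w] by (simp add: mult.assoc)
  qed
  also have "\<dots> = Cr * sqrt Cd * (\<Sum>T\<in>\<T>. sqrt (en T v) * sqrt (es (layer \<T> (m + 4) T) w))" by (simp add: sum_distrib_left)
  also have "\<dots> \<le> Cr * sqrt Cd * (sqrt (es \<T> v) * sqrt (\<Sum>T\<in>\<T>. es (layer \<T> (m + 4) T) w))"
    unfolding es_def[of \<T> v] using Cr_nonneg Cd_nonneg by (intro mult_left_mono sum_sqrt_mult_le) auto
  also have "\<dots> \<le> Cr * sqrt Cd * (sqrt (es \<T> v) * sqrt (N (m + 4) * es \<T> w))"
    using Cr_nonneg Cd_nonneg es_layers_all by (intro mult_left_mono real_sqrt_le_mono) auto
  finally show ?thesis by (simp add: real_sqrt_mult mult_ac)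
qed

lemma SG_bound:
  assumes v: "v \<in> H0curl \<Omega>" shows "es \<T> (SG v) \<le> N m * glob.Cg * es \<T> v"
proof -
  have "es \<T> (SG v) \<le> N m * (\<Sum>T\<in>\<T>. es \<T> (G v T))"
    unfolding SG_def[abs_def] by (rule es_sum_overlap[OF G(5)[OF _ v] G(6)[OF _ v]])
  also have "\<dots> \<le> N m * (\<Sum>T\<in>\<T>. glob.Cg * en T v)"
    using N_ge_1[of m] by (intro mult_left_mono sum_mono G(3) v) auto
  finally show ?thesis by (simp add: es_def sum_distrib_left mult.assoc)
qed

text \<open>The local operator annihilates its corrector and coincides with \<open>\<pi>\<close> on
  the first \<open>j0 + 2\<close> layers, so \<open>\<pi>\<close> of a corrector lives on the outer
  elements. There stability bounds it by the energy of the corrector beyond \<open>j0\<close>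
  layers.\<close>

lemma \<pi>_SG_bound:
  assumes v: "v \<in> H0curl \<Omega>" shows "es \<T> (\<pi> (SG v)) \<le> N (m + 1) * (3 * A * N 1) * Cd * es \<T> v"
proof -
  note gH = G(5)[OF _ v]
  have gV: "G v T \<in> V \<Omega>" if "T \<in> \<T>" for T using gH[OF that] H0curl_V by simp
  note \<pi>gH = glob.\<pi>_H0curl[OF gH]
  have b: "es \<T> (\<pi> (G v T)) \<le> 3 * A * N 1 * (Cd * en T v)" if T: "T \<in> \<T>" for T
  proof -
    interpret L: corrector \<Omega> \<sigma> \<kappa> \<T> \<omega> \<mu> \<epsilon> \<alpha> \<Lambda> "nbhm \<T> m T" "layer \<T> m T" C A "\<pi>loc T" by (rule local_corrector[OF T])
    have gW: "G v T \<in> V (nbhm \<T> m T)" "ae_eq \<Omega> (\<pi>loc T (G v T)) (\<lambda>x. 0)" using G(1)[OF T v] by (auto simp: W_loc_def)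
    have z: "en K (\<pi> (G v T)) = 0" if K: "K \<in> layer \<T> (j0 + 2) T" for K
    proof -
      have K\<T>: "K \<in> \<T>" using K layer_subset[OF T] by blast
      have "ae_eq (K \<inter> \<Omega>) (\<pi> (G v T)) (\<lambda>x. 0)"
        using local_agree[OF T gW(1) K] gW(2) unfolding ae_eq_def by eventually_elim auto
      then show ?thesis using nrm_0_iff[OF H0curl_L2(1)[OF \<pi>gH[OF T]] element_sets[OF K\<T>]] en_eq_0[OF K\<T> \<pi>gH[OF T]] by simp
    qed
    have "es \<T> (\<pi> (G v T)) = es (\<T> - layer \<T> (j0 + 2) T) (\<pi> (G v T))"
      unfolding es_def using z finite_mesh by (intro sum.mono_neutral_right) auto
    also have "\<dots> \<le> 3 * A * N 1 * es (\<T> - layer \<T> j0 T) (G v T)"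
    proof (rule glob.es_\<pi>[OF gV[OF T]])
      show "layer \<T> 1 K \<subseteq> \<T> - layer \<T> j0 T" if K: "K \<in> \<T> - layer \<T> (j0 + 2) T" for K
      proof
        fix K' assume K': "K' \<in> layer \<T> 1 K"
        have "K \<notin> layer \<T> (j0 + 1) T" using K layer_mono[OF T, of "j0 + 1" "j0 + 2"] by auto
        then show "K' \<in> \<T> - layer \<T> j0 T" using layer_far[of K j0 1 T K'] K' K layer_subset[of K 1] by blast
      qed
    qed auto
    also have "\<dots> \<le> 3 * A * N 1 * (Cd * en T v)"
      unfolding Cd_def using A_1 N_ge_1[of 1] by (intro mult_left_mono G(4)[OF T v]) auto
    finally show ?thesis .
  qed
  have far: "nrm K (\<pi> (G v T)) = 0" if T: "T \<in> \<T>" and K: "K \<in> \<T> - layer \<T> (m + 1) T" for T K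
  proof (rule glob.\<pi>_local_0[OF gV[OF T]])
    fix K' assume K': "K' \<in> layer \<T> 1 K"
    then have "K' \<in> \<T> - layer \<T> m T" using layer_far[of K m 1 T K'] K layer_subset[of K 1] by blast
    then show "nrm K' (G v T) = 0" by (rule G(6)[OF T v])
  qed (use K in blast)
  have "es \<T> (\<pi> (SG v)) = es \<T> (\<lambda>x. \<Sum>T\<in>\<T>. \<pi> (G v T) x)"
    unfolding SG_def[abs_def] 
    by (rule es_cong[OF H0curl_sum[OF finite_mesh \<pi>gH] ae_eq_sym[OF glob.\<pi>_sum[OF finite_mesh gH]] subset_refl])
  also have "\<dots> \<le> N (m + 1) * (\<Sum>T\<in>\<T>. es \<T> (\<pi> (G v T)))" by (rule es_sum_overlap[OF \<pi>gH far])
  also have "\<dots> \<le> N (m + 1) * (\<Sum>T\<in>\<T>. 3 * A * N 1 * (Cd * en T v))"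
    using N_ge_1[of "m + 1"] by (intro mult_left_mono sum_mono b) auto
  also have "(\<Sum>T\<in>\<T>. 3 * A * N 1 * (Cd * en T v)) = 3 * A * N 1 * (Cd * es \<T> v)" unfolding es_def by (simp only: sum_distrib_left)
  finally show ?thesis by (simp only: mult.assoc)
qed

end

text \<open>With \<open>x = \<gamma> / sqrt (M m^3)\<close> the condition says that
  \<open>\<beta> ^ m\<close> is at most \<open>x ^ 7\<close>. One factor \<open>x\<close> is spent
  on \<open>min 1 \<gamma>\<close>, the other six on the polynomial \<open>Q m^3\<close>.\<close>

lemma oversampling_threshold:
  fixes \<beta> Q L M0 :: real
  assumes \<beta>: "0 < \<beta>" "\<beta> < 1" and Q: "0 \<le> Q" and L: "0 \<le> L" and M0: "0 \<le> M0"
  shows "\<exists>M\<ge>M0. 0 < M \<and> (\<forall>m \<gamma>. 1 \<le> m \<longrightarrow> 0 < \<gamma> \<longrightarrow> \<gamma> \<le> L \<longrightarrow>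
    7 * (\<bar>ln (\<gamma> / sqrt (M * real m ^ 3))\<bar> / \<bar>ln \<beta>\<bar>) \<le> real m \<longrightarrow> s < m \<and> Q * real m ^ 3 * \<beta> ^ m \<le> min 1 \<gamma> / 4)"
proof -
  \<comment> \<open>The term \<open>L^2\<close> makes \<open>x \<le> 1\<close> and fixes the sign of
    the logarithm, \<open>4 * Q * L ^ 6\<close> absorbs the polynomial error, the last term forces
    \<open>m\<close> beyond \<open>s\<close>, and 1 makes \<open>M\<close> grow under
    powers.\<close>
  define M where "M = 1 + M0 + L\<^sup>2 + 4 * Q * L ^ 6 + (L / \<beta> ^ s)\<^sup>2"
  have M: "1 \<le> M" "M0 \<le> M" "L\<^sup>2 \<le> M" "4 * Q * L ^ 6 \<le> M" "(L / \<beta> ^ s)\<^sup>2 < M"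
    unfolding M_def using Q M0 L by (auto intro!: add_nonneg_nonneg mult_nonneg_nonneg add_pos_nonneg add_increasing2 add_increasing)
  have "s < m \<and> Q * real m ^ 3 * \<beta> ^ m \<le> min 1 \<gamma> / 4"
    if m: "1 \<le> m" and \<gamma>: "0 < \<gamma>" "\<gamma> \<le> L" and h: "7 * (\<bar>ln (\<gamma> / sqrt (M * real m ^ 3))\<bar> / \<bar>ln \<beta>\<bar>) \<le> real m" for m \<gamma>
  proof -
    define y where "y = sqrt (M * real m ^ 3)"
    define x where "x = \<gamma> / y"
    have m1: "1 \<le> real m" and m3: "1 \<le> real m ^ 3" using m by auto
    have Mm: "M \<le> M * real m ^ 3" using mult_left_mono[OF m3, of M] M(1) by simp
    have y2: "y\<^sup>2 = M * real m ^ 3" unfolding y_def using M(1) by simp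
    have yM: "sqrt M \<le> y" unfolding y_def using Mm by (rule real_sqrt_le_mono)
    have y1: "1 \<le> y" using yM M(1) order_trans[of 1 "sqrt M" y] by simp
    have Ly: "L \<le> y" using yM real_le_rsqrt[OF M(3)] by linarith
    have x: "0 < x" "x \<le> 1" "x \<le> \<gamma>" unfolding x_def using \<gamma> Ly y1 by (auto simp: divide_simps mult_le_cancel_left1)
    have "\<beta> ^ m \<le> x ^ 7"
    proof -
      have l: "ln \<beta> < 0" using \<beta> by simp
      have lx: "ln x \<le> 0" using x by simp
      have "7 * \<bar>ln x\<bar> \<le> real m * \<bar>ln \<beta>\<bar>" using h l unfolding x_def y_def by (simp add: field_simps)
      then have "real m * ln \<beta> \<le> 7 * ln x" using l lx by (simp add: abs_of_neg abs_of_nonpos)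
      then have "ln (\<beta> ^ m) \<le> ln (x ^ 7)" using \<beta> x by (simp add: ln_realpow)
      then show ?thesis using \<beta> x by (subst (asm) ln_le_cancel_iff) auto
    qed
    also have x7: "x ^ 7 = x * (x\<^sup>2) ^ 3" by (simp add: power_numeral_reduce)
    finally have b: "\<beta> ^ m \<le> x * (x\<^sup>2) ^ 3" .
    have "x * (x\<^sup>2) ^ 3 \<le> x * 1" using x by (intro mult_left_mono power_le_one) (auto simp: abs_square_le_1)
    then have bx: "\<beta> ^ m \<le> x" using b by simp
    \<comment> \<open>Otherwise
      \<open>\<beta> ^ s \<le> \<beta> ^ m \<le> x \<le> L / sqrt M\<close>, against the last
      summand of \<open>M\<close>.\<close>
    have "s < m"
    proof (rule ccontr)
      assume "\<not> s < m"
      then have "\<beta> ^ s \<le> \<beta> ^ m" using \<beta> by (intro power_decreasing) auto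
      also have "\<dots> \<le> L / sqrt M" using bx frac_le[of L \<gamma> "sqrt M" y] \<gamma> yM M(1) L unfolding x_def by simp
      finally have "sqrt M \<le> L / \<beta> ^ s" using \<beta> M(1) by (simp add: field_simps)
      then have "(sqrt M)\<^sup>2 \<le> (L / \<beta> ^ s)\<^sup>2" using M(1) by (intro power_mono) auto
      then show False using M(1,5) by simp
    qed
    moreover have "Q * real m ^ 3 * \<beta> ^ m \<le> min 1 \<gamma> / 4"
    proof -
      have "x\<^sup>2 = \<gamma>\<^sup>2 / (M * real m ^ 3)" by (simp add: x_def power_divide y2)
      also have "\<dots> \<le> L\<^sup>2 / (M * real m ^ 3)" using \<gamma> M(1) by (intro divide_right_mono power_mono) auto
      finally have "(x\<^sup>2) ^ 3 \<le> (L\<^sup>2 / (M * real m ^ 3)) ^ 3" by (intro power_mono) auto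
      also have "\<dots> = L ^ 6 / (M ^ 3 * (real m ^ 3) ^ 3)" by (simp add: power_divide power_mult_distrib flip: power_mult)
      also have "\<dots> \<le> L ^ 6 / (M * real m ^ 3)"
        using m M(1) m3 L power_increasing[of 1 3 M] power_increasing[of 1 3 "real m ^ 3"]
        by (intro divide_left_mono mult_mono mult_pos_pos) auto
      finally have "\<beta> ^ m \<le> x * (L ^ 6 / (M * real m ^ 3))" using b x mult_left_mono[of "(x\<^sup>2) ^ 3" "L ^ 6 / (M * real m ^ 3)" x] by linarith
      then have "Q * real m ^ 3 * \<beta> ^ m \<le> Q * real m ^ 3 * (x * (L ^ 6 / (M * real m ^ 3)))" using Q by (intro mult_left_mono) auto
      also have "\<dots> = x * (Q * L ^ 6 / M)" using m1 by simp
      also have "\<dots> \<le> min 1 \<gamma> * (1 / 4)" using x Q L M(1,4) by (intro mult_mono) (auto simp: divide_simps)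
      finally show ?thesis by simp
    qed
    ultimately show ?thesis by blast
  qed
  then show ?thesis using M(1,2) by (intro exI[of _ M]) auto
qed

section \<open>From the error bounds to the inf-sup constant\<close>

context lodform
begin

abbreviation "nn v \<equiv> sqrt (es \<T> v)"

lemma nonzero_nn: "v \<in> nonzero \<Omega> (H0curl \<Omega>) \<longleftrightarrow> v \<in> H0curl \<Omega> \<and> 0 < nn v"
  using es_eq_0[of v] es_nonneg[of \<T> v] by (auto simp: nonzero_def less_le)

text \<open>Continuity of the form caps every inf-sup constant, provided there is a nonzero field.
  The cap controls the logarithm in the oversampling condition, which stands in absolute
  value.\<close>

lemma \<gamma>_le_\<Lambda>:
  assumes "ereal \<gamma> \<le> inf_sup \<omega> \<Omega> (H0curl \<Omega>) (B \<Omega>)" and u: "u \<in> nonzero \<Omega> (H0curl \<Omega>)"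
  shows "\<gamma> \<le> \<Lambda>"
proof -
  have "ereal \<gamma> \<le> (SUP \<psi>\<in>nonzero \<Omega> (H0curl \<Omega>). ereal (cmod (B \<Omega> u \<psi>) / (curl_norm \<omega> \<Omega> u * curl_norm \<omega> \<Omega> \<psi>)))"
    using assms(1) INF_lower[OF u] unfolding inf_sup_def by (rule order_trans)
  also have "\<dots> \<le> ereal \<Lambda>"
  proof (rule SUP_least)
    fix \<psi> assume \<psi>: "\<psi> \<in> nonzero \<Omega> (H0curl \<Omega>)"
    then show "ereal (cmod (B \<Omega> u \<psi>) / (curl_norm \<omega> \<Omega> u * curl_norm \<omega> \<Omega> \<psi>)) \<le> ereal \<Lambda>"
      using B_bound_all[of u \<psi>] u unfolding nonzero_nn by (simp add: curl_norm_es divide_simps mult_ac)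
  qed
  finally show ?thesis by simp
qed

end

context lod
begin

text \<open>Bound for the norm of \<open>\<pi>\<close> in the energy norm.\<close>

definition P1 :: real where "P1 = sqrt (3 * A * N 1)"

text \<open>Gathers the errors in \<open>stability\<close>: the two kernel components of the test
  function, then the components \<open>\<pi> (SG _)\<close> in the test function and in the trial
  function. The root collects the constant part of the decay.\<close>

definition Q :: real where
  "Q = (8 * Cr * P1 ^ 3 * sqrt (1 + glob.Cg) + \<Lambda> * P1\<^sup>2 + P1) * sqrt (glob.Cg / glob.qd)"

text \<open>The decay factor bounds energies, that is squared norms; norms decay with its
  root.\<close>

definition rate :: real where "rate = sqrt (root 11 glob.qd)"

lemma P1: "1 \<le> P1" "P1\<^sup>2 = 3 * A * N 1"
proof -
  have "1 * 1 \<le> 3 * A * N 1" using A_1 N_ge_1[of 1] by (intro mult_mono) auto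
  then show "1 \<le> P1" "P1\<^sup>2 = 3 * A * N 1" unfolding P1_def by auto
qed

lemma Cg_nonneg: "0 \<le> glob.Cg" unfolding glob.Cg_def by (rule mult_nonneg_nonneg[OF zero_le_power2 less_imp_le[OF glob.D2N]])

lemma rate: "0 < rate" "rate < 1"
  using glob.qd unfolding rate_def by auto

lemma sqrt_Cd: "sqrt Cd = sqrt (glob.Cg / glob.qd) * rate ^ j0"
  unfolding Cd_def rate_def by (simp only: real_sqrt_mult real_sqrt_power)

lemma nn_\<pi>: "v \<in> H0curl \<Omega> \<Longrightarrow> nn (\<pi> v) \<le> P1 * nn v"
  using real_sqrt_le_mono[OF glob.es_\<pi>[of v \<T> \<T>]] layer_subset H0curl_V by (simp add: P1_def real_sqrt_mult)

lemma nn_P: "v \<in> H0curl \<Omega> \<Longrightarrow> nn (glob.P v) \<le> 2 * P1 * nn v"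
  using sqrt_es_diff[OF _ glob.\<pi>_H0curl, of v v \<T>] nn_\<pi>[of v] mult_right_mono[OF P1(1), of "nn v"]
  by (simp add: glob.P_def[abs_def])

lemma SG_zero: "v \<in> H0curl \<Omega> \<Longrightarrow> nn v = 0 \<Longrightarrow> nn (SG v) = 0"
  using SG_bound[of v] by (simp add: order_antisym)

text \<open>The error is compared with \<open>min 1 \<gamma>\<close>: the bound by 1 recovers
  \<open>v\<close> from \<open>v - SG v\<close>, the bound by \<open>\<gamma>\<close> lets half of
  the continuous inf-sup estimate survive.\<close>

lemma stability:
  assumes \<gamma>: "0 < \<gamma>" and isup: "ereal \<gamma> \<le> inf_sup \<omega> \<Omega> (H0curl \<Omega>) (B \<Omega>)"
    and small_err: "Q * N (m + 4) * rate ^ j0 \<le> min 1 \<gamma> / 4" and v: "v \<in> nonzero \<Omega> (nedelec \<Omega> \<Omega> \<T>)"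
  shows "\<exists>\<phi>\<in>nonzero \<Omega> (nedelec \<Omega> \<Omega> \<T>). \<gamma> / (8 * P1\<^sup>2) * (nn v * nn \<phi>) \<le> cmod (B \<Omega> (\<lambda>x. v x - SG v x) (\<lambda>x. \<phi> x - SG \<phi> x))"
proof -
  let ?n = "N (m + 4)" and ?q = "sqrt (glob.Cg / glob.qd) * rate ^ j0"
  have vN: "v \<in> nedelec \<Omega> \<Omega> \<T>" using v by (simp add: nonzero_def)
  then have vH: "v \<in> H0curl \<Omega>" by (auto simp: nedelec_def vanishing_outside_def)
  have v0: "0 < nn v" using v vH nonzero_nn[of v] by (simp add: nonzero_def)
  let ?u = "\<lambda>x. v x - SG v x"
  have uH: "?u \<in> H0curl \<Omega>" by (intro H0curl_diff vH SG_H0curl)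
  have N_mono: "N i \<le> N j" if "i \<le> j" for i j
    unfolding N_def using \<kappa> \<sigma> that by (intro mult_left_mono power_mono) auto
  have n1: "1 \<le> ?n" by (rule N_ge_1)
  have q0: "0 \<le> ?q" using Cg_nonneg glob.qd rate by auto
  have sn: "sqrt ?n \<le> ?n" using n1 by (intro real_le_lsqrt) (auto simp: power2_eq_square)
  have err: "(8 * Cr * P1 ^ 3 * sqrt (1 + glob.Cg) + \<Lambda> * P1\<^sup>2 + P1) * (?n * ?q) \<le> min 1 \<gamma> / 4"
    using small_err by (simp add: Q_def mult_ac)
  have nq: "0 \<le> ?n * ?q" using n1 q0 by simp
  have cs: "0 \<le> 8 * Cr * P1 ^ 3 * sqrt (1 + glob.Cg)" "0 \<le> \<Lambda> * P1\<^sup>2" "0 \<le> P1"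
    using Cr_nonneg P1(1) Cg_nonneg \<Lambda>0 by auto
  note parts = mult_nonneg_nonneg[OF cs(1) nq] mult_nonneg_nonneg[OF cs(2) nq] mult_nonneg_nonneg[OF cs(3) nq]
  have err': "8 * Cr * P1 ^ 3 * sqrt (1 + glob.Cg) * (?n * ?q) + \<Lambda> * P1\<^sup>2 * (?n * ?q) + P1 * (?n * ?q) \<le> min 1 \<gamma> / 4"
    using err by (simp only: distrib_right)
  have err1: "P1 * (?n * ?q) \<le> 1 / 4" using err' parts by linarith
  have err2: "8 * Cr * P1 ^ 3 * sqrt (1 + glob.Cg) * (?n * ?q) + \<Lambda> * P1\<^sup>2 * (?n * ?q) \<le> \<gamma> / 4"
    using err' parts by linarith
  have \<tau>: "nn (\<pi> (SG f)) \<le> P1 * (?n * ?q) * nn f" if f: "f \<in> H0curl \<Omega>" for f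
  proof -
    have "nn (\<pi> (SG f)) \<le> sqrt (N (m + 1) * P1\<^sup>2 * Cd * es \<T> f)"
      using real_sqrt_le_mono[OF \<pi>_SG_bound[OF f]] by (simp only: P1(2))
    also have "\<dots> = sqrt (N (m + 1)) * P1 * ?q * nn f" using P1(1) by (simp add: real_sqrt_mult sqrt_Cd)
    also have "\<dots> \<le> ?n * P1 * ?q * nn f"
      using P1(1) order_trans[OF real_sqrt_le_mono[OF N_mono[of "m + 1" "m + 4"]] sn] by (intro mult_right_mono q0) auto
    finally show ?thesis by (simp only: mult_ac)
  qed
  have absorb: "a \<le> b + 1 / 4 * a \<Longrightarrow> 0 \<le> b \<Longrightarrow> a \<le> 2 * b" for a b :: real by simp
  \<comment> \<open>As \<open>\<pi>\<close> fixes the finite element function,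
    \<open>v = \<pi> (v - SG v) + \<pi> (SG v)\<close> and the last term is at most a quarter of
    \<open>v\<close>.\<close>
  have vu: "nn v \<le> 2 * P1 * nn ?u"
  proof -
    have "ae_eq \<Omega> (\<lambda>x. \<pi> ?u x + \<pi> (SG v) x) v"
      using glob.\<pi>_diff[OF vH SG_H0curl[OF vH]] glob.fw_proj[OF vN] unfolding ae_eq_def by eventually_elim simp
    then have "nn v = nn (\<lambda>x. \<pi> ?u x + \<pi> (SG v) x)"
      by (intro arg_cong[where f=sqrt] es_cong) (auto intro: H0curl_add glob.\<pi>_H0curl uH SG_H0curl vH)
    also have "\<dots> \<le> nn (\<pi> ?u) + nn (\<pi> (SG v))" by (intro sqrt_es_add glob.\<pi>_H0curl uH SG_H0curl vH) auto
    also have "\<dots> \<le> P1 * nn ?u + 1 / 4 * nn v"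
      using nn_\<pi>[OF uH] \<tau>[OF vH] mult_right_mono[OF err1, of "nn v"] by auto
    finally have le: "nn v \<le> P1 * nn ?u + 1 / 4 * nn v" .
    have "0 \<le> P1 * nn ?u" using P1(1) by simp
    with le show ?thesis unfolding mult.assoc by (rule absorb)
  qed
  have u0: "0 < nn ?u"
  proof (rule ccontr)
    assume "\<not> 0 < nn ?u"
    then have "nn ?u = 0" using es_nonneg[of \<T> ?u] by simp
    with vu v0 show False by simp
  qed
  \<comment> \<open>The supremum need not be attained; half of the constant leaves room to pick a
    test function.\<close>
  have "ereal (\<gamma> / 2) < ereal \<gamma>" using \<gamma> by simp
  also have "\<dots> \<le> (SUP \<psi>\<in>nonzero \<Omega> (H0curl \<Omega>). ereal (cmod (B \<Omega> ?u \<psi>) / (curl_norm \<omega> \<Omega> ?u * curl_norm \<omega> \<Omega> \<psi>)))"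
    using isup INF_lower[of ?u "nonzero \<Omega> (H0curl \<Omega>)"] uH u0 nonzero_nn unfolding inf_sup_def by (blast intro: order_trans)
  finally obtain \<psi> where \<psi>: "\<psi> \<in> nonzero \<Omega> (H0curl \<Omega>)"
    and big: "\<gamma> / 2 < cmod (B \<Omega> ?u \<psi>) / (curl_norm \<omega> \<Omega> ?u * curl_norm \<omega> \<Omega> \<psi>)"
    unfolding less_SUP_iff by auto
  have \<psi>H: "\<psi> \<in> H0curl \<Omega>" and \<psi>0: "0 < nn \<psi>" using \<psi> nonzero_nn by auto
  have big': "\<gamma> / 2 * (nn ?u * nn \<psi>) \<le> cmod (B \<Omega> ?u \<psi>)"
    using big u0 \<psi>0 by (simp add: curl_norm_es[OF uH] curl_norm_es[OF \<psi>H] pos_less_divide_eq)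
  define \<phi> where "\<phi> = \<pi> \<psi>"
  have \<phi>H: "\<phi> \<in> H0curl \<Omega>" unfolding \<phi>_def by (rule glob.\<pi>_H0curl[OF \<psi>H])
  note SH = SG_H0curl[OF \<phi>H]
  have \<phi>b: "nn \<phi> \<le> P1 * nn \<psi>" unfolding \<phi>_def by (rule nn_\<pi>[OF \<psi>H])
  let ?u' = "\<lambda>x. \<phi> x - SG \<phi> x"
  have u'H: "?u' \<in> H0curl \<Omega>" by (intro H0curl_diff \<phi>H SH)
  note PH = glob.P_H0curl[OF \<psi>H] glob.P_H0curl[OF SH] glob.\<pi>_H0curl[OF SH]
  have PW: "glob.P \<psi> \<in> glob.W" "glob.P (SG \<phi>) \<in> glob.W" using glob.P_W \<psi>H SH H0curl_V by auto
  \<comment> \<open>Splitting \<open>\<psi>\<close> by \<open>\<pi>\<close>, then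
    \<open>\<phi>\<close> by \<open>SG\<close>, then \<open>SG \<phi>\<close> by
    \<open>\<pi>\<close> again: apart from the discrete test function there are two kernel fields,
    handled by \<open>residual_sum\<close>, and the small field
    \<open>\<pi> (SG \<phi>)\<close>.\<close>
  have "\<psi> = (\<lambda>x. ?u' x + (glob.P \<psi> x + (glob.P (SG \<phi>) x + \<pi> (SG \<phi>) x)))"
    by (simp add: glob.P_def \<phi>_def fun_eq_iff)
  then have "B \<Omega> ?u \<psi> = B \<Omega> ?u (\<lambda>x. ?u' x + (glob.P \<psi> x + (glob.P (SG \<phi>) x + \<pi> (SG \<phi>) x)))" by simp
  also have "\<dots> = B \<Omega> ?u ?u' + (B \<Omega> ?u (glob.P \<psi>) + (B \<Omega> ?u (glob.P (SG \<phi>)) + B \<Omega> ?u (\<pi> (SG \<phi>))))"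
    using B_add_right[OF u'H _ uH] B_add_right[OF PH(1) _ uH] B_add_right[OF PH(2,3) uH] H0curl_add PH by simp
  finally have "cmod (B \<Omega> ?u \<psi>) \<le> cmod (B \<Omega> ?u ?u') + (cmod (B \<Omega> ?u (glob.P \<psi>)) + (cmod (B \<Omega> ?u (glob.P (SG \<phi>))) + cmod (B \<Omega> ?u (\<pi> (SG \<phi>)))))"
    by (simp only:) (intro norm_triangle_le add_left_mono; simp add: norm_triangle_le norm_triangle_ineq add_left_mono)
  moreover
  have "cmod (B \<Omega> ?u (glob.P \<psi>)) + cmod (B \<Omega> ?u (glob.P (SG \<phi>))) \<le> 8 * Cr * P1 ^ 3 * sqrt (1 + glob.Cg) * (?n * ?q) * (nn ?u * nn \<psi>)"
  proof -
    have rearrange: "c * q * s * ((2 * p * x) * (4 * p * (p * (s * g)) * y)) = 8 * c * p ^ 3 * g * ((s * s) * q) * (x * y)"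
      for c q s p x g y :: real by (simp add: power3_eq_cube)
    have \<rho>: "Cr * sqrt (Cd * ?n) = Cr * ?q * sqrt ?n" by (simp add: real_sqrt_mult sqrt_Cd)
    have \<rho>0: "0 \<le> Cr * ?q * sqrt ?n" using n1 by (intro mult_nonneg_nonneg[OF mult_nonneg_nonneg[OF Cr_nonneg q0]]) simp
    have c1: "1 \<le> sqrt (1 + glob.Cg)" using Cg_nonneg by simp
    have s1: "1 \<le> sqrt ?n" using n1 by simp
    have a1: "1 \<le> P1 * (sqrt ?n * sqrt (1 + glob.Cg))" 
      using P1(1) s1 c1 mult_mono[of 1 P1 1 "sqrt ?n * sqrt (1 + glob.Cg)"] mult_mono[of 1 "sqrt ?n" 1 "sqrt (1 + glob.Cg)"] by simp
    have S: "nn (SG \<phi>) \<le> sqrt ?n * sqrt (1 + glob.Cg) * (P1 * nn \<psi>)"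
    proof -
      have "nn (SG \<phi>) \<le> sqrt (N m * glob.Cg * es \<T> \<phi>)" by (rule real_sqrt_le_mono[OF SG_bound[OF \<phi>H]])
      also have "\<dots> = sqrt (N m) * sqrt glob.Cg * nn \<phi>" by (simp add: real_sqrt_mult)
      also have "\<dots> \<le> sqrt ?n * sqrt (1 + glob.Cg) * (P1 * nn \<psi>)"
        using N_mono[of m "m + 4"] \<phi>b N_ge_1[of m] n1 Cg_nonneg by (intro mult_mono mult_nonneg_nonneg) auto
      finally show ?thesis .
    qed
    have "nn (glob.P \<psi>) + nn (glob.P (SG \<phi>)) \<le> 2 * P1 * nn \<psi> + 2 * P1 * (sqrt ?n * sqrt (1 + glob.Cg) * (P1 * nn \<psi>))"
      using nn_P[OF \<psi>H] order_trans[OF nn_P[OF SH] mult_left_mono[OF S]] P1(1) by (intro add_mono) auto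
    also have "\<dots> \<le> 4 * P1 * (P1 * (sqrt ?n * sqrt (1 + glob.Cg))) * nn \<psi>"
      using mult_right_mono[OF mult_left_mono[OF a1, of "2 * P1"], of "nn \<psi>"] P1(1) by (simp add: algebra_simps)
    finally have pp: "nn (glob.P \<psi>) + nn (glob.P (SG \<phi>)) \<le> 4 * P1 * (P1 * (sqrt ?n * sqrt (1 + glob.Cg))) * nn \<psi>" .
    have "cmod (B \<Omega> ?u (glob.P \<psi>)) + cmod (B \<Omega> ?u (glob.P (SG \<phi>))) \<le> Cr * ?q * sqrt ?n * (nn v * (nn (glob.P \<psi>) + nn (glob.P (SG \<phi>))))"
      using residual_sum[OF vH PW(1)] residual_sum[OF vH PW(2)] unfolding \<rho> by (simp add: distrib_left)
    also have "\<dots> \<le> Cr * ?q * sqrt ?n * ((2 * P1 * nn ?u) * (4 * P1 * (P1 * (sqrt ?n * sqrt (1 + glob.Cg))) * nn \<psi>))"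
      using vu pp P1(1) by (intro mult_left_mono[OF mult_mono \<rho>0] mult_nonneg_nonneg add_nonneg_nonneg) auto
    also have "\<dots> = 8 * Cr * P1 ^ 3 * sqrt (1 + glob.Cg) * ((sqrt ?n * sqrt ?n) * ?q) * (nn ?u * nn \<psi>)"
      by (rule rearrange)
    also have "sqrt ?n * sqrt ?n = ?n" using n1 by simp
    finally show ?thesis .
  qed
  moreover have "cmod (B \<Omega> ?u (\<pi> (SG \<phi>))) \<le> \<Lambda> * P1\<^sup>2 * (?n * ?q) * (nn ?u * nn \<psi>)"
  proof -
    have "nn (\<pi> (SG \<phi>)) \<le> P1 * (?n * ?q) * (P1 * nn \<psi>)"
      using order_trans[OF \<tau>[OF \<phi>H] mult_left_mono[OF \<phi>b parts(3)]] .
    then have "\<Lambda> * (nn ?u * nn (\<pi> (SG \<phi>))) \<le> \<Lambda> * (nn ?u * (P1 * (?n * ?q) * (P1 * nn \<psi>)))"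
      using \<Lambda>0 by (intro mult_left_mono) auto
    then show ?thesis using B_bound_all[OF uH PH(3)] by (simp only: power2_eq_square mult_ac)
  qed
  moreover have "(8 * Cr * P1 ^ 3 * sqrt (1 + glob.Cg) * (?n * ?q) + \<Lambda> * P1\<^sup>2 * (?n * ?q)) * (nn ?u * nn \<psi>) \<le> \<gamma> / 4 * (nn ?u * nn \<psi>)"
    by (rule mult_right_mono[OF err2]) simp
  ultimately have main: "\<gamma> / 4 * (nn ?u * nn \<psi>) \<le> cmod (B \<Omega> ?u ?u')"
    using big' unfolding distrib_right[of _ _ "nn ?u * nn \<psi>"] by linarith
  \<comment> \<open>If \<open>\<phi>\<close> were zero, so would be
    \<open>\<phi> - SG \<phi>\<close>, against the positive lower bound in
    \<open>main\<close>.\<close>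
  have "0 < nn \<phi>"
  proof (rule ccontr)
    assume "\<not> 0 < nn \<phi>"
    then have z: "nn \<phi> = 0" using es_nonneg[of \<T> \<phi>] by simp
    have "nn ?u' \<le> nn \<phi> + nn (SG \<phi>)" by (rule sqrt_es_diff[OF \<phi>H SH]) simp
    then have "nn ?u' = 0" using z SG_zero[OF \<phi>H z] es_nonneg[of \<T> ?u'] by simp
    then have "cmod (B \<Omega> ?u ?u') \<le> 0" using B_bound_all[OF uH u'H] by simp
    moreover have "0 < \<gamma> / 4 * (nn ?u * nn \<psi>)" using \<gamma> u0 \<psi>0 by (intro mult_pos_pos) auto
    ultimately show False using main by linarith
  qed
  then have "\<phi> \<in> nonzero \<Omega> (nedelec \<Omega> \<Omega> \<T>)"
    using \<phi>H nonzero_nn[of \<phi>] glob.fw_range[OF \<psi>H] by (simp add: nonzero_def \<phi>_def)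
  \<comment> \<open>The factor 8 is the 4 in \<open>main\<close> times the 2 from \<open>vu\<close>;
    one \<open>P1\<close> replaces \<open>v - SG v\<close> by \<open>v\<close>, the other
    \<open>\<psi>\<close> by \<open>\<phi>\<close>.\<close>
  moreover have "\<gamma> / (8 * P1\<^sup>2) * (nn v * nn \<phi>) \<le> \<gamma> / 4 * (nn ?u * nn \<psi>)"
  proof -
    have "nn v * nn \<phi> \<le> (2 * P1 * nn ?u) * (P1 * nn \<psi>)" using vu \<phi>b P1(1) by (intro mult_mono) auto
    then have "\<gamma> / (8 * P1\<^sup>2) * (nn v * nn \<phi>) \<le> \<gamma> / (8 * P1\<^sup>2) * ((2 * P1 * nn ?u) * (P1 * nn \<psi>))"
      using \<gamma> by (intro mult_left_mono) auto
    also have "\<dots> = \<gamma> / 4 * (nn ?u * nn \<psi>)" using P1(1) by (simp add: power2_eq_square field_simps)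
    finally show ?thesis .
  qed
  ultimately show ?thesis using main by (intro bexI[of _ \<phi>] order_trans[OF _ main])
qed

end

context lod
begin

lemma inf_sup_stable:
  assumes \<gamma>: "0 < \<gamma>" and isup: "ereal \<gamma> \<le> inf_sup \<omega> \<Omega> (H0curl \<Omega>) (B \<Omega>)"
    and small_err: "Q * N (m + 4) * rate ^ j0 \<le> min 1 \<gamma> / 4"
  shows "ereal (\<gamma> / (8 * P1\<^sup>2)) \<le> inf_sup \<omega> \<Omega> (nedelec \<Omega> \<Omega> \<T>)
    (\<lambda>v \<psi>. B \<Omega> (\<lambda>x. v x + K_loc \<Omega> \<T> m \<pi>loc \<mu> \<epsilon> \<omega> v x) (\<lambda>x. \<psi> x + K_loc \<Omega> \<T> m \<pi>loc \<mu> \<epsilon> \<omega> \<psi> x))"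
  unfolding inf_sup_def
proof (rule INF_greatest)
  have K: "(\<lambda>x. f x + K_loc \<Omega> \<T> m \<pi>loc \<mu> \<epsilon> \<omega> f x) = (\<lambda>x. f x - SG f x)" for f
    by (simp add: K_loc_def SG_def G_def)
  have H: "f \<in> H0curl \<Omega>" "0 < nn f" if "f \<in> nonzero \<Omega> (nedelec \<Omega> \<Omega> \<T>)" for f
    using that nonzero_nn[of f] by (auto simp: nonzero_def nedelec_def vanishing_outside_def)
  fix v assume v: "v \<in> nonzero \<Omega> (nedelec \<Omega> \<Omega> \<T>)"
  obtain \<phi> where \<phi>: "\<phi> \<in> nonzero \<Omega> (nedelec \<Omega> \<Omega> \<T>)"
    and le: "\<gamma> / (8 * P1\<^sup>2) * (nn v * nn \<phi>) \<le> cmod (B \<Omega> (\<lambda>x. v x - SG v x) (\<lambda>x. \<phi> x - SG \<phi> x))"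
    using stability[OF \<gamma> isup small_err v] by blast
  have "0 < nn v * nn \<phi>" by (intro mult_pos_pos H v \<phi>)
  then have "\<gamma> / (8 * P1\<^sup>2) \<le> cmod (B \<Omega> (\<lambda>x. v x - SG v x) (\<lambda>x. \<phi> x - SG \<phi> x)) / (curl_norm \<omega> \<Omega> v * curl_norm \<omega> \<Omega> \<phi>)"
    unfolding curl_norm_es[OF H(1)[OF v]] curl_norm_es[OF H(1)[OF \<phi>]] using le by (simp only: pos_le_divide_eq)
  then show "ereal (\<gamma> / (8 * P1\<^sup>2)) \<le> (SUP \<psi>\<in>nonzero \<Omega> (nedelec \<Omega> \<Omega> \<T>).
      ereal (cmod (B \<Omega> (\<lambda>x. v x + K_loc \<Omega> \<T> m \<pi>loc \<mu> \<epsilon> \<omega> v x) (\<lambda>x. \<psi> x + K_loc \<Omega> \<T> m \<pi>loc \<mu> \<epsilon> \<omega> \<psi> x))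
        / (curl_norm \<omega> \<Omega> v * curl_norm \<omega> \<Omega> \<psi>)))"
    unfolding K by (intro SUP_upper2[OF \<phi>]) simp
qed

lemma Q_nonneg: "0 \<le> Q"
  unfolding Q_def using Cr_nonneg P1(1) Cg_nonneg \<Lambda>0 glob.qd by (intro mult_nonneg_nonneg add_nonneg_nonneg) auto

end

section \<open>Uniform constants and conclusion\<close>

text \<open>The constants depend on none of the data quantified on the right, but their properties are
  only known once there are data at all.\<close>

lemma lod_constants:
  "\<exists>\<beta> q p :: real. 0 < \<beta> \<and> \<beta> < 1 \<and> 0 \<le> q \<and> 1 \<le> p \<and>
    (\<forall>\<Omega> \<T> \<omega> \<mu> \<epsilon> C r m \<pi> \<pi>loc. lod \<Omega> \<sigma> \<kappa> \<T> \<omega> \<mu> \<epsilon> \<alpha> \<Lambda> A C r m \<pi> \<pi>loc \<longrightarrow>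
      lod.rate \<sigma> \<kappa> \<alpha> \<Lambda> A = \<beta> \<and> lod.Q \<sigma> \<kappa> \<alpha> \<Lambda> A = q \<and> lod.P1 \<sigma> \<kappa> A = p)"
proof (cases "\<exists>\<Omega> \<T> \<omega> \<mu> \<epsilon> C r m \<pi> \<pi>loc. lod \<Omega> \<sigma> \<kappa> \<T> \<omega> \<mu> \<epsilon> \<alpha> \<Lambda> A C r m \<pi> \<pi>loc")
  case True
  then obtain \<Omega> \<T> \<omega> \<mu> \<epsilon> C r m \<pi> \<pi>loc where l: "lod \<Omega> \<sigma> \<kappa> \<T> \<omega> \<mu> \<epsilon> \<alpha> \<Lambda> A C r m \<pi> \<pi>loc" by blast
  show ?thesis using lod.rate[OF l] lod.Q_nonneg[OF l] lod.P1(1)[OF l] by blast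
next
  case False
  then show ?thesis by (intro exI[of _ "1/2"] exI[of _ 0] exI[of _ 1]) simp
qed

lemma coefficient_mono:
  assumes "coefficient \<Omega> \<alpha> \<Lambda> M" "\<Lambda> \<le> \<Lambda>'" shows "coefficient \<Omega> \<alpha> \<Lambda>' M"
proof -
  have le: "\<Lambda> * norm \<xi> \<le> \<Lambda>' * norm \<xi>" for \<xi> :: point using assms(2) by (intro mult_right_mono) auto
  have "AE x in lebesgue. x \<in> \<Omega> \<longrightarrow> (\<forall>\<xi>. \<alpha> * (norm \<xi>)\<^sup>2 \<le> \<xi> \<bullet> (M x *v \<xi>) \<and> norm (M x *v \<xi>) \<le> \<Lambda> * norm \<xi>)"
    using assms(1) by (simp add: coefficient_def)
  then have "AE x in lebesgue. x \<in> \<Omega> \<longrightarrow> (\<forall>\<xi>. \<alpha> * (norm \<xi>)\<^sup>2 \<le> \<xi> \<bullet> (M x *v \<xi>) \<and> norm (M x *v \<xi>) \<le> \<Lambda>' * norm \<xi>)"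
    by eventually_elim (blast intro: order_trans[OF _ le])
  then show ?thesis using assms(1) by (simp add: coefficient_def)
qed

theorem theorem4p5:
  fixes \<Omega> :: "point set" and \<sigma> \<kappa> \<alpha> \<Lambda> C\<pi> \<omega>0 :: real and r :: nat
  assumes "admissible_domain \<Omega>"
    and "0 < \<sigma>" and "0 < \<kappa>" and "0 < \<alpha>" and "0 < \<omega>0" and "1 \<le> r"
  shows "\<exists>(c0::real) (C0::real) (k1::real) (k2::real) (\<beta>::real) (Col :: nat \<Rightarrow> real).
     0 < c0 \<and> 0 < C0 \<and> 0 < k1 \<and> k1 \<le> k2 \<and> 0 < \<beta> \<and> \<beta> < 1 \<and> poly_bounded Col \<and>
     (\<forall>\<T>. tet_mesh \<Omega> \<sigma> \<kappa> \<T> \<longrightarrow>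
        overlap_bound \<T> Col \<and>
        (\<forall>\<mu> \<epsilon> \<pi> \<pi>loc (m::nat) (\<omega>::real) (\<gamma>::real).
           coefficient \<Omega> \<alpha> \<Lambda> \<mu> \<longrightarrow> coefficient \<Omega> \<alpha> \<Lambda> \<epsilon> \<longrightarrow>
           falk_winther \<Omega> \<Omega> \<T> (mesh_size \<T>) C\<pi> \<pi> \<longrightarrow>
           1 \<le> m \<longrightarrow> local_falk_winther \<Omega> \<T> m C\<pi> r \<pi> \<pi>loc \<longrightarrow>
           \<omega>0 \<le> \<omega> \<longrightarrow>
           uniquely_solvable \<Omega> (Bform \<mu> \<epsilon> \<omega> \<Omega> \<Omega>) \<longrightarrow>
           0 < \<gamma> \<longrightarrow> inf_sup \<omega> \<Omega> (H0curl \<Omega>) (Bform \<mu> \<epsilon> \<omega> \<Omega> \<Omega>) \<ge> ereal \<gamma> \<longrightarrow>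
           \<omega> * mesh_size \<T> \<le> c0 \<longrightarrow>
           real m \<ge> C0 * (\<bar>ln (\<gamma> / sqrt (Col m))\<bar> / \<bar>ln \<beta>\<bar>) \<longrightarrow>
           (\<exists>\<gamma>LOD>0. k1 * \<gamma> \<le> \<gamma>LOD \<and> \<gamma>LOD \<le> k2 * \<gamma> \<and>
              inf_sup \<omega> \<Omega> (nedelec \<Omega> \<Omega> \<T>)
                (\<lambda>v \<psi>. Bform \<mu> \<epsilon> \<omega> \<Omega> \<Omega>
                   (\<lambda>x. v x + K_loc \<Omega> \<T> m \<pi>loc \<mu> \<epsilon> \<omega> v x)
                   (\<lambda>x. \<psi> x + K_loc \<Omega> \<T> m \<pi>loc \<mu> \<epsilon> \<omega> \<psi> x)) \<ge> ereal \<gamma>LOD)))"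
proof -
  \<comment> \<open>The theorem gives no sign for \<open>\<Lambda>\<close>; enlarging the upper
    bound of the coefficients is harmless.\<close>
  define L where "L = max 0 \<Lambda>"
  define A where "A = max 1 (C\<pi>\<^sup>2)"
  obtain \<beta> q p :: real where \<beta>: "0 < \<beta>" "\<beta> < 1" and q: "0 \<le> q" and p: "1 \<le> p"
    and const: "\<forall>\<Omega> \<T> \<omega> \<mu> \<epsilon> C r m \<pi> \<pi>loc. lod \<Omega> \<sigma> \<kappa> \<T> \<omega> \<mu> \<epsilon> \<alpha> L A C r m \<pi> \<pi>loc \<longrightarrow>
      lod.rate \<sigma> \<kappa> \<alpha> L A = \<beta> \<and> lod.Q \<sigma> \<kappa> \<alpha> L A = q \<and> lod.P1 \<sigma> \<kappa> A = p"
    using lod_constants[of \<sigma> \<kappa> \<alpha> L A] by (elim exE conjE) rule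
  define s where "s = (\<kappa> * \<sigma>) ^ 3"
  have s: "0 < s" unfolding s_def using assms by simp
  \<comment> \<open>Absorbs the shifts: \<open>N (m + 4)\<close> is at most \<open>216 s m^3\<close>
    for \<open>m \<ge> 1\<close>, because \<open>m + 5 \<le> 6 m\<close>, and
    \<open>\<beta> ^ j0\<close> is \<open>\<beta> ^ m\<close> divided by
    \<open>\<beta> ^ (r + 2)\<close>.\<close>
  define q' where "q' = q * s * 216 / \<beta> ^ (r + 2)"
  have q': "0 \<le> q'" unfolding q'_def using q s \<beta> by simp
  \<comment> \<open>The bound \<open>8 s \<le> M\<close> makes \<open>M m^3\<close> an overlap
    bound, as \<open>m + 1 \<le> 2 m\<close>; the threshold \<open>r + 1 < m\<close> provides the
    layers on which \<open>j0\<close> relies.\<close>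
  obtain M where M: "8 * s \<le> M" "0 < M"
    and thr: "\<And>m \<gamma>. 1 \<le> m \<Longrightarrow> 0 < \<gamma> \<Longrightarrow> \<gamma> \<le> L \<Longrightarrow> 7 * (\<bar>ln (\<gamma> / sqrt (M * real m ^ 3))\<bar> / \<bar>ln \<beta>\<bar>) \<le> real m
      \<Longrightarrow> r + 1 < m \<and> q' * real m ^ 3 * \<beta> ^ m \<le> min 1 \<gamma> / 4"
    using oversampling_threshold[OF \<beta> q', of L "8 * s" "r + 1"] s by (auto simp: L_def)
  define c where "c = lodform.C2 \<alpha> L * fw_freq.D3 \<sigma> \<kappa> A * mesh.N \<sigma> \<kappa> 4"
  \<comment> \<open>The 1 gives \<open>\<omega> H \<le> 1\<close>, the root the smallness condition.
    Outside the locales the sign of \<open>c\<close> is unknown, hence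
    \<open>1 + \<bar>c\<bar>\<close>.\<close>
  define c0 where "c0 = min 1 (sqrt (\<alpha> / (16 * (1 + \<bar>c\<bar>))))"
  define k where "k = 1 / (8 * p\<^sup>2)"
  define Col where "Col m = M * real m ^ 3" for m :: nat
  have c0: "0 < c0" unfolding c0_def using \<open>0 < \<alpha>\<close> by simp
  have k: "0 < k" unfolding k_def using p by simp
  have pb: "poly_bounded Col" unfolding poly_bounded_def Col_def by blast
  have main: "overlap_bound \<T> Col \<and>
        (\<forall>\<mu> \<epsilon> \<pi> \<pi>loc (m::nat) (\<omega>::real) (\<gamma>::real).
           coefficient \<Omega> \<alpha> \<Lambda> \<mu> \<longrightarrow> coefficient \<Omega> \<alpha> \<Lambda> \<epsilon> \<longrightarrow>
           falk_winther \<Omega> \<Omega> \<T> (mesh_size \<T>) C\<pi> \<pi> \<longrightarrow>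
           1 \<le> m \<longrightarrow> local_falk_winther \<Omega> \<T> m C\<pi> r \<pi> \<pi>loc \<longrightarrow>
           \<omega>0 \<le> \<omega> \<longrightarrow>
           uniquely_solvable \<Omega> (Bform \<mu> \<epsilon> \<omega> \<Omega> \<Omega>) \<longrightarrow>
           0 < \<gamma> \<longrightarrow> inf_sup \<omega> \<Omega> (H0curl \<Omega>) (Bform \<mu> \<epsilon> \<omega> \<Omega> \<Omega>) \<ge> ereal \<gamma> \<longrightarrow>
           \<omega> * mesh_size \<T> \<le> c0 \<longrightarrow>
           real m \<ge> 7 * (\<bar>ln (\<gamma> / sqrt (Col m))\<bar> / \<bar>ln \<beta>\<bar>) \<longrightarrow>
           (\<exists>\<gamma>LOD>0. k * \<gamma> \<le> \<gamma>LOD \<and> \<gamma>LOD \<le> k * \<gamma> \<and>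
              inf_sup \<omega> \<Omega> (nedelec \<Omega> \<Omega> \<T>)
                (\<lambda>v \<psi>. Bform \<mu> \<epsilon> \<omega> \<Omega> \<Omega>
                   (\<lambda>x. v x + K_loc \<Omega> \<T> m \<pi>loc \<mu> \<epsilon> \<omega> v x)
                   (\<lambda>x. \<psi> x + K_loc \<Omega> \<T> m \<pi>loc \<mu> \<epsilon> \<omega> \<psi> x)) \<ge> ereal \<gamma>LOD))"
    (is "_ \<and> (\<forall>\<mu> \<epsilon> \<pi> \<pi>loc m \<omega> \<gamma>. _ \<longrightarrow> _ \<longrightarrow> _ \<longrightarrow> _ \<longrightarrow> _ \<longrightarrow> _ \<longrightarrow> _ \<longrightarrow> _ \<longrightarrow> _ \<longrightarrow> _ \<longrightarrow> _ \<longrightarrow> ?goal \<mu> \<epsilon> \<pi>loc m \<omega> \<gamma>)")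
    if tm: "tet_mesh \<Omega> \<sigma> \<kappa> \<T>" for \<T>
  proof (intro conjI allI impI)
    interpret mesh \<Omega> \<sigma> \<kappa> \<T> by unfold_locales (use assms tm in auto)
    show "overlap_bound \<T> Col"
      unfolding overlap_bound_def
    proof (intro allI impI ballI)
      fix m :: nat and T assume m: "1 \<le> m" and T: "T \<in> \<T>"
      have "(real m + 1) ^ 3 \<le> (2 * real m) ^ 3" using m by (intro power_mono) auto
      then have "s * (real m + 1) ^ 3 \<le> s * (8 * real m ^ 3)" using s by (intro mult_left_mono) (auto simp: power_mult_distrib)
      also have "\<dots> \<le> M * real m ^ 3" using mult_right_mono[OF M(1), of "real m ^ 3"] by (simp add: mult_ac)
      finally show "real (card {K \<in> \<T>. K \<subseteq> closure (nbhm \<T> m T)}) \<le> Col m"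
        using card_layer[OF T, of m] submesh_nbhm[OF T, of m] by (simp add: submesh_def s_def Col_def)
    qed
    fix \<mu> \<epsilon> \<pi> \<pi>loc and m :: nat and \<omega> \<gamma> :: real
    assume h: "coefficient \<Omega> \<alpha> \<Lambda> \<mu>" "coefficient \<Omega> \<alpha> \<Lambda> \<epsilon>" "falk_winther \<Omega> \<Omega> \<T> H C\<pi> \<pi>"
      "1 \<le> m" "local_falk_winther \<Omega> \<T> m C\<pi> r \<pi> \<pi>loc" "\<omega>0 \<le> \<omega>" "0 < \<gamma>"
      "ereal \<gamma> \<le> inf_sup \<omega> \<Omega> (H0curl \<Omega>) (Bform \<mu> \<epsilon> \<omega> \<Omega> \<Omega>)" "\<omega> * H \<le> c0"
      "7 * (\<bar>ln (\<gamma> / sqrt (Col m))\<bar> / \<bar>ln \<beta>\<bar>) \<le> real m"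
    let ?inf = "inf_sup \<omega> \<Omega> (nedelec \<Omega> \<Omega> \<T>) (\<lambda>v \<psi>. Bform \<mu> \<epsilon> \<omega> \<Omega> \<Omega>
       (\<lambda>x. v x + K_loc \<Omega> \<T> m \<pi>loc \<mu> \<epsilon> \<omega> v x) (\<lambda>x. \<psi> x + K_loc \<Omega> \<T> m \<pi>loc \<mu> \<epsilon> \<omega> \<psi> x))"
    have "ereal (k * \<gamma>) \<le> ?inf"
    \<comment> \<open>Without nonzero finite element functions the infimum ranges over the empty set
      and is infinite; otherwise such a function provides the nonzero field behind
      \<open>\<gamma> \<le> L\<close>.\<close>
    proof (cases "nonzero \<Omega> (nedelec \<Omega> \<Omega> \<T>) = {}")
      case True
      then show ?thesis by (simp add: inf_sup_def top_ereal_def)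
    next
      case False
      then obtain v where "v \<in> nonzero \<Omega> (H0curl \<Omega>)" by (auto simp: nonzero_def nedelec_def vanishing_outside_def)
      have \<omega>: "0 < \<omega>" using h(6) \<open>0 < \<omega>0\<close> by simp
      have L: "\<Lambda> \<le> L" "0 \<le> L" by (auto simp: L_def)
      interpret lodform \<Omega> \<sigma> \<kappa> \<T> \<omega> \<mu> \<epsilon> \<alpha> L
        by unfold_locales (use \<omega> h(9) \<open>0 < \<alpha>\<close> L coefficient_mono[OF h(1) L(1)] coefficient_mono[OF h(2) L(1)] in \<open>auto simp: c0_def\<close>)
      have "\<gamma> \<le> L" by (rule \<gamma>_le_\<Lambda>[OF h(8)]) fact
      with thr[OF h(4,7)] h(10) have rm: "r + 1 < m" and th: "q' * real m ^ 3 * \<beta> ^ m \<le> min 1 \<gamma> / 4" by (auto simp: Col_def)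
      have "(\<omega> * H)\<^sup>2 \<le> (sqrt (\<alpha> / (16 * (1 + \<bar>c\<bar>))))\<^sup>2" using h(9) \<omega> H_pos by (intro power_mono) (auto simp: c0_def)
      then have cH: "(\<omega> * H)\<^sup>2 \<le> \<alpha> / (16 * (1 + \<bar>c\<bar>))" using \<open>0 < \<alpha>\<close> by simp
      have "c * (\<omega> * H)\<^sup>2 \<le> (1 + \<bar>c\<bar>) * (\<alpha> / (16 * (1 + \<bar>c\<bar>)))" by (rule mult_mono[OF _ cH]) auto
      also have "\<dots> = \<alpha> / 16" by (simp add: field_simps)
      finally have small: "c * (\<omega> * H)\<^sup>2 \<le> \<alpha> / 16" .
      interpret lod \<Omega> \<sigma> \<kappa> \<T> \<omega> \<mu> \<epsilon> \<alpha> L A C\<pi> r m \<pi> \<pi>loc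
        by unfold_locales (use h(3,5) rm small \<open>1 \<le> r\<close> in \<open>auto simp: A_def c_def\<close>)
      \<comment> \<open>Only the values of these constants were fixed before the mesh and the
        frequency; here they are identified with those of the present data.\<close>
      have eq: "rate = \<beta>" "Q = q" "P1 = p" using const lod_axioms by blast+
      have "q * N (m + 4) * \<beta> ^ j0 \<le> q' * real m ^ 3 * \<beta> ^ m"
      proof -
        have "(real (m + 4) + 1) ^ 3 \<le> (6 * real m) ^ 3" using h(4) by (intro power_mono) auto
        then have "N (m + 4) \<le> s * (216 * real m ^ 3)" unfolding N_def s_def[symmetric] using s
          by (intro mult_left_mono) (auto simp: power_mult_distrib)
        then have "q * N (m + 4) * \<beta> ^ j0 \<le> q * (s * (216 * real m ^ 3)) * \<beta> ^ j0" using q \<beta> by (intro mult_right_mono mult_left_mono) auto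
        moreover have "\<beta> ^ m = \<beta> ^ j0 * \<beta> ^ (r + 2)"
          unfolding power_add[symmetric] by (rule arg_cong[where f="power \<beta>"]) (use rm in \<open>simp add: j0_def\<close>)
        ultimately show ?thesis using \<beta> by (simp add: q'_def)
      qed
      then have "Q * N (m + 4) * rate ^ j0 \<le> min 1 \<gamma> / 4" unfolding eq using th by linarith
      from inf_sup_stable[OF h(7,8) this] show ?thesis by (simp add: k_def eq)
    qed
    \<comment> \<open>The discrete constant is exactly \<open>k \<gamma>\<close>, so the lower and
      the upper factor coincide.\<close>
    then show "?goal \<mu> \<epsilon> \<pi>loc m \<omega> \<gamma>" using h(7) k by (intro exI[of _ "k * \<gamma>"]) simp
  qed
  show ?thesis
    by (rule exI[of _ c0], rule exI[of _ 7], rule exI[of _ k], rule exI[of _ k], rule exI[of _ \<beta>], rule exI[of _ Col])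
      (intro conjI c0 k \<beta> pb order_refl, simp, rule allI, rule impI, erule main)
qed

end
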